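(* Let $n\in\{1,2\}$, $\gamma\ge0$, $\alpha>0$, $\mathrm g(u,x)=\log|x-u|^{-1}$ and $V(x)=|x|^\alpha$ for $u,x\in\mathbb R^n$. Consider the Gibbs measure on $(\mathbb R^n)^N$ $$\mathbb P_N[d\mathbf x]=\frac1{\mathrm Z_N^{(V)}}\exp\Big(-\beta\sum_{1\le i<j\le N}\mathrm g(x_i,x_j)-\sum_{j=1}^NV(x_j)\Big)dx_1\cdots dx_N .$$ For any $\upsilon\in\mathbb S^{n-1}$, let $\psi\in SO(n)$ be such that $\psi(e_1)=\upsilon$ and set $$\varphi_N(x)=\eta_N\big(\upsilon+\alpha^{-1}\eta_N^{-\alpha}\psi(x)\big),\qquad \eta_N=(\log N)^{1/\alpha}\Big(1+\frac{\beta N-n(\alpha-1)}{\alpha^2}\frac{\log\log N}{\log N}-\frac{\log(\alpha^n\mathrm L_\gamma)}{\alpha\log N}\Big).$$ Then, under $\mathbb P_N$, the point process $\Xi_N=\sum_{j=1}^N\boldsymbol\delta_{\varphi_N^{-1}(x_j)}$ converges in distribution, as $N\beta\to\gamma$ and $N\to+\infty$, to a Poisson point process on $\mathbb R^n$ with intensity $\theta(x)=e^{-e_1\cdot x}$.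
   Context: Here $\beta=\beta_N>0$ may depend on $N$, $\mathrm Z_N^{(V)}$ is the normalizing constant, $|\cdot|$ is the Euclidean norm, and $e_1$ is the first vector of the canonical basis of $\mathbb R^n$. The constant $\mathrm L_\gamma>0$: let $\vartheta(x)=\log(1+|x|)$, $\widetilde{\mathrm g}(u,x)=\mathrm g(u,x)+\vartheta(u)+\vartheta(x)\ge0$, let $\nu_\gamma$ be the probability measure proportional to $e^{-V(x)+\gamma\vartheta(x)}dx$, let $\mathrm H(\mu|\nu)=\int\log\frac{d\mu}{d\nu}d\mu$ if $\mu\ll\nu$ and $+\infty$ otherwise, and $\mathscr F_\gamma(\mu)=\frac\gamma2\iint\widetilde{\mathrm g}(x,z)\mu(dz)\mu(dx)+\mathrm H(\mu|\nu_\gamma)$ for Borel probability measures $\mu$ on $\mathbb R^n$. The functional $\mathscr F_\gamma$ has a unique minimizer $\mu_\gamma$, whose Lebesgue density satisfies $\mu_\gamma(x)=\mathrm L_\gamma^{-1}e^{-\gamma\mathscr U^{\mu_\gamma}(x)-V(x)}$ with $\mathscr U^{\mu_\gamma}(x)=\int\mathrm g(x,z)\mu_\gamma(dz)$; thus $\mathrm L_\gamma=\int e^{-\gamma\mathscr U^{\mu_\gamma}(x)-V(x)}dx$. A sequence $\Xi_N$ of point processes on $\mathbb R^n$ converges in distribution to $\Xi$ if $\mathbb E[e^{-\Xi_N(f)}]\to\mathbb E[e^{-\Xi(f)}]$ for every continuous compactly supported $f:\mathbb R^n\to[0,+\infty)$. A Poisson point process with intensity $\theta$ has $\mathbb E[e^{-\Xi(f)}]=\exp\big(\int(e^{-f(x)}-1)\theta(x)dx\big)$.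 *)

theory Defs
  imports "HOL-Probability.Probability"
begin

section \<open>Gibbs measures with logarithmic interaction\<close>

text \<open>
  On the diagonal the mathematical kernel is \<open>+\<infinity>\<close>, whereas \<open>log_kernel u u = 0\<close> here.
  The diagonal is Lebesgue-negligible in the Gibbs weight and in the potential of a measure
  with a density; in the energy functional, where arbitrary measures occur, the value
  \<open>\<infinity>\<close> is restored in \<open>shifted_kernel\<close>.
\<close>

definition log_kernel :: "'a::euclidean_space \<Rightarrow> 'a \<Rightarrow> real" where
  "log_kernel u x = ln (inverse (norm (x - u)))"

definition gibbs_weight ::
    "real \<Rightarrow> ('a::euclidean_space \<Rightarrow> real) \<Rightarrow> nat \<Rightarrow> (nat \<Rightarrow> 'a) \<Rightarrow> real" where
  "gibbs_weight b V N x =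
     exp (- b * (\<Sum>j=1..N. \<Sum>i=1..<j. log_kernel (x i) (x j)) - (\<Sum>j=1..N. V (x j)))"

definition gibbs_measure ::
    "real \<Rightarrow> ('a::euclidean_space \<Rightarrow> real) \<Rightarrow> nat \<Rightarrow> (nat \<Rightarrow> 'a) measure" where
  "gibbs_measure b V N =
     (let L = \<Pi>\<^sub>M j\<in>{1..N}. lborel; Z = (\<integral>x. gibbs_weight b V N x \<partial>L)
      in density L (\<lambda>x. ennreal (gibbs_weight b V N x / Z)))"


section \<open>The free energy and its minimizer\<close>

definition theta_shift :: "'a::euclidean_space \<Rightarrow> real" where
  "theta_shift x = ln (1 + norm x)"

definition shifted_kernel :: "'a::euclidean_space \<Rightarrow> 'a \<Rightarrow> ennreal" where
  "shifted_kernel u x =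
     (if u = x then \<infinity> else ennreal (log_kernel u x + theta_shift u + theta_shift x))"

definition reference_measure ::
    "real \<Rightarrow> ('a::euclidean_space \<Rightarrow> real) \<Rightarrow> 'a measure" where
  "reference_measure \<gamma> V =
     (let w = (\<lambda>x. exp (- V x + \<gamma> * theta_shift x))
      in density lborel (\<lambda>x. ennreal (w x / (\<integral>y. w y \<partial>lborel))))"

text \<open>
  For probability measures \<open>\<mu> \<lless> \<nu>\<close> the negative part of \<open>log (d\<mu>/d\<nu>)\<close> is always
  \<open>\<mu>\<close>-integrable, so non-integrability means that the integral equals \<open>+\<infinity>\<close>.  The library's
  \<open>KL_divergence\<close> is real-valued and takes the reference measure as its second argument.
\<close>

definition relative_entropy :: "'a measure \<Rightarrow> 'a measure \<Rightarrow> ereal" where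
  "relative_entropy \<mu> \<nu> =
     (if absolutely_continuous \<nu> \<mu> \<and> integrable \<mu> (entropy_density (exp 1) \<nu> \<mu>)
      then ereal (KL_divergence (exp 1) \<nu> \<mu>) else \<infinity>)"

definition free_energy ::
    "real \<Rightarrow> ('a::euclidean_space \<Rightarrow> real) \<Rightarrow> 'a measure \<Rightarrow> ereal" where
  "free_energy \<gamma> V \<mu> =
     ereal (\<gamma> / 2) * enn2ereal (\<integral>\<^sup>+x. (\<integral>\<^sup>+z. shifted_kernel x z \<partial>\<mu>) \<partial>\<mu>)
       + relative_entropy \<mu> (reference_measure \<gamma> V)"

definition equilibrium_measure ::
    "real \<Rightarrow> ('a::euclidean_space \<Rightarrow> real) \<Rightarrow> 'a measure" where
  "equilibrium_measure \<gamma> V =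
     (ARG_MIN (free_energy \<gamma> V) \<mu>. prob_space \<mu> \<and> sets \<mu> = sets borel)"

definition log_potential :: "'a::euclidean_space measure \<Rightarrow> 'a \<Rightarrow> real" where
  "log_potential \<mu> x = (\<integral>z. log_kernel x z \<partial>\<mu>)"

definition L_const :: "real \<Rightarrow> ('a::euclidean_space \<Rightarrow> real) \<Rightarrow> real" where
  "L_const \<gamma> V =
     (\<integral>x. exp (- \<gamma> * log_potential (equilibrium_measure \<gamma> V) x - V x) \<partial>lborel)"


section \<open>Point processes\<close>

definition point_process ::
    "'w measure \<Rightarrow> ('w \<Rightarrow> 'a::euclidean_space measure) \<Rightarrow> bool" where
  "point_process M \<Xi> \<longleftrightarrow>
     prob_space M \<and>
     (\<forall>\<omega>\<in>space M. sets (\<Xi> \<omega>) = sets borel \<and>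
        (\<forall>B\<in>sets borel. bounded B \<longrightarrow> emeasure (\<Xi> \<omega>) B \<in> \<nat>)) \<and>
     (\<forall>B\<in>sets borel. (\<lambda>\<omega>. emeasure (\<Xi> \<omega>) B) \<in> borel_measurable M)"

definition laplace_functional ::
    "'w measure \<Rightarrow> ('w \<Rightarrow> 'a::euclidean_space measure) \<Rightarrow> ('a \<Rightarrow> real) \<Rightarrow> real" where
  "laplace_functional M \<Xi> f = (\<integral>\<omega>. exp (- (\<integral>x. f x \<partial>(\<Xi> \<omega>))) \<partial>M)"

definition test_functions :: "('a::euclidean_space \<Rightarrow> real) set" where
  "test_functions =
     {f. continuous_on UNIV f \<and> (\<forall>x. 0 \<le> f x) \<and> compact (closure {x. f x \<noteq> 0})}"

definition poisson_process ::
    "'w measure \<Rightarrow> ('w \<Rightarrow> 'a::euclidean_space measure) \<Rightarrow> ('a \<Rightarrow> real) \<Rightarrow> bool" where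
  "poisson_process M \<Xi> \<theta> \<longleftrightarrow>
     point_process M \<Xi> \<and>
     (\<forall>f\<in>test_functions.
        laplace_functional M \<Xi> f = exp (\<integral>x. (exp (- f x) - 1) * \<theta> x \<partial>lborel))"

definition converges_in_distribution ::
    "(nat \<Rightarrow> 'v measure) \<Rightarrow> (nat \<Rightarrow> 'v \<Rightarrow> 'a::euclidean_space measure) \<Rightarrow>
     'w measure \<Rightarrow> ('w \<Rightarrow> 'a measure) \<Rightarrow> bool" where
  "converges_in_distribution M \<Xi> M' \<Xi>' \<longleftrightarrow>
     (\<forall>f\<in>test_functions.
        (\<lambda>N. laplace_functional (M N) (\<Xi> N) f) \<longlonglongrightarrow> laplace_functional M' \<Xi>' f)"

text \<open>The sum of the Dirac masses at \<open>y 1, \<dots>, y N\<close>, as an image of counting measure.\<close>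

definition dirac_sum :: "nat \<Rightarrow> (nat \<Rightarrow> 'a::euclidean_space) \<Rightarrow> 'a measure" where
  "dirac_sum N y = distr (count_space {1..N}) borel y"


section \<open>The scaling at the edge\<close>

text \<open>Elements of the index type are ordered so that the first basis vector makes sense.\<close>

definition first_basis_vector :: "real ^ 'n::{finite,linorder}" where
  "first_basis_vector = axis (Min UNIV) 1"

definition power_potential :: "real \<Rightarrow> 'a::euclidean_space \<Rightarrow> real" where
  "power_potential \<alpha> x = norm x powr \<alpha>"

definition edge_scale :: "nat \<Rightarrow> real \<Rightarrow> real \<Rightarrow> real \<Rightarrow> nat \<Rightarrow> real" where
  "edge_scale n \<alpha> L b N =
     ln (real N) powr (1 / \<alpha>) *
     (1 + (b * real N - real n * (\<alpha> - 1)) / \<alpha>\<^sup>2 * (ln (ln (real N)) / ln (real N))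
        - ln (\<alpha> ^ n * L) / (\<alpha> * ln (real N)))"

definition edge_map ::
    "real \<Rightarrow> real \<Rightarrow> real ^ 'n \<Rightarrow> real ^ 'n ^ 'n \<Rightarrow> real ^ 'n \<Rightarrow> real ^ 'n" where
  "edge_map \<alpha> \<eta> \<upsilon> \<psi> x = \<eta> *\<^sub>R (\<upsilon> + (inverse \<alpha> * \<eta> powr (- \<alpha>)) *\<^sub>R (\<psi> *v x))"

end

theory Submission
  imports Defs
begin

text \<open>
  The kernel is conditionally positive definite, being a mixture of Gaussians up to functions of one
  variable.  Hence the free energy is uniformly midpoint convex: a minimizing sequence of densities is
  Cauchy in \<open>L\<^sup>1\<close>, and the Euler-Lagrange equation identifies the density of the minimizer \<open>\<mu>\<close>
  as \<open>m = exp (- \<gamma> U - V) / L\<close>.  Applied to \<open>\<mu>\<close> and the regularized empirical measure, positivity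
  bounds the pair energy from below, and together with a Jensen lower bound for the partition function
  this dominates the Gibbs measure by product measures up to a subexponential factor.  The potential
  created by all particles but one is therefore concentrated at \<open>U\<close>, uniformly in the position.
  For \<open>0 \<le> u \<le> 1\<close> this turns the derivative in \<open>s\<close> of the expectation of \<open>\<Prod>j. 1 - s u (x j)\<close> into
  \<open>- \<lambda>\<close> times the same function up to a small error, where \<open>\<lambda>\<close> is \<open>N\<close> times the mean of \<open>u\<close> under the
  density proportional to \<open>exp (- \<beta> (N - 1) U - V)\<close>, so that the limit is \<open>exp (- lim \<lambda>)\<close>.  At distance \<open>\<eta>\<close>
  the potential \<open>U\<close> is \<open>- ln \<eta>\<close> up to a vanishing error, and the choice of \<open>\<eta>\<close> makes \<open>\<lambda>\<close> converge
  to the integral of \<open>u\<close>, read in the rescaled variable \<open>x\<close>, against \<open>exp (- e \<bullet> x)\<close>.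
\<close>

section \<open>Singular and decaying integrals\<close>

lemma ball_in_sets_borel [measurable]: "ball (x::'a::euclidean_space) r \<in> sets borel"
  by (simp add: borel_open)

lemma powr_neg_half_le_dyadic_sum:
  fixes r :: real
  assumes "0 < r" "r < 1"
  shows "ennreal (r powr (-1/2)) \<le> (\<Sum>k. ennreal (2 * 2 ^ k) * indicator {..<(1/4)^k} r)"
proof -
  define P where "P k \<longleftrightarrow> r \<ge> (1/4::real)^k" for k :: nat
  have "(\<lambda>k. (1/4::real)^k) \<longlonglongrightarrow> 0" by (rule LIMSEQ_realpow_zero) auto
  then have "\<forall>\<^sub>F k in sequentially. (1/4::real)^k < r"
    using assms by (intro order_tendstoD(2)[of _ 0]) auto
  then have ex: "\<exists>k. P k" unfolding P_def by (auto simp: eventually_sequentially intro: less_imp_le)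
  define k where "k = (LEAST k. P k)"
  have Pk: "P k" unfolding k_def by (rule LeastI_ex[OF ex])
  have nP0: "\<not> P 0" using assms by (auto simp: P_def)
  then obtain j where j: "k = Suc j" using Pk by (cases k) auto
  have nPj: "\<not> P j" using not_less_Least[of j P] j unfolding k_def by auto
  have "r powr (-1/2) \<le> ((1/4)^k) powr (-1/2)"
    using Pk assms unfolding P_def by (intro powr_mono2') auto
  also have "(1/4::real)^k = (1/2)^k * (1/2)^k" by (simp add: power_mult_distrib[symmetric])
  also have "\<dots> powr (-1/2) = inverse (sqrt ((1/2)^k * (1/2)^k))"
    by (simp only: minus_divide_left[symmetric] powr_minus) (simp add: powr_half_sqrt)
  also have "\<dots> = 2 ^ k" by (simp add: real_sqrt_mult real_sqrt_divide power_one_over)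
  finally have "ennreal (r powr (-1/2)) \<le> ennreal (2 * 2 ^ j) * indicator {..<(1/4)^j} r"
    using nPj j by (auto simp: P_def not_le intro: ennreal_leI)
  also have "\<dots> = (\<Sum>k\<in>{j}. ennreal (2 * 2 ^ k) * indicator {..<(1/4)^k} r)"
    by (simp only: sum.insert_remove sum.empty finite.emptyI Diff_empty insert_Diff_single) simp
  also have "\<dots> \<le> (\<Sum>k. ennreal (2 * 2 ^ k) * indicator {..<(1/4)^k} r)"
    by (rule sum_le_suminf) auto
  finally show ?thesis .
qed

lemma nn_integral_lborel_shift:
  fixes f :: "'a::euclidean_space \<Rightarrow> ennreal"
  assumes [measurable]: "f \<in> borel_measurable borel"
  shows "(\<integral>\<^sup>+x. f (c + x) \<partial>lborel) = (\<integral>\<^sup>+x. f x \<partial>lborel)"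
proof -
  have "(\<integral>\<^sup>+x. f x \<partial>lborel) = (\<integral>\<^sup>+x. f x \<partial>distr lborel borel ((+) c))"
    by (simp add: lborel_distr_plus)
  also have "\<dots> = (\<integral>\<^sup>+x. f (c + x) \<partial>lborel)" by (rule nn_integral_distr) auto
  finally show ?thesis by simp
qed

lemma ball_singular_integral_finite:
  "(\<integral>\<^sup>+z\<in>ball (0::'a::euclidean_space) 1. ennreal (norm z powr (-1/2)) \<partial>lborel) < \<infinity>"
proof -
  let ?c = "unit_ball_vol (real DIM('a))"
  have "(\<integral>\<^sup>+z\<in>ball (0::'a) 1. ennreal (norm z powr (-1/2)) \<partial>lborel)
    \<le> (\<integral>\<^sup>+z. (\<Sum>k. ennreal (2 * 2 ^ k) * indicator (ball (0::'a) ((1/4)^k)) z) \<partial>lborel)"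
  proof (intro nn_integral_mono)
    fix z :: 'a
    show "ennreal (norm z powr (-1/2)) * indicator (ball 0 1) z \<le>
      (\<Sum>k. ennreal (2 * 2 ^ k) * indicator (ball (0::'a) ((1/4)^k)) z)"
    proof (cases "z = 0 \<or> norm z \<ge> 1")
      case False
      then have "ennreal (norm z powr (-1/2)) \<le> (\<Sum>k. ennreal (2 * 2 ^ k) * indicator {..<(1/4)^k} (norm z))"
        by (intro powr_neg_half_le_dyadic_sum) auto
      also have "\<dots> = (\<Sum>k. ennreal (2 * 2 ^ k) * indicator (ball (0::'a) ((1/4)^k)) z)"
        by (auto simp: indicator_def)
      finally show ?thesis using False by (simp add: indicator_def)
    qed auto
  qed
  also have "\<dots> = (\<Sum>k. ennreal (2 * 2 ^ k) * emeasure lborel (ball (0::'a) ((1/4)^k)))"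
    by (subst nn_integral_suminf) (measurable, simp add: nn_integral_cmult_indicator)
  also have "\<dots> \<le> (\<Sum>k. ennreal (2 * ?c * (1/2)^k))"
  proof (intro suminf_le)
    fix k
    have "(2::real) * 2 ^ k * (?c * ((1/4)^k) ^ DIM('a)) \<le> 2 * 2 ^ k * (?c * ((1/4)^k) ^ 1)"
      using DIM_positive[where 'a='a] by (intro mult_left_mono power_decreasing) (auto simp: power_le_one)
    also have "\<dots> = 2 * ?c * (2 * (1/4))^k" unfolding power_mult_distrib by simp
    finally show "ennreal (2 * 2 ^ k) * emeasure lborel (ball (0::'a) ((1/4)^k)) \<le> ennreal (2 * ?c * (1/2)^k)"
      by (simp add: emeasure_ball ennreal_mult[symmetric] ennreal_leI)
  qed auto
  also have "\<dots> = ennreal (\<Sum>k. 2 * ?c * (1/2)^k)"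
    by (rule suminf_ennreal2) (auto intro!: summable_mult)
  also have "\<dots> < \<infinity>" by simp
  finally show ?thesis .
qed

lemma singular_integral_bound:
  "\<exists>S\<ge>0. \<forall>(x::'a::euclidean_space) h C D. h \<in> borel_measurable borel \<longrightarrow> (\<forall>z. 0 \<le> h z \<and> h z \<le> C) \<longrightarrow> 0 \<le> D \<longrightarrow>
     (\<integral>\<^sup>+z. ennreal (h z) \<partial>lborel) \<le> ennreal D \<longrightarrow>
     (\<integral>\<^sup>+z. ennreal (h z * norm (x - z) powr (-1/2)) \<partial>lborel) \<le> ennreal (C * S + D)"
proof -
  let ?S = "\<integral>\<^sup>+z\<in>ball (0::'a) 1. ennreal (norm z powr (-1/2)) \<partial>lborel"
  have SS: "ennreal (enn2real ?S) = ?S" using ball_singular_integral_finite[where 'a='a] by (intro ennreal_enn2real) auto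
  show ?thesis
  proof (intro exI[of _ "enn2real ?S"] conjI allI impI)
    fix x :: 'a and h :: "'a \<Rightarrow> real" and C D :: real
    assume [measurable]: "h \<in> borel_measurable borel" and hC: "\<forall>z. 0 \<le> h z \<and> h z \<le> C" and D0: "0 \<le> D"
      and D: "(\<integral>\<^sup>+z. ennreal (h z) \<partial>lborel) \<le> ennreal D"
    have h: "\<And>z. 0 \<le> h z" "0 \<le> C" "0 \<le> D" "\<And>z. h z \<le> C"
      using hC D0 order_trans[of 0 "h 0" C] by auto
    let ?k = "\<lambda>z::'a. ennreal (norm z powr (-1/2)) * indicator (ball 0 1) z"
    have k [measurable]: "?k \<in> borel_measurable borel" by measurable
    have "(\<integral>\<^sup>+z. ennreal (h z * norm (x - z) powr (-1/2)) \<partial>lborel)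
       \<le> (\<integral>\<^sup>+z. ennreal C * ?k (-x + z) + ennreal (h z) \<partial>lborel)"
    proof (intro nn_integral_mono)
      fix z
      show "ennreal (h z * norm (x - z) powr (-1/2)) \<le> ennreal C * ?k (-x + z) + ennreal (h z)"
      proof (cases "norm (x - z) < 1")
        case True
        have "ennreal (h z * norm (x - z) powr (-1/2)) \<le> ennreal (C * norm (x - z) powr (-1/2))"
          using h by (intro ennreal_leI mult_right_mono) auto
        then show ?thesis using True h by (auto simp: indicator_def norm_minus_commute ennreal_mult intro: order_trans)
      next
        case False
        have "norm (x - z) powr (-1/2) \<le> 1 powr (-1/2)"
          using False by (intro powr_mono2') auto
        then have "h z * norm (x - z) powr (-1/2) \<le> h z"
          using h(1)[of z] by (simp add: mult_left_le)
        then show ?thesis using ennreal_leI by (auto intro: order_trans add_increasing)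
      qed
    qed
    also have "\<dots> = ennreal C * ?S + (\<integral>\<^sup>+z. ennreal (h z) \<partial>lborel)"
    proof -
      have [measurable]: "(\<lambda>z. ?k (-x + z)) \<in> borel_measurable borel"
        by (rule measurable_compose[OF _ k]) measurable
      have "(\<integral>\<^sup>+z. ennreal C * ?k (-x + z) + ennreal (h z) \<partial>lborel)
        = ennreal C * (\<integral>\<^sup>+z. ?k (-x + z) \<partial>lborel) + (\<integral>\<^sup>+z. ennreal (h z) \<partial>lborel)"
        by (subst nn_integral_add) (measurable, subst nn_integral_cmult, measurable)
      then show ?thesis by (simp only: nn_integral_lborel_shift[OF k])
    qed
    also have "\<dots> \<le> ennreal (C * enn2real ?S) + ennreal D"
      using D SS h by (intro add_mono) (auto simp: ennreal_mult)
    finally show "(\<integral>\<^sup>+z. ennreal (h z * norm (x - z) powr (-1/2)) \<partial>lborel) \<le> ennreal (C * enn2real ?S + D)"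
      using h by (simp add: ennreal_plus[symmetric] del: ennreal_plus)
  qed simp
qed

lemma inverse_power_integral_finite:
  "(\<integral>\<^sup>+z. ennreal (1 / (1 + norm (z::'a::euclidean_space)) ^ (DIM('a) + 2)) \<partial>lborel) < \<infinity>"
proof -
  let ?d = "DIM('a)"
  let ?c = "unit_ball_vol (real ?d)"
  have "(\<integral>\<^sup>+z. ennreal (1 / (1 + norm (z::'a)) ^ (?d + 2)) \<partial>lborel)
     \<le> (\<integral>\<^sup>+z. (\<Sum>k. ennreal (1 / (real k + 1) ^ (?d + 2)) * indicator (ball (0::'a) (real k + 1)) z) \<partial>lborel)"
  proof (intro nn_integral_mono)
    fix z :: 'a
    define k where "k = nat \<lfloor>norm z\<rfloor>"
    have k: "real k \<le> norm z" "norm z < real k + 1" unfolding k_def by (auto simp: of_nat_nat)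
    have "ennreal (1 / (1 + norm z) ^ (?d + 2)) \<le> ennreal (1 / (real k + 1) ^ (?d + 2)) * indicator (ball (0::'a) (real k + 1)) z"
      using k power_mono[of "real k + 1" "1 + norm z" "?d + 2"]
      by (simp add: indicator_def ennreal_leI frac_le del: power_add power_Suc add_2_eq_Suc')
    also have "\<dots> = (\<Sum>k\<in>{k}. ennreal (1 / (real k + 1) ^ (?d + 2)) * indicator (ball (0::'a) (real k + 1)) z)"
      by (simp only: sum.insert_remove sum.empty finite.emptyI Diff_empty insert_Diff_single) simp
    also have "\<dots> \<le> (\<Sum>k. ennreal (1 / (real k + 1) ^ (?d + 2)) * indicator (ball (0::'a) (real k + 1)) z)"
      by (rule sum_le_suminf) auto
    finally show "ennreal (1 / (1 + norm z) ^ (?d + 2)) \<le> \<dots>" .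
  qed
  also have "\<dots> = (\<Sum>k. ennreal (1 / (real k + 1) ^ (?d + 2)) * emeasure lborel (ball (0::'a) (real k + 1)))"
    by (subst nn_integral_suminf) (measurable, simp add: nn_integral_cmult_indicator)
  also have "\<dots> = (\<Sum>k. ennreal (?c * (1 / (real (Suc k))^2)))"
  proof (intro suminf_cong)
    fix k
    have "1 / a ^ (?d + 2) * (?c * a ^ ?d) = ?c * (1 / a\<^sup>2)" if "a > 0" for a :: real
      using that by (simp add: power_add power2_eq_square)
    from this[of "real (Suc k)"]
    show "ennreal (1 / (real k + 1) ^ (?d + 2)) * emeasure lborel (ball (0::'a) (real k + 1)) = ennreal (?c * (1 / (real (Suc k))^2))"
      by (simp add: emeasure_ball ennreal_mult[symmetric] add.commute)
  qed
  also have "\<dots> = ennreal (\<Sum>k. ?c * (1 / (real (Suc k))^2))"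
    using inverse_power_summable[of 2, where 'a=real]
    by (intro suminf_ennreal2 summable_mult) (auto simp: summable_Suc_iff[of "\<lambda>k. 1 / (real k)\<^sup>2"] field_simps inverse_eq_divide simp del: of_nat_Suc)
  also have "\<dots> < \<infinity>" by simp
  finally show ?thesis .
qed

lemma decay_integral_finite:
  fixes h :: "'a::euclidean_space \<Rightarrow> real"
  assumes "\<And>z. h z * (1 + norm z) ^ (DIM('a) + 2) \<le> C"
  shows "(\<integral>\<^sup>+z. ennreal (h z) \<partial>lborel) < \<infinity>"
proof -
  have "(\<integral>\<^sup>+z. ennreal (h z) \<partial>lborel) \<le> (\<integral>\<^sup>+z. ennreal \<bar>C\<bar> * ennreal (1 / (1 + norm (z::'a)) ^ (DIM('a) + 2)) \<partial>lborel)"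
  proof (intro nn_integral_mono)
    fix z :: 'a
    have "h z * (1 + norm z) ^ (DIM('a) + 2) \<le> \<bar>C\<bar>" using assms[of z] by linarith
    then have "h z \<le> \<bar>C\<bar> * (1 / (1 + norm z) ^ (DIM('a) + 2))"
      by (simp add: pos_le_divide_eq add_pos_nonneg)
    then show "ennreal (h z) \<le> ennreal \<bar>C\<bar> * ennreal (1 / (1 + norm z) ^ (DIM('a) + 2))"
      by (subst ennreal_mult[symmetric]) (auto intro!: ennreal_leI)
  qed
  also have "\<dots> = ennreal \<bar>C\<bar> * (\<integral>\<^sup>+z. ennreal (1 / (1 + norm (z::'a)) ^ (DIM('a) + 2)) \<partial>lborel)"
    by (rule nn_integral_cmult) auto
  also have "\<dots> < \<infinity>" using inverse_power_integral_finite[where 'a='a] by (simp add: ennreal_mult_less_top)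
  finally show ?thesis .
qed

section \<open>Positive definiteness of the logarithmic kernel\<close>

definition positive_kernel :: "('a::euclidean_space \<Rightarrow> 'a \<Rightarrow> ennreal) \<Rightarrow> bool" where
  "positive_kernel K \<longleftrightarrow> (\<forall>\<mu> \<nu>. prob_space \<mu> \<longrightarrow> sets \<mu> = sets borel \<longrightarrow> prob_space \<nu> \<longrightarrow> sets \<nu> = sets borel \<longrightarrow>
     2 * (\<integral>\<^sup>+x. (\<integral>\<^sup>+y. K x y \<partial>\<nu>) \<partial>\<mu>) \<le> (\<integral>\<^sup>+x. (\<integral>\<^sup>+y. K x y \<partial>\<mu>) \<partial>\<mu>) + (\<integral>\<^sup>+x. (\<integral>\<^sup>+y. K x y \<partial>\<nu>) \<partial>\<nu>))"

lemma ennreal_two_mult_le_squares: "2 * (a * b) \<le> a * a + b * (b::ennreal)"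
proof (cases a; cases b)
  fix r s :: real assume "a = ennreal r" "0 \<le> r" "b = ennreal s" "0 \<le> s"
  moreover have "2 * (r * s) \<le> r * r + s * s" using sum_squares_bound[of r s] by (simp add: power2_eq_square mult_ac)
  ultimately show ?thesis
    by (simp add: ennreal_mult[symmetric] ennreal_plus[symmetric] ennreal_numeral[symmetric] ennreal_leI del: ennreal_plus ennreal_numeral)
qed (auto simp: ennreal_top_mult ennreal_mult_top)

lemma positive_kernel_cmult:
  assumes "positive_kernel K" and [measurable]: "(\<lambda>(x, y). K x y) \<in> borel_measurable (borel \<Otimes>\<^sub>M borel)"
  shows "positive_kernel (\<lambda>x y. c * K x y)"
  unfolding positive_kernel_def
proof (intro allI impI)
  fix \<mu> \<nu> :: "'a measure"
  assume p: "prob_space \<mu>" "prob_space \<nu>" and s [measurable_cong]: "sets \<mu> = sets borel" "sets \<nu> = sets borel"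
  interpret \<mu>: prob_space \<mu> by fact
  interpret \<nu>: prob_space \<nu> by fact
  have "2 * (\<integral>\<^sup>+x. (\<integral>\<^sup>+y. K x y \<partial>\<nu>) \<partial>\<mu>) \<le> (\<integral>\<^sup>+x. (\<integral>\<^sup>+y. K x y \<partial>\<mu>) \<partial>\<mu>) + (\<integral>\<^sup>+x. (\<integral>\<^sup>+y. K x y \<partial>\<nu>) \<partial>\<nu>)"
    using assms(1) p s unfolding positive_kernel_def by blast
  then have "c * (2 * (\<integral>\<^sup>+x. (\<integral>\<^sup>+y. K x y \<partial>\<nu>) \<partial>\<mu>)) \<le> c * ((\<integral>\<^sup>+x. (\<integral>\<^sup>+y. K x y \<partial>\<mu>) \<partial>\<mu>) + (\<integral>\<^sup>+x. (\<integral>\<^sup>+y. K x y \<partial>\<nu>) \<partial>\<nu>))"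
    by (rule mult_left_mono) simp
  then show "2 * (\<integral>\<^sup>+x. (\<integral>\<^sup>+y. c * K x y \<partial>\<nu>) \<partial>\<mu>)
    \<le> (\<integral>\<^sup>+x. (\<integral>\<^sup>+y. c * K x y \<partial>\<mu>) \<partial>\<mu>) + (\<integral>\<^sup>+x. (\<integral>\<^sup>+y. c * K x y \<partial>\<nu>) \<partial>\<nu>)"
    by (simp add: nn_integral_cmult distrib_left mult_ac)
qed

lemma nn_integral_rotate:
  fixes K :: "'s \<Rightarrow> 'a::euclidean_space \<Rightarrow> 'a \<Rightarrow> ennreal"
  assumes "sigma_finite_measure S" "prob_space \<mu>" "prob_space \<nu>"
    and s [measurable_cong]: "sets \<mu> = sets borel" "sets \<nu> = sets borel"
    and K: "(\<lambda>(s, x, y). K s x y) \<in> borel_measurable (S \<Otimes>\<^sub>M (borel \<Otimes>\<^sub>M borel))"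
  shows "(\<integral>\<^sup>+x. (\<integral>\<^sup>+y. (\<integral>\<^sup>+s. K s x y \<partial>S) \<partial>\<nu>) \<partial>\<mu>) = (\<integral>\<^sup>+s. (\<integral>\<^sup>+x. (\<integral>\<^sup>+y. K s x y \<partial>\<nu>) \<partial>\<mu>) \<partial>S)"
proof -
  interpret S: sigma_finite_measure S by fact
  interpret \<mu>: prob_space \<mu> by fact
  interpret \<nu>: prob_space \<nu> by fact
  interpret S\<mu>: pair_sigma_finite S \<mu> ..
  interpret S\<nu>: pair_sigma_finite S \<nu> ..
  note K' [measurable] = measurable_compose[OF _ K, of "\<lambda>w. (f w, g w, h w)" for f g h, simplified]
  have "(\<integral>\<^sup>+x. (\<integral>\<^sup>+y. (\<integral>\<^sup>+s. K s x y \<partial>S) \<partial>\<nu>) \<partial>\<mu>) = (\<integral>\<^sup>+x. (\<integral>\<^sup>+s. (\<integral>\<^sup>+y. K s x y \<partial>\<nu>) \<partial>S) \<partial>\<mu>)"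
    by (intro nn_integral_cong S\<nu>.Fubini') measurable
  also have "\<dots> = (\<integral>\<^sup>+s. (\<integral>\<^sup>+x. (\<integral>\<^sup>+y. K s x y \<partial>\<nu>) \<partial>\<mu>) \<partial>S)"
    by (intro S\<mu>.Fubini') measurable
  finally show ?thesis .
qed

lemma positive_kernel_mixture:
  fixes K :: "'s \<Rightarrow> 'a::euclidean_space \<Rightarrow> 'a \<Rightarrow> ennreal"
  assumes "sigma_finite_measure S"
    and pos: "\<And>s. s \<in> space S \<Longrightarrow> positive_kernel (K s)"
    and K: "(\<lambda>(s, x, y). K s x y) \<in> borel_measurable (S \<Otimes>\<^sub>M (borel \<Otimes>\<^sub>M borel))"
  shows "positive_kernel (\<lambda>x y. \<integral>\<^sup>+s. K s x y \<partial>S)"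
  unfolding positive_kernel_def
proof (intro allI impI)
  fix \<mu> \<nu> :: "'a measure"
  assume p: "prob_space \<mu>" "prob_space \<nu>" and s [measurable_cong]: "sets \<mu> = sets borel" "sets \<nu> = sets borel"
  interpret S: sigma_finite_measure S by fact
  interpret \<mu>: prob_space \<mu> by fact
  interpret \<nu>: prob_space \<nu> by fact
  note K' [measurable] = measurable_compose[OF _ K, of "\<lambda>w. (f w, g w, h w)" for f g h, simplified]
  have "(\<integral>\<^sup>+s. 2 * (\<integral>\<^sup>+x. (\<integral>\<^sup>+y. K s x y \<partial>\<nu>) \<partial>\<mu>) \<partial>S)
    \<le> (\<integral>\<^sup>+s. (\<integral>\<^sup>+x. (\<integral>\<^sup>+y. K s x y \<partial>\<mu>) \<partial>\<mu>) + (\<integral>\<^sup>+x. (\<integral>\<^sup>+y. K s x y \<partial>\<nu>) \<partial>\<nu>) \<partial>S)"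
    using pos p s unfolding positive_kernel_def by (intro nn_integral_mono) blast
  then show "2 * (\<integral>\<^sup>+x. (\<integral>\<^sup>+y. (\<integral>\<^sup>+s. K s x y \<partial>S) \<partial>\<nu>) \<partial>\<mu>)
    \<le> (\<integral>\<^sup>+x. (\<integral>\<^sup>+y. (\<integral>\<^sup>+s. K s x y \<partial>S) \<partial>\<mu>) \<partial>\<mu>) + (\<integral>\<^sup>+x. (\<integral>\<^sup>+y. (\<integral>\<^sup>+s. K s x y \<partial>S) \<partial>\<nu>) \<partial>\<nu>)"
    using p s by (simp add: nn_integral_rotate[OF assms(1) _ _ _ _ K] nn_integral_cmult nn_integral_add)
qed

lemma positive_kernel_product:
  fixes h :: "'s \<Rightarrow> 'a::euclidean_space \<Rightarrow> ennreal"
  assumes "sigma_finite_measure S"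
    and [measurable]: "(\<lambda>(s, x). h s x) \<in> borel_measurable (S \<Otimes>\<^sub>M borel)"
  shows "positive_kernel (\<lambda>x y. \<integral>\<^sup>+s. h s x * h s y \<partial>S)"
proof (rule positive_kernel_mixture[OF assms(1)])
  fix s assume "s \<in> space S"
  then have h [measurable]: "h s \<in> borel_measurable borel" by measurable
  show "positive_kernel (\<lambda>x y. h s x * h s y)"
    unfolding positive_kernel_def
  proof (intro allI impI)
    fix \<mu> \<nu> :: "'a measure"
    assume p: "prob_space \<mu>" "prob_space \<nu>" and s [measurable_cong]: "sets \<mu> = sets borel" "sets \<nu> = sets borel"
    have "(\<integral>\<^sup>+x. (\<integral>\<^sup>+y. h s x * h s y \<partial>N) \<partial>M) = (\<integral>\<^sup>+x. h s x \<partial>M) * (\<integral>\<^sup>+x. h s x \<partial>N)"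
      if [measurable_cong]: "sets M = sets borel" "sets N = sets borel" for M N :: "'a measure"
      by (simp add: nn_integral_cmult nn_integral_multc)
    then show "2 * (\<integral>\<^sup>+x. (\<integral>\<^sup>+y. h s x * h s y \<partial>\<nu>) \<partial>\<mu>)
      \<le> (\<integral>\<^sup>+x. (\<integral>\<^sup>+y. h s x * h s y \<partial>\<mu>) \<partial>\<mu>) + (\<integral>\<^sup>+x. (\<integral>\<^sup>+y. h s x * h s y \<partial>\<nu>) \<partial>\<nu>)"
      using s by (simp add: ennreal_two_mult_le_squares)
  qed
qed measurable

lemma exp_neg_powr_decay:
  fixes c \<alpha> :: real
  assumes "0 < c" "0 < \<alpha>"
  shows "\<exists>C. \<forall>r\<ge>0. exp (- c * r powr \<alpha>) * (1 + r) ^ q \<le> C"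
proof -
  obtain k :: nat where k: "real q / \<alpha> \<le> real k" "k > 0"
    by (metis real_arch_simple gr0I le_less_trans less_imp_le not_less of_nat_0 order_trans zero_less_one of_nat_1 less_numeral_extra(1) nat_le_linear of_nat_le_iff zero_less_iff_neq_zero)
  have "exp (- c * r powr \<alpha>) * (1 + r) ^ q \<le> 2 ^ q * (1 + (real k / c) ^ k)" if r: "r \<ge> 0" for r
  proof (cases "r \<le> 1")
    case True
    have "exp (- c * r powr \<alpha>) * (1 + r) ^ q \<le> 1 * 2 ^ q"
      using True r assms by (intro mult_mono power_mono) auto
    also have "\<dots> \<le> 2 ^ q * (1 + (real k / c) ^ k)" using assms by simp
    finally show ?thesis .
  next
    case False
    let ?u = "r powr \<alpha>"
    have "r ^ q = r powr real q" using False by (simp add: powr_realpow)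
    also have "\<dots> \<le> r powr (\<alpha> * real k)" using False k assms by (intro powr_mono) (auto simp: field_simps)
    also have "\<dots> = ?u ^ k" using False by (simp add: powr_powr[symmetric] powr_realpow)
    finally have rq: "r ^ q \<le> ?u ^ k" .
    have "(c * ?u / real k) ^ k \<le> (1 + c * ?u / real k) ^ k"
      using assms by (intro power_mono) auto
    also have "\<dots> \<le> exp (c * ?u)"
      using assms k by (intro exp_ge_one_plus_x_over_n_power_n) (auto intro: order_trans[of _ 0])
    finally have "?u ^ k \<le> exp (c * ?u) * (real k / c) ^ k"
      using assms k by (simp add: power_divide power_mult_distrib field_simps)
    then have e: "exp (- c * ?u) * ?u ^ k \<le> (real k / c) ^ k"
      by (simp add: exp_minus field_simps)
    have "(1 + r) ^ q \<le> (2 * r) ^ q" using False by (intro power_mono) auto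
    also have "\<dots> \<le> 2 ^ q * ?u ^ k" using rq by (simp add: power_mult_distrib)
    finally have "exp (- c * ?u) * (1 + r) ^ q \<le> exp (- c * ?u) * (2 ^ q * ?u ^ k)"
      by (intro mult_left_mono) auto
    also have "\<dots> \<le> 2 ^ q * (real k / c) ^ k" using e by (simp add: mult_ac)
    also have "\<dots> \<le> 2 ^ q * (1 + (real k / c) ^ k)" by simp
    finally show ?thesis .
  qed
  then show ?thesis by blast
qed

lemma gaussian_integral_finite:
  assumes "0 < c"
  shows "(\<integral>\<^sup>+w. ennreal (exp (- c * (norm (w::'a::euclidean_space))\<^sup>2)) \<partial>lborel) < \<infinity>"
proof -
  obtain C where C: "\<And>r. 0 \<le> r \<Longrightarrow> exp (- c * r powr 2) * (1 + r) ^ (DIM('a) + 2) \<le> C"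
    using exp_neg_powr_decay[of c 2 "DIM('a) + 2"] assms by auto
  show ?thesis
    using C[OF norm_ge_zero] by (intro decay_integral_finite[of _ C]) (simp add: powr_numeral)
qed

lemma positive_kernel_gaussian:
  assumes "0 < t"
  shows "positive_kernel (\<lambda>x y::'a::euclidean_space. ennreal (exp (- t * (norm (x - y))\<^sup>2)))"
proof -
  let ?h = "\<lambda>w x::'a. ennreal (exp (- (2 * t) * (norm (x - w))\<^sup>2))"
  define C where "C = (\<integral>\<^sup>+w. ennreal (exp (- (4 * t) * (norm (w::'a))\<^sup>2)) \<partial>lborel)"
  have Cfin: "C < \<infinity>" unfolding C_def using assms by (intro gaussian_integral_finite) auto
  have C0: "C \<noteq> 0" unfolding C_def
  proof
    assume "(\<integral>\<^sup>+w. ennreal (exp (- (4 * t) * (norm (w::'a))\<^sup>2)) \<partial>lborel) = 0"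
    then have "AE w in (lborel :: 'a measure). False"
      by (subst (asm) nn_integral_0_iff_AE) auto
    then have "emeasure (lborel :: 'a measure) UNIV = 0"
      by (subst (asm) AE_iff_measurable[of UNIV]) auto
    then show False by simp
  qed
  have conv: "(\<integral>\<^sup>+w. ?h w x * ?h w y \<partial>lborel) = C * ennreal (exp (- t * (norm (x - y))\<^sup>2))" for x y
  proof -
    have id: "(norm (x - w))\<^sup>2 + (norm (y - w))\<^sup>2 = 2 * (norm (- ((1/2) *\<^sub>R (x + y)) + w))\<^sup>2 + (norm (x - y))\<^sup>2 / 2" for w
      unfolding power2_norm_eq_inner by (simp add: inner_simps inner_commute field_simps)
    have "(\<integral>\<^sup>+w. ?h w x * ?h w y \<partial>lborel)
       = (\<integral>\<^sup>+w. ennreal (exp (- (4 * t) * (norm (- ((1/2) *\<^sub>R (x + y)) + w))\<^sup>2)) * ennreal (exp (- t * (norm (x - y))\<^sup>2)) \<partial>lborel)"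
    proof (intro nn_integral_cong)
      fix w
      have "- (2 * t) * (norm (x - w))\<^sup>2 + - (2 * t) * (norm (y - w))\<^sup>2
         = - (2 * t) * ((norm (x - w))\<^sup>2 + (norm (y - w))\<^sup>2)" by (simp add: algebra_simps)
      also have "\<dots> = - (4 * t) * (norm (- ((1/2) *\<^sub>R (x + y)) + w))\<^sup>2 + - t * (norm (x - y))\<^sup>2"
        unfolding id by (simp add: field_simps)
      finally show "?h w x * ?h w y = ennreal (exp (- (4 * t) * (norm (- ((1/2) *\<^sub>R (x + y)) + w))\<^sup>2)) * ennreal (exp (- t * (norm (x - y))\<^sup>2))"
        by (simp only: ennreal_mult[symmetric] exp_ge_zero exp_add[symmetric])
    qed
    also have "\<dots> = (\<integral>\<^sup>+w. ennreal (exp (- (4 * t) * (norm (- ((1/2) *\<^sub>R (x + y)) + w))\<^sup>2)) \<partial>lborel) * ennreal (exp (- t * (norm (x - y))\<^sup>2))"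
      by (rule nn_integral_multc) measurable
    also have "\<dots> = C * ennreal (exp (- t * (norm (x - y))\<^sup>2))"
      unfolding C_def by (subst nn_integral_lborel_shift[of "\<lambda>w. ennreal (exp (- (4 * t) * (norm w)\<^sup>2))"]) measurable
    finally show ?thesis .
  qed
  have "positive_kernel (\<lambda>x y. \<integral>\<^sup>+w. ?h w x * ?h w y \<partial>lborel)"
    by (rule positive_kernel_product[OF sigma_finite_lborel]) measurable
  then have pk: "positive_kernel (\<lambda>x y::'a. C * ennreal (exp (- t * (norm (x - y))\<^sup>2)))"
    by (simp only: conv)
  have "positive_kernel (\<lambda>x y::'a. inverse C * (C * ennreal (exp (- t * (norm (x - y))\<^sup>2))))"
    by (rule positive_kernel_cmult[OF pk]) measurable
  moreover obtain r where r: "C = ennreal r" "0 < r" using Cfin C0 by (cases C) (auto simp: less_le)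
  then have "inverse C * C = 1" by (simp add: inverse_ennreal ennreal_mult[symmetric])
  then have "inverse C * (C * z) = z" for z by (simp add: mult.assoc[symmetric])
  ultimately show ?thesis by simp
qed

lemma inverse_eq_nn_integral_exp:
  fixes a :: real assumes "0 < a"
  shows "(\<integral>\<^sup>+t\<in>{0..}. ennreal (exp (- (t * a))) \<partial>lborel) = ennreal (1 / a)"
proof -
  have "((\<lambda>t. - exp (- (t * a)) / a) \<longlongrightarrow> - 0 / a) at_top"
    using assms
    by (intro tendsto_intros filterlim_compose[OF exp_at_bot] filterlim_compose[OF filterlim_uminus_at_bot_at_top]
        filterlim_at_top_mult_tendsto_pos[OF tendsto_const _ filterlim_ident, THEN filterlim_cong[THEN iffD1, rotated -1]]) (auto simp: mult.commute)
  then have "(\<integral>\<^sup>+t\<in>{0..}. ennreal (exp (- (t * a))) \<partial>lborel) = ennreal (- 0 / a - (- exp (- (0 * a)) / a))"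
    using assms by (intro nn_integral_FTC_atLeast) (auto intro!: derivative_eq_intros)
  then show ?thesis by simp
qed

lemma ln_ratio_eq_nn_integral:
  fixes A R s :: real assumes "0 < A" "A \<le> R" "0 \<le> s"
  shows "(\<integral>\<^sup>+u\<in>{A..R}. ennreal (1 / (u + s)) \<partial>lborel) = ennreal (ln ((R + s) / (A + s)))"
proof -
  have "(\<integral>\<^sup>+u\<in>{A..R}. ennreal (1 / (u + s)) \<partial>lborel) = ennreal (ln (R + s) - ln (A + s))"
    using assms by (intro nn_integral_FTC_Icc) (auto intro!: derivative_eq_intros)
  then show ?thesis using assms by (simp add: ln_div)
qed

lemma positive_kernel_ln_ratio:
  assumes "0 < A" "A \<le> R"
  shows "positive_kernel (\<lambda>x y::'a::euclidean_space. ennreal (ln ((R + (norm (x - y))\<^sup>2) / (A + (norm (x - y))\<^sup>2))))"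
proof -
  let ?r = "\<lambda>x y::'a. (norm (x - y))\<^sup>2"
  have 1: "positive_kernel (\<lambda>x y::'a. ennreal (exp (- (t * (u + ?r x y)))) * indicator {0..} t)" if "0 < u" "t \<noteq> 0" for t u
  proof (cases "t \<ge> 0")
    case True
    have "positive_kernel (\<lambda>x y::'a. ennreal (exp (- t * u)) * ennreal (exp (- t * ?r x y)))"
      using True that by (intro positive_kernel_cmult positive_kernel_gaussian) (simp, measurable)
    then show ?thesis using True
      by (simp add: ennreal_mult[symmetric] exp_add[symmetric] algebra_simps)
  qed (simp add: positive_kernel_def)
  have 2: "positive_kernel (\<lambda>x y::'a. ennreal (1 / (u + ?r x y)))" if "0 < u" for u
  proof -
    have e: "(\<integral>\<^sup>+t. ennreal (exp (- (t * (u + ?r x y)))) * indicator {0<..} t \<partial>lborel) = ennreal (1 / (u + ?r x y))" for x y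
    proof -
      have "(\<integral>\<^sup>+t. ennreal (exp (- (t * (u + ?r x y)))) * indicator {0<..} t \<partial>lborel)
        = (\<integral>\<^sup>+t. ennreal (exp (- (t * (u + ?r x y)))) * indicator {0..} t \<partial>lborel)"
        using AE_lborel_singleton[of "0::real"]
        by (intro nn_integral_cong_AE) (auto elim!: eventually_mono simp: indicator_def)
      then show ?thesis using that by (simp add: inverse_eq_nn_integral_exp add_pos_nonneg)
    qed
    have "positive_kernel (\<lambda>x y::'a. \<integral>\<^sup>+t. ennreal (exp (- (t * (u + ?r x y)))) * indicator {0<..} t \<partial>lborel)"
    proof (rule positive_kernel_mixture[OF sigma_finite_lborel])
      fix t :: real
      show "positive_kernel (\<lambda>x y::'a. ennreal (exp (- (t * (u + ?r x y)))) * indicator {0<..} t)"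
      proof (cases "t > 0")
        case True then show ?thesis using 1[of u t] that by simp
      qed (simp add: positive_kernel_def)
    qed measurable
    then show ?thesis unfolding e .
  qed
  have "positive_kernel (\<lambda>x y::'a. \<integral>\<^sup>+u\<in>{A..R}. ennreal (1 / (u + ?r x y)) \<partial>lborel)"
  proof (rule positive_kernel_mixture[OF sigma_finite_lborel])
    fix u :: real
    show "positive_kernel (\<lambda>x y::'a. ennreal (1 / (u + ?r x y)) * indicator {A..R} u)"
    proof (cases "u \<in> {A..R}")
      case True then show ?thesis using 2[of u] assms by simp
    qed (simp add: positive_kernel_def)
  qed measurable
  then show ?thesis using assms by (simp add: ln_ratio_eq_nn_integral)
qed

lemma one_plus_dist_square_le:
  fixes x y :: "'a::real_normed_vector"
  shows "1 + (norm (x - y))\<^sup>2 \<le> ((1 + norm x) * (1 + norm y))\<^sup>2"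
proof -
  have "(norm (x - y))\<^sup>2 \<le> (norm x + norm y)\<^sup>2" by (intro power_mono norm_triangle_ineq4) auto
  then have "1 + (norm (x - y))\<^sup>2 \<le> 1 + (norm x + norm y)\<^sup>2" by simp
  also have "\<dots> \<le> (1 + (norm x + norm y))\<^sup>2" by (simp add: power2_eq_square algebra_simps)
  also have "\<dots> \<le> ((1 + norm x) * (1 + norm y))\<^sup>2" by (intro power_mono) (auto simp: algebra_simps)
  finally show ?thesis .
qed

lemma theta_shift_nonneg [simp]: "0 \<le> theta_shift x"
  by (simp add: theta_shift_def)

lemma theta_shift_measurable [measurable]: "theta_shift \<in> borel_measurable borel"
  unfolding theta_shift_def[abs_def] by measurable

lemma half_ln_dist_square_le:
  fixes x y :: "'a::euclidean_space"
  assumes "0 \<le> A" "A \<le> 1"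
  shows "ln (A + (norm (x - y))\<^sup>2) / 2 \<le> theta_shift x + theta_shift y"
proof (cases "A + (norm (x - y))\<^sup>2 = 0")
  case False
  have "A + (norm (x - y))\<^sup>2 \<le> ((1 + norm x) * (1 + norm y))\<^sup>2" using one_plus_dist_square_le[of x y] assms by linarith
  then have "ln (A + (norm (x - y))\<^sup>2) \<le> ln (((1 + norm x) * (1 + norm y))\<^sup>2)"
    using False assms by (subst ln_le_cancel_iff) (auto simp: zero_less_mult_iff add_nonneg_nonneg less_le add_nonneg_eq_0_iff)
  also have "\<dots> = 2 * (theta_shift x + theta_shift y)"
    unfolding theta_shift_def by (subst ln_realpow) (auto simp: ln_mult add_pos_nonneg less_le add_nonneg_eq_0_iff)
  finally show ?thesis by simp
qed simp

lemma positive_smoothed_energy: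
  fixes \<mu> \<nu> :: "'a::euclidean_space measure"
  assumes p: "prob_space \<mu>" "prob_space \<nu>" and s [measurable_cong]: "sets \<mu> = sets borel" "sets \<nu> = sets borel"
    and fin: "(\<integral>\<^sup>+x. ennreal (theta_shift x) \<partial>\<mu>) < \<infinity>" "(\<integral>\<^sup>+x. ennreal (theta_shift x) \<partial>\<nu>) < \<infinity>"
    and A: "0 < A" "A \<le> 1"
  defines "k \<equiv> \<lambda>x y::'a. ennreal (theta_shift x + theta_shift y - ln (A + (norm (x - y))\<^sup>2) / 2)"
  shows "2 * (\<integral>\<^sup>+x. (\<integral>\<^sup>+y. k x y \<partial>\<nu>) \<partial>\<mu>) \<le> (\<integral>\<^sup>+x. (\<integral>\<^sup>+y. k x y \<partial>\<mu>) \<partial>\<mu>) + (\<integral>\<^sup>+x. (\<integral>\<^sup>+y. k x y \<partial>\<nu>) \<partial>\<nu>)"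
proof -
  define q where "q R x y = ennreal (ln (1 + (norm (x - y))\<^sup>2 / R) / 2)" for R and x y :: 'a
  define rho where "rho R x y = ennreal (ln ((R + (norm (x - y))\<^sup>2) / (A + (norm (x - y))\<^sup>2)))" for R and x y :: 'a
  define E where "E K M N = (\<integral>\<^sup>+x. (\<integral>\<^sup>+y. K x y \<partial>N) \<partial>M)" for K and M N :: "'a measure"
  define T where "T M = (\<integral>\<^sup>+x. ennreal (theta_shift x) \<partial>M)" for M :: "'a measure"
  have [measurable]: "(\<lambda>(x, y). k x y) \<in> borel_measurable (borel \<Otimes>\<^sub>M borel)"
    "(\<lambda>(x, y). q R x y) \<in> borel_measurable (borel \<Otimes>\<^sub>M borel)"
    "(\<lambda>(x, y). rho R x y) \<in> borel_measurable (borel \<Otimes>\<^sub>M borel)" for R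
    unfolding k_def q_def rho_def by measurable
  have id: "E k M N + E (q R) M N + ennreal (ln R / 2) = T M + T N + ennreal (1/2) * E (rho R) M N"
    if R: "R \<ge> 1" and M: "prob_space M" "prob_space N" and [measurable_cong]: "sets M = sets borel" "sets N = sets borel" for R M N
  proof -
    interpret M: prob_space M by fact
    interpret N: prob_space N by fact
    have pt: "k x y + q R x y + ennreal (ln R / 2) = ennreal (theta_shift x) + ennreal (theta_shift y) + ennreal (1/2) * rho R x y" for x y
    proof -
      let ?r = "(norm (x - y))\<^sup>2"
      have Rr: "R + ?r > 0" using R by (intro add_pos_nonneg) auto
      have Ar: "A + ?r > 0" using A by (intro add_pos_nonneg) auto
      have "ln (1 + ?r / R) = ln ((R + ?r) / R)" using R by (simp add: field_simps)
      also have "\<dots> = ln (R + ?r) - ln R" using R Rr by (subst ln_div) auto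
      finally have 1: "ln (1 + ?r / R) = ln (R + ?r) - ln R" .
      have 2: "ln ((R + ?r) / (A + ?r)) = ln (R + ?r) - ln (A + ?r)"
        using Rr Ar by (subst ln_div) auto
      have 3: "0 \<le> ln (1 + ?r / R)" "0 \<le> ln R" "0 \<le> ln ((R + ?r) / (A + ?r))"
        using R A by (auto intro!: ln_ge_zero simp: le_divide_eq add_pos_nonneg)
      show ?thesis
      proof -
        have "ennreal (theta_shift x) + ennreal (theta_shift y) + ennreal (1/2) * rho R x y
          = ennreal (theta_shift x + theta_shift y + 1/2 * ln ((R + ?r) / (A + ?r)))"
          unfolding rho_def using 3
          by (subst ennreal_mult[symmetric], simp, simp, subst ennreal_plus[symmetric], simp, simp, subst ennreal_plus[symmetric]) auto
        also have "theta_shift x + theta_shift y + 1/2 * ln ((R + ?r) / (A + ?r))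
          = (theta_shift x + theta_shift y - ln (A + ?r) / 2) + ln (1 + ?r / R) / 2 + ln R / 2"
          unfolding 1 2 by (simp add: field_simps)
        also have "ennreal \<dots> = k x y + q R x y + ennreal (ln R / 2)"
          using half_ln_dist_square_le[of A x y] A 3 unfolding k_def q_def
          by (subst ennreal_plus, simp, simp, subst ennreal_plus) auto
        finally show ?thesis by simp
      qed
    qed
    have "E (\<lambda>x y. k x y + q R x y + ennreal (ln R / 2)) M N = E k M N + E (q R) M N + ennreal (ln R / 2)"
      unfolding E_def by (simp add: nn_integral_add M.emeasure_space_1 N.emeasure_space_1)
    moreover have "E (\<lambda>x y. ennreal (theta_shift x) + ennreal (theta_shift y) + ennreal (1/2) * rho R x y) M N
      = T M + T N + ennreal (1/2) * E (rho R) M N"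
      unfolding E_def T_def by (simp add: nn_integral_add nn_integral_cmult M.emeasure_space_1 N.emeasure_space_1)
    ultimately show ?thesis unfolding pt by simp
  qed
  have main: "2 * E k \<mu> \<nu> \<le> E k \<mu> \<mu> + E k \<nu> \<nu> + (E (q R) \<mu> \<mu> + E (q R) \<nu> \<nu>)" if R: "R \<ge> 1" for R
  proof -
    have "2 * E (rho R) \<mu> \<nu> \<le> E (rho R) \<mu> \<mu> + E (rho R) \<nu> \<nu>"
      using positive_kernel_ln_ratio[of A R, where 'a='a] A R p s unfolding positive_kernel_def E_def rho_def by force
    then have "ennreal (1/2) * (2 * E (rho R) \<mu> \<nu>) \<le> ennreal (1/2) * (E (rho R) \<mu> \<mu> + E (rho R) \<nu> \<nu>)"
      by (rule mult_left_mono) simp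
    then have *: "2 * (T \<mu> + T \<nu> + ennreal (1/2) * E (rho R) \<mu> \<nu>) \<le> (T \<mu> + T \<mu> + ennreal (1/2) * E (rho R) \<mu> \<mu>) + (T \<nu> + T \<nu> + ennreal (1/2) * E (rho R) \<nu> \<nu>)"
    proof -
      have a: "2 * (t + u + h * a) = (t + t + (u + u)) + h * (2 * a)" for t u h a :: ennreal
        unfolding mult_2 distrib_left by (simp only: add_ac)
      have b: "(t + t + h * b) + (u + u + h * d) = (t + t + (u + u)) + h * (b + d)" for t u h b d :: ennreal
        by (simp add: distrib_left add_ac)
      show ?thesis unfolding a b by (rule add_left_mono) fact
    qed
    let ?c = "ennreal (ln R / 2)"
    have "?c + ?c + 2 * E k \<mu> \<nu> \<le> 2 * (E k \<mu> \<nu> + E (q R) \<mu> \<nu> + ?c)"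
      by (simp add: distrib_left mult_2 add_ac add_left_mono)
    also have "\<dots> \<le> (E k \<mu> \<mu> + E (q R) \<mu> \<mu> + ?c) + (E k \<nu> \<nu> + E (q R) \<nu> \<nu> + ?c)"
      using * R p s by (simp add: id)
    also have "\<dots> = ?c + ?c + (E k \<mu> \<mu> + E k \<nu> \<nu> + (E (q R) \<mu> \<mu> + E (q R) \<nu> \<nu>))" by (simp add: add_ac)
    finally show ?thesis
      by (subst (asm) ennreal_add_left_cancel_le) (auto simp: ennreal_plus[symmetric] simp del: ennreal_plus)
  qed
  have lim: "(\<lambda>n. E (q (real (Suc n))) M M) \<longlonglongrightarrow> 0"
    if "prob_space M" and [measurable_cong]: "sets M = sets borel" and Mfin: "T M < \<infinity>" for M
  proof -
    interpret M: prob_space M by fact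
    have "(\<lambda>n. \<integral>\<^sup>+p. q (real (Suc n)) (fst p) (snd p) \<partial>(M \<Otimes>\<^sub>M M)) \<longlonglongrightarrow> (\<integral>\<^sup>+p. 0 \<partial>(M \<Otimes>\<^sub>M M))"
    proof (rule nn_integral_dominated_convergence[where w = "\<lambda>p. ennreal (theta_shift (fst p)) + ennreal (theta_shift (snd p))"])
      show "AE p in M \<Otimes>\<^sub>M M. q (real (Suc n)) (fst p) (snd p) \<le> ennreal (theta_shift (fst p)) + ennreal (theta_shift (snd p))" for n
      proof (rule AE_I2)
        fix p :: "'a \<times> 'a"
        let ?r = "(norm (fst p - snd p))\<^sup>2"
        have "?r / real (Suc n) \<le> ?r" by (simp add: field_simps)
        then have "ln (1 + ?r / real (Suc n)) / 2 \<le> ln (1 + ?r) / 2"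
          by (subst divide_le_cancel, subst ln_le_cancel_iff) (auto simp: add_pos_nonneg)
        also have "\<dots> \<le> theta_shift (fst p) + theta_shift (snd p)" by (rule half_ln_dist_square_le) auto
        finally show "q (real (Suc n)) (fst p) (snd p) \<le> ennreal (theta_shift (fst p)) + ennreal (theta_shift (snd p))"
          unfolding q_def by (simp add: ennreal_plus[symmetric] ennreal_leI del: ennreal_plus)
      qed
      show "(\<integral>\<^sup>+p. ennreal (theta_shift (fst p)) + ennreal (theta_shift (snd p)) \<partial>(M \<Otimes>\<^sub>M M)) < \<infinity>"
        using Mfin by (subst M.nn_integral_fst[symmetric]) (auto simp: nn_integral_add T_def M.emeasure_space_1)
      show "AE p in M \<Otimes>\<^sub>M M. (\<lambda>n. q (real (Suc n)) (fst p) (snd p)) \<longlonglongrightarrow> 0"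
      proof (rule AE_I2)
        fix p :: "'a \<times> 'a"
        let ?r = "(norm (fst p - snd p))\<^sup>2"
        have "(\<lambda>n. ?r * inverse (real (Suc n))) \<longlonglongrightarrow> ?r * 0" by (intro tendsto_intros LIMSEQ_inverse_real_of_nat)
        then have "(\<lambda>n. ?r / real (Suc n)) \<longlonglongrightarrow> 0" by (simp add: divide_inverse)
        then have "(\<lambda>n. ln (1 + ?r / real (Suc n)) / 2) \<longlonglongrightarrow> ln (1 + 0) / 2" by (intro tendsto_intros) auto
        then have "(\<lambda>n. ennreal (ln (1 + ?r / real (Suc n)) / 2)) \<longlonglongrightarrow> ennreal (ln (1 + 0) / 2)" by (rule tendsto_ennrealI)
        then show "(\<lambda>n. q (real (Suc n)) (fst p) (snd p)) \<longlonglongrightarrow> 0" unfolding q_def by simp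
      qed
    qed measurable
    moreover have "(\<integral>\<^sup>+p. q R (fst p) (snd p) \<partial>(M \<Otimes>\<^sub>M M)) = E (q R) M M" for R
      unfolding E_def by (subst M.nn_integral_fst[symmetric]) auto
    ultimately show ?thesis by simp
  qed
  have "(\<lambda>n. E k \<mu> \<mu> + E k \<nu> \<nu> + (E (q (real (Suc n))) \<mu> \<mu> + E (q (real (Suc n))) \<nu> \<nu>)) \<longlonglongrightarrow> E k \<mu> \<mu> + E k \<nu> \<nu> + (0 + 0)"
    using p s fin by (intro tendsto_add lim tendsto_const) (auto simp: T_def)
  then have "2 * E k \<mu> \<nu> \<le> E k \<mu> \<mu> + E k \<nu> \<nu> + (0 + 0)"
    by (rule LIMSEQ_le_const) (use main in auto)
  then show ?thesis by (simp add: E_def)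
qed

section \<open>Minimizers of energy plus entropy\<close>

definition entropy_fun :: "real \<Rightarrow> real" where
  "entropy_fun t = t * ln t - t + 1"

lemma entropy_fun_measurable [measurable]: "entropy_fun \<in> borel_measurable borel"
  unfolding entropy_fun_def[abs_def] by measurable

lemma relative_entropy_fun_ge:
  fixes a m :: real
  assumes "0 \<le> a" "0 < m"
  shows "(a - m)\<^sup>2 / (2 * (a + m)) \<le> a * ln a - a * ln m - a + m"
proof (cases "a = 0")
  case True
  then show ?thesis using assms by (simp add: power2_eq_square)
next
  case False
  define \<alpha> \<mu> where "\<alpha> = sqrt a" and "\<mu> = sqrt m"
  have pos: "0 < \<alpha>" "0 < \<mu>" using assms False by (auto simp: \<alpha>_def \<mu>_def)
  have am: "a = \<alpha>\<^sup>2" "m = \<mu>\<^sup>2" using assms by (auto simp: \<alpha>_def \<mu>_def)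
  have "ln (\<mu> / \<alpha>) \<le> \<mu> / \<alpha> - 1" using pos by (intro ln_le_minus_one) auto
  then have "2 * \<alpha>\<^sup>2 * ln (\<mu> / \<alpha>) \<le> 2 * \<alpha>\<^sup>2 * (\<mu> / \<alpha> - 1)" by (intro mult_left_mono) auto
  also have "\<dots> = 2 * \<alpha> * \<mu> - 2 * \<alpha>\<^sup>2" using pos by (simp add: field_simps power2_eq_square)
  finally have 1: "2 * \<alpha>\<^sup>2 * (ln \<mu> - ln \<alpha>) \<le> 2 * \<alpha> * \<mu> - 2 * \<alpha>\<^sup>2" using pos by (simp add: ln_div)
  have "(\<alpha>\<^sup>2 - \<mu>\<^sup>2)\<^sup>2 = (\<alpha> - \<mu>)\<^sup>2 * (\<alpha> + \<mu>)\<^sup>2" by (simp add: power2_eq_square algebra_simps)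
  also have "\<dots> \<le> (\<alpha> - \<mu>)\<^sup>2 * (2 * (\<alpha>\<^sup>2 + \<mu>\<^sup>2))"
    using sum_squares_bound[of \<alpha> \<mu>] by (intro mult_left_mono) (auto simp: power2_eq_square algebra_simps)
  finally have "(\<alpha>\<^sup>2 - \<mu>\<^sup>2)\<^sup>2 / (2 * (\<alpha>\<^sup>2 + \<mu>\<^sup>2)) \<le> (\<alpha> - \<mu>)\<^sup>2"
    using pos by (simp add: divide_le_eq add_pos_pos)
  also have "\<dots> = \<alpha>\<^sup>2 - 2 * \<alpha> * \<mu> + \<mu>\<^sup>2" by (simp add: power2_eq_square algebra_simps)
  also have "\<dots> \<le> \<alpha>\<^sup>2 * ln (\<alpha>\<^sup>2) - \<alpha>\<^sup>2 * ln (\<mu>\<^sup>2) - \<alpha>\<^sup>2 + \<mu>\<^sup>2"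
    using 1 pos by (simp add: ln_realpow algebra_simps)
  finally show ?thesis unfolding am .
qed

lemma entropy_fun_tangent:
  assumes "0 \<le> a" "0 < m"
  shows "entropy_fun m + ln m * (a - m) \<le> entropy_fun a"
proof -
  have "0 \<le> (a - m)\<^sup>2 / (2 * (a + m))" using assms by auto
  with relative_entropy_fun_ge[OF assms] show ?thesis by (simp add: entropy_fun_def algebra_simps)
qed

lemma entropy_fun_nonneg: "0 \<le> a \<Longrightarrow> 0 \<le> entropy_fun a"
  using entropy_fun_tangent[of a 1] by (simp add: entropy_fun_def)

lemma mult_le_entropy_fun_add_exp: "0 \<le> a \<Longrightarrow> a * y \<le> entropy_fun a + exp y"
  using entropy_fun_tangent[of a "exp y"] by (simp add: entropy_fun_def algebra_simps)

lemma entropy_fun_midpoint: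
  assumes "0 \<le> a" "0 \<le> b"
  shows "entropy_fun ((a + b) / 2) + (a - b)\<^sup>2 / (12 * (a + b)) \<le> (entropy_fun a + entropy_fun b) / 2"
proof (cases "a + b = 0")
  case True
  then have "a = 0" "b = 0" using assms by auto
  then show ?thesis by (simp add: entropy_fun_def)
next
  case False
  define m where "m = (a + b) / 2"
  define D where "D = (a - b)\<^sup>2 / (12 * (a + b))"
  have m: "0 < m" using False assms by (auto simp: m_def)
  have b: "(a - b)\<^sup>2 / (12 * (a + b)) \<le> (x - m)\<^sup>2 / (2 * (x + m))" if "0 \<le> x" "x \<le> 2 * m" "(x - m)\<^sup>2 = (a - b)\<^sup>2 / 4" for x
  proof -
    have "(a - b)\<^sup>2 / (12 * (a + b)) = ((a - b)\<^sup>2 / 4) / (6 * m)" unfolding m_def by (simp add: field_simps)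
    also have "\<dots> \<le> ((a - b)\<^sup>2 / 4) / (2 * (x + m))" using that m by (intro divide_left_mono mult_pos_pos) auto
    finally show ?thesis by (simp only: that(3))
  qed
  have "(a - b)\<^sup>2 / (12 * (a + b)) \<le> a * ln a - a * ln m - a + m"
    using assms m by (intro order_trans[OF b relative_entropy_fun_ge]) (auto simp: m_def power2_eq_square field_simps)
  moreover have "(a - b)\<^sup>2 / (12 * (a + b)) \<le> b * ln b - b * ln m - b + m"
    using assms m by (intro order_trans[OF b relative_entropy_fun_ge]) (auto simp: m_def power2_eq_square field_simps)
  moreover have "a * ln m + b * ln m = 2 * (m * ln m)"
    by (subst distrib_right[symmetric]) (simp add: m_def)
  moreover have "a + b = 2 * m" by (simp add: m_def)
  ultimately show ?thesis
    unfolding entropy_fun_def m_def[symmetric] D_def[symmetric]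
  proof -
    have "M - m + 1 + D \<le> (p - a + 1 + (q - b + 1)) / 2"
      if "D \<le> p - r - a + m" "D \<le> q - s - b + m" "r + s = 2 * M" "a + b = 2 * m" for p q r s M D :: real
      using that by (simp add: field_simps)
    then show "D \<le> a * ln a - a * ln m - a + m \<Longrightarrow> D \<le> b * ln b - b * ln m - b + m \<Longrightarrow>
      a * ln m + b * ln m = 2 * (m * ln m) \<Longrightarrow> a + b = 2 * m \<Longrightarrow>
      m * ln m - m + 1 + D \<le> (a * ln a - a + 1 + (b * ln b - b + 1)) / 2" by blast
  qed
qed

lemma entropy_fun_le: "0 \<le> a \<Longrightarrow> entropy_fun a \<le> a\<^sup>2 + 1"
  using mult_left_mono[OF ln_le_minus_one[of a], of a]
  by (cases "a = 0") (auto simp: entropy_fun_def power2_eq_square algebra_simps)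

lemma tendsto_entropy_fun:
  assumes "(g \<longlongrightarrow> l) F" "\<And>n. 0 \<le> g n"
  shows "((\<lambda>n. entropy_fun (g n)) \<longlongrightarrow> entropy_fun l) F"
proof (cases "l = 0")
  case False
  then show ?thesis unfolding entropy_fun_def using assms by (intro tendsto_intros) auto
next
  case True
  have b: "\<bar>t * ln t\<bar> \<le> 2 * sqrt t + t\<^sup>2" if t: "0 \<le> t" for t :: real
  proof (cases "t = 0")
    case False
    then have t: "t > 0" using that by simp
    have "- ln (sqrt t) \<le> inverse (sqrt t) - 1" using ln_le_minus_one[of "inverse (sqrt t)"] t by (simp add: ln_inverse)
    then have "- ln t \<le> 2 * inverse (sqrt t)" using t by (simp add: ln_sqrt)
    then have "t * (- ln t) \<le> t * (2 * inverse (sqrt t))" using t by (intro mult_left_mono) auto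
    also have "\<dots> = 2 * sqrt t" using t by (simp add: field_simps real_div_sqrt)
    finally have 1: "- (t * ln t) \<le> 2 * sqrt t" by simp
    have "t * ln t \<le> t * t" using t ln_le_minus_one[of t] by (intro mult_left_mono) auto
    then have "t * ln t \<le> t\<^sup>2" by (simp add: power2_eq_square)
    moreover have "0 \<le> t\<^sup>2" "0 \<le> sqrt t" using t by auto
    ultimately show ?thesis using 1 by linarith
  qed simp
  have g0: "(g \<longlongrightarrow> 0) F" using assms True by simp
  have "((\<lambda>n. 2 * sqrt (g n) + (g n)\<^sup>2) \<longlongrightarrow> 2 * sqrt 0 + 0\<^sup>2) F"
    by (intro tendsto_intros g0)
  then have l: "((\<lambda>n. 2 * sqrt (g n) + (g n)\<^sup>2) \<longlongrightarrow> 0) F" by simp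
  have bb: "norm (g n * ln (g n)) \<le> 2 * sqrt (g n) + (g n)\<^sup>2" for n
    using b[OF assms(2)] by simp
  have "((\<lambda>n. g n * ln (g n)) \<longlongrightarrow> 0) F"
    by (rule Lim_null_comparison[OF always_eventually l]) (use bb in blast)
  then have "((\<lambda>n. g n * ln (g n) - g n + 1) \<longlongrightarrow> 0 - 0 + 1) F"
    using assms True by (intro tendsto_intros) auto
  then show ?thesis using True by (simp add: entropy_fun_def)
qed

locale entropic_energy = prob_space \<nu> for \<nu> :: "'a::euclidean_space measure" +
  fixes k :: "'a \<Rightarrow> 'a \<Rightarrow> real" and th :: "'a \<Rightarrow> real" and c C :: real
  assumes sets_nu [measurable_cong]: "sets \<nu> = sets borel"
    and k_measurable: "(\<lambda>(x, y). k x y) \<in> borel_measurable (borel \<Otimes>\<^sub>M borel)"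
    and k_nonneg: "0 \<le> k x y" and k_sym: "k x y = k y x"
    and th_measurable [measurable]: "th \<in> borel_measurable borel"
    and th_nonneg: "0 \<le> th x"
    and exp_th: "(\<integral>\<^sup>+x. ennreal (exp (th x)) \<partial>\<nu>) < \<infinity>"
    and exp_k: "(\<integral>\<^sup>+y. ennreal (exp ((k x y - th x - th y) / 2)) \<partial>\<nu>) \<le> ennreal C"
    and c_nonneg: "0 \<le> c"
    and positive: "\<And>f h. f \<in> borel_measurable borel \<Longrightarrow> h \<in> borel_measurable borel \<Longrightarrow> (\<And>x. 0 \<le> f x) \<Longrightarrow> (\<And>x. 0 \<le> h x) \<Longrightarrow>
        (\<integral>\<^sup>+x. ennreal (f x) \<partial>\<nu>) = 1 \<Longrightarrow> (\<integral>\<^sup>+x. ennreal (h x) \<partial>\<nu>) = 1 \<Longrightarrow>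
        (\<integral>\<^sup>+x. ennreal (th x * f x) \<partial>\<nu>) < \<infinity> \<Longrightarrow> (\<integral>\<^sup>+x. ennreal (th x * h x) \<partial>\<nu>) < \<infinity> \<Longrightarrow>
        2 * (\<integral>\<^sup>+x. (\<integral>\<^sup>+y. ennreal (k x y * f y) * ennreal (h x) \<partial>\<nu>) \<partial>\<nu>)
        \<le> (\<integral>\<^sup>+x. (\<integral>\<^sup>+y. ennreal (k x y * f y) * ennreal (f x) \<partial>\<nu>) \<partial>\<nu>) + (\<integral>\<^sup>+x. (\<integral>\<^sup>+y. ennreal (k x y * h y) * ennreal (h x) \<partial>\<nu>) \<partial>\<nu>)"
begin

lemmas k_measurable' [measurable] = measurable_compose[OF _ k_measurable, of "\<lambda>w. (f w, g w)" for f g, simplified]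

definition dens :: "('a \<Rightarrow> real) \<Rightarrow> bool" where
  "dens f \<longleftrightarrow> f \<in> borel_measurable borel \<and> (\<forall>x. 0 \<le> f x) \<and> (\<integral>\<^sup>+x. ennreal (f x) \<partial>\<nu>) = 1 \<and>
     (\<integral>\<^sup>+x. ennreal (entropy_fun (f x)) \<partial>\<nu>) < \<infinity>"

definition pot :: "('a \<Rightarrow> real) \<Rightarrow> 'a \<Rightarrow> real" where
  "pot f x = (\<integral>y. k x y * f y \<partial>\<nu>)"

definition inter :: "('a \<Rightarrow> real) \<Rightarrow> ('a \<Rightarrow> real) \<Rightarrow> real" where
  "inter f h = (\<integral>x. pot f x * h x \<partial>\<nu>)"

definition ent :: "('a \<Rightarrow> real) \<Rightarrow> real" where
  "ent f = (\<integral>x. entropy_fun (f x) \<partial>\<nu>)"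

definition total :: "('a \<Rightarrow> real) \<Rightarrow> real" where
  "total f = c * inter f f + ent f"

lemma densD:
  assumes "dens f"
  shows "f \<in> borel_measurable borel" "0 \<le> f x" "(\<integral>\<^sup>+x. ennreal (f x) \<partial>\<nu>) = 1"
    "integrable \<nu> f" "integral\<^sup>L \<nu> f = 1" "integrable \<nu> (\<lambda>x. entropy_fun (f x))"
    "integrable \<nu> (\<lambda>x. th x * f x)"
proof -
  show f [measurable]: "f \<in> borel_measurable borel" and nn: "0 \<le> f x" and one: "(\<integral>\<^sup>+x. ennreal (f x) \<partial>\<nu>) = 1" for x
    using assms by (auto simp: dens_def)
  show "integrable \<nu> f" using one nn by (intro integrableI_nonneg) auto
  show "integral\<^sup>L \<nu> f = 1" using one nn by (subst integral_eq_nn_integral) auto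
  have E: "(\<integral>\<^sup>+x. ennreal (entropy_fun (f x)) \<partial>\<nu>) < \<infinity>" using assms by (auto simp: dens_def)
  then show "integrable \<nu> (\<lambda>x. entropy_fun (f x))"
    using nn entropy_fun_nonneg by (intro integrableI_nonneg) auto
  have "(\<integral>\<^sup>+x. ennreal (th x * f x) \<partial>\<nu>) \<le> (\<integral>\<^sup>+x. ennreal (entropy_fun (f x)) + ennreal (exp (th x)) \<partial>\<nu>)"
    using nn mult_le_entropy_fun_add_exp[OF nn] entropy_fun_nonneg[OF nn]
    by (intro nn_integral_mono) (auto simp: ennreal_plus[symmetric] mult.commute[of "th _"] intro!: ennreal_leI simp del: ennreal_plus)
  also have "\<dots> < \<infinity>" using E exp_th by (simp add: nn_integral_add)
  finally show "integrable \<nu> (\<lambda>x. th x * f x)" using nn th_nonneg by (intro integrableI_nonneg) auto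
qed

lemma pot_facts:
  assumes f: "dens f"
  shows "integrable \<nu> (\<lambda>y. k x y * f y)" "(\<integral>\<^sup>+y. ennreal (k x y * f y) \<partial>\<nu>) = ennreal (pot f x)"
    "0 \<le> pot f x" "pot f \<in> borel_measurable borel"
    "\<exists>B. \<forall>x. pot f x \<le> B + th x"
proof -
  note [measurable] = densD(1)[OF f]
  note nn = densD(2)[OF f]
  define B where "B = 2 * ent f + 2 * \<bar>C\<bar> + (\<integral>y. th y * f y \<partial>\<nu>)"
  have B0: "0 \<le> ent f" "0 \<le> (\<integral>y. th y * f y \<partial>\<nu>)" unfolding ent_def using nn th_nonneg
    by (auto intro!: integral_nonneg_AE entropy_fun_nonneg)
  have bnd: "(\<integral>\<^sup>+y. ennreal (k x y * f y) \<partial>\<nu>) \<le> ennreal (B + th x)" for x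
  proof -
    have "(\<integral>\<^sup>+y. ennreal (k x y * f y) \<partial>\<nu>) \<le> (\<integral>\<^sup>+y. ennreal (2 * entropy_fun (f y) + th x * f y + th y * f y)
       + 2 * ennreal (exp ((k x y - th x - th y) / 2)) \<partial>\<nu>)"
    proof (intro nn_integral_mono)
      fix y
      have "k x y * f y \<le> (2 * entropy_fun (f y) + th x * f y + th y * f y) + 2 * exp ((k x y - th x - th y) / 2)"
        using mult_le_entropy_fun_add_exp[OF nn, of y "(k x y - th x - th y) / 2"] by (simp add: algebra_simps)
      then have "ennreal (k x y * f y) \<le> ennreal ((2 * entropy_fun (f y) + th x * f y + th y * f y) + 2 * exp ((k x y - th x - th y) / 2))"
        by (rule ennreal_leI)
      also have "\<dots> = ennreal (2 * entropy_fun (f y) + th x * f y + th y * f y) + 2 * ennreal (exp ((k x y - th x - th y) / 2))"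
        using nn th_nonneg entropy_fun_nonneg[OF nn] by (subst ennreal_plus) (auto simp: ennreal_mult)
      finally show "ennreal (k x y * f y) \<le> \<dots>" .
    qed
    also have "\<dots> = (\<integral>\<^sup>+y. ennreal (2 * entropy_fun (f y) + th x * f y + th y * f y) \<partial>\<nu>) + 2 * (\<integral>\<^sup>+y. ennreal (exp ((k x y - th x - th y) / 2)) \<partial>\<nu>)"
      by (subst nn_integral_add) (auto simp: nn_integral_cmult)
    also have "(\<integral>\<^sup>+y. ennreal (2 * entropy_fun (f y) + th x * f y + th y * f y) \<partial>\<nu>) = ennreal (\<integral>y. 2 * entropy_fun (f y) + th x * f y + th y * f y \<partial>\<nu>)"
      using densD[OF f] th_nonneg entropy_fun_nonneg[OF nn] by (intro nn_integral_eq_integral) auto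
    also have "(\<integral>y. 2 * entropy_fun (f y) + th x * f y + th y * f y \<partial>\<nu>) = 2 * ent f + th x + (\<integral>y. th y * f y \<partial>\<nu>)"
      using densD[OF f] by (simp add: ent_def)
    also have "2 * (\<integral>\<^sup>+y. ennreal (exp ((k x y - th x - th y) / 2)) \<partial>\<nu>) \<le> 2 * ennreal \<bar>C\<bar>"
      using exp_k[of x] by (intro mult_left_mono order_trans[OF exp_k] ennreal_leI) auto
    also have "ennreal (2 * ent f + th x + (\<integral>y. th y * f y \<partial>\<nu>)) + 2 * ennreal \<bar>C\<bar> = ennreal (B + th x)"
      using B0 th_nonneg[of x] unfolding B_def by (simp add: ennreal_mult[symmetric] ennreal_plus[symmetric] ennreal_numeral[symmetric] algebra_simps del: ennreal_plus ennreal_numeral)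
    finally show ?thesis by (auto simp: add_left_mono)
  qed
  show int: "integrable \<nu> (\<lambda>y. k x y * f y)" for x
    using bnd[of x] nn k_nonneg by (intro integrableI_nonneg) (auto intro: le_less_trans)
  show eq: "(\<integral>\<^sup>+y. ennreal (k x y * f y) \<partial>\<nu>) = ennreal (pot f x)" for x
    unfolding pot_def using int nn k_nonneg by (intro nn_integral_eq_integral) auto
  show "0 \<le> pot f x" for x unfolding pot_def using nn k_nonneg by (intro integral_nonneg_AE) auto
  show "pot f \<in> borel_measurable borel" unfolding pot_def[abs_def] by measurable
  have "pot f x \<le> B + th x" for x
    using bnd[of x] B0 th_nonneg[of x] unfolding eq by (subst (asm) ennreal_le_iff) (auto simp: B_def)
  then show "\<exists>B. \<forall>x. pot f x \<le> B + th x" by blast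
qed

lemma inter_facts:
  assumes f: "dens f" and h: "dens h"
  shows "integrable \<nu> (\<lambda>x. pot f x * h x)" "0 \<le> inter f h"
    "(\<integral>\<^sup>+x. (\<integral>\<^sup>+y. ennreal (k x y * f y) * ennreal (h x) \<partial>\<nu>) \<partial>\<nu>) = ennreal (inter f h)"
    "inter f h = inter h f"
proof -
  note [measurable] = densD(1)[OF f] densD(1)[OF h] pot_facts(4)[OF f] pot_facts(4)[OF h]
  have int: "integrable \<nu> (\<lambda>x. pot f x * h x)" if fh: "dens f" "dens h" for f h
  proof -
    note [measurable] = densD(1)[OF fh(1)] densD(1)[OF fh(2)] pot_facts(4)[OF fh(1)]
    obtain B where B: "\<And>x. pot f x \<le> B + th x" using pot_facts(5)[OF fh(1)] by auto
    show ?thesis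
    proof (rule Bochner_Integration.integrable_bound[of _ "\<lambda>x. B * h x + th x * h x"])
      show "AE x in \<nu>. norm (pot f x * h x) \<le> norm (B * h x + th x * h x)"
        using B pot_facts(3)[OF fh(1)] densD(2)[OF fh(2)]
        by (intro AE_I2) (auto simp: abs_mult distrib_right[symmetric] intro!: mult_right_mono order_trans[OF _ abs_ge_self])
    qed (use densD[OF fh(2)] in auto)
  qed
  show "integrable \<nu> (\<lambda>x. pot f x * h x)" by (rule int[OF f h])
  show "0 \<le> inter f h" unfolding inter_def using pot_facts(3)[OF f] densD(2)[OF h] by (intro integral_nonneg_AE) auto
  have eq: "(\<integral>\<^sup>+x. (\<integral>\<^sup>+y. ennreal (k x y * f y) * ennreal (h x) \<partial>\<nu>) \<partial>\<nu>) = ennreal (inter f h)" if fh: "dens f" "dens h" for f h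
  proof -
    note [measurable] = densD(1)[OF fh(1)] densD(1)[OF fh(2)]
    have "(\<integral>\<^sup>+x. (\<integral>\<^sup>+y. ennreal (k x y * f y) * ennreal (h x) \<partial>\<nu>) \<partial>\<nu>) = (\<integral>\<^sup>+x. ennreal (pot f x * h x) \<partial>\<nu>)"
      using pot_facts(3)[OF fh(1)] densD(2)[OF fh(2)]
      by (intro nn_integral_cong) (simp add: nn_integral_multc pot_facts(2)[OF fh(1)] ennreal_mult)
    also have "\<dots> = ennreal (inter f h)" unfolding inter_def
      using int[OF fh] pot_facts(3)[OF fh(1)] densD(2)[OF fh(2)] by (intro nn_integral_eq_integral) auto
    finally show ?thesis .
  qed
  show "(\<integral>\<^sup>+x. (\<integral>\<^sup>+y. ennreal (k x y * f y) * ennreal (h x) \<partial>\<nu>) \<partial>\<nu>) = ennreal (inter f h)" by (rule eq[OF f h])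
  interpret P: pair_sigma_finite \<nu> \<nu> ..
  have "ennreal (inter f h) = (\<integral>\<^sup>+y. (\<integral>\<^sup>+x. ennreal (k x y * f y) * ennreal (h x) \<partial>\<nu>) \<partial>\<nu>)"
    unfolding eq[OF f h, symmetric] by (rule P.Fubini') measurable
  also have "\<dots> = (\<integral>\<^sup>+y. (\<integral>\<^sup>+x. ennreal (k y x * h x) * ennreal (f y) \<partial>\<nu>) \<partial>\<nu>)"
    using densD(2)[OF f] densD(2)[OF h] k_nonneg by (intro nn_integral_cong) (simp add: ennreal_mult[symmetric] k_sym mult_ac)
  also have "\<dots> = ennreal (inter h f)" by (rule eq[OF h f])
  finally show "inter f h = inter h f"
    unfolding inter_def using pot_facts(3)[OF f] pot_facts(3)[OF h] densD(2)[OF h] densD(2)[OF f]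
    by (subst (asm) ennreal_inj) (auto intro!: integral_nonneg_AE)
qed

lemma inter_positive:
  assumes f: "dens f" and h: "dens h"
  shows "2 * inter f h \<le> inter f f + inter h h"
proof -
  have fin: "(\<integral>\<^sup>+x. ennreal (th x * g x) \<partial>\<nu>) < \<infinity>" if "dens g" for g
    using densD(7)[OF that] densD(2)[OF that] th_nonneg by (subst nn_integral_eq_integral) auto
  have "2 * ennreal (inter f h) \<le> ennreal (inter f f) + ennreal (inter h h)"
    using positive[OF densD(1)[OF f] densD(1)[OF h] densD(2)[OF f] densD(2)[OF h] densD(3)[OF f] densD(3)[OF h] fin[OF f] fin[OF h]]
    unfolding inter_facts(3)[OF f h] inter_facts(3)[OF f f] inter_facts(3)[OF h h] .
  then show ?thesis using inter_facts(2)[OF f h] inter_facts(2)[OF f f] inter_facts(2)[OF h h]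
    by (simp add: ennreal_mult[symmetric] ennreal_plus[symmetric] ennreal_numeral[symmetric] del: ennreal_plus ennreal_numeral)
qed

lemma dens_mix:
  assumes f: "dens f" and h: "dens h" and e: "0 \<le> e" "e \<le> 1"
  defines "g \<equiv> \<lambda>x. (1 - e) * f x + e * h x"
  shows "dens g" "inter g g = (1 - e)\<^sup>2 * inter f f + 2 * e * (1 - e) * inter f h + e\<^sup>2 * inter h h"
proof -
  note [measurable] = densD(1)[OF f] densD(1)[OF h] pot_facts(4)[OF f] pot_facts(4)[OF h]
  have nn: "0 \<le> g x" for x unfolding g_def using e densD(2)[OF f] densD(2)[OF h] by simp
  have [measurable]: "g \<in> borel_measurable borel" unfolding g_def by measurable
  have int: "integrable \<nu> g" "integral\<^sup>L \<nu> g = 1" unfolding g_def using densD[OF f] densD[OF h] by auto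
  have one: "(\<integral>\<^sup>+x. ennreal (g x) \<partial>\<nu>) = 1" using int nn by (subst nn_integral_eq_integral) auto
  have cvx: "entropy_fun (g x) \<le> (1 - e) * entropy_fun (f x) + e * entropy_fun (h x)" for x
  proof (cases "g x = 0")
    case True
    then have "(1 - e) * f x = 0" "e * h x = 0" unfolding g_def using e densD(2)[OF f, of x] densD(2)[OF h, of x]
      by (smt (verit) mult_nonneg_nonneg)+
    then have "e = 1 \<or> f x = 0" "e = 0 \<or> h x = 0" by auto
    then show ?thesis using True e by (auto simp: entropy_fun_def)
  next
    case False
    then have m: "0 < g x" using nn[of x] by simp
    have "(1 - e) * (entropy_fun (g x) + ln (g x) * (f x - g x)) + e * (entropy_fun (g x) + ln (g x) * (h x - g x))
      \<le> (1 - e) * entropy_fun (f x) + e * entropy_fun (h x)"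
      using e densD(2)[OF f] densD(2)[OF h] m by (intro add_mono mult_left_mono entropy_fun_tangent) auto
    moreover have "(1 - e) * (entropy_fun (g x) + ln (g x) * (f x - g x)) + e * (entropy_fun (g x) + ln (g x) * (h x - g x))
      = entropy_fun (g x) + ln (g x) * ((1 - e) * f x + e * h x - g x)" by (simp add: algebra_simps)
    ultimately show ?thesis by (simp add: g_def)
  qed
  have "integrable \<nu> (\<lambda>x. entropy_fun (g x))"
  proof (rule Bochner_Integration.integrable_bound[of _ "\<lambda>x. (1 - e) * entropy_fun (f x) + e * entropy_fun (h x)"])
    show "AE x in \<nu>. norm (entropy_fun (g x)) \<le> norm ((1 - e) * entropy_fun (f x) + e * entropy_fun (h x))"
      using cvx entropy_fun_nonneg[OF nn] by (intro AE_I2) (auto intro: order_trans[OF _ abs_ge_self])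
  qed (use densD[OF f] densD[OF h] in auto)
  then have "(\<integral>\<^sup>+x. ennreal (entropy_fun (g x)) \<partial>\<nu>) < \<infinity>"
    using entropy_fun_nonneg[OF nn] by (subst nn_integral_eq_integral) auto
  then show g: "dens g" using one nn by (simp add: dens_def)
  have pot: "pot g x = (1 - e) * pot f x + e * pot h x" for x
    unfolding pot_def g_def using pot_facts(1)[OF f] pot_facts(1)[OF h]
    by (simp add: distrib_left mult.left_commute[of "k x _"])
  have "pot g x * g x = (1 - e)\<^sup>2 * (pot f x * f x) + (1 - e) * e * (pot f x * h x) + (1 - e) * e * (pot h x * f x) + e\<^sup>2 * (pot h x * h x)" for x
    unfolding pot unfolding g_def by (simp add: power2_eq_square algebra_simps)
  then have "inter g g = (1 - e)\<^sup>2 * inter f f + (1 - e) * e * inter f h + (1 - e) * e * inter h f + e\<^sup>2 * inter h h"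
    unfolding inter_def using inter_facts(1)[OF f f] inter_facts(1)[OF f h] inter_facts(1)[OF h f] inter_facts(1)[OF h h] by simp
  then show "inter g g = (1 - e)\<^sup>2 * inter f f + 2 * e * (1 - e) * inter f h + e\<^sup>2 * inter h h"
    using inter_facts(4)[OF f h] by simp
qed

lemma ent_nonneg: "dens f \<Longrightarrow> 0 \<le> ent f"
  unfolding ent_def by (intro integral_nonneg_AE AE_I2 entropy_fun_nonneg densD(2))

lemma total_nonneg: "dens f \<Longrightarrow> 0 \<le> total f"
  unfolding total_def using ent_nonneg inter_facts(2) c_nonneg by simp

lemma dens_one: "dens (\<lambda>_. 1)"
  by (simp add: dens_def entropy_fun_def emeasure_space_1)

lemma total_midpoint:
  assumes f: "dens f" and h: "dens h"
  shows "integrable \<nu> (\<lambda>x. (f x - h x)\<^sup>2 / (12 * (f x + h x)))"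
    "total (\<lambda>x. (1 - 1/2) * f x + 1/2 * h x) + (\<integral>x. (f x - h x)\<^sup>2 / (12 * (f x + h x)) \<partial>\<nu>) \<le> (total f + total h) / 2"
proof -
  note [measurable] = densD(1)[OF f] densD(1)[OF h]
  let ?g = "\<lambda>x. (1 - 1/2) * f x + 1/2 * h x"
  let ?q = "\<lambda>x. (f x - h x)\<^sup>2 / (12 * (f x + h x))"
  have g: "dens ?g" by (rule dens_mix(1)[OF f h]) auto
  have pt: "entropy_fun (?g x) + ?q x \<le> (entropy_fun (f x) + entropy_fun (h x)) / 2" for x
    using entropy_fun_midpoint[OF densD(2)[OF f, of x] densD(2)[OF h, of x]] by (simp add: add_divide_distrib)
  have q0: "0 \<le> ?q x" for x using densD(2)[OF f, of x] densD(2)[OF h, of x] by simp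
  show q: "integrable \<nu> ?q"
  proof (rule Bochner_Integration.integrable_bound[of _ "\<lambda>x. (entropy_fun (f x) + entropy_fun (h x)) / 2"])
    show "AE x in \<nu>. norm (?q x) \<le> norm ((entropy_fun (f x) + entropy_fun (h x)) / 2)"
    proof (rule AE_I2)
      fix x
      have "?q x \<le> (entropy_fun (f x) + entropy_fun (h x)) / 2"
        using pt[of x] entropy_fun_nonneg[OF densD(2)[OF g, of x]] by linarith
      then show "norm (?q x) \<le> norm ((entropy_fun (f x) + entropy_fun (h x)) / 2)"
        using q0[of x] unfolding real_norm_def by (simp only: abs_of_nonneg)
    qed
  qed (use densD(6)[OF f] densD(6)[OF h] in auto)
  have "ent ?g + integral\<^sup>L \<nu> ?q \<le> (ent f + ent h) / 2"
  proof -
    have "ent ?g + integral\<^sup>L \<nu> ?q = (\<integral>x. entropy_fun (?g x) + ?q x \<partial>\<nu>)"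
      unfolding ent_def using q densD(6)[OF g] by simp
    also have "\<dots> \<le> (\<integral>x. (entropy_fun (f x) + entropy_fun (h x)) / 2 \<partial>\<nu>)"
      using q densD(6)[OF g] densD(6)[OF f] densD(6)[OF h] pt by (intro integral_mono) auto
    also have "\<dots> = (ent f + ent h) / 2"
      unfolding ent_def using densD(6)[OF f] densD(6)[OF h] by simp
    finally show ?thesis .
  qed
  moreover have "inter ?g ?g \<le> (inter f f + inter h h) / 2"
    using dens_mix(2)[OF f h, of "1/2"] inter_positive[OF f h] by (simp add: power2_eq_square field_simps)
  then have "c * inter ?g ?g \<le> c * ((inter f f + inter h h) / 2)" using c_nonneg by (rule mult_left_mono)
  ultimately show "total ?g + integral\<^sup>L \<nu> ?q \<le> (total f + total h) / 2"
    unfolding total_def by (simp add: field_simps)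
qed

lemma L1_dist_le:
  assumes f: "dens f" and h: "dens h" and t: "0 < t"
    and low: "\<And>g. dens g \<Longrightarrow> \<iota> \<le> total g" and up: "total f \<le> \<iota> + t\<^sup>2" "total h \<le> \<iota> + t\<^sup>2"
  shows "(\<integral>x. \<bar>f x - h x\<bar> \<partial>\<nu>) \<le> 5 * t"
proof -
  let ?q = "\<lambda>x. (f x - h x)\<^sup>2 / (12 * (f x + h x))"
  have "(\<integral>x. ?q x \<partial>\<nu>) \<le> t\<^sup>2"
    using total_midpoint(2)[OF f h] low[OF dens_mix(1)[OF f h, of "1/2"]] up by simp
  moreover have "(\<integral>x. \<bar>f x - h x\<bar> \<partial>\<nu>) \<le> (\<integral>x. t * (f x + h x) + 3 / t * ?q x \<partial>\<nu>)"
  proof (intro integral_mono)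
    fix x
    let ?s = "f x + h x"
    have nn: "0 \<le> f x" "0 \<le> h x" using densD(2)[OF f] densD(2)[OF h] by auto
    show "\<bar>f x - h x\<bar> \<le> t * ?s + 3 / t * ?q x"
    proof (cases "?s = 0")
      case False
      then have s: "?s > 0" using nn by simp
      let ?d = "\<bar>f x - h x\<bar>"
      have "0 \<le> (2 * t * ?s - ?d)\<^sup>2" by simp
      then have "?d * (4 * t * ?s) \<le> (2 * t * ?s)\<^sup>2 + ?d\<^sup>2" by (simp add: power2_diff algebra_simps)
      then have "?d \<le> ((2 * t * ?s)\<^sup>2 + ?d\<^sup>2) / (4 * t * ?s)" using s t by (subst pos_le_divide_eq) auto
      also have "\<dots> = t * ?s + 3 / t * (?d\<^sup>2 / (12 * ?s))"
      proof -
        have "((2 * t * u)\<^sup>2 + d\<^sup>2) / (4 * t * u) = t * u + 3 / t * (d\<^sup>2 / (12 * u))" if "0 < u" for u d :: real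
          using that t by (simp add: field_simps power2_eq_square)
        from this[OF s] show ?thesis .
      qed
      also have "\<dots> = t * ?s + 3 / t * ?q x" by (simp only: power2_abs)
      finally show ?thesis .
    qed (use nn in auto)
  next
    show "integrable \<nu> (\<lambda>x. t * (f x + h x) + 3 / t * ?q x)"
      using densD(4)[OF f] densD(4)[OF h] total_midpoint(1)[OF f h]
      by (intro Bochner_Integration.integrable_add integrable_mult_right) auto
  qed (use densD(4)[OF f] densD(4)[OF h] in auto)
  moreover have "(\<integral>x. t * (f x + h x) + 3 / t * ?q x \<partial>\<nu>) = t * 2 + 3 / t * (\<integral>x. ?q x \<partial>\<nu>)"
  proof -
    have "(\<integral>x. t * (f x + h x) + 3 / t * ?q x \<partial>\<nu>) = (\<integral>x. t * (f x + h x) \<partial>\<nu>) + (\<integral>x. 3 / t * ?q x \<partial>\<nu>)"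
      using densD(4)[OF f] densD(4)[OF h] total_midpoint(1)[OF f h]
      by (intro Bochner_Integration.integral_add integrable_mult_right) auto
    then show ?thesis
      by (simp only: integral_mult_right_zero Bochner_Integration.integral_add[OF densD(4)[OF f] densD(4)[OF h]] densD(5)[OF f] densD(5)[OF h] one_add_one)
  qed
  moreover have "3 / t * (\<integral>x. ?q x \<partial>\<nu>) \<le> 3 / t * t\<^sup>2" using calculation(1) t by (intro mult_left_mono) auto
  moreover have "3 / t * t\<^sup>2 = 3 * t" using t by (simp add: power2_eq_square)
  ultimately show ?thesis by linarith
qed

lemma total_eq_nn_integral:
  assumes f: "dens f"
  shows "(\<integral>\<^sup>+x. (\<integral>\<^sup>+y. ennreal (c * (k x y * f y * f x)) \<partial>\<nu>) + ennreal (entropy_fun (f x)) \<partial>\<nu>) = ennreal (total f)"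
proof -
  note [measurable] = densD(1)[OF f]
  note nn = densD(2)[OF f]
  have "(\<integral>\<^sup>+y. ennreal (c * (k x y * f y * f x)) \<partial>\<nu>) = ennreal c * (\<integral>\<^sup>+y. ennreal (k x y * f y) * ennreal (f x) \<partial>\<nu>)" for x
    using c_nonneg nn k_nonneg by (subst nn_integral_cmult[symmetric]) (auto simp: ennreal_mult)
  then have "(\<integral>\<^sup>+x. (\<integral>\<^sup>+y. ennreal (c * (k x y * f y * f x)) \<partial>\<nu>) + ennreal (entropy_fun (f x)) \<partial>\<nu>)
    = ennreal c * ennreal (inter f f) + (\<integral>\<^sup>+x. ennreal (entropy_fun (f x)) \<partial>\<nu>)"
    by (simp add: nn_integral_add nn_integral_cmult inter_facts(3)[OF f f])
  also have "(\<integral>\<^sup>+x. ennreal (entropy_fun (f x)) \<partial>\<nu>) = ennreal (ent f)"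
    unfolding ent_def using densD(6)[OF f] entropy_fun_nonneg[OF nn] by (intro nn_integral_eq_integral) auto
  finally show ?thesis
    using c_nonneg inter_facts(2)[OF f f] ent_nonneg[OF f] by (simp add: total_def ennreal_mult)
qed

lemma minimizer_exists: "\<exists>f. dens f \<and> (\<forall>h. dens h \<longrightarrow> total f \<le> total h)"
proof -
  define \<iota> where "\<iota> = (INF h\<in>Collect dens. total h)"
  have bdd: "bdd_below (total ` Collect dens)" using total_nonneg by (intro bdd_belowI[of _ 0]) auto
  have low: "\<iota> \<le> total g" if "dens g" for g unfolding \<iota>_def using bdd that by (intro cINF_lower) auto
  have "\<exists>h. dens h \<and> total h \<le> \<iota> + (1 / real (Suc n))\<^sup>2" for n
  proof -
    have "\<exists>x\<in>Collect dens. total x < \<iota> + (1 / real (Suc n))\<^sup>2"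
      unfolding \<iota>_def using dens_one bdd by (subst cINF_less_iff[symmetric]) auto
    then show ?thesis by (auto intro: less_imp_le)
  qed
  then obtain s where s: "\<And>n. dens (s n)" "\<And>n. total (s n) \<le> \<iota> + (1 / real (Suc n))\<^sup>2" by metis
  note [measurable] = densD(1)[OF s(1)]
  have tot: "total (s n) \<le> \<iota> + (1 / real (Suc m))\<^sup>2" if "m \<le> n" for m n
  proof -
    have "(1 / real (Suc n))\<^sup>2 \<le> (1 / real (Suc m))\<^sup>2" using that by (intro power_mono divide_left_mono) auto
    then show ?thesis using s(2)[of n] by linarith
  qed
  have dist: "(\<integral>x. \<bar>s i x - s j x\<bar> \<partial>\<nu>) \<le> 5 * (1 / real (Suc m))" if "m \<le> i" "m \<le> j" for i j m
    using low by (intro L1_dist_le[OF s(1) s(1) _ _ tot[OF that(1)] tot[OF that(2)]]) auto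
  have cauchy: "\<exists>N. \<forall>i\<ge>N. \<forall>j\<ge>N. (\<integral>x. norm (s i x - s j x) \<partial>\<nu>) < e" if "e > 0" for e
  proof -
    obtain m where m: "1 / real (Suc m) < e / 5" by (rule nat_approx_posE[of "e / 5"]) (use \<open>e > 0\<close> in simp)
    have "(\<integral>x. norm (s i x - s j x) \<partial>\<nu>) < e" if "m \<le> i" "m \<le> j" for i j
      using dist[OF that] m unfolding real_norm_def by linarith
    then show ?thesis by blast
  qed
  obtain r where r: "strict_mono r" "AE x in \<nu>. Cauchy (\<lambda>i. s (r i) x)"
    by (rule cauchy_L1_AE_cauchy_subseq[of \<nu> s]) (use densD(4)[OF s(1)] cauchy in auto)
  define f where "f x = (if Cauchy (\<lambda>i. s (r i) x) then lim (\<lambda>i. s (r i) x) else 0)" for x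
  have [measurable]: "f \<in> borel_measurable borel" unfolding f_def by measurable
  have conv: "AE x in \<nu>. (\<lambda>i. s (r i) x) \<longlonglongrightarrow> f x"
    using r(2) by eventually_elim (auto simp: f_def Cauchy_convergent_iff convergent_LIMSEQ_iff)
  have fnn: "0 \<le> f x" for x
    unfolding f_def using densD(2)[OF s(1)]
    by (auto simp: Cauchy_convergent_iff convergent_LIMSEQ_iff intro: LIMSEQ_le_const)
  have rge: "m \<le> r i" if "m \<le> i" for m i using seq_suble[OF r(1), of i] that by linarith
  have L1: "(\<integral>\<^sup>+x. ennreal \<bar>s (r m) x - f x\<bar> \<partial>\<nu>) \<le> ennreal (5 * (1 / real (Suc m)))" for m
  proof -
    have "(\<integral>\<^sup>+x. ennreal \<bar>s (r m) x - f x\<bar> \<partial>\<nu>) = (\<integral>\<^sup>+x. liminf (\<lambda>j. ennreal \<bar>s (r m) x - s (r j) x\<bar>) \<partial>\<nu>)"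
    proof (intro nn_integral_cong_AE, use conv in eventually_elim)
      fix x assume "(\<lambda>i. s (r i) x) \<longlonglongrightarrow> f x"
      then have "(\<lambda>j. ennreal \<bar>s (r m) x - s (r j) x\<bar>) \<longlonglongrightarrow> ennreal \<bar>s (r m) x - f x\<bar>"
        by (intro tendsto_ennrealI tendsto_intros)
      then show "ennreal \<bar>s (r m) x - f x\<bar> = liminf (\<lambda>j. ennreal \<bar>s (r m) x - s (r j) x\<bar>)"
        by (rule lim_imp_Liminf[OF sequentially_bot, symmetric])
    qed
    also have "\<dots> \<le> liminf (\<lambda>j. \<integral>\<^sup>+x. ennreal \<bar>s (r m) x - s (r j) x\<bar> \<partial>\<nu>)"
      by (rule nn_integral_liminf) measurable
    also have "\<dots> \<le> ennreal (5 * (1 / real (Suc m)))"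
    proof (rule Liminf_le)
      show "\<forall>\<^sub>F j in sequentially. (\<integral>\<^sup>+x. ennreal \<bar>s (r m) x - s (r j) x\<bar> \<partial>\<nu>) \<le> ennreal (5 * (1 / real (Suc m)))"
        using eventually_ge_at_top[of m]
      proof eventually_elim
        case (elim j)
        have "(\<integral>\<^sup>+x. ennreal \<bar>s (r m) x - s (r j) x\<bar> \<partial>\<nu>) = ennreal (\<integral>x. \<bar>s (r m) x - s (r j) x\<bar> \<partial>\<nu>)"
          using densD(4)[OF s(1)] by (intro nn_integral_eq_integral) auto
        also have "\<dots> \<le> ennreal (5 * (1 / real (Suc m)))" using rge[of m] elim by (intro ennreal_leI dist) auto
        finally show ?case .
      qed
    qed simp
    finally show ?thesis .
  qed
  have e0: "(\<lambda>m. ennreal (5 * (1 / real (Suc m)))) \<longlonglongrightarrow> ennreal (5 * 0)"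
    using LIMSEQ_inverse_real_of_nat by (intro tendsto_ennrealI tendsto_intros) (simp add: inverse_eq_divide)
  have one: "(\<integral>\<^sup>+x. ennreal (f x) \<partial>\<nu>) = 1"
  proof (rule antisym)
    have a: "(\<integral>\<^sup>+x. ennreal (f x) \<partial>\<nu>) \<le> 1 + ennreal (5 * (1 / real (Suc m)))" for m
    proof -
      have "(\<integral>\<^sup>+x. ennreal (f x) \<partial>\<nu>) \<le> (\<integral>\<^sup>+x. ennreal (s (r m) x) + ennreal \<bar>s (r m) x - f x\<bar> \<partial>\<nu>)"
        using densD(2)[OF s(1)] by (intro nn_integral_mono) (auto simp: ennreal_plus[symmetric] intro!: ennreal_leI simp del: ennreal_plus)
      also have "\<dots> \<le> 1 + ennreal (5 * (1 / real (Suc m)))"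
        by (subst nn_integral_add) (use add_left_mono[OF L1, of 1 m] in \<open>simp_all add: densD(3)[OF s(1)] del: of_nat_Suc\<close>)
      finally show ?thesis .
    qed
    show "(\<integral>\<^sup>+x. ennreal (f x) \<partial>\<nu>) \<le> 1"
      using LIMSEQ_le_const[OF tendsto_add[OF tendsto_const e0]] a by fastforce
    have b: "1 \<le> (\<integral>\<^sup>+x. ennreal (f x) \<partial>\<nu>) + ennreal (5 * (1 / real (Suc m)))" for m
    proof -
      have "1 = (\<integral>\<^sup>+x. ennreal (s (r m) x) \<partial>\<nu>)" by (simp add: densD(3)[OF s(1)])
      also have "\<dots> \<le> (\<integral>\<^sup>+x. ennreal (f x) + ennreal \<bar>s (r m) x - f x\<bar> \<partial>\<nu>)"
        using fnn by (intro nn_integral_mono) (auto simp: ennreal_plus[symmetric] intro!: ennreal_leI simp del: ennreal_plus)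
      also have "\<dots> \<le> (\<integral>\<^sup>+x. ennreal (f x) \<partial>\<nu>) + ennreal (5 * (1 / real (Suc m)))"
        by (subst nn_integral_add) (use add_left_mono[OF L1, of _ m] in \<open>simp_all del: of_nat_Suc\<close>)
      finally show ?thesis .
    qed
    show "1 \<le> (\<integral>\<^sup>+x. ennreal (f x) \<partial>\<nu>)"
      using LIMSEQ_le_const[OF tendsto_add[OF tendsto_const e0]] b by fastforce
  qed
  define Y where "Y g x = (\<integral>\<^sup>+y. ennreal (c * (k x y * g y * g x)) + ennreal (entropy_fun (g x)) \<partial>\<nu>)" for g x
  have [measurable]: "Y g \<in> borel_measurable borel" if [measurable]: "g \<in> borel_measurable borel" for g
    unfolding Y_def[abs_def] by measurable
  have Y: "Y g x = (\<integral>\<^sup>+y. ennreal (c * (k x y * g y * g x)) \<partial>\<nu>) + ennreal (entropy_fun (g x))"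
    if [measurable]: "g \<in> borel_measurable borel" for g x
    unfolding Y_def by (subst nn_integral_add) (auto simp: emeasure_space_1)
  have Ylim: "(\<integral>\<^sup>+x. Y f x \<partial>\<nu>) \<le> ennreal \<iota>"
  proof -
    have "(\<integral>\<^sup>+x. Y f x \<partial>\<nu>) \<le> (\<integral>\<^sup>+x. liminf (\<lambda>i. Y (s (r i)) x) \<partial>\<nu>)"
    proof (intro nn_integral_mono_AE, use conv in eventually_elim)
      fix x assume x: "(\<lambda>i. s (r i) x) \<longlonglongrightarrow> f x"
      have "Y f x = (\<integral>\<^sup>+y. liminf (\<lambda>i. ennreal (c * (k x y * s (r i) y * s (r i) x)) + ennreal (entropy_fun (s (r i) x))) \<partial>\<nu>)"
        unfolding Y_def
      proof (intro nn_integral_cong_AE, use conv in eventually_elim)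
        fix y assume "(\<lambda>i. s (r i) y) \<longlonglongrightarrow> f y"
        then have "(\<lambda>i. ennreal (c * (k x y * s (r i) y * s (r i) x)) + ennreal (entropy_fun (s (r i) x)))
          \<longlonglongrightarrow> ennreal (c * (k x y * f y * f x)) + ennreal (entropy_fun (f x))"
          using x densD(2)[OF s(1)] by (intro tendsto_add tendsto_ennrealI tendsto_intros tendsto_entropy_fun)
        then show "ennreal (c * (k x y * f y * f x)) + ennreal (entropy_fun (f x))
          = liminf (\<lambda>i. ennreal (c * (k x y * s (r i) y * s (r i) x)) + ennreal (entropy_fun (s (r i) x)))"
          by (rule lim_imp_Liminf[OF sequentially_bot, symmetric])
      qed
      also have "\<dots> \<le> liminf (\<lambda>i. Y (s (r i)) x)"
        unfolding Y_def by (rule nn_integral_liminf) measurable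
      finally show "Y f x \<le> liminf (\<lambda>i. Y (s (r i)) x)" .
    qed
    also have "\<dots> \<le> liminf (\<lambda>i. \<integral>\<^sup>+x. Y (s (r i)) x \<partial>\<nu>)"
      by (rule nn_integral_liminf) measurable
    also have "\<dots> = liminf (\<lambda>i. ennreal (total (s (r i))))"
      by (simp add: Y total_eq_nn_integral[OF s(1)])
    also have "\<dots> \<le> ennreal \<iota>"
    proof -
      have "(\<lambda>i. \<iota> + (1 / real (Suc i))\<^sup>2) \<longlonglongrightarrow> \<iota> + 0\<^sup>2"
        using LIMSEQ_inverse_real_of_nat by (intro tendsto_intros) (simp add: inverse_eq_divide)
      then have "(\<lambda>i. ennreal (\<iota> + (1 / real (Suc i))\<^sup>2)) \<longlonglongrightarrow> ennreal \<iota>" by (intro tendsto_ennrealI) simp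
      moreover have "liminf (\<lambda>i. ennreal (total (s (r i)))) \<le> liminf (\<lambda>i. ennreal (\<iota> + (1 / real (Suc i))\<^sup>2))"
        using tot rge by (intro Liminf_mono always_eventually allI ennreal_leI) auto
      ultimately show ?thesis by (simp only: lim_imp_Liminf[OF sequentially_bot])
    qed
    finally show ?thesis .
  qed
  have "(\<integral>\<^sup>+x. ennreal (entropy_fun (f x)) \<partial>\<nu>) \<le> (\<integral>\<^sup>+x. Y f x \<partial>\<nu>)"
    by (intro nn_integral_mono) (simp add: Y)
  also note Ylim
  also have "ennreal \<iota> < \<infinity>" by simp
  finally have "(\<integral>\<^sup>+x. ennreal (entropy_fun (f x)) \<partial>\<nu>) < \<infinity>" .
  then have f: "dens f" using one fnn by (simp add: dens_def)
  have i0: "0 \<le> \<iota>" unfolding \<iota>_def using dens_one total_nonneg by (intro cINF_greatest) auto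
  have "total f \<le> \<iota>" using Ylim total_eq_nn_integral[OF f] i0 by (simp add: Y)
  then show ?thesis using f low by (meson order_trans)
qed

lemma minimizer_Euler_Lagrange:
  assumes f: "dens f" and min: "\<And>h. dens h \<Longrightarrow> total f \<le> total h"
  shows "\<exists>Z>0. AE x in \<nu>. f x = exp (- 2 * c * pot f x) / Z"
proof -
  note [measurable] = densD(1)[OF f] pot_facts(4)[OF f]
  define w where "w x = exp (- 2 * c * pot f x)" for x
  define Z where "Z = (\<integral>x. w x \<partial>\<nu>)"
  define s where "s x = w x / Z" for x
  have [measurable]: "w \<in> borel_measurable borel" "s \<in> borel_measurable borel" unfolding w_def[abs_def] s_def[abs_def] by measurable
  have w: "0 < w x" "w x \<le> 1" for x unfolding w_def using c_nonneg pot_facts(3)[OF f, of x] by auto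
  have wint: "integrable \<nu> w" using w by (intro integrable_const_bound[of _ 1]) (auto simp: less_imp_le)
  have Z: "0 < Z"
  proof -
    have "Z \<noteq> 0"
    proof
      assume "Z = 0"
      then have "AE x in \<nu>. w x = 0" unfolding Z_def using wint w by (subst (asm) integral_nonneg_eq_0_iff_AE) (auto simp: less_imp_le)
      then have "AE x in \<nu>. False" by eventually_elim (use w in \<open>auto simp: less_le\<close>)
      then show False by simp
    qed
    moreover have "0 \<le> Z" unfolding Z_def using w by (intro integral_nonneg_AE) (auto simp: less_imp_le)
    ultimately show ?thesis by simp
  qed
  have s0: "0 < s x" "s x \<le> 1 / Z" for x unfolding s_def using w Z by (auto intro: divide_right_mono)
  have sint: "integrable \<nu> s" "integral\<^sup>L \<nu> s = 1" unfolding s_def using wint Z by (auto simp: Z_def)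
  have ds: "dens s"
    unfolding dens_def
  proof (intro conjI allI)
    show "0 \<le> s x" for x using s0 by (simp add: less_imp_le)
    show "(\<integral>\<^sup>+x. ennreal (s x) \<partial>\<nu>) = 1" using sint s0 by (subst nn_integral_eq_integral) (auto simp: less_imp_le)
    have "entropy_fun (s x) \<le> (1 / Z)\<^sup>2 + 1" for x
      using entropy_fun_le[of "s x"] power_mono[OF s0(2)[of x], of 2] s0(1)[of x] by simp
    then have "(\<integral>\<^sup>+x. ennreal (entropy_fun (s x)) \<partial>\<nu>) \<le> (\<integral>\<^sup>+x. ennreal ((1 / Z)\<^sup>2 + 1) \<partial>\<nu>)"
      by (intro nn_integral_mono ennreal_leI)
    also have "\<dots> < \<infinity>" by (simp add: emeasure_space_1)
    finally show "(\<integral>\<^sup>+x. ennreal (entropy_fun (s x)) \<partial>\<nu>) < \<infinity>" .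
  qed measurable
  have ln_s: "ln (s x) = - 2 * c * pot f x - ln Z" for x
    unfolding s_def w_def using Z by (subst ln_div) auto
  define Q where "Q x = (ln (s x) - ln ((f x + s x) / 2)) * (s x - f x)" for x
  have Q0: "0 \<le> Q x" for x
  proof (cases "f x \<le> s x")
    case True
    then have "ln ((f x + s x) / 2) \<le> ln (s x)" using s0(1)[of x] densD(2)[OF f, of x] by (subst ln_le_cancel_iff) auto
    then show ?thesis using True by (auto simp: Q_def)
  next
    case False
    then have "ln (s x) \<le> ln ((f x + s x) / 2)" using s0(1)[of x] densD(2)[OF f, of x] by (subst ln_le_cancel_iff) auto
    then show ?thesis using False by (auto simp: Q_def intro: mult_nonpos_nonpos)
  qed
  define B where "B = c * (inter f f + inter s s)"
  have lint: "integrable \<nu> (\<lambda>x. ln (s x) * (s x - f x))" (is ?int)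
    and lval: "(\<integral>x. ln (s x) * (s x - f x) \<partial>\<nu>) = - 2 * c * (inter f s - inter f f)" (is ?val)
  proof -
    have eq: "ln (s x) * (s x - f x) = - 2 * c * (pot f x * s x - pot f x * f x) - ln Z * (s x - f x)" for x
      unfolding ln_s by (simp add: algebra_simps)
    show ?int unfolding eq using inter_facts(1)[OF f ds] inter_facts(1)[OF f f] sint densD(4)[OF f] by auto
    show ?val unfolding eq inter_def using inter_facts(1)[OF f ds] inter_facts(1)[OF f f] sint densD(4,5)[OF f] by simp
  qed
  have bound: "(\<integral>\<^sup>+x. ennreal (Q x) \<partial>\<nu>) \<le> ennreal (e * B)" if e: "0 < e" "e \<le> 1/2" for e
  proof -
    define g where "g x = (1 - e) * f x + e * s x" for x
    have g: "dens g" unfolding g_def using e by (intro dens_mix(1)[OF f ds]) auto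
    have gg: "inter g g = (1 - e)\<^sup>2 * inter f f + 2 * e * (1 - e) * inter f s + e\<^sup>2 * inter s s"
      unfolding g_def using e by (intro dens_mix(2)[OF f ds]) auto
    define R where "R x = e * (ln (s x) * (s x - f x)) - (entropy_fun (g x) - entropy_fun (f x))" for x
    have Rint: "integrable \<nu> R" unfolding R_def using lint densD(6)[OF g] densD(6)[OF f] by auto
    have RQ: "e * Q x \<le> R x" for x
    proof -
      have g0: "0 < g x" unfolding g_def using e s0(1)[of x] densD(2)[OF f, of x] by (intro add_nonneg_pos) auto
      have "entropy_fun (g x) + ln (g x) * (f x - g x) \<le> entropy_fun (f x)"
        by (rule entropy_fun_tangent[OF densD(2)[OF f] g0])
      moreover have "ln (g x) * (f x - g x) = - e * (ln (g x) * (s x - f x))" unfolding g_def by (simp add: algebra_simps)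
      ultimately have 1: "entropy_fun (g x) - entropy_fun (f x) \<le> e * (ln (g x) * (s x - f x))" by simp
      have m0: "0 < (f x + s x) / 2" using s0(1)[of x] densD(2)[OF f, of x] by simp
      have d: "(f x + s x) / 2 - g x = (1/2 - e) * (s x - f x)" unfolding g_def by (simp add: field_simps)
      have "ln (g x) * (s x - f x) \<le> ln ((f x + s x) / 2) * (s x - f x)"
      proof (cases "f x \<le> s x")
        case True
        then have "0 \<le> (1/2 - e) * (s x - f x)" using e by simp
        then have "g x \<le> (f x + s x) / 2" using d by linarith
        then have "ln (g x) \<le> ln ((f x + s x) / 2)" using g0 m0 by (subst ln_le_cancel_iff) auto
        then show ?thesis using True by (intro mult_right_mono) auto
      next
        case False
        then have "(1/2 - e) * (s x - f x) \<le> 0" using e by (intro mult_nonneg_nonpos) auto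
        then have "(f x + s x) / 2 \<le> g x" using d by linarith
        then have "ln ((f x + s x) / 2) \<le> ln (g x)" using g0 m0 by (subst ln_le_cancel_iff) auto
        then show ?thesis using False by (intro mult_right_mono_neg) auto
      qed
      then have "e * (ln (g x) * (s x - f x)) \<le> e * (ln ((f x + s x) / 2) * (s x - f x))" using e by (intro mult_left_mono) auto
      then show ?thesis using 1 unfolding R_def Q_def by (simp add: algebra_simps)
    qed
    have R0: "0 \<le> R x" for x using RQ[of x] Q0[of x] e by (meson mult_nonneg_nonneg less_imp_le order_trans)
    have "integral\<^sup>L \<nu> R = e * (- 2 * c * (inter f s - inter f f)) - (ent g - ent f)"
      unfolding R_def ent_def lval[symmetric] using lint densD(6)[OF g] densD(6)[OF f] by simp
    also have "\<dots> \<le> e * (- 2 * c * (inter f s - inter f f)) + c * (inter g g - inter f f)"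
      using min[OF g] unfolding total_def by (simp add: algebra_simps)
    also have "\<dots> = c * (e\<^sup>2 * (inter f f - 2 * inter f s + inter s s))"
      unfolding gg by (simp add: power2_eq_square algebra_simps)
    also have "\<dots> \<le> c * (e\<^sup>2 * (inter f f + inter s s))"
      using c_nonneg inter_facts(2)[OF f ds] by (intro mult_left_mono) auto
    also have "\<dots> = e * (e * B)" unfolding B_def by (simp add: power2_eq_square)
    finally have RB: "integral\<^sup>L \<nu> R \<le> e * (e * B)" .
    have "ennreal e * (\<integral>\<^sup>+x. ennreal (Q x) \<partial>\<nu>) = (\<integral>\<^sup>+x. ennreal (e * Q x) \<partial>\<nu>)"
      unfolding Q_def using e Q0 by (subst nn_integral_cmult[symmetric]) (auto simp: ennreal_mult' Q_def)
    also have "\<dots> \<le> (\<integral>\<^sup>+x. ennreal (R x) \<partial>\<nu>)" using RQ by (intro nn_integral_mono ennreal_leI)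
    also have "\<dots> = ennreal (integral\<^sup>L \<nu> R)" using Rint R0 by (intro nn_integral_eq_integral) auto
    also have "\<dots> \<le> ennreal (e * (e * B))" using RB by (rule ennreal_leI)
    also have "\<dots> = ennreal e * ennreal (e * B)" using e by (simp add: ennreal_mult')
    finally show ?thesis using e by (subst (asm) ennreal_mult_le_mult_iff) auto
  qed
  have "(\<lambda>n. ennreal (1 / real (Suc (Suc n)) * B)) \<longlonglongrightarrow> ennreal (0 * B)"
    using LIMSEQ_Suc[OF LIMSEQ_inverse_real_of_nat] by (intro tendsto_ennrealI tendsto_intros) (simp add: inverse_eq_divide)
  then have "(\<integral>\<^sup>+x. ennreal (Q x) \<partial>\<nu>) \<le> ennreal (0 * B)"
    by (rule LIMSEQ_le_const) (intro exI[of _ 0] allI impI bound, auto)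
  then have "(\<integral>\<^sup>+x. ennreal (Q x) \<partial>\<nu>) = 0" by simp
  then have "AE x in \<nu>. ennreal (Q x) = 0"
    by (subst (asm) nn_integral_0_iff_AE) (auto simp: Q_def)
  then have "AE x in \<nu>. f x = s x"
  proof eventually_elim
    case (elim x)
    then have "Q x = 0" using Q0[of x] by (simp add: ennreal_eq_0_iff)
    then consider "ln (s x) = ln ((f x + s x) / 2)" | "s x = f x" unfolding Q_def by auto
    then show ?case
    proof cases
      case 1
      then have "s x = (f x + s x) / 2" using s0(1)[of x] densD(2)[OF f, of x] by (subst (asm) ln_inj_iff) auto
      then show ?thesis by simp
    qed simp
  qed
  then show ?thesis using Z unfolding s_def w_def by auto
qed

end

section \<open>The equilibrium measure\<close>

lemma log_kernel_eq: "log_kernel u x = - ln (norm (x - u))"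
  by (cases "x = u") (simp_all add: log_kernel_def ln_inverse)

lemma log_kernel_sym: "log_kernel u x = log_kernel x u"
  by (simp add: log_kernel_eq norm_minus_commute)

lemma log_kernel_measurable [measurable]:
  "(\<lambda>w. log_kernel (f w) (g w)) \<in> borel_measurable M"
  if [measurable]: "f \<in> borel_measurable M" "g \<in> borel_measurable M"
  unfolding log_kernel_eq by measurable

lemma log_kernel_ge: "0 \<le> log_kernel x y + theta_shift x + theta_shift y"
proof (cases "x = y")
  case False
  then have "ln ((norm (x - y))\<^sup>2) = 2 * ln (norm (x - y))" by (subst ln_realpow) auto
  then show ?thesis using half_ln_dist_square_le[of 0 x y] by (simp add: log_kernel_eq norm_minus_commute)
qed (simp add: log_kernel_eq)

lemma decay_integrable:
  fixes h :: "'a::euclidean_space \<Rightarrow> real"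
  assumes "h \<in> borel_measurable borel" "\<And>z. 0 \<le> h z" "\<exists>C. \<forall>z. h z * (1 + norm z) ^ (DIM('a) + 2) \<le> C"
  shows "integrable lborel h"
  using assms decay_integral_finite[of h] by (intro integrableI_nonneg) auto

locale confining_potential =
  fixes V :: "'a::euclidean_space \<Rightarrow> real" and \<gamma> :: real
  assumes V_measurable [measurable]: "V \<in> borel_measurable borel"
    and V_decay: "\<And>q. \<exists>C. \<forall>x. exp (- V x) * (1 + norm x) ^ q \<le> C"
    and gamma_nonneg: "0 \<le> \<gamma>"
begin

lemma powr_decay: "\<exists>C. \<forall>x. exp (- V x + p * theta_shift x) * (1 + norm x) ^ q \<le> C"
proof -
  define m where "m = nat \<lceil>p\<rceil>"
  obtain C where C: "\<And>x. exp (- V x) * (1 + norm x) ^ (m + q) \<le> C" using V_decay by blast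
  have "exp (- V x + p * theta_shift x) * (1 + norm x) ^ q \<le> C" for x
  proof -
    have "p * theta_shift x \<le> real m * theta_shift x" unfolding m_def by (intro mult_right_mono real_nat_ceiling_ge) auto
    then have "exp (p * theta_shift x) \<le> exp (real m * theta_shift x)" by simp
    also have "\<dots> = (1 + norm x) ^ m"
      unfolding theta_shift_def by (subst exp_of_nat_mult) (simp add: add_pos_nonneg)
    finally have "exp (- V x) * exp (p * theta_shift x) * (1 + norm x) ^ q \<le> exp (- V x) * (1 + norm x) ^ m * (1 + norm x) ^ q"
      by (intro mult_right_mono mult_left_mono) auto
    also have "\<dots> = exp (- V x) * (1 + norm x) ^ (m + q)" by (simp add: power_add)
    finally show ?thesis using C[of x] unfolding exp_add by linarith
  qed
  then show ?thesis by blast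
qed

definition ref_weight :: "'a \<Rightarrow> real" where
  "ref_weight x = exp (- V x + \<gamma> * theta_shift x)"

definition ref_density :: "'a \<Rightarrow> real" where
  "ref_density x = ref_weight x / (\<integral>y. ref_weight y \<partial>lborel)"

lemma ref_measurable [measurable]: "ref_weight \<in> borel_measurable borel" "ref_density \<in> borel_measurable borel"
  unfolding ref_weight_def[abs_def] ref_density_def[abs_def] by measurable

lemma ref_weight_integrable: "integrable lborel ref_weight"
  by (rule decay_integrable) (use powr_decay[of \<gamma> "DIM('a) + 2"] in \<open>simp_all add: ref_weight_def del: power_add power_Suc add_2_eq_Suc'\<close>)

lemma ref_integral_pos: "0 < (\<integral>y. ref_weight y \<partial>lborel)"
proof -
  have "(\<integral>y. ref_weight y \<partial>lborel) \<noteq> 0"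
  proof
    assume "(\<integral>y. ref_weight y \<partial>lborel) = 0"
    then have "AE x in lborel. ref_weight x = 0" using ref_weight_integrable
      by (subst (asm) integral_nonneg_eq_0_iff_AE) (auto simp: ref_weight_def)
    then have "AE x in (lborel :: 'a measure). False" by eventually_elim (simp add: ref_weight_def)
    then have "emeasure (lborel :: 'a measure) UNIV = 0"
      by (subst (asm) AE_iff_measurable[of UNIV]) auto
    then show False by simp
  qed
  moreover have "0 \<le> (\<integral>y. ref_weight y \<partial>lborel)" by (intro integral_nonneg_AE) (auto simp: ref_weight_def)
  ultimately show ?thesis by simp
qed

lemma ref_density_pos: "0 < ref_density x"
  unfolding ref_density_def by (rule divide_pos_pos[OF _ ref_integral_pos]) (simp add: ref_weight_def)

lemma ref_density_decay: "\<exists>C. \<forall>x. ref_density x * (1 + norm x) ^ q \<le> C"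
proof -
  obtain C where C: "\<And>x. ref_weight x * (1 + norm x) ^ q \<le> C" using powr_decay[of \<gamma> q] unfolding ref_weight_def by blast
  have "ref_density x * (1 + norm x) ^ q \<le> C / (\<integral>y. ref_weight y \<partial>lborel)" for x
    using divide_right_mono[OF C[of x], of "\<integral>y. ref_weight y \<partial>lborel"] ref_integral_pos by (simp add: ref_density_def)
  then show ?thesis by blast
qed

abbreviation "\<nu> \<equiv> reference_measure \<gamma> V"

lemma reference_measure_eq: "\<nu> = density lborel (\<lambda>x. ennreal (ref_density x))"
  unfolding reference_measure_def ref_density_def ref_weight_def by simp

lemma sets_reference [measurable_cong]: "sets \<nu> = sets borel"
  by (simp add: reference_measure_eq)

lemma nn_integral_reference:
  "f \<in> borel_measurable borel \<Longrightarrow> (\<integral>\<^sup>+x. f x \<partial>\<nu>) = (\<integral>\<^sup>+x. ennreal (ref_density x) * f x \<partial>lborel)"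
  unfolding reference_measure_eq by (intro nn_integral_density) auto

lemma prob_reference: "prob_space \<nu>"
proof
  have "emeasure \<nu> (space \<nu>) = (\<integral>\<^sup>+x. 1 \<partial>\<nu>)" by simp
  also have "\<dots> = (\<integral>\<^sup>+x. ennreal (ref_density x) \<partial>lborel)" by (subst nn_integral_reference) auto
  also have "\<dots> = ennreal (\<integral>x. ref_density x \<partial>lborel)"
    using ref_weight_integrable ref_density_pos by (intro nn_integral_eq_integral) (auto simp: ref_density_def less_imp_le)
  also have "(\<integral>x. ref_density x \<partial>lborel) = 1" unfolding ref_density_def using ref_integral_pos by simp
  finally show "emeasure \<nu> (space \<nu>) = 1" by simp
qed

lemma AE_reference_neq: "AE z in \<nu>. z \<noteq> x"
  unfolding reference_measure_eq by (subst AE_density) (auto intro: AE_mp[OF AE_lborel_singleton[of x]])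

lemma AE_referenceI: "(\<And>z. z \<noteq> x \<Longrightarrow> P z) \<Longrightarrow> AE z in \<nu>. P z"
  by (rule AE_mp[OF AE_reference_neq[of x]]) simp

lemma exp_half_log_kernel: "x \<noteq> y \<Longrightarrow> exp (log_kernel x y / 2) = norm (x - y) powr (-1/2)"
  by (simp add: log_kernel_eq powr_def norm_minus_commute)

lemma reference_singular_bound: "\<exists>C. \<forall>x. (\<integral>\<^sup>+y. ennreal (exp (log_kernel x y / 2)) \<partial>\<nu>) \<le> ennreal C"
proof -
  obtain S where S: "0 \<le> S" "\<And>(x::'a) h C D. h \<in> borel_measurable borel \<Longrightarrow> (\<forall>z. 0 \<le> h z \<and> h z \<le> C) \<Longrightarrow> 0 \<le> D \<Longrightarrow>
       (\<integral>\<^sup>+z. ennreal (h z) \<partial>lborel) \<le> ennreal D \<Longrightarrow>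
       (\<integral>\<^sup>+z. ennreal (h z * norm (x - z) powr (-1/2)) \<partial>lborel) \<le> ennreal (C * S + D)"
    using singular_integral_bound[where 'a='a] by blast
  obtain C where C: "\<And>x. ref_density x \<le> C" using ref_density_decay[of 0] by auto
  interpret prob_space \<nu> by (rule prob_reference)
  have one: "(\<integral>\<^sup>+z. ennreal (ref_density z) \<partial>lborel) \<le> ennreal 1"
    using emeasure_space_1 nn_integral_reference[of "\<lambda>_. 1"] by simp
  have "(\<integral>\<^sup>+y. ennreal (exp (log_kernel x y / 2)) \<partial>\<nu>) \<le> ennreal (C * S + 1)" for x
  proof -
    have "(\<integral>\<^sup>+y. ennreal (exp (log_kernel x y / 2)) \<partial>\<nu>) = (\<integral>\<^sup>+y. ennreal (norm (x - y) powr (-1/2)) \<partial>\<nu>)"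
    proof (rule nn_integral_cong_AE, rule AE_referenceI[of x])
      fix y :: 'a assume "y \<noteq> x"
      then have "exp (log_kernel x y / 2) = norm (x - y) powr (-1/2)" by (intro exp_half_log_kernel) simp
      then show "ennreal (exp (log_kernel x y / 2)) = ennreal (norm (x - y) powr (-1/2))" by (rule arg_cong)
    qed
    also have "\<dots> = (\<integral>\<^sup>+y. ennreal (ref_density y * norm (x - y) powr (-1/2)) \<partial>lborel)"
      using ref_density_pos by (subst nn_integral_reference) (auto simp: ennreal_mult less_imp_le)
    also have "\<dots> \<le> ennreal (C * S + 1)"
      using ref_density_pos C one by (intro S(2)) (auto simp: less_imp_le)
    finally show ?thesis .
  qed
  then show ?thesis by blast
qed

abbreviation "kern x y \<equiv> log_kernel x y + theta_shift x + theta_shift y"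

lemma positive_log_energy:
  assumes [measurable]: "f \<in> borel_measurable borel" "h \<in> borel_measurable borel"
    and nn: "\<And>x. 0 \<le> f x" "\<And>x. 0 \<le> h x"
    and one: "(\<integral>\<^sup>+x. ennreal (f x) \<partial>\<nu>) = 1" "(\<integral>\<^sup>+x. ennreal (h x) \<partial>\<nu>) = 1"
    and fin: "(\<integral>\<^sup>+x. ennreal (theta_shift x * f x) \<partial>\<nu>) < \<infinity>" "(\<integral>\<^sup>+x. ennreal (theta_shift x * h x) \<partial>\<nu>) < \<infinity>"
  shows "2 * (\<integral>\<^sup>+x. (\<integral>\<^sup>+y. ennreal (kern x y * f y) * ennreal (h x) \<partial>\<nu>) \<partial>\<nu>)
    \<le> (\<integral>\<^sup>+x. (\<integral>\<^sup>+y. ennreal (kern x y * f y) * ennreal (f x) \<partial>\<nu>) \<partial>\<nu>) + (\<integral>\<^sup>+x. (\<integral>\<^sup>+y. ennreal (kern x y * h y) * ennreal (h x) \<partial>\<nu>) \<partial>\<nu>)"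
proof -
  define kA where "kA A x y = theta_shift x + theta_shift y - ln (A + (norm (x - y))\<^sup>2) / 2" for A and x y :: 'a
  interpret prob_space \<nu> by (rule prob_reference)
  interpret P: pair_sigma_finite \<nu> \<nu> ..
  define E where "E A f h = (\<integral>\<^sup>+x. (\<integral>\<^sup>+y. ennreal (kA A x y * f y) * ennreal (h x) \<partial>\<nu>) \<partial>\<nu>)" for A and f h :: "'a \<Rightarrow> real"
  define F where "F f h = (\<integral>\<^sup>+x. (\<integral>\<^sup>+y. ennreal (kern x y * f y) * ennreal (h x) \<partial>\<nu>) \<partial>\<nu>)" for f h :: "'a \<Rightarrow> real"
  have kA_meas [measurable]: "(\<lambda>(x, y). kA A x y) \<in> borel_measurable (borel \<Otimes>\<^sub>M borel)" for A
    unfolding kA_def by measurable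
  note [measurable] = measurable_compose[OF _ kA_meas, of "\<lambda>w. (u w, v w)" for u v, simplified]
  have kA0: "0 \<le> kA A x y" if "0 < A" "A \<le> 1" for A x y
    using half_ln_dist_square_le[of A x y] that by (simp add: kA_def)
  have Eeq: "(\<integral>\<^sup>+x. (\<integral>\<^sup>+y. ennreal (kA A x y) \<partial>density \<nu> (\<lambda>x. ennreal (g x))) \<partial>density \<nu> (\<lambda>x. ennreal (h x))) = E A g h"
    if [measurable]: "g \<in> borel_measurable borel" "h \<in> borel_measurable borel" and p: "\<And>x. 0 \<le> g x" "\<And>x. 0 \<le> h x" "0 < A" "A \<le> 1"
    for g h A
  proof -
    have "(\<integral>\<^sup>+y. ennreal (kA A x y) \<partial>density \<nu> (\<lambda>x. ennreal (g x))) = (\<integral>\<^sup>+y. ennreal (kA A x y * g y) \<partial>\<nu>)" for x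
      using p kA0 by (subst nn_integral_density) (auto simp: ennreal_mult mult.commute)
    then show ?thesis unfolding E_def
      by (simp add: nn_integral_density nn_integral_multc nn_integral_cmult mult.commute)
  qed
  have main: "2 * E A f h \<le> E A f f + E A h h" if A: "0 < A" "A \<le> 1" for A
  proof -
    let ?M = "density \<nu> (\<lambda>x. ennreal (f x))" and ?N = "density \<nu> (\<lambda>x. ennreal (h x))"
    have "prob_space ?M" "prob_space ?N"
      by (rule prob_spaceI; use one in \<open>simp add: emeasure_density\<close>)+
    moreover have "(\<integral>\<^sup>+x. ennreal (theta_shift x) \<partial>?M) < \<infinity>" "(\<integral>\<^sup>+x. ennreal (theta_shift x) \<partial>?N) < \<infinity>"
      using fin nn by (auto simp: nn_integral_density ennreal_mult[symmetric] mult.commute)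
    ultimately have "2 * (\<integral>\<^sup>+x. (\<integral>\<^sup>+y. ennreal (kA A x y) \<partial>?M) \<partial>?N) \<le> (\<integral>\<^sup>+x. (\<integral>\<^sup>+y. ennreal (kA A x y) \<partial>?N) \<partial>?N) + (\<integral>\<^sup>+x. (\<integral>\<^sup>+y. ennreal (kA A x y) \<partial>?M) \<partial>?M)"
      unfolding kA_def using A by (intro positive_smoothed_energy) (auto simp: sets_reference)
    then show ?thesis using A nn by (simp add: Eeq add.commute)
  qed
  have le: "E A f f \<le> F f f" if A: "0 < A" "A \<le> 1" and ff: "\<And>x. 0 \<le> f x" for A f
    unfolding E_def F_def
  proof (rule nn_integral_mono, rule nn_integral_mono_AE, rule AE_referenceI, intro mult_right_mono ennreal_leI ff)
    fix x y :: 'a assume "y \<noteq> x"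
    then have "ln ((norm (x - y))\<^sup>2) \<le> ln (A + (norm (x - y))\<^sup>2)" using A by (subst ln_le_cancel_iff) (auto simp: add_pos_nonneg)
    moreover have "ln ((norm (x - y))\<^sup>2) = 2 * ln (norm (x - y))" using \<open>y \<noteq> x\<close> by (subst ln_realpow) auto
    ultimately show "kA A x y \<le> kern x y" by (simp add: kA_def log_kernel_eq norm_minus_commute)
  qed simp
  let ?A = "\<lambda>n. 1 / real (Suc n)"
  have A: "0 < ?A n" "?A n \<le> 1" for n by auto
  have lim: "F f h \<le> liminf (\<lambda>n. E (?A n) f h)"
  proof -
    have "F f h \<le> (\<integral>\<^sup>+x. liminf (\<lambda>n. \<integral>\<^sup>+y. ennreal (kA (?A n) x y * f y) * ennreal (h x) \<partial>\<nu>) \<partial>\<nu>)"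
      unfolding F_def
    proof (intro nn_integral_mono)
      fix x
      have "(\<integral>\<^sup>+y. ennreal (kern x y * f y) * ennreal (h x) \<partial>\<nu>) = (\<integral>\<^sup>+y. liminf (\<lambda>n. ennreal (kA (?A n) x y * f y) * ennreal (h x)) \<partial>\<nu>)"
      proof (intro nn_integral_cong_AE AE_mp[OF AE_reference_neq[of x] AE_I2] impI)
        fix y assume "y \<noteq> x"
        then have r: "(norm (x - y))\<^sup>2 > 0" by simp
        have "(\<lambda>n. ?A n) \<longlonglongrightarrow> 0" using LIMSEQ_inverse_real_of_nat by (simp add: inverse_eq_divide)
        then have "(\<lambda>n. kA (?A n) x y) \<longlonglongrightarrow> theta_shift x + theta_shift y - ln (0 + (norm (x - y))\<^sup>2) / 2"
          unfolding kA_def using r by (intro tendsto_intros) auto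
        also have "theta_shift x + theta_shift y - ln (0 + (norm (x - y))\<^sup>2) / 2 = kern x y"
          using r by (simp add: log_kernel_eq norm_minus_commute ln_realpow)
        finally have "(\<lambda>n. ennreal (kA (?A n) x y * f y * h x)) \<longlonglongrightarrow> ennreal (kern x y * f y * h x)"
          by (intro tendsto_ennrealI tendsto_intros)
        then have "(\<lambda>n. ennreal (kA (?A n) x y * f y) * ennreal (h x)) \<longlonglongrightarrow> ennreal (kern x y * f y) * ennreal (h x)"
          using nn by (simp add: ennreal_mult'')
        then show "ennreal (kern x y * f y) * ennreal (h x) = liminf (\<lambda>n. ennreal (kA (?A n) x y * f y) * ennreal (h x))"
          by (rule lim_imp_Liminf[OF sequentially_bot, symmetric])
      qed
      also have "\<dots> \<le> liminf (\<lambda>n. \<integral>\<^sup>+y. ennreal (kA (?A n) x y * f y) * ennreal (h x) \<partial>\<nu>)"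
        by (rule nn_integral_liminf) measurable
      finally show "(\<integral>\<^sup>+y. ennreal (kern x y * f y) * ennreal (h x) \<partial>\<nu>) \<le> \<dots>" .
    qed
    also have "\<dots> \<le> liminf (\<lambda>n. E (?A n) f h)"
      unfolding E_def by (rule nn_integral_liminf) measurable
    finally show ?thesis .
  qed
  have "F f h \<le> (F f f + F h h) / 2"
  proof (rule order_trans[OF lim], rule Liminf_le)
    show "\<forall>\<^sub>F n in sequentially. E (?A n) f h \<le> (F f f + F h h) / 2"
    proof (intro always_eventually allI)
      fix n
      have "2 * E (?A n) f h \<le> F f f + F h h"
        using main[OF A] le[OF A nn(1)] le[OF A nn(2)] by (meson add_mono order_trans)
      then have "E (?A n) f h * 2 / 2 \<le> (F f f + F h h) / 2" by (intro divide_right_mono_ennreal) (simp add: mult.commute)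
      then show "E (?A n) f h \<le> (F f f + F h h) / 2" by (simp add: ennreal_mult_divide_eq)
    qed
  qed simp
  then have "2 * F f h \<le> 2 * ((F f f + F h h) / 2)" by (rule mult_left_mono) simp
  also have "\<dots> = F f f + F h h"
  proof -
    have "2 * (z / 2) = z" for z :: ennreal
      by (simp add: ennreal_times_divide mult.commute[of 2 z] ennreal_mult_divide_eq)
    then show ?thesis .
  qed
  finally show ?thesis unfolding F_def .
qed

lemma entropic_energy_reference: "\<exists>C. entropic_energy \<nu> kern theta_shift (\<gamma> / 2) C"
proof -
  obtain C where C: "\<And>x. (\<integral>\<^sup>+y. ennreal (exp (log_kernel x y / 2)) \<partial>\<nu>) \<le> ennreal C" using reference_singular_bound by blast
  interpret prob_space \<nu> by (rule prob_reference)
  have "entropic_energy \<nu> kern theta_shift (\<gamma> / 2) C"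
  proof (unfold_locales, goal_cases)
    case 7
    have "integrable lborel (\<lambda>x. ref_density x * (1 + norm x))"
    proof (rule decay_integrable)
      show "\<exists>C. \<forall>z. ref_density z * (1 + norm z) * (1 + norm z) ^ (DIM('a) + 2) \<le> C"
        using ref_density_decay[of "Suc (DIM('a) + 2)"] by (simp add: mult_ac)
    qed (use ref_density_pos in \<open>auto simp: less_imp_le\<close>)
    then have "(\<integral>\<^sup>+x. ennreal (ref_density x * (1 + norm x)) \<partial>lborel) < \<infinity>"
      using ref_density_pos by (subst nn_integral_eq_integral) (auto simp: less_imp_le)
    moreover have "exp (theta_shift x) = 1 + norm x" for x :: 'a by (simp add: theta_shift_def add_pos_nonneg)
    ultimately show ?case
      using ref_density_pos by (subst nn_integral_reference) (simp_all add: ennreal_mult[symmetric] less_imp_le del: ennreal_plus)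
  next
    case (8 x) then show ?case using C by simp
  next
    case (10 f h) then show ?case by (rule positive_log_energy)
  qed (use gamma_nonneg log_kernel_ge in \<open>auto simp: sets_reference log_kernel_sym\<close>)
  then show ?thesis ..
qed

lemma equilibrium_exists:
  fixes C :: real
  assumes EE: "entropic_energy \<nu> kern theta_shift (\<gamma> / 2) C"
  defines "dens \<equiv> entropic_energy.dens \<nu>"
  defines "tot \<equiv> entropic_energy.total \<nu> kern (\<gamma> / 2)"
  shows "\<exists>f. dens f \<and> (\<forall>h. dens h \<longrightarrow> tot f \<le> tot h) \<and> equilibrium_measure \<gamma> V = density \<nu> (\<lambda>x. ennreal (f x))"
proof -
  interpret E: entropic_energy \<nu> kern theta_shift "\<gamma> / 2" C by (rule EE)
  have dens: "dens = E.dens" and tot: "tot = E.total" by (simp_all add: dens_def tot_def)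
  let ?P = "\<lambda>\<mu>::'a measure. prob_space \<mu> \<and> sets \<mu> = sets borel"
  have AC: "absolutely_continuous \<nu> (density \<nu> (\<lambda>x. ennreal (f x)))" if [measurable]: "f \<in> borel_measurable borel" for f
    by (rule absolutely_continuousI_density) measurable
  have RN: "AE x in \<nu>. enn2real (RN_deriv \<nu> (density \<nu> (\<lambda>x. ennreal (f x))) x) = f x"
    if [measurable]: "f \<in> borel_measurable borel" and "\<And>x. 0 \<le> f x" for f
  proof -
    have "AE x in \<nu>. ennreal (f x) = RN_deriv \<nu> (density \<nu> (\<lambda>x. ennreal (f x))) x"
      by (rule E.RN_deriv_unique) auto
    then show ?thesis
    proof eventually_elim
      case (elim x)
      show ?case unfolding elim[symmetric] using that(2)[of x] by simp
    qed
  qed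
  have ent_int: "integrable (density \<nu> (\<lambda>x. ennreal (f x))) (entropy_density (exp 1) \<nu> (density \<nu> (\<lambda>x. ennreal (f x))))
      \<longleftrightarrow> integrable \<nu> (\<lambda>x. f x * ln (f x))"
    if [measurable]: "f \<in> borel_measurable borel" and nn: "\<And>x. 0 \<le> f x" for f
  proof -
    have "integrable (density \<nu> (\<lambda>x. ennreal (f x))) (entropy_density (exp 1) \<nu> (density \<nu> (\<lambda>x. ennreal (f x))))
      \<longleftrightarrow> integrable \<nu> (\<lambda>x. f x *\<^sub>R entropy_density (exp 1) \<nu> (density \<nu> (\<lambda>x. ennreal (f x))) x)"
      using nn by (intro integrable_density) (auto simp: entropy_density_def)
    also have "\<dots> \<longleftrightarrow> integrable \<nu> (\<lambda>x. f x * ln (f x))"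
      using RN[OF that] by (intro integrable_cong_AE) (auto simp: entropy_density_def log_def elim!: eventually_mono)
    finally show ?thesis .
  qed
  have energy: "(\<integral>\<^sup>+x. (\<integral>\<^sup>+z. shifted_kernel x z \<partial>density \<nu> (\<lambda>x. ennreal (f x))) \<partial>density \<nu> (\<lambda>x. ennreal (f x))) = ennreal (E.inter f f)"
    if f: "dens f" for f
  proof -
    note f' = f[unfolded dens]
    note [measurable] = E.densD(1)[OF f']
    have in1: "(\<integral>\<^sup>+z. shifted_kernel x z \<partial>density \<nu> (\<lambda>x. ennreal (f x))) = (\<integral>\<^sup>+z. ennreal (kern x z * f z) \<partial>\<nu>)" for x
    proof -
      have "(\<integral>\<^sup>+z. shifted_kernel x z \<partial>density \<nu> (\<lambda>x. ennreal (f x))) = (\<integral>\<^sup>+z. ennreal (f z) * shifted_kernel x z \<partial>\<nu>)"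
        unfolding shifted_kernel_def by (intro nn_integral_density) measurable
      also have "\<dots> = (\<integral>\<^sup>+z. ennreal (kern x z * f z) \<partial>\<nu>)"
      proof (rule nn_integral_cong_AE, rule AE_referenceI[of x])
        fix z assume "z \<noteq> x"
        then show "ennreal (f z) * shifted_kernel x z = ennreal (kern x z * f z)"
          using E.densD(2)[OF f'] log_kernel_ge[of x z] by (simp add: shifted_kernel_def ennreal_mult mult.commute)
      qed
      finally show ?thesis .
    qed
    show ?thesis unfolding in1
      by (subst nn_integral_density) (auto simp: E.inter_facts(3)[OF f' f', symmetric] nn_integral_multc nn_integral_cmult mult.commute)
  qed
  have entr: "integrable \<nu> (\<lambda>x. f x * ln (f x)) \<and> (\<integral>x. f x * ln (f x) \<partial>\<nu>) = E.ent f" if f: "dens f" for f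
  proof -
    note f' = f[unfolded dens]
    have eq: "f x * ln (f x) = entropy_fun (f x) + f x - 1" for x by (simp add: entropy_fun_def)
    show ?thesis unfolding eq E.ent_def using E.densD[OF f'] by (simp add: E.prob_space)
  qed
  have FE: "free_energy \<gamma> V (density \<nu> (\<lambda>x. ennreal (f x))) = ereal (tot f)" if f: "dens f" for f
  proof -
    note f' = f[unfolded dens]
    have "KL_divergence (exp 1) \<nu> (density \<nu> (\<lambda>x. ennreal (f x))) = (\<integral>x. f x * log (exp 1) (f x) \<partial>\<nu>)"
      using E.densD[OF f'] by (intro E.KL_density) auto
    then have KL: "KL_divergence (exp 1) \<nu> (density \<nu> (\<lambda>x. ennreal (f x))) = E.ent f" using entr[OF f] by (simp add: log_def)
    show ?thesis
      using AC[OF E.densD(1)[OF f']] ent_int[OF E.densD(1)[OF f'] E.densD(2)[OF f']] entr[OF f] E.inter_facts(2)[OF f' f']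
      unfolding free_energy_def relative_entropy_def energy[OF f] by (simp add: KL tot E.total_def)
  qed
  have P: "?P (density \<nu> (\<lambda>x. ennreal (f x)))" if f: "dens f" for f
  proof -
    note [measurable] = E.densD(1)[OF f[unfolded dens]]
    have "prob_space (density \<nu> (\<lambda>x. ennreal (f x)))"
      using E.densD(3)[OF f[unfolded dens]] by (auto intro!: prob_spaceI simp: emeasure_density)
    then show ?thesis by (simp add: sets_reference)
  qed
  have finite: "\<exists>f. dens f \<and> \<mu> = density \<nu> (\<lambda>x. ennreal (f x))" if mu: "?P \<mu>" and fin: "free_energy \<gamma> V \<mu> < \<infinity>" for \<mu>
  proof -
    have "0 \<le> ereal (\<gamma> / 2) * enn2ereal (\<integral>\<^sup>+x. (\<integral>\<^sup>+z. shifted_kernel x z \<partial>\<mu>) \<partial>\<mu>)" using gamma_nonneg by simp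
    then have ac: "absolutely_continuous \<nu> \<mu>" and int: "integrable \<mu> (entropy_density (exp 1) \<nu> \<mu>)"
      using fin unfolding free_energy_def relative_entropy_def by (auto split: if_splits)
    have fm: "finite_measure \<mu>" and s: "sets \<mu> = sets \<nu>" using mu by (auto simp: prob_space_def sets_reference)
    obtain D where D: "D \<in> borel_measurable \<nu>" "AE x in \<nu>. RN_deriv \<nu> \<mu> x = ennreal (D x)" "AE x in \<mu>. 0 < D x" "\<And>x. 0 \<le> D x"
      by (rule E.real_RN_deriv[OF fm ac s]) (rule that)
    have [measurable]: "D \<in> borel_measurable borel" using D(1) measurable_cong_sets[OF sets_reference refl] by blast
    have "\<mu> = density \<nu> (RN_deriv \<nu> \<mu>)" by (rule E.density_RN_deriv[OF ac s, symmetric])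
    also have "\<dots> = density \<nu> (\<lambda>x. ennreal (D x))" using D(2) by (intro density_cong) auto
    finally have mD: "\<mu> = density \<nu> (\<lambda>x. ennreal (D x))" .
    have one: "(\<integral>\<^sup>+x. ennreal (D x) \<partial>\<nu>) = 1"
    proof -
      have "emeasure (density \<nu> (\<lambda>x. ennreal (D x))) (space \<nu>) = 1"
        using prob_space.emeasure_space_1[of \<mu>] mu mD by (metis space_density)
      then show ?thesis by (simp add: emeasure_density)
    qed
    have "integrable \<nu> (\<lambda>x. D x * ln (D x))" using int ent_int[of D] D(4) unfolding mD by auto
    moreover have "integrable \<nu> D" using one D(4) by (intro integrableI_nonneg) auto
    ultimately have "integrable \<nu> (\<lambda>x. entropy_fun (D x))" unfolding entropy_fun_def by auto
    then have "(\<integral>\<^sup>+x. ennreal (entropy_fun (D x)) \<partial>\<nu>) < \<infinity>"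
      using entropy_fun_nonneg[OF D(4)] by (subst nn_integral_eq_integral) auto
    then have "dens D" unfolding dens E.dens_def using one D(4) by auto
    then show ?thesis using mD by blast
  qed
  obtain f0 where f0: "dens f0" "\<And>h. dens h \<Longrightarrow> tot f0 \<le> tot h"
    using E.minimizer_exists unfolding dens tot by blast
  have "is_arg_min (free_energy \<gamma> V) ?P (density \<nu> (\<lambda>x. ennreal (f0 x)))"
    unfolding is_arg_min_def
  proof (intro conjI P f0 notI)
    assume "\<exists>y. ?P y \<and> free_energy \<gamma> V y < free_energy \<gamma> V (density \<nu> (\<lambda>x. ennreal (f0 x)))"
    then obtain \<mu> where mu: "?P \<mu>" "free_energy \<gamma> V \<mu> < ereal (tot f0)" using FE[OF f0(1)] by auto
    then obtain f where "dens f" "\<mu> = density \<nu> (\<lambda>x. ennreal (f x))" using finite[of \<mu>] by (metis less_ereal.simps(4) less_trans)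
    then show False using FE[of f] f0(2)[of f] mu by auto
  qed (use P f0 in auto)
  then have eq: "is_arg_min (free_energy \<gamma> V) ?P (equilibrium_measure \<gamma> V)"
    unfolding equilibrium_measure_def arg_min_def by (rule someI)
  then have eP: "?P (equilibrium_measure \<gamma> V)" unfolding is_arg_min_def by blast
  have emin: "free_energy \<gamma> V (equilibrium_measure \<gamma> V) \<le> ereal (tot h)" if "dens h" for h
    using eq P[OF that] FE[OF that] unfolding is_arg_min_def by (metis not_le)
  then have "free_energy \<gamma> V (equilibrium_measure \<gamma> V) < \<infinity>" using f0(1) by (metis ereal_infty_less(1) less_ereal.simps(4) le_less_trans)
  then obtain f where f: "dens f" "equilibrium_measure \<gamma> V = density \<nu> (\<lambda>x. ennreal (f x))" using finite eP by blast
  have "tot f \<le> tot h" if "dens h" for h using emin[OF that] FE[OF f(1)] f(2) by simp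
  then show ?thesis using f by blast
qed

lemma equilibrium_density:
  defines "\<mu> \<equiv> equilibrium_measure \<gamma> V"
  shows "prob_space \<mu>" "0 < L_const \<gamma> V" "integrable \<mu> theta_shift"
    "\<mu> = density lborel (\<lambda>x. ennreal (exp (- \<gamma> * log_potential \<mu> x - V x) / L_const \<gamma> V))"
    "\<And>x. integrable \<mu> (log_kernel x)"
proof -
  obtain C where EE: "entropic_energy \<nu> kern theta_shift (\<gamma> / 2) C" using entropic_energy_reference by blast
  interpret E: entropic_energy \<nu> kern theta_shift "\<gamma> / 2" C by (rule EE)
  obtain f where f: "E.dens f" and min: "\<And>h. E.dens h \<Longrightarrow> E.total f \<le> E.total h" and mu: "\<mu> = density \<nu> (\<lambda>x. ennreal (f x))"
    using equilibrium_exists[OF EE] unfolding \<mu>_def by blast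
  obtain Z where Z: "0 < Z" "AE x in \<nu>. f x = exp (- 2 * (\<gamma> / 2) * E.pot f x) / Z"
    using E.minimizer_Euler_Lagrange[OF f min] by blast
  note [measurable] = E.densD(1)[OF f] E.pot_facts(4)[OF f]
  note nn = E.densD(2)[OF f]
  show ps: "prob_space \<mu>" using E.densD(3)[OF f] unfolding mu by (auto intro!: prob_spaceI simp: emeasure_density)
  interpret M: prob_space \<mu> by (rule ps)
  have sm [measurable_cong]: "sets \<mu> = sets borel" unfolding mu by (simp add: sets_reference)
  show th: "integrable \<mu> theta_shift"
    unfolding mu using nn E.densD(7)[OF f] by (subst integrable_density) (auto simp: mult.commute)
  have kint: "integrable \<mu> (\<lambda>z. kern x z)" for x
    unfolding mu using nn E.pot_facts(1)[OF f, of x] by (subst integrable_density) (auto simp: mult.commute)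
  show lint: "integrable \<mu> (log_kernel x)" for x
  proof -
    have eq: "log_kernel x = (\<lambda>z. kern x z - theta_shift x - theta_shift z)" by auto
    show ?thesis by (subst eq) (intro Bochner_Integration.integrable_diff kint th, simp)
  qed
  define T where "T = (\<integral>z. theta_shift z \<partial>\<mu>)"
  have pot: "E.pot f x = log_potential \<mu> x + theta_shift x + T" for x
  proof -
    have "E.pot f x = (\<integral>z. kern x z \<partial>\<mu>)"
      unfolding mu E.pot_def using nn by (subst integral_density) (auto simp: mult.commute)
    also have "\<dots> = log_potential \<mu> x + theta_shift x + T"
      unfolding log_potential_def T_def using lint[of x] th by (simp add: M.prob_space)
    finally show ?thesis .
  qed
  define w where "w x = exp (- \<gamma> * log_potential \<mu> x - V x)" for x
  have [measurable]: "log_potential \<mu> \<in> borel_measurable borel" unfolding log_potential_def[abs_def] by measurable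
  have [measurable]: "w \<in> borel_measurable borel" unfolding w_def[abs_def] by measurable
  define K where "K = exp (- \<gamma> * T) / ((\<integral>y. ref_weight y \<partial>lborel) * Z)"
  have K: "0 < K" unfolding K_def using Z ref_integral_pos by simp
  have dd: "density \<nu> g = density lborel (\<lambda>x. ennreal (ref_density x) * g x)" if [measurable]: "g \<in> borel_measurable borel" for g
    unfolding reference_measure_eq by (rule density_density_eq) measurable
  have "\<mu> = density \<nu> (\<lambda>x. ennreal (exp (- \<gamma> * E.pot f x) / Z))"
    unfolding mu using Z(2) by (intro density_cong) (auto elim!: eventually_mono)
  also have "\<dots> = density lborel (\<lambda>x. ennreal (ref_density x) * ennreal (exp (- \<gamma> * E.pot f x) / Z))"
    by (rule dd) measurable
  also have "\<dots> = density lborel (\<lambda>x. ennreal (K * w x))"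
  proof (intro density_cong AE_I2)
    fix x
    have "ref_density x * (exp (- \<gamma> * E.pot f x) / Z) = K * w x"
      unfolding ref_density_def ref_weight_def pot K_def w_def by (simp add: exp_add[symmetric] mult_exp_exp field_simps)
    then show "ennreal (ref_density x) * ennreal (exp (- \<gamma> * E.pot f x) / Z) = ennreal (K * w x)"
      using ref_density_pos[of x] by (subst ennreal_mult'[symmetric]) auto
  qed measurable
  finally have muK: "\<mu> = density lborel (\<lambda>x. ennreal (K * w x))" .
  have w0: "0 \<le> w x" for x by (simp add: w_def)
  have "1 = (\<integral>\<^sup>+x. ennreal (K * w x) \<partial>lborel)"
    using M.emeasure_space_1 unfolding muK by (simp add: emeasure_density)
  then have one: "integrable lborel (\<lambda>x. K * w x)" "(\<integral>x. K * w x \<partial>lborel) = 1"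
  proof -
    assume a: "1 = (\<integral>\<^sup>+x. ennreal (K * w x) \<partial>lborel)"
    show i: "integrable lborel (\<lambda>x. K * w x)" using a K w0 by (intro integrableI_nonneg) (auto simp: less_imp_le a[symmetric])
    show "(\<integral>x. K * w x \<partial>lborel) = 1" using a K w0 by (subst integral_eq_nn_integral) (auto simp: a[symmetric] less_imp_le)
  qed
  have L: "L_const \<gamma> V = (\<integral>x. w x \<partial>lborel)" unfolding L_const_def w_def \<mu>_def ..
  have KL: "K * L_const \<gamma> V = 1" using one(2) unfolding L by simp
  then show "0 < L_const \<gamma> V" using K by (metis zero_less_mult_pos zero_less_one)
  then have "K = 1 / L_const \<gamma> V" using KL by (simp add: field_simps)
  then show "\<mu> = density lborel (\<lambda>x. ennreal (exp (- \<gamma> * log_potential \<mu> x - V x) / L_const \<gamma> V))"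
    using muK unfolding w_def by simp
qed

end

section \<open>The mean-field potential\<close>

lemma log_kernel_le: "log_kernel x z \<le> 2 * norm (x - z) powr (-1/2)"
proof (cases "x = z")
  case False
  then have r: "0 < norm (x - z)" by simp
  have "ln (norm (x - z) powr (-1/2)) \<le> norm (x - z) powr (-1/2) - 1" using r by (intro ln_le_minus_one) simp
  then show ?thesis using r by (simp add: log_kernel_eq ln_powr norm_minus_commute)
qed (simp add: log_kernel_eq)

locale mean_field = confining_potential
begin

definition "\<mu> = equilibrium_measure \<gamma> V"
definition "U = log_potential \<mu>"
definition "L = L_const \<gamma> V"
definition m :: "'a \<Rightarrow> real" where "m x = exp (- \<gamma> * U x - V x) / L"
definition "G = (\<integral>x. U x \<partial>\<mu>)"

lemma mu_density: "\<mu> = density lborel (\<lambda>x. ennreal (m x))"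
  using equilibrium_density(4) unfolding \<mu>_def m_def U_def L_def by simp

lemma prob_mu: "prob_space \<mu>" using equilibrium_density(1) by (simp add: \<mu>_def)
lemma L_pos: "0 < L" using equilibrium_density(2) by (simp add: L_def)
lemma theta_integrable: "integrable \<mu> theta_shift" using equilibrium_density(3) by (simp add: \<mu>_def)
lemma log_kernel_integrable: "integrable \<mu> (log_kernel x)" using equilibrium_density(5) by (simp add: \<mu>_def)
lemma sets_mu [measurable_cong]: "sets \<mu> = sets borel" by (simp add: mu_density)
lemma m_pos: "0 < m x" using L_pos by (simp add: m_def)

lemma U_eq: "U x = (\<integral>z. log_kernel x z \<partial>\<mu>)" by (simp add: U_def log_potential_def)

lemma U_measurable [measurable]: "U \<in> borel_measurable borel"
proof -
  interpret prob_space \<mu> by (rule prob_mu)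
  show ?thesis unfolding U_eq[abs_def] by measurable
qed

lemma m_measurable [measurable]: "m \<in> borel_measurable borel"
  unfolding m_def[abs_def] by measurable

lemma U_ge: "\<exists>C. \<forall>x. - C - theta_shift x \<le> U x"
proof -
  interpret prob_space \<mu> by (rule prob_mu)
  define T where "T = (\<integral>z. theta_shift z \<partial>\<mu>)"
  have "- T - theta_shift x \<le> U x" for x
  proof -
    have "(\<integral>z. - theta_shift x - theta_shift z \<partial>\<mu>) \<le> U x"
      unfolding U_eq
    proof (intro integral_mono)
      show "- theta_shift x - theta_shift z \<le> log_kernel x z" for z using log_kernel_ge[of x z] by linarith
    qed (use theta_integrable log_kernel_integrable in auto)
    then show ?thesis using theta_integrable by (simp add: T_def prob_space)
  qed
  then show ?thesis by blast
qed

lemma m_decay: "\<exists>C. \<forall>x. m x * (1 + norm x) ^ q \<le> C"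
proof -
  obtain T where T: "\<And>x. - T - theta_shift x \<le> U x" using U_ge by blast
  obtain C where C: "\<And>x. exp (- V x + \<gamma> * theta_shift x) * (1 + norm x) ^ q \<le> C" using powr_decay by blast
  have "m x * (1 + norm x) ^ q \<le> exp (\<gamma> * T) / L * C" for x
  proof -
    have "- \<gamma> * U x \<le> \<gamma> * (T + theta_shift x)" using mult_left_mono[OF T[of x] gamma_nonneg] by (simp add: algebra_simps)
    then have "exp (- \<gamma> * U x - V x) \<le> exp (\<gamma> * T) * exp (- V x + \<gamma> * theta_shift x)"
      unfolding exp_add[symmetric] by (subst exp_le_cancel_iff) (simp add: algebra_simps)
    then have "m x \<le> exp (\<gamma> * T) / L * exp (- V x + \<gamma> * theta_shift x)"
      unfolding m_def using L_pos by (simp add: field_simps)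
    then have "m x * (1 + norm x) ^ q \<le> exp (\<gamma> * T) / L * exp (- V x + \<gamma> * theta_shift x) * (1 + norm x) ^ q"
      by (rule mult_right_mono) simp
    also have "\<dots> \<le> exp (\<gamma> * T) / L * C" unfolding mult.assoc using C L_pos by (intro mult_left_mono) auto
    finally show ?thesis .
  qed
  then show ?thesis by blast
qed

lemma m_power_integrable: "integrable lborel (\<lambda>x. m x * (1 + norm x) ^ q)"
proof (rule decay_integrable)
  show "\<exists>C. \<forall>z. m z * (1 + norm z) ^ q * (1 + norm z) ^ (DIM('a) + 2) \<le> C"
    using m_decay[of "q + (DIM('a) + 2)"] by (simp add: power_add mult_ac)
qed (use m_pos in \<open>auto simp: less_imp_le\<close>)

lemma nn_integral_mu: "f \<in> borel_measurable borel \<Longrightarrow> (\<integral>\<^sup>+x. f x \<partial>\<mu>) = (\<integral>\<^sup>+x. ennreal (m x) * f x \<partial>lborel)"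
  unfolding mu_density by (intro nn_integral_density) auto

lemma m_singular_bound:
  "\<exists>C\<ge>0. \<forall>x. (\<integral>\<^sup>+z. ennreal (m z * (1 + norm z) ^ q * norm (x - z) powr (-1/2)) \<partial>lborel) \<le> ennreal C"
proof -
  obtain S where S: "0 \<le> S" "\<And>(x::'a) h C D. h \<in> borel_measurable borel \<Longrightarrow> (\<forall>z. 0 \<le> h z \<and> h z \<le> C) \<Longrightarrow> 0 \<le> D \<Longrightarrow>
       (\<integral>\<^sup>+z. ennreal (h z) \<partial>lborel) \<le> ennreal D \<Longrightarrow>
       (\<integral>\<^sup>+z. ennreal (h z * norm (x - z) powr (-1/2)) \<partial>lborel) \<le> ennreal (C * S + D)"
    using singular_integral_bound[where 'a='a] by blast
  obtain C where C: "\<And>x. m x * (1 + norm x) ^ q \<le> C" using m_decay by blast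
  define D where "D = (\<integral>x. m x * (1 + norm x) ^ q \<partial>lborel)"
  have nn: "0 \<le> m x * (1 + norm x) ^ q" for x using m_pos[of x] by simp
  have D0: "0 \<le> D" unfolding D_def using nn by (intro integral_nonneg_AE) auto
  have "(\<integral>\<^sup>+z. ennreal (m z * (1 + norm z) ^ q) \<partial>lborel) = ennreal D"
    unfolding D_def using m_power_integrable nn by (intro nn_integral_eq_integral) auto
  then have "(\<integral>\<^sup>+z. ennreal (m z * (1 + norm z) ^ q * norm (x - z) powr (-1/2)) \<partial>lborel) \<le> ennreal (C * S + D)" for x
    using nn C D0 by (intro S(2)) auto
  moreover have "0 \<le> C * S + D" using order_trans[OF nn[of 0] C[of 0]] S(1) D0 by simp
  ultimately show ?thesis by blast
qed

lemma mu_singular_bound: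
  "\<exists>C\<ge>0. \<forall>x. integrable \<mu> (\<lambda>z. norm (x - z) powr (-1/2)) \<and> (\<integral>z. norm (x - z) powr (-1/2) \<partial>\<mu>) \<le> C"
proof -
  obtain C where C: "C \<ge> 0" "\<And>x. (\<integral>\<^sup>+z. ennreal (m z * (1 + norm z) ^ 0 * norm (x - z) powr (-1/2)) \<partial>lborel) \<le> ennreal C"
    using m_singular_bound[of 0] by blast
  have b: "(\<integral>\<^sup>+z. ennreal (norm (x - z) powr (-1/2)) \<partial>\<mu>) \<le> ennreal C" for x
    using C(2)[of x] m_pos by (subst nn_integral_mu) (auto simp: ennreal_mult less_imp_le)
  have i: "integrable \<mu> (\<lambda>z. norm (x - z) powr (-1/2))" for x
    using b[of x] by (intro integrableI_nonneg) (auto intro: le_less_trans)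
  then have "(\<integral>z. norm (x - z) powr (-1/2) \<partial>\<mu>) \<le> C" for x
    using b[of x] C(1) by (subst (asm) nn_integral_eq_integral) auto
  then show ?thesis using C(1) i by blast
qed

lemma U_bound: "\<exists>C\<ge>0. \<forall>x. \<bar>U x\<bar> \<le> C + theta_shift x"
proof -
  obtain T where T: "\<And>x. - T - theta_shift x \<le> U x" using U_ge by blast
  obtain C where C: "C \<ge> 0" "\<And>x. integrable \<mu> (\<lambda>z. norm (x - z) powr (-1/2))" "\<And>x. (\<integral>z. norm (x - z) powr (-1/2) \<partial>\<mu>) \<le> C"
    using mu_singular_bound by blast
  have "\<bar>U x\<bar> \<le> (\<bar>T\<bar> + 2 * C) + theta_shift x" for x
  proof -
    have "U x \<le> (\<integral>z. 2 * norm (x - z) powr (-1/2) \<partial>\<mu>)"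
      unfolding U_eq using C(2) log_kernel_integrable log_kernel_le[of x] by (intro integral_mono) auto
    also have "\<dots> \<le> 2 * C" using C(3)[of x] by simp
    finally have "U x \<le> 2 * C" .
    then show ?thesis using T[of x] C(1) theta_shift_nonneg[of x] unfolding abs_le_iff by linarith
  qed
  then show ?thesis using C(1) by (intro exI[of _ "\<bar>T\<bar> + 2 * C"]) auto
qed

lemma U_integrable: "integrable \<mu> U"
proof -
  interpret prob_space \<mu> by (rule prob_mu)
  obtain C where C: "\<And>x. \<bar>U x\<bar> \<le> C + theta_shift x" using U_bound by blast
  show ?thesis
    by (rule Bochner_Integration.integrable_bound[of _ "\<lambda>x. C + theta_shift x"])
      (use C theta_integrable in \<open>auto intro: order_trans[OF _ abs_ge_self]\<close>)
qed

lemma AE_mu_neq: "AE z in \<mu>. z \<noteq> x"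
  unfolding mu_density by (subst AE_density) (auto intro: AE_mp[OF AE_lborel_singleton[of x]])

definition g_reg :: "real \<Rightarrow> 'a \<Rightarrow> 'a \<Rightarrow> real" where
  "g_reg \<epsilon> x y = - ln (\<epsilon>\<^sup>2 + (norm (x - y))\<^sup>2) / 2"

definition U_reg :: "real \<Rightarrow> 'a \<Rightarrow> real" where
  "U_reg \<epsilon> x = (\<integral>z. g_reg \<epsilon> x z \<partial>\<mu>)"

lemma g_reg_measurable [measurable]:
  "(\<lambda>w. g_reg \<epsilon> (f w) (g w)) \<in> borel_measurable M"
  if [measurable]: "f \<in> borel_measurable M" "g \<in> borel_measurable M"
  unfolding g_reg_def by measurable

lemma g_reg_ge: "0 < \<epsilon> \<Longrightarrow> \<epsilon> \<le> 1 \<Longrightarrow> - theta_shift x - theta_shift y \<le> g_reg \<epsilon> x y"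
  using half_ln_dist_square_le[of "\<epsilon>\<^sup>2" x y] by (simp add: g_reg_def power_le_one)

lemma g_reg_le: "0 < \<epsilon> \<Longrightarrow> g_reg \<epsilon> x y \<le> - ln \<epsilon>"
proof -
  assume e: "0 < \<epsilon>"
  then have "ln (\<epsilon>\<^sup>2) \<le> ln (\<epsilon>\<^sup>2 + (norm (x - y))\<^sup>2)" by (subst ln_le_cancel_iff) (auto simp: add_pos_nonneg)
  then show ?thesis using e by (simp add: g_reg_def ln_realpow)
qed

lemma g_reg_le_log_kernel:
  assumes "0 < \<epsilon>" "x \<noteq> y"
  shows "g_reg \<epsilon> x y \<le> log_kernel x y"
proof -
  have "ln ((norm (x - y))\<^sup>2) \<le> ln (\<epsilon>\<^sup>2 + (norm (x - y))\<^sup>2)" using assms by (subst ln_le_cancel_iff) (auto simp: add_pos_nonneg)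
  moreover have "ln ((norm (x - y))\<^sup>2) = 2 * ln (norm (x - y))" using assms by (subst ln_realpow) auto
  ultimately show ?thesis by (simp add: g_reg_def log_kernel_eq norm_minus_commute)
qed

lemma log_kernel_le_g_reg:
  assumes e: "0 < \<epsilon>" "\<epsilon> \<le> 1"
  shows "log_kernel x y - g_reg \<epsilon> x y \<le> 2 * sqrt \<epsilon> * norm (x - y) powr (-1/2)"
proof (cases "x = y")
  case True
  then show ?thesis using e by (simp add: log_kernel_eq g_reg_def ln_realpow)
next
  case False
  let ?r = "norm (x - y)"
  have r: "0 < ?r" using False by simp
  define s where "s = sqrt (\<epsilon> / ?r)"
  have s: "0 < s" "s\<^sup>2 = \<epsilon> / ?r" using e r by (auto simp: s_def)
  have "ln (\<epsilon>\<^sup>2 + ?r\<^sup>2) \<le> ln ((1 + s) ^ 4 * ?r\<^sup>2)"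
  proof (subst ln_le_cancel_iff)
    have "s ^ 4 = (s\<^sup>2)\<^sup>2" by (simp add: power4_eq_xxxx power2_eq_square mult.assoc)
    then have "s ^ 4 = (\<epsilon> / ?r)\<^sup>2" unfolding s(2) .
    then have "\<epsilon>\<^sup>2 + ?r\<^sup>2 = (s ^ 4 + 1) * ?r\<^sup>2" using r by (simp add: field_simps)
    also have "\<dots> \<le> (1 + s) ^ 4 * ?r\<^sup>2" using s by (intro mult_right_mono) (auto simp: power4_eq_xxxx algebra_simps)
    finally show "\<epsilon>\<^sup>2 + ?r\<^sup>2 \<le> (1 + s) ^ 4 * ?r\<^sup>2" .
  qed (use e r s in \<open>auto intro: add_pos_nonneg\<close>)
  also have "\<dots> = 4 * ln (1 + s) + 2 * ln ?r" using r s by (simp add: ln_mult ln_realpow)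
  also have "\<dots> \<le> 4 * s + 2 * ln ?r" using ln_add_one_self_le_self[of s] s by simp
  finally have fin: "ln (\<epsilon>\<^sup>2 + ?r\<^sup>2) / 2 - ln ?r \<le> 2 * s" by simp
  have "?r powr (-1/2) = inverse (sqrt ?r)"
    by (simp only: minus_divide_left[symmetric] powr_minus) (simp add: powr_half_sqrt)
  moreover have "s = sqrt \<epsilon> * inverse (sqrt ?r)"
    unfolding s_def by (simp only: divide_inverse real_sqrt_mult real_sqrt_inverse)
  ultimately have "s = sqrt \<epsilon> * ?r powr (-1/2)" by (simp only:)
  then have "2 * s = 2 * sqrt \<epsilon> * ?r powr (-1/2)" by (simp only: mult.assoc)
  then show ?thesis using fin unfolding log_kernel_eq g_reg_def norm_minus_commute[of y x] by linarith
qed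

lemma g_reg_integrable: "0 < \<epsilon> \<Longrightarrow> \<epsilon> \<le> 1 \<Longrightarrow> integrable \<mu> (g_reg \<epsilon> x)"
proof -
  assume e: "0 < \<epsilon>" "\<epsilon> \<le> 1"
  interpret prob_space \<mu> by (rule prob_mu)
  show ?thesis
  proof (rule Bochner_Integration.integrable_bound[of _ "\<lambda>z. theta_shift x + theta_shift z + \<bar>ln \<epsilon>\<bar>"])
    show "AE z in \<mu>. norm (g_reg \<epsilon> x z) \<le> norm (theta_shift x + theta_shift z + \<bar>ln \<epsilon>\<bar>)"
    proof (rule AE_I2)
      fix z
      show "norm (g_reg \<epsilon> x z) \<le> norm (theta_shift x + theta_shift z + \<bar>ln \<epsilon>\<bar>)"
        using g_reg_ge[OF e, of x z] g_reg_le[OF e(1), of x z] theta_shift_nonneg[of x] theta_shift_nonneg[of z]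
        unfolding real_norm_def by linarith
    qed
  qed (use theta_integrable in auto)
qed

lemma U_reg_facts:
  assumes e: "0 < \<epsilon>" "\<epsilon> \<le> 1"
  shows "integrable \<mu> (U_reg \<epsilon>)" "U_reg \<epsilon> x \<le> U x" "(\<integral>x. U_reg \<epsilon> x \<partial>\<mu>) \<le> G"
    "U_reg \<epsilon> \<in> borel_measurable borel"
proof -
  interpret prob_space \<mu> by (rule prob_mu)
  show [measurable]: "U_reg \<epsilon> \<in> borel_measurable borel" unfolding U_reg_def[abs_def] by measurable
  show le: "U_reg \<epsilon> x \<le> U x" for x
    unfolding U_reg_def U_eq
  proof (rule integral_mono_AE[OF g_reg_integrable[OF e] log_kernel_integrable], rule AE_mp[OF AE_mu_neq[of x]], rule AE_I2, rule impI)
    fix z assume "z \<noteq> x" then show "g_reg \<epsilon> x z \<le> log_kernel x z" using g_reg_le_log_kernel[OF e(1), of x z] by simp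
  qed
  define T where "T = (\<integral>z. theta_shift z \<partial>\<mu>)"
  have ge: "- theta_shift x - T \<le> U_reg \<epsilon> x" for x
  proof -
    have "(\<integral>z. - theta_shift x - theta_shift z \<partial>\<mu>) \<le> U_reg \<epsilon> x"
      unfolding U_reg_def using g_reg_ge[OF e] theta_integrable g_reg_integrable[OF e] by (intro integral_mono) auto
    then show ?thesis using theta_integrable by (simp add: T_def prob_space)
  qed
  show int: "integrable \<mu> (U_reg \<epsilon>)"
  proof (rule Bochner_Integration.integrable_bound[of _ "\<lambda>x. theta_shift x + \<bar>T\<bar> + \<bar>U x\<bar>"])
    show "AE x in \<mu>. norm (U_reg \<epsilon> x) \<le> norm (theta_shift x + \<bar>T\<bar> + \<bar>U x\<bar>)"
    proof (rule AE_I2)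
      fix x show "norm (U_reg \<epsilon> x) \<le> norm (theta_shift x + \<bar>T\<bar> + \<bar>U x\<bar>)"
        using ge[of x] le[of x] theta_shift_nonneg[of x] unfolding real_norm_def by linarith
    qed
  qed (use theta_integrable U_integrable in auto)
  show "(\<integral>x. U_reg \<epsilon> x \<partial>\<mu>) \<le> G" unfolding G_def using int U_integrable le by (intro integral_mono) auto
qed

definition pair_energy :: "nat set \<Rightarrow> (nat \<Rightarrow> 'a) \<Rightarrow> real" where
  "pair_energy I x = (\<Sum>i\<in>I. \<Sum>j\<in>I. log_kernel (x i) (x j)) / 2"

lemma regularized_energy_lower_bound:
  assumes I: "finite I" "I \<noteq> {}" and e: "0 < \<epsilon>" "\<epsilon> \<le> 1"
  defines "M \<equiv> real (card I)"
  shows "2 * M * (\<Sum>i\<in>I. U_reg \<epsilon> (x i)) - M\<^sup>2 * (\<integral>y. U_reg \<epsilon> y \<partial>\<mu>) \<le> (\<Sum>i\<in>I. \<Sum>j\<in>I. g_reg \<epsilon> (x i) (x j))"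
proof -
  interpret mu: prob_space \<mu> by (rule prob_mu)
  have M: "0 < M" using I by (simp add: M_def card_gt_0_iff)
  let ?D = "uniform_count_measure I"
  interpret D: prob_space ?D using I by (intro prob_space_uniform_count_measure)
  have xm: "x \<in> measurable ?D borel" by (auto simp: measurable_def sets_uniform_count_measure space_uniform_count_measure)
  define N where "N = distr ?D borel x"
  have pN: "prob_space N" unfolding N_def by (rule D.prob_space_distr[OF xm])
  have sN [measurable_cong]: "sets N = sets borel" by (simp add: N_def)
  have nnN: "(\<integral>\<^sup>+z. ennreal (h z) \<partial>N) = ennreal ((\<Sum>i\<in>I. h (x i)) / M)"
    if [measurable]: "h \<in> borel_measurable borel" and h0: "\<And>z. 0 \<le> h z" for h
  proof -
    have "(\<integral>\<^sup>+z. ennreal (h z) \<partial>N) = (\<integral>\<^sup>+i. ennreal (h (x i)) \<partial>?D)"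
      unfolding N_def by (rule nn_integral_distr[OF xm]) measurable
    also have "\<dots> = (\<Sum>i\<in>I. ennreal (1 / M) * ennreal (h (x i)))"
      unfolding uniform_count_measure_def M_def by (rule nn_integral_point_measure_finite[OF I(1)])
    also have "\<dots> = (\<Sum>i\<in>I. ennreal (h (x i) / M))" using M h0 by (simp add: ennreal_mult[symmetric] mult.commute)
    also have "\<dots> = ennreal ((\<Sum>i\<in>I. h (x i)) / M)" using M h0 by (subst sum_ennreal) (auto simp: sum_divide_distrib)
    finally show ?thesis .
  qed
  define k where "k y z = theta_shift y + theta_shift z - ln (\<epsilon>\<^sup>2 + (norm (y - z))\<^sup>2) / 2" for y z :: 'a
  have kg: "k y z = theta_shift y + theta_shift z + g_reg \<epsilon> y z" for y z by (simp add: k_def g_reg_def)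
  have k0: "0 \<le> k y z" for y z unfolding kg using g_reg_ge[OF e, of y z] by linarith
  have [measurable]: "k y \<in> borel_measurable borel" for y unfolding k_def[abs_def] by measurable
  define T where "T = (\<integral>z. theta_shift z \<partial>\<mu>)"
  have kint: "integrable \<mu> (k y)" for y unfolding kg[abs_def] using theta_integrable g_reg_integrable[OF e] by auto
  have kmu: "(\<integral>\<^sup>+z. ennreal (k y z) \<partial>\<mu>) = ennreal (theta_shift y + T + U_reg \<epsilon> y)" for y
  proof -
    have "(\<integral>\<^sup>+z. ennreal (k y z) \<partial>\<mu>) = ennreal (\<integral>z. k y z \<partial>\<mu>)" using kint k0 by (intro nn_integral_eq_integral) auto
    also have "(\<integral>z. k y z \<partial>\<mu>) = theta_shift y + T + U_reg \<epsilon> y"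
      unfolding kg T_def U_reg_def using theta_integrable g_reg_integrable[OF e] by (simp add: mu.prob_space)
    finally show ?thesis .
  qed
  have P0: "0 \<le> theta_shift y + T + U_reg \<epsilon> y" for y
  proof -
    have "0 \<le> (\<integral>z. k y z \<partial>\<mu>)" using k0 by (intro integral_nonneg_AE) auto
    also have "(\<integral>z. k y z \<partial>\<mu>) = theta_shift y + T + U_reg \<epsilon> y"
      unfolding kg T_def U_reg_def using theta_integrable g_reg_integrable[OF e] by (simp add: mu.prob_space)
    finally show ?thesis .
  qed
  note [measurable] = U_reg_facts(4)[OF e]
  have 1: "(\<integral>\<^sup>+y. (\<integral>\<^sup>+z. ennreal (k y z) \<partial>\<mu>) \<partial>N) = ennreal ((\<Sum>i\<in>I. theta_shift (x i) + T + U_reg \<epsilon> (x i)) / M)"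
    unfolding kmu using P0 by (intro nnN) measurable
  have 2: "(\<integral>\<^sup>+y. (\<integral>\<^sup>+z. ennreal (k y z) \<partial>\<mu>) \<partial>\<mu>) = ennreal (2 * T + (\<integral>y. U_reg \<epsilon> y \<partial>\<mu>))"
  proof -
    have "(\<integral>\<^sup>+y. (\<integral>\<^sup>+z. ennreal (k y z) \<partial>\<mu>) \<partial>\<mu>) = ennreal (\<integral>y. theta_shift y + T + U_reg \<epsilon> y \<partial>\<mu>)"
      unfolding kmu using P0 theta_integrable U_reg_facts(1)[OF e] by (intro nn_integral_eq_integral) auto
    also have "(\<integral>y. theta_shift y + T + U_reg \<epsilon> y \<partial>\<mu>) = 2 * T + (\<integral>y. U_reg \<epsilon> y \<partial>\<mu>)"
      using theta_integrable U_reg_facts(1)[OF e] by (simp add: T_def mu.prob_space)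
    finally show ?thesis .
  qed
  have 3: "(\<integral>\<^sup>+y. (\<integral>\<^sup>+z. ennreal (k y z) \<partial>N) \<partial>N) = ennreal ((\<Sum>i\<in>I. (\<Sum>j\<in>I. k (x i) (x j)) / M) / M)"
  proof -
    have "(\<integral>\<^sup>+z. ennreal (k y z) \<partial>N) = ennreal ((\<Sum>j\<in>I. k y (x j)) / M)" for y by (rule nnN) (use k0 in auto)
    then have "(\<integral>\<^sup>+y. (\<integral>\<^sup>+z. ennreal (k y z) \<partial>N) \<partial>N) = (\<integral>\<^sup>+y. ennreal ((\<Sum>j\<in>I. k y (x j)) / M) \<partial>N)" by simp
    also have "\<dots> = ennreal ((\<Sum>i\<in>I. (\<Sum>j\<in>I. k (x i) (x j)) / M) / M)"
    proof (rule nnN)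
      show "(\<lambda>y. (\<Sum>j\<in>I. k y (x j)) / M) \<in> borel_measurable borel" unfolding k_def by measurable
    qed (use k0 M in \<open>auto intro!: divide_nonneg_pos sum_nonneg\<close>)
    finally show ?thesis .
  qed
  have "2 * (\<integral>\<^sup>+y. (\<integral>\<^sup>+z. ennreal (k y z) \<partial>\<mu>) \<partial>N) \<le> (\<integral>\<^sup>+y. (\<integral>\<^sup>+z. ennreal (k y z) \<partial>N) \<partial>N) + (\<integral>\<^sup>+y. (\<integral>\<^sup>+z. ennreal (k y z) \<partial>\<mu>) \<partial>\<mu>)"
    unfolding k_def
  proof (rule positive_smoothed_energy[OF pN mu.prob_space_axioms sN sets_mu])
    show "(\<integral>\<^sup>+x. ennreal (theta_shift x) \<partial>N) < \<infinity>" by (subst nnN) auto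
    show "(\<integral>\<^sup>+x. ennreal (theta_shift x) \<partial>\<mu>) < \<infinity>" using theta_integrable by (subst nn_integral_eq_integral) auto
  qed (use e in \<open>auto simp: power_le_one\<close>)
  moreover have "0 \<le> (\<Sum>i\<in>I. theta_shift (x i) + T + U_reg \<epsilon> (x i)) / M" "0 \<le> (\<Sum>i\<in>I. (\<Sum>j\<in>I. k (x i) (x j)) / M) / M"
    using P0 k0 M by (auto intro!: divide_nonneg_pos sum_nonneg)
  moreover have "0 \<le> (\<integral>y. theta_shift y + T + U_reg \<epsilon> y \<partial>\<mu>)" using P0 by (intro integral_nonneg_AE) auto
  then have "0 \<le> 2 * T + (\<integral>y. U_reg \<epsilon> y \<partial>\<mu>)" using theta_integrable U_reg_facts(1)[OF e] by (simp add: T_def mu.prob_space)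
  ultimately have A: "2 * ((\<Sum>i\<in>I. theta_shift (x i) + T + U_reg \<epsilon> (x i)) / M) \<le> (\<Sum>i\<in>I. (\<Sum>j\<in>I. k (x i) (x j)) / M) / M + (2 * T + (\<integral>y. U_reg \<epsilon> y \<partial>\<mu>))"
    unfolding 1 2 3 by (simp add: ennreal_mult[symmetric] ennreal_plus[symmetric] ennreal_numeral[symmetric] del: ennreal_plus ennreal_numeral)
  define S where "S = (\<Sum>i\<in>I. theta_shift (x i))"
  define W where "W = (\<Sum>i\<in>I. U_reg \<epsilon> (x i))"
  define Q where "Q = (\<Sum>i\<in>I. \<Sum>j\<in>I. g_reg \<epsilon> (x i) (x j))"
  define H where "H = (\<integral>y. U_reg \<epsilon> y \<partial>\<mu>)"
  have s1: "(\<Sum>i\<in>I. theta_shift (x i) + T + U_reg \<epsilon> (x i)) = S + M * T + W"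
    by (simp add: sum.distrib S_def W_def M_def)
  have s2: "(\<Sum>i\<in>I. (\<Sum>j\<in>I. k (x i) (x j)) / M) = (2 * M * S + Q) / M"
    unfolding sum_divide_distrib[symmetric] kg by (simp add: sum.distrib S_def Q_def M_def sum_distrib_left[symmetric] sum_distrib_right[symmetric] mult.commute)
  have "2 * ((S + M * T + W) / M) * M\<^sup>2 \<le> ((2 * M * S + Q) / M / M + (2 * T + H)) * M\<^sup>2"
    using A unfolding s1 s2 H_def by (rule mult_right_mono) simp
  moreover have "2 * ((S + M * T + W) / M) * M\<^sup>2 = 2 * M * S + 2 * M\<^sup>2 * T + 2 * M * W"
    using M by (simp add: power2_eq_square field_simps)
  moreover have "((2 * M * S + Q) / M / M + (2 * T + H)) * M\<^sup>2 = 2 * M * S + Q + 2 * M\<^sup>2 * T + M\<^sup>2 * H"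
    using M by (simp add: power2_eq_square field_simps)
  ultimately show ?thesis unfolding W_def[symmetric] Q_def[symmetric] H_def[symmetric] by linarith
qed

lemma pair_energy_lower_bound:
  "\<exists>C\<ge>0. \<forall>\<epsilon> I x. 0 < \<epsilon> \<longrightarrow> \<epsilon> \<le> 1 \<longrightarrow> finite I \<longrightarrow> I \<noteq> {} \<longrightarrow> inj_on x I \<longrightarrow>
     - pair_energy I x \<le> real (card I) * (ln (1 / \<epsilon>) / 2) - real (card I) * (\<Sum>i\<in>I. U (x i))
       + (real (card I))\<^sup>2 * (C * sqrt \<epsilon>) + (real (card I))\<^sup>2 * (G / 2)"
proof -
  interpret mu: prob_space \<mu> by (rule prob_mu)
  obtain C where C: "C \<ge> 0" "\<And>x. integrable \<mu> (\<lambda>z. norm (x - z) powr (-1/2))" "\<And>x. (\<integral>z. norm (x - z) powr (-1/2) \<partial>\<mu>) \<le> C"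
    using mu_singular_bound by blast
  have UU: "U x - 2 * C * sqrt \<epsilon> \<le> U_reg \<epsilon> x" if e: "0 < \<epsilon>" "\<epsilon> \<le> 1" for \<epsilon> :: real and x
  proof -
    have "U x - U_reg \<epsilon> x = (\<integral>z. log_kernel x z - g_reg \<epsilon> x z \<partial>\<mu>)"
      unfolding U_eq U_reg_def using log_kernel_integrable g_reg_integrable[OF e] by simp
    also have "\<dots> \<le> (\<integral>z. 2 * sqrt \<epsilon> * norm (x - z) powr (-1/2) \<partial>\<mu>)"
      using log_kernel_integrable g_reg_integrable[OF e] C(2) log_kernel_le_g_reg[OF e, of x] by (intro integral_mono) auto
    also have "\<dots> = 2 * sqrt \<epsilon> * (\<integral>z. norm (x - z) powr (-1/2) \<partial>\<mu>)" by simp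
    also have "\<dots> \<le> 2 * sqrt \<epsilon> * C" using C(3)[of x] e by (intro mult_left_mono) auto
    finally show ?thesis by (simp add: mult_ac)
  qed
  show ?thesis
  proof (intro exI[of _ "2 * C"] conjI allI impI)
    fix \<epsilon> :: real and I :: "nat set" and x :: "nat \<Rightarrow> 'a" assume e: "0 < \<epsilon>" "\<epsilon> \<le> 1" and I: "finite I" "I \<noteq> {}" and inj: "inj_on x I"
    define M where "M = real (card I)"
    have M: "0 \<le> M" by (simp add: M_def)
    have g0: "g_reg \<epsilon> y y = ln (1 / \<epsilon>)" for y using e by (simp add: g_reg_def ln_realpow ln_div)
    have "(\<Sum>i\<in>I. \<Sum>j\<in>I. g_reg \<epsilon> (x i) (x j)) - M * ln (1 / \<epsilon>) = (\<Sum>i\<in>I. \<Sum>j\<in>I. if i = j then 0 else g_reg \<epsilon> (x i) (x j))"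
    proof -
      have "(\<Sum>j\<in>I. g_reg \<epsilon> (x i) (x j)) - ln (1 / \<epsilon>) = (\<Sum>j\<in>I. if i = j then 0 else g_reg \<epsilon> (x i) (x j))" if "i \<in> I" for i
        using that I by (simp add: sum.remove[OF I(1) that] g0)
      then have "(\<Sum>i\<in>I. (\<Sum>j\<in>I. g_reg \<epsilon> (x i) (x j)) - ln (1 / \<epsilon>)) = (\<Sum>i\<in>I. \<Sum>j\<in>I. if i = j then 0 else g_reg \<epsilon> (x i) (x j))"
        by (intro sum.cong) auto
      then show ?thesis by (simp add: sum_subtractf M_def)
    qed
    also have "\<dots> \<le> (\<Sum>i\<in>I. \<Sum>j\<in>I. log_kernel (x i) (x j))"
    proof (intro sum_mono)
      fix i j assume ij: "i \<in> I" "j \<in> I"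
      show "(if i = j then 0 else g_reg \<epsilon> (x i) (x j)) \<le> log_kernel (x i) (x j)"
        using g_reg_le_log_kernel[OF e(1), of "x i" "x j"] inj ij by (auto simp: log_kernel_eq inj_on_def)
    qed
    finally have 1: "(\<Sum>i\<in>I. \<Sum>j\<in>I. g_reg \<epsilon> (x i) (x j)) - M * ln (1 / \<epsilon>) \<le> 2 * pair_energy I x" by (simp add: pair_energy_def)
    have 2: "2 * M * (\<Sum>i\<in>I. U_reg \<epsilon> (x i)) - M\<^sup>2 * (\<integral>y. U_reg \<epsilon> y \<partial>\<mu>) \<le> (\<Sum>i\<in>I. \<Sum>j\<in>I. g_reg \<epsilon> (x i) (x j))"
      unfolding M_def by (rule regularized_energy_lower_bound[OF I e])
    have "(\<Sum>i\<in>I. U (x i) - 2 * C * sqrt \<epsilon>) \<le> (\<Sum>i\<in>I. U_reg \<epsilon> (x i))" by (intro sum_mono UU e)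
    then have "M * ((\<Sum>i\<in>I. U (x i)) - M * (2 * C * sqrt \<epsilon>)) \<le> M * (\<Sum>i\<in>I. U_reg \<epsilon> (x i))"
      using M by (intro mult_left_mono) (auto simp: sum_subtractf M_def)
    moreover have "M\<^sup>2 * (\<integral>y. U_reg \<epsilon> y \<partial>\<mu>) \<le> M\<^sup>2 * G" using U_reg_facts(3)[OF e] by (intro mult_left_mono) auto
    ultimately have "2 * (M * ((\<Sum>i\<in>I. U (x i)) - M * (2 * C * sqrt \<epsilon>))) - M\<^sup>2 * G - M * ln (1 / \<epsilon>) \<le> 2 * pair_energy I x"
      using 1 2 by linarith
    then show "- pair_energy I x \<le> real (card I) * (ln (1 / \<epsilon>) / 2) - real (card I) * (\<Sum>i\<in>I. U (x i))
       + (real (card I))\<^sup>2 * (2 * C * sqrt \<epsilon>) + (real (card I))\<^sup>2 * (G / 2)"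
      unfolding M_def[symmetric] by (simp add: power2_eq_square algebra_simps)
  qed (use C in simp)
qed

end

section \<open>Domination by product measures\<close>

lemma ennreal_exp_integral_le:
  assumes "prob_space M" "integrable M X"
  shows "ennreal (exp (\<integral>x. X x \<partial>M)) \<le> (\<integral>\<^sup>+x. ennreal (exp (X x)) \<partial>M)"
proof (cases "(\<integral>\<^sup>+x. ennreal (exp (X x)) \<partial>M) < \<infinity>")
  case True
  interpret prob_space M by fact
  have [measurable]: "X \<in> borel_measurable M" using assms(2) by simp
  have int: "integrable M (\<lambda>x. exp (X x))" using True by (intro integrableI_nonneg) auto
  let ?c = "\<integral>x. X x \<partial>M"
  have "exp ?c * (1 + X x - ?c) \<le> exp (X x)" for x
  proof -
    have "exp ?c * (1 + (X x - ?c)) \<le> exp ?c * exp (X x - ?c)" by (intro mult_left_mono exp_ge_add_one_self) auto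
    then show ?thesis by (simp add: exp_add[symmetric] algebra_simps)
  qed
  then have "(\<integral>x. exp ?c * (1 + X x - ?c) \<partial>M) \<le> (\<integral>x. exp (X x) \<partial>M)"
    using assms(2) int by (intro integral_mono) auto
  also have "(\<integral>x. exp ?c * (1 + X x - ?c) \<partial>M) = exp ?c" using assms(2) by (simp add: prob_space)
  finally show ?thesis using int by (subst nn_integral_eq_integral) (auto intro: ennreal_leI)
next
  case False
  then have "(\<integral>\<^sup>+x. ennreal (exp (X x)) \<partial>M) = \<infinity>" by (simp add: less_top[symmetric])
  then show ?thesis by simp
qed

lemma product_sigma_finite_lborel: "product_sigma_finite (\<lambda>_::nat. lborel :: 'a::euclidean_space measure)"
  by (simp add: product_sigma_finite_def sigma_finite_lborel)

lemma nn_integral_PiM_insert: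
  fixes f :: "(nat \<Rightarrow> 'a::euclidean_space) \<Rightarrow> ennreal"
  assumes "finite I" "i \<notin> I" "f \<in> borel_measurable (PiM (insert i I) (\<lambda>_. lborel))"
  shows "(\<integral>\<^sup>+x. f x \<partial>PiM (insert i I) (\<lambda>_. lborel)) = (\<integral>\<^sup>+x. (\<integral>\<^sup>+y. f (x(i := y)) \<partial>lborel) \<partial>PiM I (\<lambda>_. lborel))"
  using product_sigma_finite.product_nn_integral_insert[OF product_sigma_finite_lborel assms] .

lemma AE_PiM_inj_on:
  assumes "finite I"
  shows "AE x in PiM I (\<lambda>_. lborel :: 'a::euclidean_space measure). inj_on x (I :: nat set)"
proof -
  have pair: "AE x in PiM I (\<lambda>_. lborel :: 'a measure). x i \<noteq> x j" if ij: "i \<in> I" "j \<in> I" "i \<noteq> j" for i j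
  proof -
    define J where "J = I - {i}"
    have J: "I = insert i J" "i \<notin> J" "finite J" "j \<in> J" using ij assms by (auto simp: J_def)
    let ?u = "\<lambda>x :: nat \<Rightarrow> 'a. indicator {0} (norm (x i - x j)) :: ennreal"
    have [measurable]: "(\<lambda>x. x i) \<in> borel_measurable (PiM (insert i J) (\<lambda>_. lborel :: 'a measure))"
      "(\<lambda>x. x j) \<in> borel_measurable (PiM (insert i J) (\<lambda>_. lborel :: 'a measure))"
      using J measurable_component_singleton[of _ "insert i J" "\<lambda>_. lborel :: 'a measure"] by auto
    have m: "?u \<in> borel_measurable (PiM (insert i J) (\<lambda>_. lborel))" by measurable
    have "(\<integral>\<^sup>+x. ?u x \<partial>PiM (insert i J) (\<lambda>_. lborel)) = (\<integral>\<^sup>+x. (\<integral>\<^sup>+y. ?u (x(i := y)) \<partial>lborel) \<partial>PiM J (\<lambda>_. lborel))"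
      by (rule nn_integral_PiM_insert[OF J(3,2) m])
    also have "\<dots> = (\<integral>\<^sup>+x. (\<integral>\<^sup>+y. 0 \<partial>(lborel :: 'a measure)) \<partial>PiM J (\<lambda>_. lborel :: 'a measure))"
    proof (rule nn_integral_cong, rule nn_integral_cong_AE)
      fix x :: "nat \<Rightarrow> 'a"
      show "AE y in lborel. ?u (x(i := y)) = 0"
        using AE_lborel_singleton[of "x j"] by eventually_elim (use ij in auto)
    qed
    finally have "(\<integral>\<^sup>+x. ?u x \<partial>PiM (insert i J) (\<lambda>_. lborel)) = 0" by simp
    then have "AE x in PiM (insert i J) (\<lambda>_. lborel). ?u x = 0"
      using nn_integral_0_iff_AE[OF m] by blast
    then show ?thesis unfolding J(1)[symmetric] by eventually_elim (auto split: split_indicator_asm)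
  qed
  have "AE x in PiM I (\<lambda>_. lborel :: 'a measure). \<forall>i\<in>I. \<forall>j\<in>I. i \<noteq> j \<longrightarrow> x i \<noteq> x j"
    using assms pair by (intro AE_finite_allI AE_impI) auto
  then show ?thesis by eventually_elim (auto simp: inj_on_def)
qed

context mean_field
begin

abbreviation "\<Lambda> I \<equiv> PiM (I :: nat set) (\<lambda>_. lborel :: 'a measure)"

definition weight :: "real \<Rightarrow> nat set \<Rightarrow> (nat \<Rightarrow> 'a) \<Rightarrow> real" where
  "weight b I x = exp (- b * pair_energy I x - (\<Sum>i\<in>I. V (x i)))"

lemma weight_pos: "0 < weight b I x" by (simp add: weight_def)

lemma component_measurable [measurable (raw)]: "i \<in> I \<Longrightarrow> (\<lambda>x. x i) \<in> borel_measurable (\<Lambda> I)"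
  using measurable_component_singleton[of i I "\<lambda>_. lborel :: 'a measure"] by simp

lemma weight_measurable [measurable]: "weight b I \<in> borel_measurable (\<Lambda> I)"
  unfolding weight_def[abs_def] pair_energy_def by measurable

lemma weight_insert:
  assumes "finite I" "i \<notin> I"
  shows "weight b (insert i I) (x(i := y)) = weight b I x * exp (- V y - b * (\<Sum>j\<in>I. log_kernel y (x j)))"
proof -
  define z where "z = x(i := y)"
  have zi: "z i = y" and e: "\<And>j. j \<in> I \<Longrightarrow> z j = x j" using assms by (auto simp: z_def)
  have "(\<Sum>a\<in>insert i I. \<Sum>c\<in>insert i I. log_kernel (z a) (z c))
    = (log_kernel y y + (\<Sum>c\<in>I. log_kernel y (x c))) + (\<Sum>a\<in>I. log_kernel (x a) y + (\<Sum>c\<in>I. log_kernel (x a) (x c)))"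
    using assms by (simp add: zi e cong: sum.cong)
  also have "\<dots> = 2 * (\<Sum>j\<in>I. log_kernel y (x j)) + (\<Sum>a\<in>I. \<Sum>c\<in>I. log_kernel (x a) (x c))"
    by (simp add: sum.distrib log_kernel_eq norm_minus_commute sum_negf sum_subtractf)
  finally have "pair_energy (insert i I) z = pair_energy I x + (\<Sum>j\<in>I. log_kernel y (x j))"
    unfolding pair_energy_def by simp
  moreover have "(\<Sum>j\<in>insert i I. V (z j)) = V y + (\<Sum>j\<in>I. V (x j))"
    using assms by (simp add: zi e cong: sum.cong)
  ultimately show ?thesis unfolding weight_def z_def[symmetric] by (simp add: exp_add[symmetric] algebra_simps)
qed

lemma tilted_partition_lower_bound:
  assumes "finite I"
  shows "ennreal (L ^ card I * exp (G * (real (card I) * (\<gamma> - c) - b * (real (card I) * (real (card I) - 1) / 2))))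
    \<le> (\<integral>\<^sup>+x. ennreal (weight b I x * exp (- c * (\<Sum>i\<in>I. U (x i)))) \<partial>\<Lambda> I)"
  using assms
proof (induction I arbitrary: c rule: finite_induct)
  case empty
  show ?case by (simp add: PiM_empty nn_integral_count_space_finite weight_def pair_energy_def)
next
  case (insert i I)
  interpret mu: prob_space \<mu> by (rule prob_mu)
  let ?M = "real (card I)"
  have inner: "ennreal (weight b I x * exp (- (c + b) * (\<Sum>i\<in>I. U (x i)))) * ennreal (L * exp ((\<gamma> - c) * G))
    \<le> (\<integral>\<^sup>+y. ennreal (weight b (insert i I) (x(i := y)) * exp (- c * (\<Sum>j\<in>insert i I. U ((x(i := y)) j)))) \<partial>lborel)" for x
  proof -
    define X where "X y = (\<gamma> - c) * U y - b * (\<Sum>j\<in>I. log_kernel (x j) y)" for y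
    have Xi: "integrable \<mu> X" unfolding X_def using U_integrable log_kernel_integrable by auto
    have Xm: "(\<integral>y. X y \<partial>\<mu>) = (\<gamma> - c) * G - b * (\<Sum>j\<in>I. U (x j))"
      unfolding X_def G_def U_eq using U_integrable[unfolded U_eq[abs_def]] log_kernel_integrable by simp
    have [measurable]: "X \<in> borel_measurable borel" unfolding X_def by measurable
    let ?W = "weight b I x * exp (- c * (\<Sum>i\<in>I. U (x i)))"
    have eq: "weight b (insert i I) (x(i := y)) * exp (- c * (\<Sum>j\<in>insert i I. U ((x(i := y)) j)))
       = ?W * (L * (m y * exp (X y)))" for y
    proof -
      have "(\<Sum>j\<in>insert i I. U ((x(i := y)) j)) = U y + (\<Sum>j\<in>I. U (x j))"
        using insert.hyps by (simp cong: sum.cong) (intro sum.cong, auto)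
      moreover have "L * (m y * exp (X y)) = exp (- V y - b * (\<Sum>j\<in>I. log_kernel y (x j))) * exp (- c * U y)"
        unfolding m_def X_def using L_pos
        by (simp add: exp_add[symmetric] algebra_simps log_kernel_sym[of y])
      ultimately show ?thesis unfolding weight_insert[OF insert.hyps]
        by (simp add: exp_add[symmetric] algebra_simps)
    qed
    have "ennreal (weight b I x * exp (- (c + b) * (\<Sum>i\<in>I. U (x i)))) * ennreal (L * exp ((\<gamma> - c) * G))
      = ennreal (?W * L) * ennreal (exp (\<integral>y. X y \<partial>\<mu>))"
      using weight_pos[of b I x] L_pos unfolding Xm
      by (simp add: ennreal_mult[symmetric] exp_add[symmetric] algebra_simps)
    also have "\<dots> \<le> ennreal (?W * L) * (\<integral>\<^sup>+y. ennreal (exp (X y)) \<partial>\<mu>)"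
      by (intro mult_left_mono ennreal_exp_integral_le[OF prob_mu Xi]) simp
    also have "\<dots> = (\<integral>\<^sup>+y. ennreal (?W * L) * (ennreal (m y) * ennreal (exp (X y))) \<partial>lborel)"
      by (subst nn_integral_mu, measurable, subst nn_integral_cmult, measurable)
    also have "\<dots> = (\<integral>\<^sup>+y. ennreal (weight b (insert i I) (x(i := y)) * exp (- c * (\<Sum>j\<in>insert i I. U ((x(i := y)) j)))) \<partial>lborel)"
      unfolding eq using weight_pos[of b I x] L_pos m_pos
      by (intro nn_integral_cong) (simp add: ennreal_mult[symmetric] less_imp_le mult.assoc)
    finally show ?thesis .
  qed
  have "ennreal (L ^ card (insert i I) * exp (G * (real (card (insert i I)) * (\<gamma> - c) - b * (real (card (insert i I)) * (real (card (insert i I)) - 1) / 2))))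
    = ennreal (L ^ card I * exp (G * (?M * (\<gamma> - (c + b)) - b * (?M * (?M - 1) / 2)))) * ennreal (L * exp ((\<gamma> - c) * G))"
  proof -
    have "G * ((1 + ?M) * (\<gamma> - c) - b * ((1 + ?M) * ((1 + ?M) - 1) / 2)) = G * (?M * (\<gamma> - (c + b)) - b * (?M * (?M - 1) / 2)) + (\<gamma> - c) * G"
      by (simp add: field_simps)
    then show ?thesis using insert.hyps L_pos
      by (simp add: ennreal_mult[symmetric] exp_add[symmetric] mult_ac)
  qed
  also have "\<dots> \<le> (\<integral>\<^sup>+x. ennreal (weight b I x * exp (- (c + b) * (\<Sum>i\<in>I. U (x i)))) \<partial>\<Lambda> I) * ennreal (L * exp ((\<gamma> - c) * G))"
    by (intro mult_right_mono insert.IH) simp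
  also have "\<dots> = (\<integral>\<^sup>+x. ennreal (weight b I x * exp (- (c + b) * (\<Sum>i\<in>I. U (x i)))) * ennreal (L * exp ((\<gamma> - c) * G)) \<partial>\<Lambda> I)"
    by (rule nn_integral_multc[symmetric]) measurable
  also have "\<dots> \<le> (\<integral>\<^sup>+x. (\<integral>\<^sup>+y. ennreal (weight b (insert i I) (x(i := y)) * exp (- c * (\<Sum>j\<in>insert i I. U ((x(i := y)) j)))) \<partial>lborel) \<partial>\<Lambda> I)"
    by (intro nn_integral_mono inner)
  also have "\<dots> = (\<integral>\<^sup>+x. ennreal (weight b (insert i I) x * exp (- c * (\<Sum>i\<in>insert i I. U (x i)))) \<partial>\<Lambda> (insert i I))"
    by (rule nn_integral_PiM_insert[symmetric, OF insert.hyps]) measurable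
  finally show ?case .
qed

definition partition_fun :: "real \<Rightarrow> nat set \<Rightarrow> real" where
  "partition_fun b I = (\<integral>x. weight b I x \<partial>\<Lambda> I)"

lemma exp_U_le: "\<exists>C\<ge>0. \<forall>x. exp \<bar>U x\<bar> \<le> C * (1 + norm x)"
proof -
  obtain C where C: "C \<ge> 0" "\<And>x. \<bar>U x\<bar> \<le> C + theta_shift x" using U_bound by blast
  have "exp \<bar>U x\<bar> \<le> exp C * (1 + norm x)" for x
  proof -
    have "exp \<bar>U x\<bar> \<le> exp (C + theta_shift x)" using C(2) by simp
    then show ?thesis by (simp add: exp_add theta_shift_def add_pos_nonneg)
  qed
  then show ?thesis by (intro exI[of _ "exp C"]) auto
qed

lemma nn_integral_prod_PiM:
  assumes "finite I" and [measurable]: "h \<in> borel_measurable borel" and "\<And>y. 0 \<le> h y"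
  shows "(\<integral>\<^sup>+x. ennreal (\<Prod>i\<in>I. h (x i)) \<partial>\<Lambda> I) = (\<integral>\<^sup>+y. ennreal (h y) \<partial>lborel) ^ card I"
proof -
  have "(\<integral>\<^sup>+x. ennreal (\<Prod>i\<in>I. h (x i)) \<partial>\<Lambda> I) = (\<integral>\<^sup>+x. (\<Prod>i\<in>I. ennreal (h (x i))) \<partial>\<Lambda> I)"
    using assms(3) by (simp add: prod_ennreal)
  also have "\<dots> = (\<Prod>i\<in>I. \<integral>\<^sup>+y. ennreal (h y) \<partial>lborel)"
    by (rule product_sigma_finite.product_nn_integral_prod[OF product_sigma_finite_lborel assms(1)]) measurable
  finally show ?thesis by simp
qed

text \<open>The weight is controlled by a product of \<open>m exp ((\<gamma> - b M) U)\<close>, up to a factor \<open>exp (\<eta> M)\<close> with small \<open>\<eta>\<close>;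
  this replaces any finer study of the correlations of the Gibbs measure.\<close>

lemma weight_domination:
  assumes "0 < \<eta>"
  shows "\<exists>\<tau>>0. \<tau> \<le> 1 \<and> (\<forall>I b. finite I \<longrightarrow> I \<noteq> {} \<longrightarrow> 0 < b \<longrightarrow> \<bar>b * real (card I) - \<gamma>\<bar> < \<tau> \<longrightarrow> 1 / real (card I) < \<tau> \<longrightarrow>
    integrable (\<Lambda> I) (weight b I) \<and> 0 < partition_fun b I \<and>
    (AE x in \<Lambda> I. weight b I x \<le> partition_fun b I * exp (\<eta> * real (card I)) *
       (\<Prod>i\<in>I. m (x i) * exp ((\<gamma> - b * real (card I)) * U (x i)))))"
proof -
  obtain C where C: "C \<ge> 0" and PE: "\<And>\<epsilon> I x. 0 < \<epsilon> \<Longrightarrow> \<epsilon> \<le> 1 \<Longrightarrow> finite I \<Longrightarrow> I \<noteq> {} \<Longrightarrow> inj_on x I \<Longrightarrow>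
     - pair_energy I x \<le> real (card I) * (ln (1 / \<epsilon>) / 2) - real (card I) * (\<Sum>i\<in>I. U (x i))
       + (real (card I))\<^sup>2 * (C * sqrt \<epsilon>) + (real (card I))\<^sup>2 * (G / 2)"
    using pair_energy_lower_bound by blast
  obtain CU where CU: "CU \<ge> 0" "\<And>x. exp \<bar>U x\<bar> \<le> CU * (1 + norm x)" using exp_U_le by blast
  define q where "q = min 1 (\<eta> / (4 * ((\<gamma> + 1) * (C + 1))))"
  have q: "0 < q" "q \<le> 1" "(\<gamma> + 1) * C * q \<le> \<eta> / 4"
  proof -
    have p: "0 < (\<gamma> + 1) * (C + 1)" using gamma_nonneg C by (intro mult_pos_pos) auto
    then show "0 < q" "q \<le> 1" using assms by (auto simp: q_def)
    have "(\<gamma> + 1) * C * q \<le> ((\<gamma> + 1) * (C + 1)) * (\<eta> / (4 * ((\<gamma> + 1) * (C + 1))))"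
      using gamma_nonneg C \<open>0 < q\<close> by (intro mult_mono) (auto simp: q_def)
    also have "\<dots> = \<eta> / 4" using p by (simp add: field_simps)
    finally show "(\<gamma> + 1) * C * q \<le> \<eta> / 4" .
  qed
  define \<epsilon> where "\<epsilon> = q\<^sup>2"
  have e: "0 < \<epsilon>" "\<epsilon> \<le> 1" "sqrt \<epsilon> = q" using q by (auto simp: \<epsilon>_def power_le_one)
  define K where "K = (\<gamma> + 1) * (ln (1 / \<epsilon>) + \<bar>G\<bar> + 1)"
  have le0: "0 \<le> ln (1 / \<epsilon>)" using e by simp
  have K: "0 < K" unfolding K_def using gamma_nonneg le0 by (intro mult_pos_pos) auto
  define \<tau> where "\<tau> = min 1 (\<eta> / (4 * K))"
  have t: "0 < \<tau>" "\<tau> \<le> 1" using assms K by (auto simp: \<tau>_def)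
  have tK: "\<tau> * K \<le> \<eta> / 4"
  proof -
    have "\<tau> * K \<le> \<eta> / (4 * K) * K" using K by (intro mult_right_mono) (auto simp: \<tau>_def)
    then show ?thesis using K by simp
  qed
  show ?thesis
  proof (intro exI[of _ \<tau>] conjI t allI impI)
    fix I :: "nat set" and b :: real
    define M where "M = real (card I)"
    assume I: "finite I" "I \<noteq> {}" and b: "0 < b" and "\<bar>b * real (card I) - \<gamma>\<bar> < \<tau>" "1 / real (card I) < \<tau>"
    then have bM: "\<bar>b * M - \<gamma>\<bar> < \<tau>" and M1: "1 / M < \<tau>" by (auto simp: M_def)
    have M: "0 < M" using I by (simp add: M_def card_gt_0_iff)
    have bMle: "b * M \<le> \<gamma> + 1" using bM t by linarith
    have b_le: "b \<le> (\<gamma> + 1) * \<tau>"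
    proof -
      have "b = (b * M) * (1 / M)" using M by simp
      also have "\<dots> \<le> (\<gamma> + 1) * \<tau>" using bMle M1 M b gamma_nonneg by (intro mult_mono) auto
      finally show ?thesis .
    qed
    have d1: "\<bar>\<gamma> - b * M\<bar> \<le> 1" using bM t by linarith
    define h where "h y = m y * exp ((\<gamma> - b * M) * U y)" for y
    have hm [measurable]: "h \<in> borel_measurable borel" unfolding h_def[abs_def] by measurable
    have h0: "0 \<le> h y" for y unfolding h_def using m_pos[of y] by simp
    have hle: "h y \<le> CU * (m y * (1 + norm y) ^ 1)" for y
    proof -
      have "(\<gamma> - b * M) * U y \<le> \<bar>\<gamma> - b * M\<bar> * \<bar>U y\<bar>" by (metis abs_ge_self abs_mult)
      also have "\<dots> \<le> 1 * \<bar>U y\<bar>" using d1 by (intro mult_right_mono) auto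
      finally have "exp ((\<gamma> - b * M) * U y) \<le> CU * (1 + norm y)" using CU(2)[of y] by (intro order_trans[OF _ CU(2)]) simp
      then show ?thesis unfolding h_def using m_pos[of y] by (simp add: mult.left_commute)
    qed
    have hfin: "(\<integral>\<^sup>+y. ennreal (h y) \<partial>lborel) < \<infinity>"
    proof -
      have "(\<integral>\<^sup>+y. ennreal (h y) \<partial>lborel) \<le> (\<integral>\<^sup>+y. ennreal (CU * (m y * (1 + norm y) ^ 1)) \<partial>lborel)"
        by (intro nn_integral_mono ennreal_leI hle)
      also have "\<dots> < \<infinity>" using m_power_integrable[of 1] CU(1) m_pos by (subst nn_integral_eq_integral) (auto simp: less_imp_le)
      finally show ?thesis .
    qed
    define B where "B = exp (b * (M * (ln (1 / \<epsilon>) / 2) + M\<^sup>2 * (C * q) + M\<^sup>2 * (G / 2)))"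
    have prodh: "L ^ card I * (\<Prod>i\<in>I. h (x i)) = exp (- b * M * (\<Sum>i\<in>I. U (x i)) - (\<Sum>i\<in>I. V (x i)))" for x
    proof -
      have "L * h y = exp (- b * M * U y - V y)" for y
        unfolding h_def m_def using L_pos by (simp add: exp_add[symmetric] algebra_simps)
      then have "(\<Prod>i\<in>I. L * h (x i)) = (\<Prod>i\<in>I. exp (- b * M * U (x i) - V (x i)))" by simp
      then show ?thesis using I(1) by (simp add: prod.distrib exp_sum[symmetric] sum_subtractf sum_negf sum_distrib_left)
    qed
    have upper: "weight b I x \<le> B * (L ^ card I * (\<Prod>i\<in>I. h (x i)))" if "inj_on x I" for x
    proof -
      have "b * (- pair_energy I x) \<le> b * (M * (ln (1 / \<epsilon>) / 2) - M * (\<Sum>i\<in>I. U (x i)) + M\<^sup>2 * (C * q) + M\<^sup>2 * (G / 2))"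
        using PE[OF e(1,2) I that] b unfolding M_def[symmetric] e(3) by (intro mult_left_mono) auto
      then have "- b * pair_energy I x - (\<Sum>i\<in>I. V (x i)) \<le> b * (M * (ln (1 / \<epsilon>) / 2) + M\<^sup>2 * (C * q) + M\<^sup>2 * (G / 2))
         + (- b * M * (\<Sum>i\<in>I. U (x i)) - (\<Sum>i\<in>I. V (x i)))" by (simp add: algebra_simps)
      then show ?thesis unfolding prodh weight_def B_def exp_add[symmetric] by simp
    qed
    have AEu: "AE x in \<Lambda> I. weight b I x \<le> B * (L ^ card I * (\<Prod>i\<in>I. h (x i)))"
      using AE_PiM_inj_on[OF I(1)] by eventually_elim (rule upper)
    have wfin: "(\<integral>\<^sup>+x. ennreal (weight b I x) \<partial>\<Lambda> I) < \<infinity>"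
    proof -
      have "(\<integral>\<^sup>+x. ennreal (weight b I x) \<partial>\<Lambda> I) \<le> (\<integral>\<^sup>+x. ennreal (B * L ^ card I) * ennreal (\<Prod>i\<in>I. h (x i)) \<partial>\<Lambda> I)"
        using AEu L_pos h0 by (intro nn_integral_mono_AE) (auto elim!: eventually_mono simp: ennreal_mult[symmetric] B_def prod_nonneg mult.assoc intro!: ennreal_leI)
      also have "\<dots> = ennreal (B * L ^ card I) * (\<integral>\<^sup>+y. ennreal (h y) \<partial>lborel) ^ card I"
        using nn_integral_prod_PiM[OF I(1) hm h0] by (subst nn_integral_cmult) auto
      also have "\<dots> < \<infinity>" using hfin by (simp add: ennreal_mult_less_top power_less_top_ennreal)
      finally show ?thesis .
    qed
    show int: "integrable (\<Lambda> I) (weight b I)"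
      using wfin weight_pos by (intro integrableI_nonneg) (auto simp: less_imp_le)
    have Znn: "(\<integral>\<^sup>+x. ennreal (weight b I x) \<partial>\<Lambda> I) = ennreal (partition_fun b I)"
      unfolding partition_fun_def using int weight_pos by (intro nn_integral_eq_integral) (auto simp: less_imp_le)
    define E where "E = G * (M * \<gamma> - b * (M * (M - 1) / 2))"
    have Z0: "0 \<le> partition_fun b I" unfolding partition_fun_def using weight_pos by (intro integral_nonneg_AE) (auto simp: less_imp_le)
    have "ennreal (L ^ card I * exp E) \<le> ennreal (partition_fun b I)"
      using tilted_partition_lower_bound[OF I(1), of 0 b] unfolding Znn[symmetric] E_def M_def by simp
    then have Zlow: "L ^ card I * exp E \<le> partition_fun b I" using Z0 by simp
    then show "0 < partition_fun b I" using L_pos by (smt (verit) exp_gt_zero mult_pos_pos zero_less_power)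
    have BE: "B \<le> exp (\<eta> * M) * exp E"
    proof -
      have "b * (M * (ln (1 / \<epsilon>) / 2) + M\<^sup>2 * (C * q) + M\<^sup>2 * (G / 2)) - E
        = M * (b * ln (1 / \<epsilon>) / 2 + (b * M) * C * q + (b * M - \<gamma>) * G - b * G / 2)"
        unfolding E_def by (simp add: field_simps power2_eq_square)
      also have "\<dots> \<le> M * \<eta>"
      proof (intro mult_left_mono)
        have 1: "b * ln (1 / \<epsilon>) / 2 - b * G / 2 \<le> \<eta> / 4"
        proof -
          have "b * (ln (1 / \<epsilon>) - G) \<le> b * (ln (1 / \<epsilon>) + \<bar>G\<bar> + 1)" using b by (intro mult_left_mono) auto
          also have "\<dots> \<le> (\<gamma> + 1) * \<tau> * (ln (1 / \<epsilon>) + \<bar>G\<bar> + 1)" using b_le le0 by (intro mult_right_mono) auto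
          also have "\<dots> \<le> \<eta> / 4" using tK by (simp add: K_def mult_ac)
          finally show ?thesis using assms by (simp add: algebra_simps)
        qed
        have 2: "(b * M) * C * q \<le> \<eta> / 4"
        proof -
          have "(b * M) * C * q \<le> (\<gamma> + 1) * C * q" using bMle C q by (intro mult_right_mono) auto
          then show ?thesis using q by linarith
        qed
        have 3: "(b * M - \<gamma>) * G \<le> \<eta> / 4"
        proof -
          have "(b * M - \<gamma>) * G \<le> \<bar>b * M - \<gamma>\<bar> * \<bar>G\<bar>" by (metis abs_ge_self abs_mult)
          also have "\<dots> \<le> \<tau> * K"
          proof (intro mult_mono)
            have "1 * (ln (1 / \<epsilon>) + \<bar>G\<bar> + 1) \<le> K" unfolding K_def using gamma_nonneg le0 by (intro mult_right_mono) auto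
            moreover have "\<bar>G\<bar> \<le> 1 * (ln (1 / \<epsilon>) + \<bar>G\<bar> + 1)" using le0 by simp
            ultimately show "\<bar>G\<bar> \<le> K" by (rule order_trans[rotated])
          qed (use bM t in auto)
          finally show ?thesis using tK by linarith
        qed
        show "b * ln (1 / \<epsilon>) / 2 + (b * M) * C * q + (b * M - \<gamma>) * G - b * G / 2 \<le> \<eta>"
          using 1 2 3 assms by linarith
      qed (use M in simp)
      finally show ?thesis unfolding B_def exp_add[symmetric] by (simp add: algebra_simps)
    qed
    show "AE x in \<Lambda> I. weight b I x \<le> partition_fun b I * exp (\<eta> * real (card I)) *
       (\<Prod>i\<in>I. m (x i) * exp ((\<gamma> - b * real (card I)) * U (x i)))"
      using AEu
    proof eventually_elim
      case (elim x)
      have p0: "0 \<le> (\<Prod>i\<in>I. h (x i))" using h0 by (intro prod_nonneg) auto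
      have "B * L ^ card I \<le> exp (\<eta> * M) * exp E * L ^ card I" using BE L_pos by (intro mult_right_mono) auto
      also have "\<dots> = exp (\<eta> * M) * (L ^ card I * exp E)" by simp
      also have "\<dots> \<le> exp (\<eta> * M) * partition_fun b I" using Zlow by (intro mult_left_mono) auto
      finally have "B * L ^ card I * (\<Prod>i\<in>I. h (x i)) \<le> exp (\<eta> * M) * partition_fun b I * (\<Prod>i\<in>I. h (x i))"
        using p0 by (rule mult_right_mono)
      then show ?case using elim unfolding h_def M_def by (simp add: mult_ac)
    qed
  qed
qed

end

section \<open>Concentration of the potential of the particles\<close>

lemma exp_le_quadratic: "exp a \<le> 1 + a + a\<^sup>2 * exp \<bar>a\<bar>" for a :: real
proof -
  have "1 - a \<le> exp (- a)" using exp_ge_add_one_self[of "- a"] by simp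
  then have "(1 - a) * exp a \<le> exp (- a) * exp a" by (intro mult_right_mono) auto
  then have 1: "exp a \<le> 1 + a + a * (exp a - 1)" by (simp add: exp_add[symmetric] algebra_simps)
  have "a * (exp a - 1) \<le> a\<^sup>2 * exp \<bar>a\<bar>"
  proof (cases "0 \<le> a")
    case True
    have "exp a - 1 \<le> a * exp a" using 1 by (simp add: algebra_simps)
    then have "a * (exp a - 1) \<le> a * (a * exp a)" using True by (intro mult_left_mono) auto
    then show ?thesis using True by (simp add: power2_eq_square)
  next
    case False
    have "1 - exp a \<le> - a" using exp_ge_add_one_self[of a] by linarith
    then have "(- a) * (1 - exp a) \<le> (- a) * (- a)" using False by (intro mult_left_mono) auto
    also have "\<dots> \<le> a\<^sup>2 * exp \<bar>a\<bar>"
      using mult_left_mono[of 1 "exp \<bar>a\<bar>" "a * a"] by (simp add: power2_eq_square)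
    finally show ?thesis by (simp add: algebra_simps)
  qed
  then show ?thesis using 1 by linarith
qed

lemma square_le_2_exp: "0 \<le> t \<Longrightarrow> t\<^sup>2 \<le> 2 * exp t" for t :: real
  using exp_lower_Taylor_quadratic[of t] by simp

lemma abs_exp_minus_one_le:
  fixes s e p :: real
  assumes p: "1 \<le> p" and e: "0 \<le> e" "e \<le> 1"
  shows "\<bar>exp s - 1\<bar> \<le> 2 * e + (1 / p) * (3 * exp (p * (s - e)) + exp (p * (- s - e)))"
proof -
  have am: "exp t \<le> 1 + (1 / p) * exp (p * t)" for t
  proof -
    have "exp t \<le> (1 - 1 / p) + (1 / p) * exp (p * t)"
      using convex_onD[OF exp_convex, of "1 / p" 0 "p * t"] p by simp
    moreover have "0 \<le> 1 / p" using p by simp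
    ultimately show ?thesis by linarith
  qed
  have ee: "exp e \<le> 1 + 2 * e" "exp e \<le> 3" using exp_bound[of e] e power2_eq_square[of e] mult_left_le[of e e] by auto
  have "exp s = exp e * exp (s - e)" by (simp add: exp_add[symmetric])
  also have "\<dots> \<le> exp e * (1 + (1 / p) * exp (p * (s - e)))" by (intro mult_left_mono am) auto
  also have "\<dots> = exp e + exp e * ((1 / p) * exp (p * (s - e)))" by (simp add: algebra_simps)
  also have "\<dots> \<le> (1 + 2 * e) + 3 * ((1 / p) * exp (p * (s - e)))"
    using ee p by (intro add_mono mult_right_mono) auto
  finally have u: "exp s - 1 \<le> 2 * e + (1 / p) * (3 * exp (p * (s - e)))" by simp
  have l: "1 - exp s \<le> 2 * e + (1 / p) * exp (p * (- s - e))"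
  proof (cases "s \<ge> 0")
    case False
    have "- s - e \<le> (1 / p) * exp (p * (- s - e))"
    proof -
      have "p * (- s - e) \<le> exp (p * (- s - e))" using exp_ge_add_one_self[of "p * (- s - e)"] by linarith
      then show ?thesis using p by (simp add: field_simps)
    qed
    moreover have "1 - exp s \<le> - s" using exp_ge_add_one_self[of s] by linarith
    ultimately show ?thesis using e by linarith
  next
    case True
    have "0 \<le> (1 / p) * exp (p * (- s - e))" using p by simp
    moreover have "1 - exp s \<le> 0" using True by simp
    ultimately show ?thesis using e by linarith
  qed
  have "0 \<le> (1 / p) * (3 * exp (p * (s - e)))" "0 \<le> (1 / p) * exp (p * (- s - e))" using p by auto
  then show ?thesis using u l unfolding distrib_left abs_le_iff by linarith
qed

context mean_field
begin

definition \<psi> :: "'a \<Rightarrow> 'a \<Rightarrow> real" where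
  "\<psi> y x = - log_kernel y x - theta_shift y"

lemma psi_measurable [measurable]: "\<psi> y \<in> borel_measurable borel"
  unfolding \<psi>_def[abs_def] by measurable

lemma psi_integrable: "integrable \<mu> (\<psi> y)" "(\<integral>x. \<psi> y x \<partial>\<mu>) = - U y - theta_shift y"
proof -
  interpret mu: prob_space \<mu> by (rule prob_mu)
  show "integrable \<mu> (\<psi> y)" "(\<integral>x. \<psi> y x \<partial>\<mu>) = - U y - theta_shift y"
    unfolding \<psi>_def U_eq using log_kernel_integrable[of y] by (auto simp: mu.prob_space)
qed

lemma exp_half_psi_le: "exp (\<bar>\<psi> y x\<bar> / 2) \<le> (1 + norm x) * (1 + norm (y - x) powr (-1/2))"
proof -
  let ?r = "norm (y - x)"
  have sq: "exp (t / 2) = sqrt (exp t)" for t :: real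
    by (rule real_sqrt_unique[symmetric]) (simp_all add: power2_eq_square exp_add[symmetric])
  have n1: "sqrt (1 + norm x) \<le> 1 + norm x" by (rule real_le_lsqrt) (auto simp: power2_eq_square algebra_simps)
  have p0: "0 \<le> ?r powr (-1/2)" by simp
  have th: "exp (theta_shift z) = 1 + norm z" for z :: 'a by (simp add: theta_shift_def add_pos_nonneg)
  show ?thesis
  proof (cases "x = y")
    case True
    have "\<bar>\<psi> y x\<bar> = theta_shift x" using True theta_shift_nonneg[of x] by (simp add: \<psi>_def log_kernel_eq)
    then show ?thesis using True n1 by (simp add: sq th)
  next
    case False
    then have r: "0 < ?r" by simp
    have psi: "\<psi> y x = ln ?r - theta_shift y" by (simp add: \<psi>_def log_kernel_eq norm_minus_commute)
    have "exp (\<psi> y x) = ?r / (1 + norm y)" using r by (simp add: psi exp_diff th)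
    also have "\<dots> \<le> 1 + norm x"
    proof -
      have "?r \<le> norm y + norm x" by (rule norm_triangle_ineq4)
      also have "\<dots> \<le> (1 + norm x) * (1 + norm y)" by (simp add: algebra_simps)
      finally show ?thesis by (simp add: divide_le_eq add_pos_nonneg)
    qed
    finally have u: "exp (\<psi> y x / 2) \<le> 1 + norm x" unfolding sq using n1 by (meson order_trans real_sqrt_le_mono)
    have "exp (- \<psi> y x) = (1 + norm y) / ?r" using r by (simp add: psi exp_diff th)
    also have "\<dots> \<le> 1 + (1 + norm x) / ?r"
    proof -
      have "norm y \<le> norm x + ?r" using norm_triangle_ineq[of x "y - x"] by simp
      then have "1 + norm y \<le> ?r + (1 + norm x)" by simp
      then have "(1 + norm y) / ?r \<le> (?r + (1 + norm x)) / ?r" by (rule divide_right_mono) simp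
      also have "\<dots> = 1 + (1 + norm x) / ?r" using r by (simp add: add_divide_distrib)
      finally show ?thesis .
    qed
    finally have "exp (- \<psi> y x / 2) \<le> sqrt (1 + (1 + norm x) / ?r)" unfolding sq by simp
    also have "\<dots> \<le> sqrt 1 + sqrt ((1 + norm x) / ?r)" by (intro sqrt_add_le_add_sqrt) auto
    also have "\<dots> = 1 + sqrt (1 + norm x) * ?r powr (-1/2)"
    proof -
      have "?r powr (-1/2) = inverse (sqrt ?r)"
        by (simp only: minus_divide_left[symmetric] powr_minus) (simp add: powr_half_sqrt)
      then show ?thesis by (simp only:) (simp only: divide_inverse real_sqrt_mult real_sqrt_inverse real_sqrt_one)
    qed
    also have "\<dots> \<le> (1 + norm x) + (1 + norm x) * ?r powr (-1/2)"
      using n1 p0 by (intro add_mono mult_right_mono) auto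
    finally have l: "exp (- \<psi> y x / 2) \<le> (1 + norm x) * (1 + ?r powr (-1/2))" by (simp add: algebra_simps)
    have "1 + norm x \<le> (1 + norm x) * (1 + ?r powr (-1/2))" using p0 by (simp add: algebra_simps)
    then have u': "exp (\<psi> y x / 2) \<le> (1 + norm x) * (1 + ?r powr (-1/2))" using u by linarith
    show ?thesis
    proof (cases "0 \<le> \<psi> y x")
      case True then show ?thesis using u' by simp
    next
      case False then show ?thesis using l by simp
    qed
  qed
qed

lemma quadratic_moment_bound:
  "\<exists>D\<ge>0. \<forall>y. (\<integral>\<^sup>+x. ennreal (((U x)\<^sup>2 + (\<psi> y x)\<^sup>2) * exp (\<bar>U x\<bar> + \<bar>\<psi> y x\<bar> / 4)) \<partial>\<mu>) \<le> ennreal D"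
proof -
  obtain C where C: "C \<ge> 0" "\<And>x. exp \<bar>U x\<bar> \<le> C * (1 + norm x)" using exp_U_le by blast
  obtain S where S: "S \<ge> 0" "\<And>x. (\<integral>\<^sup>+z. ennreal (m z * (1 + norm z) ^ 3 * norm (x - z) powr (-1/2)) \<partial>lborel) \<le> ennreal S"
    using m_singular_bound[of 3] by blast
  define K where "K = (\<integral>z. m z * (1 + norm z) ^ 3 \<partial>lborel)"
  have K0: "0 \<le> K" unfolding K_def using m_pos by (intro integral_nonneg_AE) (auto simp: less_imp_le)
  have K: "(\<integral>\<^sup>+z. ennreal (m z * (1 + norm z) ^ 3) \<partial>lborel) = ennreal K"
    unfolding K_def using m_power_integrable[of 3] m_pos by (intro nn_integral_eq_integral) (auto simp: less_imp_le)
  have pt: "m x * (((U x)\<^sup>2 + (\<psi> y x)\<^sup>2) * exp (\<bar>U x\<bar> + \<bar>\<psi> y x\<bar> / 4))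
    \<le> 34 * C\<^sup>2 * (m x * (1 + norm x) ^ 3 + m x * (1 + norm x) ^ 3 * norm (y - x) powr (-1/2))" for x y
  proof -
    let ?a = "\<bar>U x\<bar>" and ?b = "\<bar>\<psi> y x\<bar>"
    have a: "(U x)\<^sup>2 \<le> 2 * exp ?a" using square_le_2_exp[of ?a] by simp
    have b: "(\<psi> y x)\<^sup>2 \<le> 32 * exp (?b / 4)" using square_le_2_exp[of "?b / 4"] by (simp add: power_divide)
    have ab: "exp ?a \<le> exp ?a * exp ?a" "exp (?b / 4) \<le> exp ?a * exp (?b / 4)" "exp ?a \<le> exp ?a * exp (?b / 4)" by auto
    have "(U x)\<^sup>2 + (\<psi> y x)\<^sup>2 \<le> 34 * (exp ?a * exp (?b / 4))" using a b ab by linarith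
    then have "((U x)\<^sup>2 + (\<psi> y x)\<^sup>2) * exp (?a + ?b / 4) \<le> 34 * (exp ?a * exp (?b / 4)) * exp (?a + ?b / 4)"
      by (rule mult_right_mono) simp
    also have "\<dots> = 34 * ((exp ?a)\<^sup>2 * exp (?b / 2))" by (simp add: exp_add[symmetric] power2_eq_square)
    also have "\<dots> \<le> 34 * ((C * (1 + norm x))\<^sup>2 * ((1 + norm x) * (1 + norm (y - x) powr (-1/2))))"
      using C by (intro mult_left_mono mult_mono power_mono exp_half_psi_le) auto
    finally have "m x * (((U x)\<^sup>2 + (\<psi> y x)\<^sup>2) * exp (?a + ?b / 4)) \<le> m x * \<dots>"
      using m_pos[of x] by (intro mult_left_mono) auto
    also have "\<dots> = 34 * C\<^sup>2 * (m x * (1 + norm x) ^ 3 + m x * (1 + norm x) ^ 3 * norm (y - x) powr (-1/2))"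
      by (simp add: power2_eq_square power3_eq_cube algebra_simps)
    finally show ?thesis .
  qed
  have "(\<integral>\<^sup>+x. ennreal (((U x)\<^sup>2 + (\<psi> y x)\<^sup>2) * exp (\<bar>U x\<bar> + \<bar>\<psi> y x\<bar> / 4)) \<partial>\<mu>) \<le> ennreal (34 * C\<^sup>2 * (K + S))" for y
  proof -
    have "(\<integral>\<^sup>+x. ennreal (((U x)\<^sup>2 + (\<psi> y x)\<^sup>2) * exp (\<bar>U x\<bar> + \<bar>\<psi> y x\<bar> / 4)) \<partial>\<mu>)
      = (\<integral>\<^sup>+x. ennreal (m x * (((U x)\<^sup>2 + (\<psi> y x)\<^sup>2) * exp (\<bar>U x\<bar> + \<bar>\<psi> y x\<bar> / 4))) \<partial>lborel)"
      using m_pos by (subst nn_integral_mu) (auto simp: ennreal_mult less_imp_le)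
    also have "\<dots> \<le> (\<integral>\<^sup>+x. ennreal (34 * C\<^sup>2) * (ennreal (m x * (1 + norm x) ^ 3) + ennreal (m x * (1 + norm x) ^ 3 * norm (y - x) powr (-1/2))) \<partial>lborel)"
    proof (intro nn_integral_mono)
      fix x
      have "ennreal (34 * C\<^sup>2) * (ennreal (m x * (1 + norm x) ^ 3) + ennreal (m x * (1 + norm x) ^ 3 * norm (y - x) powr (-1/2)))
        = ennreal (34 * C\<^sup>2 * (m x * (1 + norm x) ^ 3 + m x * (1 + norm x) ^ 3 * norm (y - x) powr (-1/2)))"
        using m_pos[of x] by (subst ennreal_mult, simp, simp, subst ennreal_plus) auto
      then show "ennreal (m x * (((U x)\<^sup>2 + (\<psi> y x)\<^sup>2) * exp (\<bar>U x\<bar> + \<bar>\<psi> y x\<bar> / 4)))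
        \<le> ennreal (34 * C\<^sup>2) * (ennreal (m x * (1 + norm x) ^ 3) + ennreal (m x * (1 + norm x) ^ 3 * norm (y - x) powr (-1/2)))"
        using pt[of x y] by (simp add: ennreal_leI)
    qed
    also have "\<dots> = ennreal (34 * C\<^sup>2) * ((\<integral>\<^sup>+x. ennreal (m x * (1 + norm x) ^ 3) \<partial>lborel) + (\<integral>\<^sup>+x. ennreal (m x * (1 + norm x) ^ 3 * norm (y - x) powr (-1/2)) \<partial>lborel))"
      by (subst nn_integral_cmult, measurable, subst nn_integral_add) measurable
    also have "\<dots> \<le> ennreal (34 * C\<^sup>2) * (ennreal K + ennreal S)"
      unfolding K by (intro mult_left_mono add_left_mono S(2)) auto
    also have "\<dots> = ennreal (34 * C\<^sup>2 * (K + S))" using K0 S(1) by (simp add: ennreal_mult ennreal_plus[symmetric] del: ennreal_plus)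
    finally show ?thesis .
  qed
  then show ?thesis using K0 S(1) by (intro exI[of _ "34 * C\<^sup>2 * (K + S)"]) auto
qed

lemma tilted_moment_bound:
  "\<exists>D\<ge>0. \<forall>y (\<delta>::real) (\<kappa>::real). \<bar>\<delta>\<bar> \<le> 1 \<longrightarrow> \<bar>\<kappa>\<bar> \<le> 1/4 \<longrightarrow>
     (\<integral>\<^sup>+x. ennreal (exp (\<delta> * U x + \<kappa> * \<psi> y x)) \<partial>\<mu>) \<le> ennreal (exp (\<delta> * G + \<kappa> * (- U y - theta_shift y) + 2 * (\<delta>\<^sup>2 + \<kappa>\<^sup>2) * D))"
proof -
  interpret mu: prob_space \<mu> by (rule prob_mu)
  obtain D where D: "D \<ge> 0" "\<And>y. (\<integral>\<^sup>+x. ennreal (((U x)\<^sup>2 + (\<psi> y x)\<^sup>2) * exp (\<bar>U x\<bar> + \<bar>\<psi> y x\<bar> / 4)) \<partial>\<mu>) \<le> ennreal D"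
    using quadratic_moment_bound by blast
  show ?thesis
  proof (intro exI[of _ D] conjI allI impI D(1))
    fix y and \<delta> \<kappa> :: real assume dk: "\<bar>\<delta>\<bar> \<le> 1" "\<bar>\<kappa>\<bar> \<le> 1/4"
    let ?q = "\<lambda>x. ((U x)\<^sup>2 + (\<psi> y x)\<^sup>2) * exp (\<bar>U x\<bar> + \<bar>\<psi> y x\<bar> / 4)"
    have qi: "integrable \<mu> ?q" using D(2)[of y] by (intro integrableI_nonneg) (auto intro: le_less_trans)
    have qD: "(\<integral>x. ?q x \<partial>\<mu>) \<le> D" using D(1) D(2)[of y] qi by (subst (asm) nn_integral_eq_integral) auto
    let ?a = "\<lambda>x. \<delta> * U x + \<kappa> * \<psi> y x"
    let ?s = "2 * (\<delta>\<^sup>2 + \<kappa>\<^sup>2)"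
    have pt: "exp (?a x) \<le> 1 + ?a x + ?s * ?q x" for x
    proof -
      have "(?a x)\<^sup>2 \<le> 2 * ((\<delta> * U x)\<^sup>2 + (\<kappa> * \<psi> y x)\<^sup>2)"
        using sum_squares_bound[of "\<delta> * U x" "\<kappa> * \<psi> y x"] by (simp add: power2_sum)
      also have "\<dots> \<le> 2 * ((\<delta>\<^sup>2 + \<kappa>\<^sup>2) * ((U x)\<^sup>2 + (\<psi> y x)\<^sup>2))" by (simp add: power_mult_distrib algebra_simps)
      finally have 1: "(?a x)\<^sup>2 \<le> ?s * ((U x)\<^sup>2 + (\<psi> y x)\<^sup>2)" by (simp only: mult.assoc)
      have "\<bar>?a x\<bar> \<le> \<bar>\<delta>\<bar> * \<bar>U x\<bar> + \<bar>\<kappa>\<bar> * \<bar>\<psi> y x\<bar>" by (metis abs_mult abs_triangle_ineq)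
      also have "\<dots> \<le> 1 * \<bar>U x\<bar> + 1/4 * \<bar>\<psi> y x\<bar>" using dk by (intro add_mono mult_right_mono) auto
      finally have "exp \<bar>?a x\<bar> \<le> exp (\<bar>U x\<bar> + \<bar>\<psi> y x\<bar> / 4)" by simp
      then have "(?a x)\<^sup>2 * exp \<bar>?a x\<bar> \<le> ?s * ((U x)\<^sup>2 + (\<psi> y x)\<^sup>2) * exp (\<bar>U x\<bar> + \<bar>\<psi> y x\<bar> / 4)"
        using 1 by (intro mult_mono) auto
      then show ?thesis using exp_le_quadratic[of "?a x"] by (simp add: mult.assoc)
    qed
    have ri: "integrable \<mu> (\<lambda>x. 1 + ?a x + ?s * ?q x)"
      using U_integrable psi_integrable(1)[of y] qi by (intro Bochner_Integration.integrable_add integrable_mult_right) auto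
    have "(\<integral>\<^sup>+x. ennreal (exp (?a x)) \<partial>\<mu>) \<le> (\<integral>\<^sup>+x. ennreal (1 + ?a x + ?s * ?q x) \<partial>\<mu>)"
      using pt by (intro nn_integral_mono ennreal_leI)
    also have "\<dots> = ennreal (\<integral>x. 1 + ?a x + ?s * ?q x \<partial>\<mu>)"
      using ri pt by (intro nn_integral_eq_integral) (auto intro: order_trans[OF exp_ge_zero])
    also have "(\<integral>x. 1 + ?a x + ?s * ?q x \<partial>\<mu>) = 1 + (\<delta> * G + \<kappa> * (- U y - theta_shift y)) + ?s * (\<integral>x. ?q x \<partial>\<mu>)"
    proof -
      have "(\<integral>x. 1 + ?a x + ?s * ?q x \<partial>\<mu>) = (\<integral>x. 1 + ?a x \<partial>\<mu>) + (\<integral>x. ?s * ?q x \<partial>\<mu>)"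
        using U_integrable psi_integrable(1)[of y] qi by (intro Bochner_Integration.integral_add integrable_mult_right) auto
      also have "(\<integral>x. 1 + ?a x \<partial>\<mu>) = 1 + (\<delta> * G + \<kappa> * (- U y - theta_shift y))"
        using U_integrable psi_integrable[of y] by (simp add: mu.prob_space G_def)
      also have "(\<integral>x. ?s * ?q x \<partial>\<mu>) = ?s * (\<integral>x. ?q x \<partial>\<mu>)" by (rule integral_mult_right_zero)
      finally show ?thesis .
    qed
    also have "\<dots> \<le> 1 + (\<delta> * G + \<kappa> * (- U y - theta_shift y)) + ?s * D" using qD by (intro add_left_mono mult_left_mono) auto
    also have "\<dots> \<le> exp (\<delta> * G + \<kappa> * (- U y - theta_shift y) + ?s * D)"
      using exp_ge_add_one_self[of "\<delta> * G + \<kappa> * (- U y - theta_shift y) + ?s * D"] by linarith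
    finally show "(\<integral>\<^sup>+x. ennreal (exp (?a x)) \<partial>\<mu>) \<le> ennreal (exp (\<delta> * G + \<kappa> * (- U y - theta_shift y) + ?s * D))"
      by (simp add: ennreal_leI)
  qed
qed

definition gibbs :: "real \<Rightarrow> nat set \<Rightarrow> (nat \<Rightarrow> 'a) measure" where
  "gibbs b I = density (\<Lambda> I) (\<lambda>x. ennreal (weight b I x / partition_fun b I))"

lemma sets_gibbs [measurable_cong]: "sets (gibbs b I) = sets (\<Lambda> I)"
  by (simp add: gibbs_def)

lemma nn_integral_gibbs:
  "f \<in> borel_measurable (\<Lambda> I) \<Longrightarrow> (\<integral>\<^sup>+x. f x \<partial>gibbs b I) = (\<integral>\<^sup>+x. ennreal (weight b I x / partition_fun b I) * f x \<partial>\<Lambda> I)"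
  unfolding gibbs_def by (intro nn_integral_density) auto

lemma gibbs_prod_le:
  assumes I: "finite I" and Z: "0 < partition_fun b I"
    and dom: "AE x in \<Lambda> I. weight b I x \<le> partition_fun b I * exp (\<eta> * real (card I)) *
       (\<Prod>i\<in>I. m (x i) * exp ((\<gamma> - b * real (card I)) * U (x i)))"
    and [measurable]: "h \<in> borel_measurable borel" and h: "\<And>y. 0 \<le> h y"
  shows "(\<integral>\<^sup>+x. ennreal (\<Prod>i\<in>I. h (x i)) \<partial>gibbs b I) \<le>
    (ennreal (exp \<eta>) * (\<integral>\<^sup>+y. ennreal (exp ((\<gamma> - b * real (card I)) * U y) * h y) \<partial>\<mu>)) ^ card I"
proof -
  let ?d = "\<gamma> - b * real (card I)"
  let ?k = "\<lambda>y. m y * exp (?d * U y) * h y"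
  have k0: "0 \<le> ?k y" for y using m_pos[of y] h[of y] by simp
  have km: "?k \<in> borel_measurable borel" by measurable
  have "(\<integral>\<^sup>+x. ennreal (\<Prod>i\<in>I. h (x i)) \<partial>gibbs b I) = (\<integral>\<^sup>+x. ennreal (weight b I x / partition_fun b I) * ennreal (\<Prod>i\<in>I. h (x i)) \<partial>\<Lambda> I)"
    by (rule nn_integral_gibbs) measurable
  also have "\<dots> \<le> (\<integral>\<^sup>+x. ennreal (exp (\<eta> * real (card I))) * ennreal (\<Prod>i\<in>I. ?k (x i)) \<partial>\<Lambda> I)"
  proof (intro nn_integral_mono_AE, use dom in eventually_elim)
    case (elim x)
    have p: "0 \<le> (\<Prod>i\<in>I. h (x i))" using h by (intro prod_nonneg) auto
    have "weight b I x / partition_fun b I \<le> exp (\<eta> * real (card I)) * (\<Prod>i\<in>I. m (x i) * exp (?d * U (x i)))"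
      using elim Z by (simp add: divide_le_eq mult_ac)
    then have "weight b I x / partition_fun b I * (\<Prod>i\<in>I. h (x i)) \<le> exp (\<eta> * real (card I)) * (\<Prod>i\<in>I. m (x i) * exp (?d * U (x i))) * (\<Prod>i\<in>I. h (x i))"
      using p by (rule mult_right_mono)
    also have "\<dots> = exp (\<eta> * real (card I)) * (\<Prod>i\<in>I. ?k (x i))" by (simp add: prod.distrib)
    finally show ?case using p Z weight_pos[of b I x] k0
      by (subst (1 2) ennreal_mult[symmetric]) (auto simp: prod_nonneg less_imp_le intro!: ennreal_leI)
  qed
  also have "\<dots> = ennreal (exp (\<eta> * real (card I))) * (\<integral>\<^sup>+y. ennreal (?k y) \<partial>lborel) ^ card I"
    using nn_integral_prod_PiM[OF I km k0] by (subst nn_integral_cmult) auto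
  also have "ennreal (exp (\<eta> * real (card I))) = ennreal (exp \<eta>) ^ card I"
    by (simp add: ennreal_power exp_of_nat2_mult[symmetric])
  also have "(\<integral>\<^sup>+y. ennreal (?k y) \<partial>lborel) = (\<integral>\<^sup>+y. ennreal (exp (?d * U y) * h y) \<partial>\<mu>)"
    using m_pos h by (subst nn_integral_mu) (auto simp: ennreal_mult[symmetric] less_imp_le mult.assoc)
  finally show ?thesis by (simp add: power_mult_distrib)
qed

text \<open>Exponential moments of order \<open>\<kappa> M\<close> with small fixed \<open>\<kappa>\<close> absorb the factor \<open>exp (\<eta> M)\<close> of the domination
  and force the concentration of \<open>b \<Sum>\<^sub>j log_kernel y (x j)\<close> around \<open>b M U y\<close>, uniformly in \<open>y\<close>.\<close>

lemma concentration:
  assumes "0 < e"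
  shows "\<exists>\<tau>>0. \<tau> \<le> 1 \<and> (\<forall>I b. finite I \<longrightarrow> I \<noteq> {} \<longrightarrow> 0 < b \<longrightarrow> \<bar>b * real (card I) - \<gamma>\<bar> < \<tau> \<longrightarrow> 1 / real (card I) < \<tau> \<longrightarrow>
    integrable (\<Lambda> I) (weight b I) \<and> 0 < partition_fun b I \<and>
    (\<forall>y. (\<integral>\<^sup>+x. ennreal \<bar>exp (- b * (\<Sum>j\<in>I. log_kernel y (x j))) - exp (- b * real (card I) * U y)\<bar> \<partial>gibbs b I)
       \<le> ennreal (e * exp (- b * real (card I) * U y))))"
proof -
  obtain D where D: "D \<ge> 0" and TM: "\<And>y \<delta> \<kappa>. \<bar>\<delta>\<bar> \<le> 1 \<Longrightarrow> \<bar>\<kappa>\<bar> \<le> 1/4 \<Longrightarrow>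
     (\<integral>\<^sup>+x. ennreal (exp (\<delta> * U x + \<kappa> * \<psi> y x)) \<partial>\<mu>) \<le> ennreal (exp (\<delta> * G + \<kappa> * (- U y - theta_shift y) + 2 * (\<delta>\<^sup>2 + \<kappa>\<^sup>2) * D))"
    using tilted_moment_bound by blast
  define a where "a = min 1 (e / 6)"
  have a: "0 < a" "a \<le> 1" "6 * a \<le> e" using assms by (auto simp: a_def)
  define B where "B = \<gamma> + 1"
  have B: "1 \<le> B" using gamma_nonneg by (simp add: B_def)
  define \<kappa> where "\<kappa> = a / (8 * B\<^sup>2 * (D + 1))"
  have \<kappa>: "0 < \<kappa>" unfolding \<kappa>_def using a B D by (intro divide_pos_pos mult_pos_pos) auto
  have \<kappa>B: "\<kappa> * B \<le> 1/4"
  proof -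
    have "\<kappa> * B \<le> \<kappa> * (B * B * (D + 1))" using \<kappa> B D by (intro mult_left_mono) (simp_all add: mult_ge1_I mult_le_cancel_left1 mult.assoc)
    also have "\<dots> = a / 8" unfolding \<kappa>_def using B D by (simp add: power2_eq_square)
    finally show ?thesis using a by linarith
  qed
  have \<kappa>D: "2 * (\<kappa> * B)\<^sup>2 * D \<le> \<kappa> * a / 4"
  proof -
    have "8 * B\<^sup>2 * D * \<kappa> \<le> 8 * B\<^sup>2 * (D + 1) * \<kappa>" using \<kappa> by (intro mult_right_mono mult_left_mono) auto
    also have "\<dots> = a" unfolding \<kappa>_def using B D by simp
    finally have "\<kappa> * (8 * B\<^sup>2 * D * \<kappa>) \<le> \<kappa> * a" using \<kappa> by (intro mult_left_mono) auto
    then show ?thesis by (simp add: power2_eq_square algebra_simps)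
  qed
  define \<eta> where "\<eta> = \<kappa> * a / 4"
  have \<eta>: "0 < \<eta>" using \<kappa> a by (simp add: \<eta>_def)
  obtain \<tau>0 where \<tau>0: "\<tau>0 > 0" "\<tau>0 \<le> 1" and WD: "\<And>I b. finite I \<Longrightarrow> I \<noteq> {} \<Longrightarrow> 0 < b \<Longrightarrow> \<bar>b * real (card I) - \<gamma>\<bar> < \<tau>0 \<Longrightarrow> 1 / real (card I) < \<tau>0 \<Longrightarrow>
    integrable (\<Lambda> I) (weight b I) \<and> 0 < partition_fun b I \<and>
    (AE x in \<Lambda> I. weight b I x \<le> partition_fun b I * exp (\<eta> * real (card I)) *
       (\<Prod>i\<in>I. m (x i) * exp ((\<gamma> - b * real (card I)) * U (x i))))"
    using weight_domination[OF \<eta>] by blast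
  define \<tau> where "\<tau> = min \<tau>0 (min (\<kappa> * a / (4 * (\<bar>G\<bar> + 2 * D + 1))) (\<kappa> * a))"
  have GD: "0 < \<bar>G\<bar> + 2 * D + 1" using D by linarith
  have \<tau>: "0 < \<tau>" "\<tau> \<le> 1" "\<tau> \<le> \<tau>0" "\<tau> \<le> \<kappa> * a" using \<tau>0 \<kappa> a GD by (auto simp: \<tau>_def)
  have \<tau>G: "\<tau> * (\<bar>G\<bar> + 2 * D + 1) \<le> \<kappa> * a / 4"
  proof -
    have "\<tau> * (\<bar>G\<bar> + 2 * D + 1) \<le> \<kappa> * a / (4 * (\<bar>G\<bar> + 2 * D + 1)) * (\<bar>G\<bar> + 2 * D + 1)"
      using GD by (intro mult_right_mono) (auto simp: \<tau>_def)
    also have "\<dots> = \<kappa> * a / 4" using GD by (simp add: field_simps)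
    finally show ?thesis .
  qed
  show ?thesis
  proof (rule exI[of _ \<tau>], intro conjI \<tau>(1,2), intro allI impI)
    fix I :: "nat set" and b :: real
    define M where "M = real (card I)"
    assume I: "finite I" "I \<noteq> {}" and b: "0 < b" and "\<bar>b * real (card I) - \<gamma>\<bar> < \<tau>" "1 / real (card I) < \<tau>"
    then have bM: "\<bar>b * M - \<gamma>\<bar> < \<tau>" and M1: "1 / M < \<tau>" by (auto simp: M_def)
    have M: "0 < M" using I by (simp add: M_def card_gt_0_iff)
    have W: "integrable (\<Lambda> I) (weight b I)" "0 < partition_fun b I"
      "AE x in \<Lambda> I. weight b I x \<le> partition_fun b I * exp (\<eta> * real (card I)) *
       (\<Prod>i\<in>I. m (x i) * exp ((\<gamma> - b * real (card I)) * U (x i)))"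
      using WD[OF I b] bM M1 \<tau> unfolding M_def by auto
    define \<delta> where "\<delta> = \<gamma> - b * M"
    have \<delta>: "\<bar>\<delta>\<bar> < \<tau>" "\<bar>\<delta>\<bar> \<le> 1" using bM \<tau> by (auto simp: \<delta>_def)
    have bMB: "b * M \<le> B" using bM \<tau> by (simp add: B_def)
    define p where "p = \<kappa> * M"
    have p: "1 / p \<le> a" "1 \<le> p"
    proof -
      have "1 / M \<le> \<kappa> * a" using M1 \<tau> by linarith
      then have 1: "1 \<le> a * p" using M by (simp add: p_def field_simps)
      have "a * p \<le> 1 * p" using a \<kappa> M by (intro mult_right_mono) (auto simp: p_def)
      then show "1 \<le> p" using 1 by linarith
      then show "1 / p \<le> a" using 1 by (simp add: divide_le_eq)
    qed
    define k where "k = \<kappa> * (b * M)"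
    have k: "0 \<le> k" "k \<le> \<kappa> * B" using \<kappa> b M bMB by (auto simp: k_def)
    have k2: "2 * k\<^sup>2 * D \<le> \<kappa> * a / 4"
    proof -
      have "k\<^sup>2 \<le> (\<kappa> * B)\<^sup>2" using k by (intro power_mono) auto
      then have "2 * k\<^sup>2 * D \<le> 2 * (\<kappa> * B)\<^sup>2 * D" using D by (intro mult_right_mono) auto
      then show ?thesis using \<kappa>D by linarith
    qed
    have moment: "(\<integral>\<^sup>+x. ennreal (exp (p * (\<sigma> * (b * (\<Sum>j\<in>I. \<psi> y (x j)) - b * M * (- U y - theta_shift y)) - a))) \<partial>gibbs b I) \<le> 1"
      if \<sigma>: "\<sigma> = 1 \<or> \<sigma> = -1" for y and \<sigma> :: real
    proof -
      let ?l = "- U y - theta_shift y"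
      define h where "h z = exp (\<sigma> * k * \<psi> y z - \<sigma> * k * ?l - \<kappa> * a)" for z
      have [measurable]: "h \<in> borel_measurable borel" unfolding h_def[abs_def] by measurable
      have hp: "exp (p * (\<sigma> * (b * (\<Sum>j\<in>I. \<psi> y (x j)) - b * M * ?l) - a)) = (\<Prod>j\<in>I. h (x j))" for x
      proof -
        have "(\<Sum>j\<in>I. \<sigma> * k * \<psi> y (x j) - \<sigma> * k * ?l - \<kappa> * a) = \<sigma> * k * (\<Sum>j\<in>I. \<psi> y (x j)) - M * (\<sigma> * k * ?l) - M * (\<kappa> * a)"
          by (simp add: sum_subtractf sum_distrib_left M_def)
        also have "\<dots> = p * (\<sigma> * (b * (\<Sum>j\<in>I. \<psi> y (x j)) - b * M * ?l) - a)"
          unfolding p_def k_def by (simp add: algebra_simps)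
        finally show ?thesis unfolding h_def using I(1) by (simp add: exp_sum[symmetric])
      qed
      have "(\<integral>\<^sup>+x. ennreal (\<Prod>j\<in>I. h (x j)) \<partial>gibbs b I) \<le>
        (ennreal (exp \<eta>) * (\<integral>\<^sup>+z. ennreal (exp ((\<gamma> - b * real (card I)) * U z) * h z) \<partial>\<mu>)) ^ card I"
        by (rule gibbs_prod_le[OF I(1) W(2,3)]) (auto simp: h_def)
      also have "\<dots> \<le> 1 ^ card I"
      proof (rule power_mono)
        have "(\<integral>\<^sup>+z. ennreal (exp ((\<gamma> - b * real (card I)) * U z) * h z) \<partial>\<mu>)
          = (\<integral>\<^sup>+z. ennreal (exp (- \<sigma> * k * ?l - \<kappa> * a)) * ennreal (exp (\<delta> * U z + (\<sigma> * k) * \<psi> y z)) \<partial>\<mu>)"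
          unfolding h_def \<delta>_def M_def by (intro nn_integral_cong) (simp add: ennreal_mult[symmetric] exp_add[symmetric] algebra_simps)
        also have "\<dots> = ennreal (exp (- \<sigma> * k * ?l - \<kappa> * a)) * (\<integral>\<^sup>+z. ennreal (exp (\<delta> * U z + (\<sigma> * k) * \<psi> y z)) \<partial>\<mu>)"
          by (rule nn_integral_cmult) measurable
        also have "\<dots> \<le> ennreal (exp (- \<sigma> * k * ?l - \<kappa> * a)) * ennreal (exp (\<delta> * G + (\<sigma> * k) * ?l + 2 * (\<delta>\<^sup>2 + (\<sigma> * k)\<^sup>2) * D))"
          using \<delta> k \<kappa>B \<sigma> by (intro mult_left_mono TM) (auto simp: abs_mult)
        also have "\<dots> = ennreal (exp (- \<kappa> * a + \<delta> * G + 2 * (\<delta>\<^sup>2 + k\<^sup>2) * D))"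
          using \<sigma> by (auto simp: ennreal_mult[symmetric] exp_add[symmetric] algebra_simps)
        finally have "ennreal (exp \<eta>) * (\<integral>\<^sup>+z. ennreal (exp ((\<gamma> - b * real (card I)) * U z) * h z) \<partial>\<mu>)
          \<le> ennreal (exp \<eta>) * ennreal (exp (- \<kappa> * a + \<delta> * G + 2 * (\<delta>\<^sup>2 + k\<^sup>2) * D))" by (rule mult_left_mono) simp
        also have "\<dots> = ennreal (exp (\<eta> - \<kappa> * a + \<delta> * G + 2 * (\<delta>\<^sup>2 + k\<^sup>2) * D))"
          by (simp add: ennreal_mult[symmetric] exp_add[symmetric] algebra_simps)
        also have "\<dots> \<le> ennreal (exp 0)"
        proof (intro ennreal_leI, subst exp_le_cancel_iff)
          have "\<delta>\<^sup>2 \<le> \<bar>\<delta>\<bar> * 1" using \<delta> mult_left_mono[of "\<bar>\<delta>\<bar>" 1 "\<bar>\<delta>\<bar>"] by (simp add: power2_eq_square)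
          then have "2 * \<delta>\<^sup>2 * D \<le> 2 * \<bar>\<delta>\<bar> * D" using D by (intro mult_right_mono) auto
          moreover have "\<delta> * G \<le> \<bar>\<delta>\<bar> * \<bar>G\<bar>" by (metis abs_ge_self abs_mult)
          moreover have "\<bar>\<delta>\<bar> * (\<bar>G\<bar> + 2 * D) \<le> \<tau> * (\<bar>G\<bar> + 2 * D + 1)" using \<delta> D \<tau> by (intro mult_mono) auto
          ultimately have "\<delta> * G + 2 * \<delta>\<^sup>2 * D \<le> \<kappa> * a / 4" using \<tau>G by (simp add: algebra_simps)
          moreover have "2 * (\<delta>\<^sup>2 + k\<^sup>2) * D = 2 * \<delta>\<^sup>2 * D + 2 * k\<^sup>2 * D" by (simp add: algebra_simps)
          moreover have "0 < \<kappa> * a" using \<kappa> a by simp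
          ultimately show "\<eta> - \<kappa> * a + \<delta> * G + 2 * (\<delta>\<^sup>2 + k\<^sup>2) * D \<le> 0" using k2 unfolding \<eta>_def by linarith
        qed
        finally show "ennreal (exp \<eta>) * (\<integral>\<^sup>+z. ennreal (exp ((\<gamma> - b * real (card I)) * U z) * h z) \<partial>\<mu>) \<le> 1" by simp
      qed simp
      finally show ?thesis unfolding hp by simp
    qed
    show "integrable (\<Lambda> I) (weight b I) \<and> 0 < partition_fun b I \<and>
      (\<forall>y. (\<integral>\<^sup>+x. ennreal \<bar>exp (- b * (\<Sum>j\<in>I. log_kernel y (x j))) - exp (- b * real (card I) * U y)\<bar> \<partial>gibbs b I)
       \<le> ennreal (e * exp (- b * real (card I) * U y)))"
    proof (intro conjI W(1,2) allI)
      fix y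
      let ?l = "- U y - theta_shift y"
      define s where "s x = b * (\<Sum>j\<in>I. \<psi> y (x j)) - b * M * ?l" for x
      have [measurable]: "s \<in> borel_measurable (\<Lambda> I)" unfolding s_def[abs_def] by measurable
      let ?c = "exp (- b * M * U y)"
      have eq: "\<bar>exp (- b * (\<Sum>j\<in>I. log_kernel y (x j))) - ?c\<bar> = ?c * \<bar>exp (s x) - 1\<bar>" for x
      proof -
        have "- b * (\<Sum>j\<in>I. log_kernel y (x j)) = - b * M * U y + s x"
          unfolding s_def \<psi>_def by (simp add: sum_subtractf sum_negf M_def algebra_simps)
        then have "exp (- b * (\<Sum>j\<in>I. log_kernel y (x j))) - ?c = ?c * (exp (s x) - 1)"
          by (simp only: exp_add right_diff_distrib mult_1_right)
        then show ?thesis by (simp add: abs_mult)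
      qed
      have ga: "(\<integral>\<^sup>+x. ennreal a \<partial>gibbs b I) = ennreal a"
      proof -
        have "emeasure (gibbs b I) (space (gibbs b I)) = (\<integral>\<^sup>+x. 1 \<partial>gibbs b I)" by simp
        also have "\<dots> = (\<integral>\<^sup>+x. ennreal (weight b I x / partition_fun b I) \<partial>\<Lambda> I)"
          by (subst nn_integral_gibbs) auto
        also have "\<dots> = ennreal (\<integral>x. weight b I x / partition_fun b I \<partial>\<Lambda> I)"
          using W(1,2) weight_pos by (intro nn_integral_eq_integral) (auto simp: less_imp_le)
        also have "(\<integral>x. weight b I x / partition_fun b I \<partial>\<Lambda> I) = 1"
          using W(2) by (simp add: partition_fun_def)
        finally show ?thesis by simp
      qed
      have pt: "ennreal \<bar>exp (s x) - 1\<bar> \<le> 2 * ennreal a + ennreal a * (3 * ennreal (exp (p * (1 * s x - a))) + ennreal (exp (p * (-1 * s x - a))))" for x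
      proof -
        let ?u = "exp (p * (s x - a))" and ?v = "exp (p * (- s x - a))"
        have "\<bar>exp (s x) - 1\<bar> \<le> 2 * a + 1 / p * (3 * ?u + ?v)"
          using a p by (intro abs_exp_minus_one_le) auto
        also have "\<dots> \<le> 2 * a + a * (3 * ?u + ?v)" using p by (intro add_left_mono mult_right_mono) auto
        finally have "ennreal \<bar>exp (s x) - 1\<bar> \<le> ennreal (2 * a + a * (3 * ?u + ?v))" by (rule ennreal_leI)
        also have "\<dots> = 2 * ennreal a + ennreal a * (3 * ennreal ?u + ennreal ?v)"
          using a by (simp add: ennreal_plus ennreal_mult del: ennreal_plus[symmetric])
        finally show ?thesis by simp
      qed
      have "(\<integral>\<^sup>+x. ennreal \<bar>exp (s x) - 1\<bar> \<partial>gibbs b I)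
        \<le> (\<integral>\<^sup>+x. 2 * ennreal a + ennreal a * (3 * ennreal (exp (p * (1 * s x - a))) + ennreal (exp (p * (-1 * s x - a)))) \<partial>gibbs b I)"
        by (intro nn_integral_mono pt)
      also have "\<dots> = (\<integral>\<^sup>+x. 2 * ennreal a \<partial>gibbs b I) + ennreal a * (3 * (\<integral>\<^sup>+x. ennreal (exp (p * (1 * s x - a))) \<partial>gibbs b I) + (\<integral>\<^sup>+x. ennreal (exp (p * (-1 * s x - a))) \<partial>gibbs b I))"
        by (subst nn_integral_add, measurable, subst nn_integral_cmult, measurable, subst nn_integral_add, measurable, subst nn_integral_cmult, measurable)
      also have "(\<integral>\<^sup>+x. 2 * ennreal a \<partial>gibbs b I) = 2 * ennreal a" using ga by (subst nn_integral_cmult) auto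
      also have "2 * ennreal a + ennreal a * (3 * (\<integral>\<^sup>+x. ennreal (exp (p * (1 * s x - a))) \<partial>gibbs b I) + (\<integral>\<^sup>+x. ennreal (exp (p * (-1 * s x - a))) \<partial>gibbs b I))
        \<le> 2 * ennreal a + ennreal a * (3 * 1 + 1)"
        unfolding s_def by (intro add_left_mono mult_left_mono add_mono moment) auto
      also have "\<dots> = ennreal (6 * a)"
      proof -
        have "(2 + 4) * ennreal a = 2 * ennreal a + 4 * ennreal a" by (rule distrib_right)
        then show ?thesis using a by (simp add: ennreal_mult mult.commute)
      qed
      also have "\<dots> \<le> ennreal e" using a by (intro ennreal_leI)
      finally have "ennreal ?c * (\<integral>\<^sup>+x. ennreal \<bar>exp (s x) - 1\<bar> \<partial>gibbs b I) \<le> ennreal ?c * ennreal e" by (rule mult_left_mono) simp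
      moreover have "(\<integral>\<^sup>+x. ennreal \<bar>exp (- b * (\<Sum>j\<in>I. log_kernel y (x j))) - ?c\<bar> \<partial>gibbs b I) = ennreal ?c * (\<integral>\<^sup>+x. ennreal \<bar>exp (s x) - 1\<bar> \<partial>gibbs b I)"
        unfolding eq by (subst nn_integral_cmult[symmetric]) (auto simp: ennreal_mult)
      ultimately show "(\<integral>\<^sup>+x. ennreal \<bar>exp (- b * (\<Sum>j\<in>I. log_kernel y (x j))) - exp (- b * real (card I) * U y)\<bar> \<partial>gibbs b I)
       \<le> ennreal (e * exp (- b * real (card I) * U y))"
        using assms unfolding M_def[symmetric] by (simp add: ennreal_mult mult.commute)
    qed
  qed
qed

end

section \<open>Poisson approximation\<close>

lemma has_real_derivative_prod_one_minus:
  fixes a :: "'i \<Rightarrow> real"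
  shows "((\<lambda>s. \<Prod>j\<in>J. (1 - s * a j)) has_real_derivative - (\<Sum>i\<in>J. a i * (\<Prod>j\<in>J - {i}. (1 - s * a j)))) (at s)"
proof -
  have "((\<lambda>s. \<Prod>j\<in>J. (1 - s * a j)) has_real_derivative (\<Sum>i\<in>J. - a i * (\<Prod>j\<in>J - {i}. (1 - s * a j)))) (at s)"
    by (rule has_field_derivative_prod) (auto intro!: derivative_eq_intros)
  then show ?thesis by (simp add: sum_negf)
qed

lemma prod_one_minus_expand:
  fixes a :: "'i \<Rightarrow> real"
  assumes "finite J"
  shows "(\<Prod>j\<in>J. (1 - s * a j)) = (\<Sum>B\<in>Pow J. (- s) ^ card B * (\<Prod>j\<in>B. a j))"
proof -
  have "(\<Prod>j\<in>J. (1 - s * a j)) = (\<Prod>j\<in>J. (- s * a j + 1))" by simp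
  also have "\<dots> = (\<Sum>B\<in>Pow J. (\<Prod>j\<in>B. - s * a j) * (\<Prod>j\<in>J - B. 1))" by (rule prod_add[OF assms])
  finally show ?thesis by (simp only: prod.distrib prod_constant power_one mult_1_right)
qed

lemma ratio_estimate:
  fixes r \<Lambda> q A k e x :: real
  assumes A: "0 < A" and k: "0 \<le> k" and e: "0 \<le> e" "e \<le> 1/2" and q: "0 \<le> q" "q \<le> 1"
    and r: "\<bar>r - A\<bar> \<le> e * A" and L: "\<bar>r * \<Lambda> - q * A\<bar> \<le> e * A + k" and x: "\<bar>r * x - q * k\<bar> \<le> e * k"
  shows "\<bar>x - \<Lambda> * (k / A)\<bar> \<le> 4 * e * (k / A) + 2 * (k / A)\<^sup>2"
proof -
  have "e * A \<le> (1/2) * A" using A e by (intro mult_right_mono) auto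
  then have rA: "A / 2 \<le> r" using r by linarith
  then have r0: "0 < r" using A by linarith
  define t where "t = k / A"
  have t: "0 \<le> t" "k = t * A" using A k by (auto simp: t_def)
  have "r * (x - \<Lambda> * t) = (r * x - q * k) - t * (r * \<Lambda> - q * A)" unfolding t(2) by (simp add: algebra_simps)
  then have "\<bar>r * (x - \<Lambda> * t)\<bar> \<le> \<bar>r * x - q * k\<bar> + \<bar>t * (r * \<Lambda> - q * A)\<bar>" by linarith
  also have "\<dots> \<le> e * k + t * (e * A + k)" using x L t(1) by (auto simp: abs_mult intro!: add_mono mult_left_mono)
  also have "\<dots> = (4 * e * t + 2 * t\<^sup>2) * (A / 2)" unfolding t(2) by (simp add: power2_eq_square field_simps)
  also have "\<dots> \<le> (4 * e * t + 2 * t\<^sup>2) * r" using rA t(1) e by (intro mult_left_mono) auto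
  finally have "r * \<bar>x - \<Lambda> * t\<bar> \<le> r * (4 * e * t + 2 * t\<^sup>2)" using r0 by (simp add: abs_mult mult.commute)
  then show ?thesis using r0 unfolding t_def[symmetric] by simp
qed

context mean_field
begin

text \<open>Up to normalization, the density of a particle added to particles distributed like \<open>\<mu>\<close>
  with \<open>\<kappa> = b M\<close>.\<close>
definition tilt :: "real \<Rightarrow> 'a \<Rightarrow> real" where
  "tilt \<kappa> y = exp (- V y - \<kappa> * U y)"

lemma tilt_measurable [measurable]: "tilt \<kappa> \<in> borel_measurable borel"
  unfolding tilt_def[abs_def] by measurable

lemma tilt_pos: "0 < tilt \<kappa> y" by (simp add: tilt_def)

lemma tilt_le: "\<exists>C\<ge>0. \<forall>\<kappa> y. \<bar>\<kappa> - \<gamma>\<bar> \<le> 1 \<longrightarrow> tilt \<kappa> y \<le> C * (m y * (1 + norm y))"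
proof -
  obtain C where C: "C \<ge> 0" "\<And>x. exp \<bar>U x\<bar> \<le> C * (1 + norm x)" using exp_U_le by blast
  have "tilt \<kappa> y \<le> L * C * (m y * (1 + norm y))" if "\<bar>\<kappa> - \<gamma>\<bar> \<le> 1" for \<kappa> y
  proof -
    have "tilt \<kappa> y = L * m y * exp ((\<gamma> - \<kappa>) * U y)"
      unfolding tilt_def m_def using L_pos by (simp add: exp_add[symmetric] algebra_simps)
    moreover have "(\<gamma> - \<kappa>) * U y \<le> \<bar>U y\<bar>"
    proof -
      have "(\<gamma> - \<kappa>) * U y \<le> \<bar>\<gamma> - \<kappa>\<bar> * \<bar>U y\<bar>" by (metis abs_ge_self abs_mult)
      also have "\<dots> \<le> 1 * \<bar>U y\<bar>" using that by (intro mult_right_mono) auto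
      finally show ?thesis by simp
    qed
    then have "exp ((\<gamma> - \<kappa>) * U y) \<le> C * (1 + norm y)" by (intro order_trans[OF _ C(2)]) simp
    then have "L * m y * exp ((\<gamma> - \<kappa>) * U y) \<le> L * m y * (C * (1 + norm y))"
      using L_pos m_pos[of y] by (intro mult_left_mono) auto
    ultimately show ?thesis by (simp add: mult_ac)
  qed
  then show ?thesis using C L_pos by (intro exI[of _ "L * C"]) auto
qed

lemma tilt_integrable:
  assumes "\<bar>\<kappa> - \<gamma>\<bar> \<le> 1" and [measurable]: "v \<in> borel_measurable borel" and v: "\<And>y. 0 \<le> v y" "\<And>y. v y \<le> 1"
  shows "integrable lborel (\<lambda>y. v y * tilt \<kappa> y)"
proof -
  obtain C where C: "C \<ge> 0" "\<And>y. tilt \<kappa> y \<le> C * (m y * (1 + norm y))" using tilt_le assms(1) by blast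
  show ?thesis
  proof (rule Bochner_Integration.integrable_bound[of _ "\<lambda>y. C * (m y * (1 + norm y) ^ 1)"])
    show "integrable lborel (\<lambda>y. C * (m y * (1 + norm y) ^ 1))" using m_power_integrable[of 1] by simp
    show "AE y in lborel. norm (v y * tilt \<kappa> y) \<le> norm (C * (m y * (1 + norm y) ^ 1))"
    proof (rule AE_I2)
      fix y
      have "v y * tilt \<kappa> y \<le> 1 * tilt \<kappa> y" using v tilt_pos[of \<kappa> y] by (intro mult_right_mono) auto
      also have "\<dots> \<le> C * (m y * (1 + norm y) ^ 1)" using C(2)[of y] by simp
      finally show "norm (v y * tilt \<kappa> y) \<le> norm (C * (m y * (1 + norm y) ^ 1))"
        using v(1)[of y] tilt_pos[of \<kappa> y] unfolding real_norm_def by (simp only: abs_of_nonneg mult_nonneg_nonneg less_imp_le order_trans[OF _ abs_ge_self])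
    qed
  qed measurable
qed

definition good :: "real \<Rightarrow> real \<Rightarrow> nat set \<Rightarrow> bool" where
  "good e b I \<longleftrightarrow> finite I \<and> integrable (\<Lambda> I) (weight b I) \<and> 0 < partition_fun b I \<and>
    (\<forall>y. (\<integral>\<^sup>+x. ennreal \<bar>exp (- b * (\<Sum>j\<in>I. log_kernel y (x j))) - exp (- b * real (card I) * U y)\<bar> \<partial>gibbs b I)
       \<le> ennreal (e * exp (- b * real (card I) * U y)))"

lemma prob_gibbs:
  assumes "integrable (\<Lambda> I) (weight b I)" "0 < partition_fun b I"
  shows "prob_space (gibbs b I)"
proof
  have "emeasure (gibbs b I) (space (gibbs b I)) = (\<integral>\<^sup>+x. 1 \<partial>gibbs b I)" by simp
  also have "\<dots> = (\<integral>\<^sup>+x. ennreal (weight b I x / partition_fun b I) \<partial>\<Lambda> I)"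
    by (subst nn_integral_gibbs) auto
  also have "\<dots> = ennreal (\<integral>x. weight b I x / partition_fun b I \<partial>\<Lambda> I)"
    using assms weight_pos by (intro nn_integral_eq_integral) (auto simp: less_imp_le)
  also have "(\<integral>x. weight b I x / partition_fun b I \<partial>\<Lambda> I) = 1"
    using assms(2) by (simp add: partition_fun_def)
  finally show "emeasure (gibbs b I) (space (gibbs b I)) = 1" by simp
qed

lemma prod_one_minus_bounds:
  assumes "\<And>y. 0 \<le> u y" "\<And>y. u y \<le> (1::real)" "0 \<le> s" "s \<le> 1"
  shows "0 \<le> (\<Prod>j\<in>I. (1 - s * u (x j)))" "(\<Prod>j\<in>I. (1 - s * u (x j))) \<le> 1"
proof -
  have "0 \<le> 1 - s * u y \<and> 1 - s * u y \<le> 1" for y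
    using mult_mono[of s 1 "u y" 1] assms by auto
  then show "0 \<le> (\<Prod>j\<in>I. (1 - s * u (x j)))" "(\<Prod>j\<in>I. (1 - s * u (x j))) \<le> 1"
    by (auto intro!: prod_nonneg prod_le_1)
qed

lemma insert_particle:
  assumes gd: "good e b I" and e: "0 \<le> e" and k: "\<bar>b * real (card I) - \<gamma>\<bar> \<le> 1" and i: "i \<notin> I"
    and J: "integrable (\<Lambda> (insert i I)) (weight b (insert i I))"
    and Q [measurable]: "Q \<in> borel_measurable (\<Lambda> I)" and Q01: "\<And>x. 0 \<le> Q x" "\<And>x. Q x \<le> 1"
    and Qi: "\<And>x y. Q (x(i := y)) = Q x" and QJ [measurable]: "Q \<in> borel_measurable (\<Lambda> (insert i I))"
    and v [measurable]: "v \<in> borel_measurable borel" and v01: "\<And>y. 0 \<le> v y" "\<And>y. v y \<le> 1"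
  defines "K \<equiv> (\<integral>y. v y * tilt (b * real (card I)) y \<partial>lborel)"
  shows "\<bar>(\<integral>x. weight b (insert i I) x * (v (x i) * Q x) \<partial>\<Lambda> (insert i I)) / partition_fun b I - (\<integral>x. Q x \<partial>gibbs b I) * K\<bar> \<le> e * K"
proof -
  define Z where "Z = partition_fun b I"
  have I: "finite I" and wI: "integrable (\<Lambda> I) (weight b I)" and Z: "0 < Z"
    and conc: "\<And>y. (\<integral>\<^sup>+x. ennreal \<bar>exp (- b * (\<Sum>j\<in>I. log_kernel y (x j))) - exp (- b * real (card I) * U y)\<bar> \<partial>gibbs b I)
       \<le> ennreal (e * exp (- b * real (card I) * U y))"
    using gd by (auto simp: good_def Z_def)
  interpret Gb: prob_space "gibbs b I" using prob_gibbs[OF wI] Z by (simp add: Z_def)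
  interpret pair_sigma_finite "gibbs b I" "lborel :: 'a measure" ..
  define c where "c y = exp (- b * real (card I) * U y)" for y
  define W where "W y x = exp (- b * (\<Sum>j\<in>I. log_kernel y (x j)))" for y :: 'a and x :: "nat \<Rightarrow> 'a"
  define q where "q = (\<integral>x. Q x \<partial>gibbs b I)"
  have [measurable]: "(\<lambda>(x, y). W y x) \<in> borel_measurable (gibbs b I \<Otimes>\<^sub>M lborel)" "W y \<in> borel_measurable (gibbs b I)" for y
    unfolding W_def[abs_def] by measurable
  have Qint: "integrable (gibbs b I) Q" using Q01 by (intro Gb.integrable_const_bound[of _ 1]) auto
  have q: "(\<integral>\<^sup>+x. ennreal (Q x) \<partial>gibbs b I) = ennreal q" unfolding q_def using Qint Q01 by (intro nn_integral_eq_integral) auto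
  have q0: "0 \<le> q" unfolding q_def using Q01 by (intro integral_nonneg_AE) auto
  let ?T = "\<integral>\<^sup>+x. ennreal (weight b (insert i I) x * (v (x i) * Q x)) \<partial>\<Lambda> (insert i I)"
  have Kint: "integrable lborel (\<lambda>y. v y * tilt (b * real (card I)) y)" by (rule tilt_integrable[OF k v v01])
  have Knn: "(\<integral>\<^sup>+y. ennreal (v y * exp (- V y)) * ennreal (c y) \<partial>lborel) = ennreal K"
  proof -
    have "(\<integral>\<^sup>+y. ennreal (v y * exp (- V y)) * ennreal (c y) \<partial>lborel) = (\<integral>\<^sup>+y. ennreal (v y * tilt (b * real (card I)) y) \<partial>lborel)"
      using v01 by (intro nn_integral_cong) (simp add: ennreal_mult[symmetric] c_def tilt_def exp_add[symmetric] mult.assoc)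
    also have "\<dots> = ennreal K" unfolding K_def using Kint v01 tilt_pos by (intro nn_integral_eq_integral) (auto simp: less_imp_le)
    finally show ?thesis .
  qed
  have K0: "0 \<le> K" unfolding K_def using v01 tilt_pos by (intro integral_nonneg_AE) (auto simp: less_imp_le)
  have T: "?T = ennreal Z * (\<integral>\<^sup>+y. ennreal (v y * exp (- V y)) * (\<integral>\<^sup>+x. ennreal (Q x * W y x) \<partial>gibbs b I) \<partial>lborel)"
  proof -
    have "?T = (\<integral>\<^sup>+x. (\<integral>\<^sup>+y. ennreal (weight b (insert i I) (x(i := y)) * (v ((x(i := y)) i) * Q (x(i := y)))) \<partial>lborel) \<partial>\<Lambda> I)"
      by (rule nn_integral_PiM_insert[OF I i]) measurable
    also have "\<dots> = (\<integral>\<^sup>+x. ennreal (weight b I x / Z) * (\<integral>\<^sup>+y. ennreal Z * (ennreal (v y * exp (- V y)) * ennreal (Q x * W y x)) \<partial>lborel) \<partial>\<Lambda> I)"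
    proof (intro nn_integral_cong)
      fix x assume x: "x \<in> space (\<Lambda> I)"
      have [measurable]: "(\<lambda>y. W y x) \<in> borel_measurable borel" unfolding W_def by measurable
      show "(\<integral>\<^sup>+y. ennreal (weight b (insert i I) (x(i := y)) * (v ((x(i := y)) i) * Q (x(i := y)))) \<partial>lborel)
        = ennreal (weight b I x / Z) * (\<integral>\<^sup>+y. ennreal Z * (ennreal (v y * exp (- V y)) * ennreal (Q x * W y x)) \<partial>lborel)"
        unfolding weight_insert[OF I i] Qi using v01 Q01 Z weight_pos[of b I x]
        by (subst nn_integral_cmult[symmetric], measurable)
          (auto intro!: nn_integral_cong simp: ennreal_mult[symmetric] less_imp_le W_def exp_diff exp_minus exp_add field_simps)
    qed
    also have "\<dots> = (\<integral>\<^sup>+x. (\<integral>\<^sup>+y. ennreal Z * (ennreal (v y * exp (- V y)) * ennreal (Q x * W y x)) \<partial>lborel) \<partial>gibbs b I)"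
      unfolding Z_def by (rule nn_integral_gibbs[symmetric]) (unfold W_def, measurable)
    also have "\<dots> = (\<integral>\<^sup>+y. (\<integral>\<^sup>+x. ennreal Z * (ennreal (v y * exp (- V y)) * ennreal (Q x * W y x)) \<partial>gibbs b I) \<partial>lborel)"
      by (rule Fubini'[symmetric]) measurable
    also have "\<dots> = (\<integral>\<^sup>+y. ennreal Z * (ennreal (v y * exp (- V y)) * (\<integral>\<^sup>+x. ennreal (Q x * W y x) \<partial>gibbs b I)) \<partial>lborel)"
      by (intro nn_integral_cong) (simp add: nn_integral_cmult)
    also have "\<dots> = ennreal Z * (\<integral>\<^sup>+y. ennreal (v y * exp (- V y)) * (\<integral>\<^sup>+x. ennreal (Q x * W y x) \<partial>gibbs b I) \<partial>lborel)"
      by (rule nn_integral_cmult) measurable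
    finally show ?thesis .
  qed
  have Qd: "Q x * d \<le> \<bar>d\<bar>" for x d
  proof -
    have "Q x * d \<le> Q x * \<bar>d\<bar>" using Q01(1)[of x] by (intro mult_left_mono) auto
    also have "\<dots> \<le> 1 * \<bar>d\<bar>" using Q01(2)[of x] by (intro mult_right_mono) auto
    finally show ?thesis by simp
  qed
  have QWu: "(\<integral>\<^sup>+x. ennreal (Q x * W y x) \<partial>gibbs b I) \<le> ennreal ((q + e) * c y)" for y
  proof -
    have "(\<integral>\<^sup>+x. ennreal (Q x * W y x) \<partial>gibbs b I) \<le> (\<integral>\<^sup>+x. ennreal (c y) * ennreal (Q x) + ennreal \<bar>W y x - c y\<bar> \<partial>gibbs b I)"
    proof (intro nn_integral_mono)
      fix x
      have "Q x * (W y x - c y) \<le> \<bar>W y x - c y\<bar>" by (rule Qd)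
      then have "Q x * W y x \<le> c y * Q x + \<bar>W y x - c y\<bar>" by (simp add: algebra_simps)
      then show "ennreal (Q x * W y x) \<le> ennreal (c y) * ennreal (Q x) + ennreal \<bar>W y x - c y\<bar>"
        using Q01[of x] by (simp add: ennreal_mult[symmetric] ennreal_plus[symmetric] c_def ennreal_leI del: ennreal_plus)
    qed
    also have "\<dots> = ennreal (c y) * ennreal q + (\<integral>\<^sup>+x. ennreal \<bar>W y x - c y\<bar> \<partial>gibbs b I)"
      by (subst nn_integral_add, measurable, subst nn_integral_cmult, measurable) (simp add: q)
    also have "\<dots> \<le> ennreal (c y) * ennreal q + ennreal (e * c y)"
      using conc[of y] unfolding W_def c_def by (intro add_left_mono)
    also have "\<dots> = ennreal ((q + e) * c y)"
      using q0 e by (simp add: ennreal_mult[symmetric] ennreal_plus[symmetric] c_def algebra_simps del: ennreal_plus)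
    finally show ?thesis .
  qed
  have QWl: "ennreal (q * c y) \<le> (\<integral>\<^sup>+x. ennreal (Q x * W y x) \<partial>gibbs b I) + ennreal (e * c y)" for y
  proof -
    have "ennreal (q * c y) = (\<integral>\<^sup>+x. ennreal (c y) * ennreal (Q x) \<partial>gibbs b I)"
      by (subst nn_integral_cmult, measurable) (simp add: q ennreal_mult[symmetric] q0 c_def mult.commute)
    also have "\<dots> \<le> (\<integral>\<^sup>+x. ennreal (Q x * W y x) + ennreal \<bar>W y x - c y\<bar> \<partial>gibbs b I)"
    proof (intro nn_integral_mono)
      fix x
      have "Q x * (c y - W y x) \<le> \<bar>W y x - c y\<bar>" using Qd[of x "c y - W y x"] by (simp add: abs_minus_commute)
      then have "c y * Q x \<le> Q x * W y x + \<bar>W y x - c y\<bar>" by (simp add: algebra_simps)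
      then show "ennreal (c y) * ennreal (Q x) \<le> ennreal (Q x * W y x) + ennreal \<bar>W y x - c y\<bar>"
        using Q01[of x] by (simp add: ennreal_mult[symmetric] ennreal_plus[symmetric] c_def W_def ennreal_leI del: ennreal_plus)
    qed
    also have "\<dots> = (\<integral>\<^sup>+x. ennreal (Q x * W y x) \<partial>gibbs b I) + (\<integral>\<^sup>+x. ennreal \<bar>W y x - c y\<bar> \<partial>gibbs b I)"
      by (rule nn_integral_add) measurable
    also have "\<dots> \<le> (\<integral>\<^sup>+x. ennreal (Q x * W y x) \<partial>gibbs b I) + ennreal (e * c y)"
      using conc[of y] unfolding W_def c_def by (intro add_left_mono)
    finally show ?thesis .
  qed
  define R where "R = (\<integral>\<^sup>+y. ennreal (v y * exp (- V y)) * (\<integral>\<^sup>+x. ennreal (Q x * W y x) \<partial>gibbs b I) \<partial>lborel)"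
  have Kc: "(\<integral>\<^sup>+y. ennreal (v y * exp (- V y)) * ennreal (a * c y) \<partial>lborel) = ennreal (a * K)" if "0 \<le> a" for a
  proof -
    have "(\<integral>\<^sup>+y. ennreal (v y * exp (- V y)) * ennreal (a * c y) \<partial>lborel) = (\<integral>\<^sup>+y. ennreal a * (ennreal (v y * exp (- V y)) * ennreal (c y)) \<partial>lborel)"
      using that by (intro nn_integral_cong) (simp add: ennreal_mult c_def mult_ac)
    also have "\<dots> = ennreal a * ennreal K" unfolding Knn[symmetric] c_def by (rule nn_integral_cmult) measurable
    finally show ?thesis using that K0 by (simp add: ennreal_mult)
  qed
  have Ru: "R \<le> ennreal ((q + e) * K)"
  proof -
    have "R \<le> (\<integral>\<^sup>+y. ennreal (v y * exp (- V y)) * ennreal ((q + e) * c y) \<partial>lborel)"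
      unfolding R_def by (intro nn_integral_mono mult_left_mono QWu) simp
    then show ?thesis using Kc[of "q + e"] q0 e by simp
  qed
  have Rl: "ennreal (q * K) \<le> R + ennreal (e * K)"
  proof -
    have "ennreal (q * K) = (\<integral>\<^sup>+y. ennreal (v y * exp (- V y)) * ennreal (q * c y) \<partial>lborel)" using Kc[OF q0] by simp
    also have "\<dots> \<le> (\<integral>\<^sup>+y. ennreal (v y * exp (- V y)) * ((\<integral>\<^sup>+x. ennreal (Q x * W y x) \<partial>gibbs b I) + ennreal (e * c y)) \<partial>lborel)"
      by (intro nn_integral_mono mult_left_mono QWl) simp
    also have "\<dots> = R + (\<integral>\<^sup>+y. ennreal (v y * exp (- V y)) * ennreal (e * c y) \<partial>lborel)"
      unfolding R_def distrib_left c_def by (rule nn_integral_add) measurable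
    finally show ?thesis using Kc[OF e] by simp
  qed
  let ?t = "\<integral>x. weight b (insert i I) x * (v (x i) * Q x) \<partial>\<Lambda> (insert i I)"
  have nn: "0 \<le> weight b (insert i I) x * (v (x i) * Q x)" for x using weight_pos[of b "insert i I" x] v01 Q01 by simp
  have "integrable (\<Lambda> (insert i I)) (\<lambda>x. weight b (insert i I) x * (v (x i) * Q x))"
  proof (rule Bochner_Integration.integrable_bound[OF J])
    show "AE x in \<Lambda> (insert i I). norm (weight b (insert i I) x * (v (x i) * Q x)) \<le> norm (weight b (insert i I) x)"
    proof (rule AE_I2)
      fix x
      have "v (x i) * Q x \<le> 1" using v01 Q01 by (intro mult_le_one) auto
      then have "weight b (insert i I) x * (v (x i) * Q x) \<le> weight b (insert i I) x"
        using weight_pos[of b "insert i I" x] by (simp add: mult_left_le)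
      then show "norm (weight b (insert i I) x * (v (x i) * Q x)) \<le> norm (weight b (insert i I) x)"
        using nn[of x] by simp
    qed
  qed measurable
  then have "ennreal ?t = ennreal Z * R" unfolding R_def T[symmetric] using nn by (intro nn_integral_eq_integral[symmetric]) auto
  moreover have "R < \<infinity>" using Ru by (auto intro: le_less_trans)
  then obtain \<rho> where \<rho>: "R = ennreal \<rho>" "0 \<le> \<rho>" by (cases R) auto
  ultimately have "?t = Z * \<rho>" using Z nn by (simp add: ennreal_mult[symmetric])
  then have "?t / partition_fun b I = \<rho>" using Z by (simp add: Z_def)
  moreover have "\<rho> \<le> (q + e) * K" using Ru q0 e K0 \<rho> by simp
  moreover have "q * K \<le> \<rho> + e * K" using Rl \<rho> e K0 by (simp add: ennreal_plus[symmetric] del: ennreal_plus)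
  ultimately show ?thesis unfolding q_def[symmetric] by (simp add: abs_le_iff algebra_simps)
qed

lemma prod_component_measurable:
  fixes u :: "'a \<Rightarrow> real"
  assumes "S \<subseteq> J" and [measurable]: "u \<in> borel_measurable borel"
  shows "(\<lambda>x. \<Prod>j\<in>S. (1 - s * u (x j))) \<in> borel_measurable (\<Lambda> J)"
proof (rule borel_measurable_prod)
  fix j assume "j \<in> S"
  then have [measurable]: "(\<lambda>x. x j) \<in> borel_measurable (\<Lambda> J)" using assms(1) by (intro component_measurable) auto
  show "(\<lambda>x. 1 - s * u (x j)) \<in> borel_measurable (\<Lambda> J)" by measurable
qed

lemma laplace_estimate:
  fixes u :: "'a \<Rightarrow> real"
  assumes J: "finite J" "card J = N" "1 \<le> N"
    and gdJ: "integrable (\<Lambda> J) (weight b J)" "0 < partition_fun b J"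
    and gd: "\<And>i. i \<in> J \<Longrightarrow> good e b (J - {i})"
    and e: "0 \<le> e" "e \<le> 1/2" and \<kappa>: "\<bar>b * (real N - 1) - \<gamma>\<bar> \<le> 1"
    and u [measurable]: "u \<in> borel_measurable borel" and u01: "\<And>y. 0 \<le> u y" "\<And>y. u y \<le> 1"
  defines "lam \<equiv> real N * ((\<integral>y. u y * tilt (b * (real N - 1)) y \<partial>lborel) / (\<integral>y. tilt (b * (real N - 1)) y \<partial>lborel))"
  shows "\<bar>(\<integral>x. (\<Prod>j\<in>J. (1 - u (x j))) \<partial>gibbs b J) - exp (- lam)\<bar> \<le> 4 * e * lam + 2 * lam\<^sup>2 / real N"
proof -
  define t where "t = b * (real N - 1)"
  define A where "A = (\<integral>y. tilt t y \<partial>lborel)"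
  define k where "k = (\<integral>y. u y * tilt t y \<partial>lborel)"
  have t: "\<bar>t - \<gamma>\<bar> \<le> 1" using \<kappa> by (simp add: t_def)
  have Ai: "integrable lborel (tilt t)" using tilt_integrable[OF t, of "\<lambda>_. 1"] by simp
  have ki: "integrable lborel (\<lambda>y. u y * tilt t y)" by (rule tilt_integrable[OF t u u01])
  have k0: "0 \<le> k" unfolding k_def using u01 tilt_pos by (intro integral_nonneg_AE) (auto simp: less_imp_le)
  have A0: "0 < A"
  proof -
    have "A \<noteq> 0"
    proof
      assume "A = 0"
      then have "AE x in lborel. tilt t x = 0" using Ai tilt_pos unfolding A_def
        by (subst (asm) integral_nonneg_eq_0_iff_AE) (auto simp: less_imp_le)
      then have "AE x in (lborel :: 'a measure). False" by eventually_elim (use tilt_pos in \<open>auto simp: less_le\<close>)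
      then have "emeasure (lborel :: 'a measure) UNIV = 0"
        by (subst (asm) AE_iff_measurable[of UNIV]) auto
      then show False by simp
    qed
    moreover have "0 \<le> A" unfolding A_def using tilt_pos by (intro integral_nonneg_AE) (auto simp: less_imp_le)
    ultimately show ?thesis by simp
  qed
  have lam: "lam = real N * (k / A)" by (simp add: lam_def k_def A_def t_def)
  have lam0: "0 \<le> lam" using k0 A0 by (simp add: lam)
  define ZJ where "ZJ = partition_fun b J"
  have ZJ: "0 < ZJ" using gdJ by (simp add: ZJ_def)
  interpret GJ: prob_space "gibbs b J" by (rule prob_gibbs[OF gdJ])
  have gi: "(\<integral>x. F x \<partial>gibbs b J) = (\<integral>x. weight b J x * F x \<partial>\<Lambda> J) / ZJ" if [measurable]: "F \<in> borel_measurable (\<Lambda> J)" for F :: "(nat \<Rightarrow> 'a) \<Rightarrow> real"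
  proof -
    have "(\<integral>x. F x \<partial>gibbs b J) = (\<integral>x. (weight b J x / ZJ) *\<^sub>R F x \<partial>\<Lambda> J)"
      unfolding gibbs_def ZJ_def[symmetric] using ZJ weight_pos by (intro integral_density) (auto simp: less_imp_le)
    then show ?thesis by (simp add: divide_inverse mult_ac flip: integral_mult_right_zero)
  qed
  have bint: "integrable (gibbs b J) F" if [measurable]: "F \<in> borel_measurable (\<Lambda> J)" and "\<And>x. \<bar>F x\<bar> \<le> 1" for F :: "(nat \<Rightarrow> 'a) \<Rightarrow> real"
    using that(2) by (intro GJ.integrable_const_bound[of _ 1]) auto
  define P where "P S s x = (\<Prod>j\<in>S. (1 - s * u (x j)))" for S s and x :: "nat \<Rightarrow> 'a"
  have Pm [measurable]: "P S s \<in> borel_measurable (\<Lambda> T)" if "S \<subseteq> T" for S T s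
    unfolding P_def[abs_def] by (rule prod_component_measurable[OF that u])
  have P01: "0 \<le> P S s x" "P S s x \<le> 1" if "0 \<le> s" "s \<le> 1" for S s x
    unfolding P_def by (rule prod_one_minus_bounds[where u = u, OF u01 that])+
  define Lam where "Lam s = (\<integral>x. P J s x \<partial>gibbs b J)" for s
  define E where "E i s = (\<integral>x. u (x i) * P (J - {i}) s x \<partial>gibbs b J)" for i s
  have pair: "\<bar>E i s - Lam s * (k / A)\<bar> \<le> 4 * e * (k / A) + 2 * (k / A)\<^sup>2" if i: "i \<in> J" and s: "0 \<le> s" "s \<le> 1" for i s
  proof -
    define I where "I = J - {i}"
    have JI: "J = insert i I" "i \<notin> I" "finite I" using i J by (auto simp: I_def)
    have cI: "real (card I) = real N - 1" using i J by (simp add: I_def of_nat_diff)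
    have gI: "good e b I" using gd[OF i] by (simp add: I_def)
    define ZI where "ZI = partition_fun b I"
    have ZI: "0 < ZI" using gI by (simp add: good_def ZI_def)
    interpret GI: prob_space "gibbs b I" using gI by (intro prob_gibbs) (auto simp: good_def)
    have tI: "b * real (card I) = t" by (simp add: cI t_def)
    have Pup: "P I s (x(i := y)) = P I s x" for x y
      unfolding P_def using JI(2) by (intro prod.cong) auto
    have ins: "\<bar>(\<integral>x. weight b J x * (v (x i) * Q x) \<partial>\<Lambda> J) / ZI - (\<integral>x. Q x \<partial>gibbs b I) * (\<integral>y. v y * tilt t y \<partial>lborel)\<bar> \<le> e * (\<integral>y. v y * tilt t y \<partial>lborel)"
      if "Q \<in> borel_measurable (\<Lambda> I)" "Q \<in> borel_measurable (\<Lambda> J)" "\<And>x. 0 \<le> Q x" "\<And>x. Q x \<le> 1" "\<And>x y. Q (x(i := y)) = Q x"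
         "v \<in> borel_measurable borel" "\<And>y. 0 \<le> v y" "\<And>y. v y \<le> 1" for Q v
      using insert_particle[OF gI e(1) _ JI(2) gdJ(1)[unfolded JI(1)] that(1,3,4,5) that(2)[unfolded JI(1)] that(6,7,8)] t
      unfolding tI ZI_def[symmetric] JI(1)[symmetric] by blast
    have PI [measurable]: "P I s \<in> borel_measurable (\<Lambda> I)" "P I s \<in> borel_measurable (\<Lambda> J)" using JI by (auto intro!: Pm)
    define q where "q = (\<integral>x. P I s x \<partial>gibbs b I)"
    define r where "r = ZJ / ZI"
    have q: "0 \<le> q" "q \<le> 1"
    proof -
      show "0 \<le> q" unfolding q_def using P01[OF s] by (intro integral_nonneg_AE) auto
      have "q \<le> (\<integral>x. 1 \<partial>gibbs b I)" unfolding q_def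
        using P01[OF s] by (intro integral_mono GI.integrable_const_bound[of _ 1]) auto
      then show "q \<le> 1" by (simp add: GI.prob_space)
    qed
    have r: "\<bar>r - A\<bar> \<le> e * A"
    proof -
      have "\<bar>(\<integral>x. weight b J x * (1 * 1) \<partial>\<Lambda> J) / ZI - (\<integral>x. 1 \<partial>gibbs b I) * (\<integral>y. 1 * tilt t y \<partial>lborel)\<bar> \<le> e * (\<integral>y. 1 * tilt t y \<partial>lborel)"
        by (rule ins) auto
      moreover have "(\<integral>x. 1 \<partial>gibbs b I) = (1::real)" by (simp add: GI.prob_space)
      ultimately show ?thesis unfolding r_def ZJ_def partition_fun_def A_def by (simp only: mult_1_left mult_1_right)
    qed
    have RE: "r * E i s = (\<integral>x. weight b J x * (u (x i) * P I s x) \<partial>\<Lambda> J) / ZI"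
      unfolding r_def E_def I_def[symmetric] using ZJ i by (subst gi) auto
    have x: "\<bar>r * E i s - q * k\<bar> \<le> e * k"
      unfolding RE q_def k_def by (rule ins[OF PI P01[OF s] Pup u u01])
    have PJ: "P J s x = (1 - s * u (x i)) * P I s x" for x unfolding P_def JI(1) using JI by simp
    define v where "v y = 1 - s * u y" for y
    have v01: "0 \<le> v y" "v y \<le> 1" for y using mult_mono[of s 1 "u y" 1] u01[of y] s by (auto simp: v_def)
    have [measurable]: "v \<in> borel_measurable borel" unfolding v_def by measurable
    have RL: "r * Lam s = (\<integral>x. weight b J x * (v (x i) * P I s x) \<partial>\<Lambda> J) / ZI"
      unfolding r_def Lam_def v_def PJ using ZJ i by (subst gi) auto
    have kv: "(\<integral>y. v y * tilt t y \<partial>lborel) = A - s * k"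
    proof -
      have "v y * tilt t y = tilt t y - s * (u y * tilt t y)" for y by (simp add: v_def algebra_simps)
      then show ?thesis using Ai ki by (simp add: A_def k_def)
    qed
    have vb: "\<bar>r * Lam s - q * (A - s * k)\<bar> \<le> e * (A - s * k)"
      unfolding RL q_def kv[symmetric] by (rule ins[OF PI P01[OF s] Pup _ v01]) measurable
    have sk: "0 \<le> s * k" "0 \<le> e * (s * k)" "q * (s * k) \<le> k" "0 \<le> q * (s * k)"
      using s k0 e q mult_mono[of "q * s" 1 k k] mult_mono[of q 1 s 1] by (auto simp: mult.assoc)
    have Lb: "\<bar>r * Lam s - q * A\<bar> \<le> e * A + k"
      using vb sk unfolding right_diff_distrib abs_le_iff by linarith
    show ?thesis by (rule ratio_estimate[OF A0 k0 e q r Lb x])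
  qed
  define g where "g = real N * (4 * e * (k / A) + 2 * (k / A)\<^sup>2)"
  have sumE: "\<bar>(\<Sum>i\<in>J. E i s) - lam * Lam s\<bar> \<le> g" if s: "0 \<le> s" "s \<le> 1" for s
  proof -
    have "(\<Sum>i\<in>J. E i s) - lam * Lam s = (\<Sum>i\<in>J. E i s - Lam s * (k / A))"
      by (simp add: sum_subtractf lam J(2))
    also have "\<bar>\<dots>\<bar> \<le> (\<Sum>i\<in>J. \<bar>E i s - Lam s * (k / A)\<bar>)" by (rule sum_abs)
    also have "\<dots> \<le> (\<Sum>i\<in>J. 4 * e * (k / A) + 2 * (k / A)\<^sup>2)" by (intro sum_mono pair s)
    finally show ?thesis by (simp add: g_def J(2))
  qed
  have deriv: "(Lam has_real_derivative - (\<Sum>i\<in>J. E i s)) (at s)" if s: "0 \<le> s" "s \<le> 1" for s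
  proof -
    define pu where "pu B x = (\<Prod>j\<in>B. u (x j))" for B and x :: "nat \<Rightarrow> 'a"
    have pum [measurable]: "pu B \<in> borel_measurable (\<Lambda> J)" if "B \<subseteq> J" for B
      unfolding pu_def
    proof (rule borel_measurable_prod)
      fix j assume "j \<in> B"
      then have [measurable]: "(\<lambda>x. x j) \<in> borel_measurable (\<Lambda> J)" using that by (intro component_measurable) auto
      show "(\<lambda>x. u (x j)) \<in> borel_measurable (\<Lambda> J)" by measurable
    qed
    have pui: "integrable (gibbs b J) (pu B)" if "B \<in> Pow J" for B
    proof (rule bint)
      show "\<bar>pu B x\<bar> \<le> 1" for x unfolding pu_def abs_prod using u01 by (intro prod_le_1) auto
    qed (use that in auto)
    define d where "d B s = (- 1) * (real (card B) * (- s) ^ (card B - Suc 0))" for B :: "nat set" and s :: real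
    have Dd: "((\<lambda>s. (- s) ^ card B * c) has_real_derivative d B s * c) (at s)" for B and c s :: real
      unfolding d_def by (auto intro!: derivative_eq_intros)
    have "Lam = (\<lambda>s. \<Sum>B\<in>Pow J. (- s) ^ card B * (\<integral>x. pu B x \<partial>gibbs b J))"
    proof
      fix s show "Lam s = (\<Sum>B\<in>Pow J. (- s) ^ card B * (\<integral>x. pu B x \<partial>gibbs b J))"
        unfolding Lam_def P_def prod_one_minus_expand[OF J(1)] pu_def[symmetric]
        using pui by (subst Bochner_Integration.integral_sum) auto
    qed
    moreover have "((\<lambda>s. \<Sum>B\<in>Pow J. (- s) ^ card B * (\<integral>x. pu B x \<partial>gibbs b J)) has_real_derivative (\<Sum>B\<in>Pow J. d B s * (\<integral>x. pu B x \<partial>gibbs b J))) (at s)"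
      by (intro DERIV_sum Dd)
    moreover have "(\<Sum>B\<in>Pow J. d B s * (\<integral>x. pu B x \<partial>gibbs b J)) = - (\<Sum>i\<in>J. E i s)"
    proof -
      have "(\<Sum>B\<in>Pow J. d B s * (\<integral>x. pu B x \<partial>gibbs b J)) = (\<integral>x. (\<Sum>B\<in>Pow J. d B s * pu B x) \<partial>gibbs b J)"
        using pui by (subst Bochner_Integration.integral_sum) auto
      also have "\<dots> = (\<integral>x. - (\<Sum>i\<in>J. u (x i) * P (J - {i}) s x) \<partial>gibbs b J)"
      proof (intro Bochner_Integration.integral_cong refl)
        fix x
        have "((\<lambda>s. \<Sum>B\<in>Pow J. (- s) ^ card B * pu B x) has_real_derivative (\<Sum>B\<in>Pow J. d B s * pu B x)) (at s)"
          by (intro DERIV_sum Dd)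
        then have "((\<lambda>s. P J s x) has_real_derivative (\<Sum>B\<in>Pow J. d B s * pu B x)) (at s)"
          unfolding P_def prod_one_minus_expand[OF J(1)] pu_def .
        moreover have "((\<lambda>s. P J s x) has_real_derivative - (\<Sum>i\<in>J. u (x i) * P (J - {i}) s x)) (at s)"
          unfolding P_def by (rule has_real_derivative_prod_one_minus)
        ultimately show "(\<Sum>B\<in>Pow J. d B s * pu B x) = - (\<Sum>i\<in>J. u (x i) * P (J - {i}) s x)" by (rule DERIV_unique)
      qed
      also have "\<dots> = - (\<Sum>i\<in>J. E i s)"
      proof -
        have "integrable (gibbs b J) (\<lambda>x. u (x i) * P (J - {i}) s x)" if "i \<in> J" for i
        proof (rule bint)
          show "\<bar>u (x i) * P (J - {i}) s x\<bar> \<le> 1" for x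
            using u01[of "x i"] P01[OF s, of "J - {i}" x] by (simp add: abs_mult mult_le_one)
        qed (use that in measurable, auto)
        then show ?thesis unfolding E_def by (simp add: Bochner_Integration.integral_sum)
      qed
      finally show ?thesis .
    qed
    ultimately show ?thesis by simp
  qed
  have L01: "Lam 0 = 1" unfolding Lam_def P_def by (simp add: GJ.prob_space)
  have D2: "((\<lambda>s. exp (lam * s) * Lam s) has_real_derivative exp (lam * s) * (lam * Lam s - (\<Sum>i\<in>J. E i s))) (at s)" if s: "0 \<le> s" "s \<le> 1" for s
    by (rule derivative_eq_intros deriv[OF s] refl | simp add: algebra_simps)+
  obtain s where s: "0 < s" "s < 1" "exp (lam * 1) * Lam 1 - exp (lam * 0) * Lam 0 = (1 - 0) * (exp (lam * s) * (lam * Lam s - (\<Sum>i\<in>J. E i s)))"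
    using MVT2[of 0 1 "\<lambda>s. exp (lam * s) * Lam s" "\<lambda>s. exp (lam * s) * (lam * Lam s - (\<Sum>i\<in>J. E i s))"] D2 by auto
  have "\<bar>exp lam * Lam 1 - 1\<bar> = exp (lam * s) * \<bar>(\<Sum>i\<in>J. E i s) - lam * Lam s\<bar>"
    using s(3) L01 by (simp add: abs_mult abs_minus_commute)
  also have "\<dots> \<le> exp lam * g"
    using sumE[of s] s lam0 mult_left_mono[of s 1 lam] by (intro mult_mono) auto
  finally have "exp (- lam) * \<bar>exp lam * Lam 1 - 1\<bar> \<le> exp (- lam) * (exp lam * g)" by (intro mult_left_mono) auto
  then have "\<bar>exp (- lam) * (exp lam * Lam 1 - 1)\<bar> \<le> exp (- lam) * (exp lam * g)" by (simp only: abs_mult abs_exp_cancel)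
  also have "\<dots> = g" by (simp add: mult.assoc[symmetric] exp_add[symmetric])
  finally have "\<bar>exp (- lam) * (exp lam * Lam 1 - 1)\<bar> \<le> g" .
  moreover have "exp (- lam) * (exp lam * Lam 1 - 1) = Lam 1 - exp (- lam)" by (simp add: right_diff_distrib exp_minus)
  moreover have "g = 4 * e * lam + 2 * lam\<^sup>2 / real N" unfolding g_def lam using J(3) by (simp add: field_simps power2_eq_square)
  ultimately show ?thesis unfolding Lam_def P_def by simp
qed

end

section \<open>Asymptotics at the edge\<close>

lemma nn_integral_orthogonal_transformation:
  fixes T :: "'a::euclidean_space \<Rightarrow> 'a" and f :: "'a \<Rightarrow> ennreal"
  assumes T: "orthogonal_transformation T" and [measurable]: "f \<in> borel_measurable borel"
  shows "(\<integral>\<^sup>+x. f (T x) \<partial>lborel) = (\<integral>\<^sup>+x. f x \<partial>lborel)"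
proof -
  have lin: "linear T" and nrm: "\<And>x. norm (T x) = norm x"
    using T orthogonal_transformation_linear orthogonal_transformation_norm by auto
  have [measurable]: "T \<in> borel_measurable borel"
    using lin by (intro borel_measurable_continuous_onI linear_continuous_on linear_conv_bounded_linear[THEN iffD1])
  let ?g = "\<lambda>y::'a. indicator (ball 0 1) y :: ennreal"
  let ?v = "emeasure lborel (ball (0::'a) 1)"
  have inv: "\<exists>y'. y = T y'" for y using orthogonal_transformation_surj[OF T] by (metis surjD)
  have shift: "(\<integral>\<^sup>+x. f (T x + y) \<partial>lborel) = (\<integral>\<^sup>+x. f (T x) \<partial>lborel)" for y
  proof -
    obtain y' where y: "y = T y'" using inv by blast
    have "(\<integral>\<^sup>+x. f (T x + y) \<partial>lborel) = (\<integral>\<^sup>+x. f (T (y' + x)) \<partial>lborel)"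
      unfolding y by (simp add: linear_add[OF lin] add.commute)
    also have "\<dots> = (\<integral>\<^sup>+x. f (T x) \<partial>lborel)" by (rule nn_integral_lborel_shift[of "\<lambda>x. f (T x)"]) measurable
    finally show ?thesis .
  qed
  have ball: "(\<integral>\<^sup>+x. ?g (y - T x) \<partial>lborel) = ?v" for y
  proof -
    obtain y' where y: "y = T y'" using inv by blast
    have "?g (y - T x) = indicator (ball y' 1) x" for x
      unfolding y linear_diff[OF lin, symmetric] by (simp add: indicator_def dist_norm nrm)
    then have "(\<integral>\<^sup>+x. ?g (y - T x) \<partial>lborel) = emeasure lborel (ball y' 1)" by simp
    then show ?thesis by (simp add: emeasure_ball)
  qed
  have "?v * (\<integral>\<^sup>+x. f (T x) \<partial>lborel) = (\<integral>\<^sup>+y. ?g y * (\<integral>\<^sup>+x. f (T x + y) \<partial>lborel) \<partial>lborel)"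
    unfolding shift by (simp add: nn_integral_multc)
  also have "\<dots> = (\<integral>\<^sup>+y. (\<integral>\<^sup>+x. ?g y * f (T x + y) \<partial>lborel) \<partial>lborel)"
    by (intro nn_integral_cong) (simp add: nn_integral_cmult)
  also have "\<dots> = (\<integral>\<^sup>+x. (\<integral>\<^sup>+y. ?g y * f (T x + y) \<partial>lborel) \<partial>lborel)"
    by (rule lborel_pair.Fubini') measurable
  also have "\<dots> = (\<integral>\<^sup>+x. (\<integral>\<^sup>+y. ?g (y - T x) * f y \<partial>lborel) \<partial>lborel)"
  proof (rule nn_integral_cong)
    fix x
    have "(\<integral>\<^sup>+y. ?g (y - T x) * f y \<partial>lborel) = (\<integral>\<^sup>+y. ?g (T x + y - T x) * f (T x + y) \<partial>lborel)"
      by (rule nn_integral_lborel_shift[symmetric]) measurable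
    then show "(\<integral>\<^sup>+y. ?g y * f (T x + y) \<partial>lborel) = (\<integral>\<^sup>+y. ?g (y - T x) * f y \<partial>lborel)" by simp
  qed
  also have "\<dots> = (\<integral>\<^sup>+y. (\<integral>\<^sup>+x. ?g (y - T x) * f y \<partial>lborel) \<partial>lborel)"
    by (rule lborel_pair.Fubini') measurable
  also have "\<dots> = (\<integral>\<^sup>+y. ?v * f y \<partial>lborel)"
    by (intro nn_integral_cong) (simp add: nn_integral_multc ball)
  also have "\<dots> = ?v * (\<integral>\<^sup>+y. f y \<partial>lborel)" by (rule nn_integral_cmult) measurable
  finally have "?v * (\<integral>\<^sup>+x. f (T x) \<partial>lborel) = ?v * (\<integral>\<^sup>+y. f y \<partial>lborel)" .
  moreover have "?v \<noteq> 0" "?v \<noteq> \<top>"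
    using unit_ball_vol_pos[of "real DIM('a)"] by (simp_all add: emeasure_ball less_imp_neq[symmetric])
  ultimately show ?thesis by (simp add: ennreal_mult_cancel_left)
qed

lemma nn_integral_scaled_orthogonal:
  fixes T :: "'a::euclidean_space \<Rightarrow> 'a" and f :: "'a \<Rightarrow> ennreal"
  assumes T: "orthogonal_transformation T" and [measurable]: "f \<in> borel_measurable borel" and c: "0 < c"
  shows "(\<integral>\<^sup>+x. f x \<partial>lborel) = ennreal (c ^ DIM('a)) * (\<integral>\<^sup>+x. f (a + c *\<^sub>R T x) \<partial>lborel)"
proof -
  have "(\<integral>\<^sup>+x. f x \<partial>lborel) = (\<integral>\<^sup>+x. f x \<partial>density (distr lborel borel (\<lambda>x. a + c *\<^sub>R x)) (\<lambda>_. ennreal (\<bar>c\<bar> ^ DIM('a))))"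
    using lborel_affine[of c a] c by simp
  also have "\<dots> = (\<integral>\<^sup>+x. ennreal (c ^ DIM('a)) * f (a + c *\<^sub>R x) \<partial>lborel)"
    using c by (simp add: nn_integral_density nn_integral_distr)
  also have "\<dots> = ennreal (c ^ DIM('a)) * (\<integral>\<^sup>+x. f (a + c *\<^sub>R x) \<partial>lborel)"
    by (rule nn_integral_cmult) measurable
  also have "(\<integral>\<^sup>+x. f (a + c *\<^sub>R x) \<partial>lborel) = (\<integral>\<^sup>+x. f (a + c *\<^sub>R T x) \<partial>lborel)"
    using nn_integral_orthogonal_transformation[OF T, of "\<lambda>x. f (a + c *\<^sub>R x)"] by simp
  finally show ?thesis .
qed

lemma tendsto_ln_square_over: "((\<lambda>x::real. (ln x)\<^sup>2 / x) \<longlongrightarrow> 0) at_top"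
proof -
  have "((\<lambda>x. 4 * (ln (sqrt x) / sqrt x)\<^sup>2) \<longlongrightarrow> 4 * 0\<^sup>2) at_top"
    by (intro tendsto_intros filterlim_compose[OF ln_x_over_x_tendsto_0 sqrt_at_top])
  then have "((\<lambda>x. 4 * (ln (sqrt x) / sqrt x)\<^sup>2) \<longlongrightarrow> 0) at_top" by simp
  then show ?thesis
  proof (rule Lim_transform_eventually)
    show "\<forall>\<^sub>F x in at_top. 4 * (ln (sqrt x) / sqrt x)\<^sup>2 = (ln x)\<^sup>2 / x"
      using eventually_gt_at_top[of "0::real"]
      by eventually_elim (simp add: ln_sqrt power_divide)
  qed
qed

lemma abs_exp_sub_le: "\<bar>exp w - 1 - w\<bar> \<le> w\<^sup>2 * exp \<bar>w\<bar>" for w :: real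
proof -
  have "0 \<le> w\<^sup>2 * exp \<bar>w\<bar>" by simp
  then show ?thesis using exp_le_quadratic[of w] exp_ge_add_one_self[of w] unfolding abs_le_iff by linarith
qed

lemma powr_linear_remainder:
  fixes d :: "nat \<Rightarrow> real"
  assumes d: "d \<longlonglongrightarrow> 0" and ld: "(\<lambda>N. l N * (d N)\<^sup>2) \<longlonglongrightarrow> 0" and l: "\<forall>\<^sub>F N in sequentially. 0 \<le> l N"
  shows "(\<lambda>N. l N * ((1 + d N) powr \<alpha> - 1 - \<alpha> * d N)) \<longlonglongrightarrow> 0"
proof -
  define K where "K = 2 * \<bar>\<alpha>\<bar> + (2 * \<alpha>)\<^sup>2 * exp \<bar>2 * \<alpha>\<bar>"
  have "\<forall>\<^sub>F N in sequentially. \<bar>d N\<bar> < 1/2" using tendstoD[OF d, of "1/2"] by (simp add: dist_real_def)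
  then have "\<forall>\<^sub>F N in sequentially. norm (l N * ((1 + d N) powr \<alpha> - 1 - \<alpha> * d N)) \<le> K * (l N * (d N)\<^sup>2)"
    using l
  proof eventually_elim
    case (elim N)
    let ?d = "d N" and ?w = "\<alpha> * ln (1 + d N)"
    have ln1: "\<bar>ln (1 + ?d) - ?d\<bar> \<le> 2 * ?d\<^sup>2" using elim by (intro abs_ln_one_plus_x_minus_x_bound) auto
    have "2 * ?d\<^sup>2 \<le> \<bar>?d\<bar>" using elim mult_left_mono[of "2 * \<bar>?d\<bar>" 1 "\<bar>?d\<bar>"] by (simp add: power2_eq_square)
    then have ln2: "\<bar>ln (1 + ?d)\<bar> \<le> 2 * \<bar>?d\<bar>" using ln1 by linarith
    have w: "\<bar>?w\<bar> \<le> \<bar>2 * \<alpha>\<bar> * \<bar>?d\<bar>" using mult_left_mono[OF ln2, of "\<bar>\<alpha>\<bar>"] by (simp add: abs_mult mult_ac)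
    have w1: "\<bar>?w\<bar> \<le> \<bar>2 * \<alpha>\<bar>" using w elim mult_left_mono[of "\<bar>?d\<bar>" 1 "\<bar>2 * \<alpha>\<bar>"] by linarith
    have "(1 + ?d) powr \<alpha> = exp ?w" using elim by (simp add: powr_def)
    then have "(1 + ?d) powr \<alpha> - 1 - \<alpha> * ?d = (exp ?w - 1 - ?w) + \<alpha> * (ln (1 + ?d) - ?d)"
      by (simp add: algebra_simps)
    then have "\<bar>(1 + ?d) powr \<alpha> - 1 - \<alpha> * ?d\<bar> \<le> \<bar>exp ?w - 1 - ?w\<bar> + \<bar>\<alpha> * (ln (1 + ?d) - ?d)\<bar>"
      by (simp only: abs_triangle_ineq)
    also have "\<dots> \<le> ?w\<^sup>2 * exp \<bar>?w\<bar> + \<bar>\<alpha>\<bar> * (2 * ?d\<^sup>2)"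
      using ln1 by (intro add_mono[OF abs_exp_sub_le]) (simp add: abs_mult mult_left_mono)
    also have "?w\<^sup>2 * exp \<bar>?w\<bar> \<le> (\<bar>2 * \<alpha>\<bar> * \<bar>?d\<bar>)\<^sup>2 * exp \<bar>2 * \<alpha>\<bar>"
      using w w1 power_mono[OF w, of 2] by (intro mult_mono) auto
    finally have "\<bar>(1 + ?d) powr \<alpha> - 1 - \<alpha> * ?d\<bar> \<le> K * ?d\<^sup>2"
      unfolding K_def by (simp add: power_mult_distrib algebra_simps)
    then have "l N * \<bar>(1 + ?d) powr \<alpha> - 1 - \<alpha> * ?d\<bar> \<le> l N * (K * ?d\<^sup>2)" using elim by (intro mult_left_mono) auto
    then show ?case using elim by (simp add: abs_mult mult_ac)
  qed
  moreover have "(\<lambda>N. K * (l N * (d N)\<^sup>2)) \<longlonglongrightarrow> 0" using tendsto_mult_left[OF ld, of K] by simp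
  ultimately show ?thesis by (rule Lim_null_comparison)
qed

lemma tendsto_of_mult_real:
  fixes b :: "nat \<Rightarrow> real"
  assumes b: "(\<lambda>N. b N * real N) \<longlonglongrightarrow> \<gamma>"
  shows "b \<longlonglongrightarrow> 0" "(\<lambda>N. b N * (real N - 1)) \<longlonglongrightarrow> \<gamma>"
proof -
  have "(\<lambda>N. (b N * real N) * (1 / real N)) \<longlonglongrightarrow> \<gamma> * 0"
    by (intro tendsto_intros b)
  then have "(\<lambda>N. (b N * real N) * (1 / real N)) \<longlonglongrightarrow> 0" by simp
  then show b0: "b \<longlonglongrightarrow> 0"
  proof (rule Lim_transform_eventually)
    show "\<forall>\<^sub>F N in sequentially. (b N * real N) * (1 / real N) = b N"
      using eventually_gt_at_top[of 0] by eventually_elim simp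
  qed
  have "(\<lambda>N. b N * real N - b N) \<longlonglongrightarrow> \<gamma> - 0" by (intro tendsto_intros b b0)
  then show "(\<lambda>N. b N * (real N - 1)) \<longlonglongrightarrow> \<gamma>" by (simp add: algebra_simps)
qed

lemma edge_scale_asymptotics:
  fixes b :: "nat \<Rightarrow> real" and n :: nat and \<alpha> L \<gamma> :: real
  assumes \<alpha>: "0 < \<alpha>" and L: "0 < L" and b: "(\<lambda>N. b N * real N) \<longlonglongrightarrow> \<gamma>"
  defines "\<eta> \<equiv> \<lambda>N. edge_scale n \<alpha> L (b N) N"
  shows "filterlim \<eta> at_top sequentially"
    and "(\<lambda>N. ln (real N) - real n * ln \<alpha> + (real n - real n * \<alpha> + b N * (real N - 1)) * ln (\<eta> N) - \<eta> N powr \<alpha>) \<longlonglongrightarrow> ln L"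
proof -
  define l where "l N = ln (real N)" for N
  define A where "A N = (b N * real N - real n * (\<alpha> - 1)) / \<alpha>\<^sup>2" for N
  define B where "B = ln (\<alpha> ^ n * L) / \<alpha>"
  define d where "d N = A N * (ln (l N) / l N) - B / l N" for N
  have \<eta>: "\<eta> N = l N powr (1 / \<alpha>) * (1 + d N)" for N
    unfolding \<eta>_def edge_scale_def d_def A_def B_def l_def by (simp add: algebra_simps)
  have l: "filterlim l at_top sequentially"
    unfolding l_def by (rule filterlim_compose[OF ln_at_top filterlim_real_sequentially])
  have lpos: "\<forall>\<^sub>F N in sequentially. 1 < l N" using l by (simp add: filterlim_at_top_dense)
  have A: "A \<longlonglongrightarrow> (\<gamma> - real n * (\<alpha> - 1)) / \<alpha>\<^sup>2"
    unfolding A_def using \<alpha> by (intro tendsto_intros b) auto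
  have l1: "(\<lambda>N. ln (l N) / l N) \<longlonglongrightarrow> 0" by (rule filterlim_compose[OF ln_x_over_x_tendsto_0 l])
  have l2: "(\<lambda>N. (ln (l N))\<^sup>2 / l N) \<longlonglongrightarrow> 0" by (rule filterlim_compose[OF tendsto_ln_square_over l])
  have l3: "(\<lambda>N. 1 / l N) \<longlonglongrightarrow> 0" using tendsto_inverse_0_at_top[OF l] by (simp add: inverse_eq_divide)
  have d: "d \<longlonglongrightarrow> 0"
  proof -
    have "(\<lambda>N. A N * (ln (l N) / l N) - B * (1 / l N)) \<longlonglongrightarrow> (\<gamma> - real n * (\<alpha> - 1)) / \<alpha>\<^sup>2 * 0 - B * 0"
      by (intro tendsto_intros A l1 l3)
    then show ?thesis unfolding d_def by simp
  qed
  have ld2: "(\<lambda>N. l N * (d N)\<^sup>2) \<longlonglongrightarrow> 0"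
  proof -
    have "(\<lambda>N. (A N)\<^sup>2 * ((ln (l N))\<^sup>2 / l N) - 2 * A N * B * (ln (l N) / l N) + B\<^sup>2 * (1 / l N))
      \<longlonglongrightarrow> ((\<gamma> - real n * (\<alpha> - 1)) / \<alpha>\<^sup>2)\<^sup>2 * 0 - 2 * ((\<gamma> - real n * (\<alpha> - 1)) / \<alpha>\<^sup>2) * B * 0 + B\<^sup>2 * 0"
      by (intro tendsto_intros A l1 l2 l3)
    then have "(\<lambda>N. (A N)\<^sup>2 * ((ln (l N))\<^sup>2 / l N) - 2 * A N * B * (ln (l N) / l N) + B\<^sup>2 * (1 / l N)) \<longlonglongrightarrow> 0" by simp
    then show ?thesis
    proof (rule Lim_transform_eventually)
      show "\<forall>\<^sub>F N in sequentially. (A N)\<^sup>2 * ((ln (l N))\<^sup>2 / l N) - 2 * A N * B * (ln (l N) / l N) + B\<^sup>2 * (1 / l N) = l N * (d N)\<^sup>2"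
        using lpos by eventually_elim (simp add: d_def power2_eq_square field_simps)
    qed
  qed
  have dsm: "\<forall>\<^sub>F N in sequentially. \<bar>d N\<bar> < 1/2" using tendstoD[OF d, of "1/2"] by (simp add: dist_real_def)
  show "filterlim \<eta> at_top sequentially"
  proof -
    have "filterlim (\<lambda>N. l N powr (1 / \<alpha>)) at_top sequentially"
    proof (rule filterlim_cong[THEN iffD1, OF refl refl])
      have "filterlim (\<lambda>N. (1 / \<alpha>) * ln (l N)) at_top sequentially"
        using \<alpha> by (intro filterlim_tendsto_pos_mult_at_top[OF tendsto_const] filterlim_compose[OF ln_at_top l]) auto
      then show "filterlim (\<lambda>N. exp ((1 / \<alpha>) * ln (l N))) at_top sequentially"
        by (rule filterlim_compose[OF exp_at_top])
      show "\<forall>\<^sub>F N in sequentially. exp ((1 / \<alpha>) * ln (l N)) = l N powr (1 / \<alpha>)"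
        using lpos by eventually_elim (simp add: powr_def)
    qed
    then have "filterlim (\<lambda>N. (1 + d N) * l N powr (1 / \<alpha>)) at_top sequentially"
      by (intro filterlim_tendsto_pos_mult_at_top[where c = "1 + 0"] tendsto_intros d) auto
    then show ?thesis unfolding \<eta> by (simp add: mult.commute)
  qed
  define t where "t N = b N * (real N - 1)" for N
  have bl: "(\<lambda>N. b N * ln (l N)) \<longlonglongrightarrow> 0"
  proof -
    have "(\<lambda>N. ln (real N) / real N) \<longlonglongrightarrow> 0" by (rule filterlim_compose[OF ln_x_over_x_tendsto_0 filterlim_real_sequentially])
    then have "(\<lambda>N. (b N * real N) * ((ln (l N) / l N) * (ln (real N) / real N))) \<longlonglongrightarrow> \<gamma> * (0 * 0)"
      by (intro tendsto_intros b l1)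
    then have "(\<lambda>N. (b N * real N) * ((ln (l N) / l N) * (ln (real N) / real N))) \<longlonglongrightarrow> 0" by simp
    then show ?thesis
    proof (rule Lim_transform_eventually)
      show "\<forall>\<^sub>F N in sequentially. (b N * real N) * ((ln (l N) / l N) * (ln (real N) / real N)) = b N * ln (l N)"
        using lpos eventually_gt_at_top[of 0] by eventually_elim (simp add: l_def)
    qed
  qed
  have t: "t \<longlonglongrightarrow> \<gamma>" unfolding t_def by (rule tendsto_of_mult_real(2)[OF b])
  have "(\<lambda>N. - real n * ln \<alpha> + ln (\<alpha> ^ n * L) - b N * ln (l N) / \<alpha> + (real n - real n * \<alpha> + t N) * ln (1 + d N)
     - l N * ((1 + d N) powr \<alpha> - 1 - \<alpha> * d N)) \<longlonglongrightarrow> - real n * ln \<alpha> + ln (\<alpha> ^ n * L) - 0 / \<alpha> + (real n - real n * \<alpha> + \<gamma>) * ln (1 + 0) - 0"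
    using \<alpha> by (intro tendsto_intros bl d t powr_linear_remainder ld2) (auto intro: eventually_mono[OF lpos])
  also have "- real n * ln \<alpha> + ln (\<alpha> ^ n * L) - 0 / \<alpha> + (real n - real n * \<alpha> + \<gamma>) * ln (1 + 0) - 0 = ln L"
    using \<alpha> L by (simp add: ln_mult ln_realpow)
  finally have lim: "(\<lambda>N. - real n * ln \<alpha> + ln (\<alpha> ^ n * L) - b N * ln (l N) / \<alpha> + (real n - real n * \<alpha> + t N) * ln (1 + d N)
     - l N * ((1 + d N) powr \<alpha> - 1 - \<alpha> * d N)) \<longlonglongrightarrow> ln L" .
  show "(\<lambda>N. ln (real N) - real n * ln \<alpha> + (real n - real n * \<alpha> + b N * (real N - 1)) * ln (\<eta> N) - \<eta> N powr \<alpha>) \<longlonglongrightarrow> ln L"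
  proof (rule Lim_transform_eventually[OF lim], use lpos dsm in eventually_elim)
    case (elim N)
    have lne: "ln (\<eta> N) = ln (l N) / \<alpha> + ln (1 + d N)" unfolding \<eta> using elim by (simp add: ln_mult ln_powr)
    have eta: "\<eta> N powr \<alpha> = l N * (1 + d N) powr \<alpha>"
      unfolding \<eta> using elim \<alpha> by (simp add: powr_mult powr_powr)
    have ad: "\<alpha> * (l N * d N) = \<alpha> * A N * ln (l N) - \<alpha> * B" unfolding d_def using elim by (simp add: field_simps)
    have aA: "\<alpha> * A N = (b N * real N - real n * (\<alpha> - 1)) / \<alpha>" unfolding A_def using \<alpha> by (simp add: power2_eq_square)
    have aB: "\<alpha> * B = ln (\<alpha> ^ n * L)" unfolding B_def using \<alpha> by simp
    have "(real n - real n * \<alpha> + t N) * (ln (l N) / \<alpha>) - \<alpha> * A N * ln (l N) = - b N * ln (l N) / \<alpha>"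
      unfolding aA t_def using \<alpha> by (simp add: field_simps)
    then show ?case unfolding lne eta t_def[symmetric] l_def[symmetric] using ad aB by (simp add: algebra_simps)
  qed
qed

lemma ln_one_plus_le_sqrt:
  fixes s :: real assumes "0 \<le> s" shows "ln (1 + s) \<le> 2 * sqrt s"
proof -
  have "1 + s \<le> (1 + sqrt s)\<^sup>2" using assms by (simp add: power2_sum)
  then have "ln (1 + s) \<le> ln ((1 + sqrt s)\<^sup>2)" using assms by (subst ln_le_cancel_iff) (auto simp: add_pos_nonneg)
  also have "\<dots> = 2 * ln (1 + sqrt s)" using assms by (subst ln_realpow) (auto simp: add_pos_nonneg)
  also have "\<dots> \<le> 2 * sqrt s" using ln_add_one_self_le_self[of "sqrt s"] assms by simp
  finally show ?thesis .
qed

lemma abs_log_kernel_add_ln_le: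
  fixes x y :: "'a::euclidean_space"
  assumes y: "1 \<le> norm y" and xy: "x \<noteq> y"
  shows "\<bar>log_kernel y x + ln (norm y)\<bar> \<le> 2 * norm y powr (-1/2) * ((1 + norm x) * (1 + norm (y - x) powr (-1/2)))"
proof -
  define X Y r where "X = norm x" and "Y = norm y" and "r = norm (y - x)"
  have r: "0 < r" and Y: "1 \<le> Y" and X: "0 \<le> X" using assms by (auto simp: r_def Y_def X_def)
  have half: "t powr (-1/2) = inverse (sqrt t)" if "0 \<le> t" for t :: real
    using that by (simp only: minus_divide_left[symmetric] powr_minus) (simp add: powr_half_sqrt)
  have sX: "sqrt X \<le> 1 + X"
    using X by (intro real_le_lsqrt) (auto simp: power2_eq_square algebra_simps)
  have sY: "sqrt Y \<le> Y" using Y by (intro real_le_lsqrt) (auto simp: power2_eq_square)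
  let ?h = "(1 + X) * (1 + inverse (sqrt r))"
  have ir: "0 < inverse (sqrt r)" using r by simp
  have tri: "Y \<le> X + r" "r \<le> X + Y"
    using norm_triangle_ineq[of x "y - x"] norm_triangle_ineq4[of y x] by (auto simp: X_def Y_def r_def)
  have "ln Y - ln r = ln (Y / r)" using r Y by (simp add: ln_div)
  also have "\<dots> \<le> ln (1 + X / r)"
    using tri r Y X by (subst ln_le_cancel_iff) (auto simp: field_simps add_pos_nonneg)
  also have "\<dots> \<le> 2 * sqrt (X / r)" using X r by (intro ln_one_plus_le_sqrt) auto
  finally have a: "sqrt Y * (ln Y - ln r) \<le> sqrt Y * (2 * sqrt (X / r))" using Y by (intro mult_left_mono) auto
  have "sqrt Y \<le> sqrt X + sqrt r"
    using tri Y X r by (intro order_trans[OF real_sqrt_le_mono sqrt_add_le_add_sqrt]) auto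
  then have "sqrt Y * sqrt (X / r) \<le> (sqrt X + sqrt r) * sqrt (X / r)" using X r by (intro mult_right_mono) auto
  also have "\<dots> = X * inverse (sqrt r) + sqrt X"
    using X r by (simp add: real_sqrt_divide field_simps)
  also have "\<dots> \<le> (1 + X) * inverse (sqrt r) + (1 + X)" using sX ir by (intro add_mono mult_right_mono) auto
  finally have u: "sqrt Y * (ln Y - ln r) \<le> 2 * ?h" using a by (simp add: algebra_simps)
  have "ln r - ln Y = ln (r / Y)" using r Y by (simp add: ln_div)
  also have "\<dots> \<le> ln (1 + X / Y)"
    using tri r Y X by (subst ln_le_cancel_iff) (auto simp: field_simps add_pos_nonneg)
  also have "\<dots> \<le> X / Y" using X Y by (intro ln_add_one_self_le_self) auto
  finally have "sqrt Y * (ln r - ln Y) \<le> sqrt Y * (X / Y)" using Y by (intro mult_left_mono) auto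
  also have "\<dots> \<le> Y * (X / Y)" using sY X Y by (intro mult_right_mono) auto
  also have "\<dots> = X" using Y by simp
  also have "X \<le> 2 * ?h"
  proof -
    have "0 \<le> (1 + X) * inverse (sqrt r)" using X ir by simp
    then show ?thesis using X by (simp add: algebra_simps)
  qed
  finally have "sqrt Y * \<bar>ln Y - ln r\<bar> \<le> 2 * ?h" using u by (cases "ln r \<le> ln Y") auto
  then have "\<bar>ln Y - ln r\<bar> \<le> 2 * inverse (sqrt Y) * ?h" using Y by (simp add: field_simps)
  moreover have "log_kernel y x + ln (norm y) = ln Y - ln r" by (simp add: log_kernel_eq Y_def r_def norm_minus_commute)
  ultimately show ?thesis unfolding half[OF norm_ge_zero] unfolding X_def[symmetric] Y_def[symmetric] r_def[symmetric] by simp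
qed

context mean_field
begin

lemma U_add_ln_bound: "\<exists>C\<ge>0. \<forall>y. 1 \<le> norm y \<longrightarrow> \<bar>U y + ln (norm y)\<bar> \<le> C * norm y powr (-1/2)"
proof -
  interpret mu: prob_space \<mu> by (rule prob_mu)
  obtain S where S: "S \<ge> 0" "\<And>x. (\<integral>\<^sup>+z. ennreal (m z * (1 + norm z) ^ 1 * norm (x - z) powr (-1/2)) \<partial>lborel) \<le> ennreal S"
    using m_singular_bound[of 1] by blast
  define K where "K = (\<integral>z. m z * (1 + norm z) ^ 1 \<partial>lborel)"
  have K0: "0 \<le> K" unfolding K_def using m_pos by (intro integral_nonneg_AE) (auto simp: less_imp_le)
  have K: "(\<integral>\<^sup>+z. ennreal (m z * (1 + norm z) ^ 1) \<partial>lborel) = ennreal K"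
    unfolding K_def using m_power_integrable[of 1] m_pos by (intro nn_integral_eq_integral) (auto simp: less_imp_le)
  define h where "h y x = (1 + norm x) * (1 + norm (y - x) powr (-1/2))" for x y :: 'a
  have hb: "(\<integral>\<^sup>+x. ennreal (h y x) \<partial>\<mu>) \<le> ennreal (K + S)" for y
  proof -
    have "(\<integral>\<^sup>+x. ennreal (h y x) \<partial>\<mu>) = (\<integral>\<^sup>+x. ennreal (m x * (1 + norm x) ^ 1) + ennreal (m x * (1 + norm x) ^ 1 * norm (y - x) powr (-1/2)) \<partial>lborel)"
      unfolding h_def using m_pos
      by (subst nn_integral_mu, measurable)
        (auto intro!: nn_integral_cong simp: ennreal_mult[symmetric] ennreal_plus[symmetric] less_imp_le algebra_simps simp del: ennreal_plus)
    also have "\<dots> = ennreal K + (\<integral>\<^sup>+x. ennreal (m x * (1 + norm x) ^ 1 * norm (y - x) powr (-1/2)) \<partial>lborel)"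
      unfolding K[symmetric] by (rule nn_integral_add) measurable
    also have "\<dots> \<le> ennreal K + ennreal S" by (intro add_left_mono S)
    finally show ?thesis using K0 S(1) by simp
  qed
  have h0: "0 \<le> h y x" for y x by (simp add: h_def)
  have [measurable]: "h y \<in> borel_measurable borel" for y unfolding h_def by measurable
  have hi: "integrable \<mu> (h y)" for y using hb[of y] h0 by (intro integrableI_nonneg) (auto intro: le_less_trans)
  have hI: "(\<integral>x. h y x \<partial>\<mu>) \<le> K + S" for y
    using hb[of y] hi[of y] h0 K0 S(1) by (subst (asm) nn_integral_eq_integral) (auto simp del: ennreal_plus)
  have "\<bar>U y + ln (norm y)\<bar> \<le> 2 * (K + S) * norm y powr (-1/2)" if y: "1 \<le> norm y" for y
  proof -
    have "U y + ln (norm y) = (\<integral>x. log_kernel y x + ln (norm y) \<partial>\<mu>)"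
      unfolding U_eq using log_kernel_integrable[of y] by (simp add: mu.prob_space)
    also have "\<bar>\<dots>\<bar> \<le> (\<integral>x. \<bar>log_kernel y x + ln (norm y)\<bar> \<partial>\<mu>)" by (rule integral_abs_bound)
    also have "\<dots> \<le> (\<integral>x. 2 * norm y powr (-1/2) * h y x \<partial>\<mu>)"
    proof (rule integral_mono_AE)
      show "AE x in \<mu>. \<bar>log_kernel y x + ln (norm y)\<bar> \<le> 2 * norm y powr (-1/2) * h y x"
        using AE_mu_neq[of y] by eventually_elim (unfold h_def, rule abs_log_kernel_add_ln_le[OF y])
    qed (use log_kernel_integrable[of y] hi[of y] in auto)
    also have "\<dots> = 2 * norm y powr (-1/2) * (\<integral>x. h y x \<partial>\<mu>)" by (rule integral_mult_right_zero)
    also have "\<dots> \<le> 2 * norm y powr (-1/2) * (K + S)" by (intro mult_left_mono hI) auto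
    also have "\<dots> = 2 * (K + S) * norm y powr (-1/2)"
    proof -
      have "2 * p * q = 2 * q * p" for p q :: real by simp
      then show ?thesis .
    qed
    finally show ?thesis .
  qed
  then show ?thesis using K0 S(1) by (intro exI[of _ "2 * (K + S)"]) auto
qed

lemma tilt_integral_limit:
  assumes k: "\<kappa> \<longlonglongrightarrow> \<gamma>"
  shows "(\<lambda>N. \<integral>y. tilt (\<kappa> N) y \<partial>lborel) \<longlonglongrightarrow> L"
proof -
  obtain C where C: "C \<ge> 0" "\<And>\<kappa> y. \<bar>\<kappa> - \<gamma>\<bar> \<le> 1 \<Longrightarrow> tilt \<kappa> y \<le> C * (m y * (1 + norm y))" using tilt_le by blast
  define k' where "k' N = max (\<gamma> - 1) (min (\<gamma> + 1) (\<kappa> N))" for N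
  have k': "k' \<longlonglongrightarrow> \<gamma>"
  proof -
    have "k' \<longlonglongrightarrow> max (\<gamma> - 1) (min (\<gamma> + 1) \<gamma>)" unfolding k'_def by (intro tendsto_intros k)
    then show ?thesis by simp
  qed
  have kb: "\<bar>k' N - \<gamma>\<bar> \<le> 1" for N unfolding k'_def by auto
  have "(\<lambda>N. \<integral>y. tilt (k' N) y \<partial>lborel) \<longlonglongrightarrow> (\<integral>y. tilt \<gamma> y \<partial>lborel)"
  proof (rule integral_dominated_convergence[where w = "\<lambda>y. C * (m y * (1 + norm y) ^ 1)"])
    show "integrable lborel (\<lambda>y. C * (m y * (1 + norm y) ^ 1))" using m_power_integrable[of 1] by simp
    show "AE y in lborel. (\<lambda>N. tilt (k' N) y) \<longlonglongrightarrow> tilt \<gamma> y"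
      unfolding tilt_def by (intro AE_I2 tendsto_intros k')
    show "AE y in lborel. norm (tilt (k' N) y) \<le> C * (m y * (1 + norm y) ^ 1)" for N
      using C(2)[OF kb[of N]] tilt_pos[of "k' N"] by (auto simp: less_imp_le)
  qed measurable
  moreover have "(\<integral>y. tilt \<gamma> y \<partial>lborel) = L"
  proof -
    interpret mu: prob_space \<mu> by (rule prob_mu)
    have eq: "tilt \<gamma> y = L * m y" for y unfolding tilt_def m_def using L_pos by (simp add: algebra_simps)
    have "ennreal (\<integral>y. m y \<partial>lborel) = (\<integral>\<^sup>+y. ennreal (m y) \<partial>lborel)"
      using m_power_integrable[of 0] m_pos by (intro nn_integral_eq_integral[symmetric]) (auto simp: less_imp_le)
    also have "\<dots> = 1" using mu.emeasure_space_1 nn_integral_mu[of "\<lambda>_. 1"] by simp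
    finally have "(\<integral>y. m y \<partial>lborel) = 1" by simp
    then show ?thesis unfolding eq by simp
  qed
  ultimately have "(\<lambda>N. \<integral>y. tilt (k' N) y \<partial>lborel) \<longlonglongrightarrow> L" by simp
  then show ?thesis
  proof (rule Lim_transform_eventually)
    have "\<forall>\<^sub>F N in sequentially. \<bar>\<kappa> N - \<gamma>\<bar> < 1" using tendstoD[OF k, of 1] by (simp add: dist_real_def)
    then show "\<forall>\<^sub>F N in sequentially. (\<integral>y. tilt (k' N) y \<partial>lborel) = (\<integral>y. tilt (\<kappa> N) y \<partial>lborel)"
      by eventually_elim (simp add: k'_def abs_less_iff max_def min_def)
  qed
qed

lemma poisson_limit:
  fixes b :: "nat \<Rightarrow> real" and u :: "nat \<Rightarrow> 'a \<Rightarrow> real"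
  assumes bpos: "\<And>N. 1 \<le> N \<Longrightarrow> 0 < b N" and b: "(\<lambda>N. b N * real N) \<longlonglongrightarrow> \<gamma>"
    and u: "\<And>N. u N \<in> borel_measurable borel" and u01: "\<And>N y. 0 \<le> u N y" "\<And>N y. u N y \<le> 1"
    and lim: "(\<lambda>N. real N * (\<integral>y. u N y * tilt (b N * (real N - 1)) y \<partial>lborel)) \<longlonglongrightarrow> L * \<theta>"
  shows "(\<lambda>N. \<integral>x. (\<Prod>j\<in>{1..N}. (1 - u N (x j))) \<partial>gibbs (b N) {1..N}) \<longlonglongrightarrow> exp (- \<theta>)"
proof -
  have t: "(\<lambda>N. b N * (real N - 1)) \<longlonglongrightarrow> \<gamma>" by (rule tendsto_of_mult_real(2)[OF b])
  define lam where "lam N = real N * ((\<integral>y. u N y * tilt (b N * (real N - 1)) y \<partial>lborel) / (\<integral>y. tilt (b N * (real N - 1)) y \<partial>lborel))" for N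
  have lam: "lam \<longlonglongrightarrow> \<theta>"
  proof -
    have "(\<lambda>N. real N * (\<integral>y. u N y * tilt (b N * (real N - 1)) y \<partial>lborel) / (\<integral>y. tilt (b N * (real N - 1)) y \<partial>lborel)) \<longlonglongrightarrow> L * \<theta> / L"
      using L_pos by (intro tendsto_divide lim tilt_integral_limit t) auto
    then show ?thesis unfolding lam_def using L_pos by simp
  qed
  define X where "X N = (\<integral>x. (\<Prod>j\<in>{1..N}. (1 - u N (x j))) \<partial>gibbs (b N) {1..N})" for N
  have est: "\<forall>\<^sub>F N in sequentially. \<bar>X N - exp (- lam N)\<bar> \<le> 4 * e * lam N + 2 * (lam N)\<^sup>2 / real N" if e: "0 < e" "e \<le> 1/2" for e
  proof -
    obtain \<tau> where \<tau>: "0 < \<tau>" "\<tau> \<le> 1" and conc: "\<And>I b. finite I \<Longrightarrow> I \<noteq> {} \<Longrightarrow> 0 < b \<Longrightarrow> \<bar>b * real (card I) - \<gamma>\<bar> < \<tau> \<Longrightarrow> 1 / real (card I) < \<tau> \<Longrightarrow>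
      integrable (\<Lambda> I) (weight b I) \<and> 0 < partition_fun b I \<and>
      (\<forall>y. (\<integral>\<^sup>+x. ennreal \<bar>exp (- b * (\<Sum>j\<in>I. log_kernel y (x j))) - exp (- b * real (card I) * U y)\<bar> \<partial>gibbs b I)
         \<le> ennreal (e * exp (- b * real (card I) * U y)))"
      using concentration[OF e(1)] by blast
    have 1: "\<forall>\<^sub>F N in sequentially. \<bar>b N * real N - \<gamma>\<bar> < \<tau>" using tendstoD[OF b \<tau>(1)] by (simp add: dist_real_def)
    have 2: "\<forall>\<^sub>F N in sequentially. \<bar>b N * (real N - 1) - \<gamma>\<bar> < \<tau>" using tendstoD[OF t \<tau>(1)] by (simp add: dist_real_def)
    have 3: "\<forall>\<^sub>F N in sequentially. 1 / real (N - 1) < \<tau>"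
    proof -
      have "(\<lambda>N. 1 / real N) \<longlonglongrightarrow> 0" using lim_inverse_n by (simp add: inverse_eq_divide)
      then have "\<forall>\<^sub>F N in sequentially. 1 / real N < \<tau>" using \<tau> by (intro order_tendstoD(2)[of _ 0]) auto
      then obtain N0 where N0: "\<And>N. N0 \<le> N \<Longrightarrow> 1 / real N < \<tau>" by (auto simp: eventually_sequentially)
      show ?thesis unfolding eventually_sequentially
      proof (intro exI[of _ "Suc N0"] allI impI)
        fix N assume "Suc N0 \<le> N" then show "1 / real (N - 1) < \<tau>" by (intro N0) auto
      qed
    qed
    show ?thesis
      using 1 2 3 eventually_ge_at_top[of 2]
    proof eventually_elim
      case (elim N)
      have bN: "0 < b N" using bpos elim by auto
      have cN: "1 / real N < \<tau>"
      proof -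
        have "1 / real N \<le> 1 / real (N - 1)" using elim by (intro divide_left_mono) auto
        then show ?thesis using elim by linarith
      qed
      have J: "integrable (\<Lambda> {1..N}) (weight (b N) {1..N})" "0 < partition_fun (b N) {1..N}"
        using conc[of "{1..N}" "b N"] bN elim cN by auto
      have gd: "good e (b N) ({1..N} - {i})" if i: "i \<in> {1..N}" for i
      proof -
        have c: "card ({1..N} - {i}) = N - 1" using i by simp
        have ne: "{1..N} - {i} \<noteq> {}"
        proof
          assume h: "{1..N} - {i} = {}"
          have "N - 1 = 0" using c unfolding h by simp
          then show False using elim by simp
        qed
        show ?thesis unfolding good_def
          using conc[OF _ ne bN] elim unfolding c by (simp add: of_nat_diff)
      qed
      show ?case unfolding X_def lam_def
        by (rule laplace_estimate[OF _ _ _ J gd]) (use elim e \<tau> u u01 in auto)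
    qed
  qed
  have "(\<lambda>N. X N - exp (- lam N)) \<longlonglongrightarrow> 0"
  proof (rule LIMSEQ_I)
    fix r :: real assume r: "0 < r"
    define B where "B = \<bar>\<theta>\<bar> + 1"
    define e where "e = min (1/2) (r / (16 * B))"
    have B: "1 \<le> B" by (simp add: B_def)
    have e: "0 < e" "e \<le> 1/2" using r B by (auto simp: e_def)
    have eB: "4 * e * B \<le> r / 4"
    proof -
      have "e * B \<le> r / (16 * B) * B" using B by (intro mult_right_mono) (auto simp: e_def)
      then show ?thesis using B by simp
    qed
    have lB: "\<forall>\<^sub>F N in sequentially. lam N < B" using lam by (rule order_tendstoD(2)) (simp add: B_def)
    have "(\<lambda>N. 2 * (lam N)\<^sup>2 * inverse (real N)) \<longlonglongrightarrow> 2 * \<theta>\<^sup>2 * 0" by (intro tendsto_intros lam lim_inverse_n)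
    then have "(\<lambda>N. 2 * (lam N)\<^sup>2 / real N) \<longlonglongrightarrow> 0" by (simp add: divide_inverse)
    then have l2: "\<forall>\<^sub>F N in sequentially. 2 * (lam N)\<^sup>2 / real N < r / 4" using r by (intro order_tendstoD(2)) auto
    have "\<forall>\<^sub>F N in sequentially. norm (X N - exp (- lam N) - 0) < r"
      using est[OF e] lB l2
    proof eventually_elim
      case (elim N)
      have "4 * e * lam N \<le> 4 * e * B" using elim e by (intro mult_left_mono) auto
      then show ?case using elim eB r by simp
    qed
    then show "\<exists>no. \<forall>n\<ge>no. norm (X n - exp (- lam n) - 0) < r" by (simp add: eventually_sequentially)
  qed
  moreover have "(\<lambda>N. exp (- lam N)) \<longlonglongrightarrow> exp (- \<theta>)" by (intro tendsto_intros lam)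
  ultimately have "(\<lambda>N. (X N - exp (- lam N)) + exp (- lam N)) \<longlonglongrightarrow> 0 + exp (- \<theta>)" by (rule tendsto_add)
  then show ?thesis by (simp add: X_def)
qed

end

lemma pair_sum_symmetric:
  fixes k :: "nat \<Rightarrow> nat \<Rightarrow> real"
  assumes "\<And>i j. k i j = k j i" "\<And>i. k i i = 0"
  shows "(\<Sum>j=1..N. \<Sum>i=1..<j. k i j) = (\<Sum>i\<in>{1..N}. \<Sum>j\<in>{1..N}. k i j) / 2"
proof (induction N)
  case (Suc N)
  have S: "{1..Suc N} = insert (Suc N) {1..N}" by auto
  have "(\<Sum>i\<in>{1..Suc N}. \<Sum>j\<in>{1..Suc N}. k i j) = (\<Sum>i\<in>{1..N}. \<Sum>j\<in>{1..N}. k i j) + 2 * (\<Sum>i\<in>{1..N}. k i (Suc N))"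
    unfolding S using assms(1)[of "Suc N"] assms(2) by (simp add: sum.distrib)
  moreover have "{1..<Suc N} = {1..N}" by auto
  ultimately show ?case using Suc by simp
qed simp

lemma power_potential_mean_field:
  assumes "0 < \<alpha>" "0 \<le> \<gamma>"
  shows "mean_field (power_potential \<alpha> :: 'a::euclidean_space \<Rightarrow> real) \<gamma>"
proof (unfold_locales)
  show "(power_potential \<alpha> :: 'a \<Rightarrow> real) \<in> borel_measurable borel"
    unfolding power_potential_def[abs_def] by measurable
  fix q
  obtain C where C: "\<And>r. 0 \<le> r \<Longrightarrow> exp (- 1 * r powr \<alpha>) * (1 + r) ^ q \<le> C"
    using exp_neg_powr_decay[of 1 \<alpha> q] assms by auto
  have "exp (- power_potential \<alpha> x) * (1 + norm x) ^ q \<le> C" for x :: 'a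
    using C[of "norm x"] by (simp add: power_potential_def)
  then show "\<exists>C. \<forall>x::'a. exp (- power_potential \<alpha> x) * (1 + norm x) ^ q \<le> C" by blast
qed (use assms in simp)

context mean_field
begin

lemma gibbs_measure_eq: "gibbs_measure b V N = gibbs b {1..N}"
proof -
  have "gibbs_weight b V N = weight b {1..N}"
  proof
    fix x
    have "(\<Sum>j=1..N. \<Sum>i=1..<j. log_kernel (x i) (x j)) = pair_energy {1..N} x"
      unfolding pair_energy_def
      by (rule pair_sum_symmetric) (simp_all add: log_kernel_eq norm_minus_commute)
    then show "gibbs_weight b V N x = weight b {1..N} x"
      unfolding gibbs_weight_def weight_def by simp
  qed
  then show ?thesis unfolding gibbs_measure_def gibbs_def partition_fun_def Let_def by simp
qed

end

lemma abs_ln_le_of_near_one: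
  fixes r :: real assumes "\<bar>r - 1\<bar> \<le> 1/2" shows "\<bar>ln r\<bar> \<le> 2 * \<bar>r - 1\<bar>"
proof -
  let ?d = "r - 1"
  have "\<bar>ln (1 + ?d) - ?d\<bar> \<le> 2 * ?d\<^sup>2" using assms by (intro abs_ln_one_plus_x_minus_x_bound) auto
  moreover have "2 * ?d\<^sup>2 \<le> \<bar>?d\<bar>" using assms mult_left_mono[of "2 * \<bar>?d\<bar>" 1 "\<bar>?d\<bar>"] by (simp add: power2_eq_square)
  moreover have "\<bar>a\<bar> \<le> 2 * \<bar>d\<bar>" if "\<bar>a - d\<bar> \<le> q" "q \<le> \<bar>d\<bar>" for a d q :: real
    using that by linarith
  ultimately have "\<bar>ln (1 + ?d)\<bar> \<le> 2 * \<bar>?d\<bar>" by blast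
  then show ?thesis by simp
qed

locale edge = mean_field V \<gamma> for V :: "'a::euclidean_space \<Rightarrow> real" and \<gamma> :: real +
  fixes \<alpha> :: real and T :: "'a \<Rightarrow> 'a" and \<upsilon> e :: 'a and b :: "nat \<Rightarrow> real" and \<eta> :: "nat \<Rightarrow> real"
  assumes V_eq: "V = power_potential \<alpha>" and alpha_pos: "0 < \<alpha>"
    and T: "orthogonal_transformation T" and Te: "T e = \<upsilon>" and norm_upsilon: "norm \<upsilon> = 1"
    and b_pos: "\<And>N. 1 \<le> N \<Longrightarrow> 0 < b N" and b_lim: "(\<lambda>N. b N * real N) \<longlonglongrightarrow> \<gamma>"
  defines "\<eta> \<equiv> \<lambda>N. edge_scale DIM('a) \<alpha> L (b N) N"
begin

definition \<delta> :: "nat \<Rightarrow> real" where "\<delta> N = inverse \<alpha> * \<eta> N powr (- \<alpha>)"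
definition \<phi> :: "nat \<Rightarrow> 'a \<Rightarrow> 'a" where "\<phi> N z = \<eta> N *\<^sub>R (\<upsilon> + \<delta> N *\<^sub>R T z)"
definition t :: "nat \<Rightarrow> real" where "t N = b N * (real N - 1)"
definition c0 :: "nat \<Rightarrow> real" where
  "c0 N = ln (real N) - real DIM('a) * ln \<alpha> + (real DIM('a) - real DIM('a) * \<alpha> + t N) * ln (\<eta> N) - \<eta> N powr \<alpha>"

lemma eta_lim: "filterlim \<eta> at_top sequentially"
  unfolding \<eta>_def by (rule edge_scale_asymptotics(1)[OF alpha_pos L_pos b_lim])

lemma c0_lim: "c0 \<longlonglongrightarrow> ln L"
  unfolding c0_def t_def \<eta>_def by (rule edge_scale_asymptotics(2)[OF alpha_pos L_pos b_lim])

lemma t_lim: "t \<longlonglongrightarrow> \<gamma>" unfolding t_def by (rule tendsto_of_mult_real(2)[OF b_lim])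

lemma eta_ge: "\<forall>\<^sub>F N in sequentially. 2 \<le> \<eta> N"
  using eta_lim by (simp add: filterlim_at_top)

lemma delta_lim: "\<delta> \<longlonglongrightarrow> 0"
proof -
  have "(\<lambda>N. \<eta> N powr (- \<alpha>)) \<longlonglongrightarrow> 0"
    using alpha_pos by (intro tendsto_neg_powr eta_lim) auto
  then show ?thesis unfolding \<delta>_def using tendsto_mult_left[of _ 0 _ "inverse \<alpha>"] by simp
qed

lemma T_norm: "norm (T z) = norm z" using T by (rule orthogonal_transformation_norm)

lemma rho_near_one: "0 \<le> \<delta> N \<Longrightarrow> \<bar>norm (\<upsilon> + \<delta> N *\<^sub>R T z) - 1\<bar> \<le> \<delta> N * norm z"
proof -
  assume d: "0 \<le> \<delta> N"
  have "\<bar>norm (\<upsilon> + \<delta> N *\<^sub>R T z) - norm \<upsilon>\<bar> \<le> norm (\<delta> N *\<^sub>R T z)"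
    using norm_triangle_ineq3[of "\<upsilon> + \<delta> N *\<^sub>R T z" \<upsilon>] by simp
  then show ?thesis using d by (simp add: norm_upsilon T_norm)
qed

lemma delta_nonneg: "0 \<le> \<delta> N" unfolding \<delta>_def using alpha_pos by simp

lemma norm_phi: "0 < \<eta> N \<Longrightarrow> norm (\<phi> N z) = \<eta> N * norm (\<upsilon> + \<delta> N *\<^sub>R T z)"
  by (simp add: \<phi>_def)

lemma V_apply: "V y = norm y powr \<alpha>"
  using fun_cong[OF V_eq, of y] by (simp only: power_potential_def)

lemma potential_estimate:
  assumes \<eta>: "2 \<le> \<eta> N" and dz: "\<delta> N * norm z \<le> 1/2"
  shows "V (\<phi> N z) - \<eta> N powr \<alpha> = (norm (\<upsilon> + \<delta> N *\<^sub>R T z) powr \<alpha> - 1) / (\<alpha> * \<delta> N)"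
    "\<bar>V (\<phi> N z) - \<eta> N powr \<alpha>\<bar> \<le> 2 * norm z * (1 + \<alpha> * exp \<alpha>)"
proof -
  let ?\<rho> = "norm (\<upsilon> + \<delta> N *\<^sub>R T z)"
  have ad: "\<eta> N powr \<alpha> = 1 / (\<alpha> * \<delta> N)" "0 < \<delta> N"
    unfolding \<delta>_def using alpha_pos \<eta> by (auto simp: powr_minus field_simps)
  show eq: "V (\<phi> N z) - \<eta> N powr \<alpha> = (?\<rho> powr \<alpha> - 1) / (\<alpha> * \<delta> N)"
    using \<eta> by (simp add: V_apply norm_phi powr_mult ad(1) diff_divide_distrib)
  have r: "\<bar>?\<rho> - 1\<bar> \<le> \<delta> N * norm z" by (rule rho_near_one[OF delta_nonneg])
  then have r2: "\<bar>?\<rho> - 1\<bar> \<le> 1/2" using dz by linarith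
  have ln: "\<bar>ln ?\<rho>\<bar> \<le> 2 * (\<delta> N * norm z)"
    by (rule order_trans[OF abs_ln_le_of_near_one[OF r2] mult_left_mono[OF r]]) simp
  let ?w = "\<alpha> * ln ?\<rho>"
  have w: "\<bar>?w\<bar> \<le> \<alpha> * (2 * (\<delta> N * norm z))" using ln alpha_pos by (simp add: abs_mult)
  have "\<alpha> * (2 * (\<delta> N * norm z)) \<le> \<alpha> * 1" using dz alpha_pos by (intro mult_left_mono) auto
  then have w1: "\<bar>?w\<bar> \<le> \<alpha>" using w by linarith
  have "?\<rho> > 0" using r2 by linarith
  then have "?\<rho> powr \<alpha> = exp ?w" by (simp add: powr_def)
  then have "\<bar>?\<rho> powr \<alpha> - 1\<bar> \<le> \<bar>?w\<bar> + ?w\<^sup>2 * exp \<bar>?w\<bar>" using abs_exp_sub_le[of ?w] by linarith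
  also have "?w\<^sup>2 * exp \<bar>?w\<bar> \<le> (\<bar>?w\<bar> * \<alpha>) * exp \<alpha>"
  proof (rule mult_mono)
    show "?w\<^sup>2 \<le> \<bar>?w\<bar> * \<alpha>" using mult_left_mono[OF w1, of "\<bar>?w\<bar>"] by (simp add: power2_eq_square)
  qed (use w1 alpha_pos in auto)
  finally have "\<bar>?\<rho> powr \<alpha> - 1\<bar> \<le> \<bar>?w\<bar> * (1 + \<alpha> * exp \<alpha>)" by (simp add: algebra_simps)
  also have "\<dots> \<le> \<alpha> * (2 * (\<delta> N * norm z)) * (1 + \<alpha> * exp \<alpha>)" using w alpha_pos by (intro mult_right_mono) auto
  finally have "\<bar>?\<rho> powr \<alpha> - 1\<bar> / (\<alpha> * \<delta> N) \<le> \<alpha> * (2 * (\<delta> N * norm z)) * (1 + \<alpha> * exp \<alpha>) / (\<alpha> * \<delta> N)"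
    using ad alpha_pos by (intro divide_right_mono) auto
  also have "\<dots> = 2 * norm z * (1 + \<alpha> * exp \<alpha>)" using ad alpha_pos by simp
  finally show "\<bar>V (\<phi> N z) - \<eta> N powr \<alpha>\<bar> \<le> 2 * norm z * (1 + \<alpha> * exp \<alpha>)"
    unfolding eq using ad alpha_pos by (simp add: abs_divide)
qed

lemma delta_small: "\<forall>\<^sub>F N in sequentially. \<delta> N * R \<le> 1/2"
proof -
  have "(\<lambda>N. \<delta> N * R) \<longlonglongrightarrow> 0 * R" by (intro tendsto_intros delta_lim)
  then have "\<forall>\<^sub>F N in sequentially. \<delta> N * R < 1/2" by (intro order_tendstoD(2)) auto
  then show ?thesis by eventually_elim simp
qed

lemma potential_lim: "(\<lambda>N. V (\<phi> N z) - \<eta> N powr \<alpha>) \<longlonglongrightarrow> e \<bullet> z"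
proof -
  let ?s = "e \<bullet> z" and ?r = "norm z"
  define F where "F h = (1 + 2 * h * ?s + h\<^sup>2 * ?r\<^sup>2) powr (\<alpha> / 2)" for h
  have D: "(F has_real_derivative \<alpha> * ?s) (at 0)"
    unfolding F_def by (auto intro!: derivative_eq_intros)
  then have "((\<lambda>h. (F (0 + h) - F 0) / h) \<longlongrightarrow> \<alpha> * ?s) (at 0)" by (simp add: DERIV_def)
  moreover have "filterlim \<delta> (at 0) sequentially"
    using delta_lim
  proof (rule filterlim_atI)
    show "\<forall>\<^sub>F N in sequentially. \<delta> N \<noteq> 0" using eta_ge by eventually_elim (use alpha_pos in \<open>auto simp: \<delta>_def\<close>)
  qed
  ultimately have "(\<lambda>N. (F (0 + \<delta> N) - F 0) / \<delta> N) \<longlonglongrightarrow> \<alpha> * ?s" by (rule filterlim_compose)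
  then have "(\<lambda>N. (F (0 + \<delta> N) - F 0) / \<delta> N / \<alpha>) \<longlonglongrightarrow> \<alpha> * ?s / \<alpha>" using alpha_pos by (intro tendsto_intros) auto
  then have lim: "(\<lambda>N. (F (0 + \<delta> N) - F 0) / \<delta> N / \<alpha>) \<longlonglongrightarrow> ?s" using alpha_pos by simp
  have inn: "\<upsilon> \<bullet> T z = ?s" using T unfolding Te[symmetric] by (simp add: orthogonal_transformation_def)
  have sq: "(norm (\<upsilon> + h *\<^sub>R T z))\<^sup>2 = 1 + 2 * h * ?s + h\<^sup>2 * ?r\<^sup>2" for h
  proof -
    have "(norm (\<upsilon> + h *\<^sub>R T z))\<^sup>2 = (norm \<upsilon>)\<^sup>2 + 2 * h * (\<upsilon> \<bullet> T z) + h\<^sup>2 * (norm (T z))\<^sup>2"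
      unfolding power2_norm_eq_inner by (simp add: inner_simps inner_commute power2_eq_square algebra_simps)
    then show ?thesis by (simp add: norm_upsilon inn T_norm)
  qed
  have Feq: "F h = norm (\<upsilon> + h *\<^sub>R T z) powr \<alpha>" for h
  proof -
    have "F h = ((norm (\<upsilon> + h *\<^sub>R T z))\<^sup>2) powr (\<alpha> / 2)" by (simp add: F_def sq)
    also have "\<dots> = (norm (\<upsilon> + h *\<^sub>R T z) powr 2) powr (\<alpha> / 2)" by simp
    finally show ?thesis by (simp only: powr_powr) simp
  qed
  show ?thesis
  proof (rule Lim_transform_eventually[OF lim])
    show "\<forall>\<^sub>F N in sequentially. (F (0 + \<delta> N) - F 0) / \<delta> N / \<alpha> = V (\<phi> N z) - \<eta> N powr \<alpha>"
      using eta_ge delta_small[of "norm z"]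
      by eventually_elim (simp add: potential_estimate(1) Feq norm_upsilon mult.commute)
  qed
qed

lemma log_potential_estimate:
  "\<exists>C\<ge>0. \<forall>N z. 2 \<le> \<eta> N \<longrightarrow> \<delta> N * norm z \<le> 1/2 \<longrightarrow>
     \<bar>U (\<phi> N z) + ln (\<eta> N)\<bar> \<le> C * (\<eta> N / 2) powr (-1/2) + 2 * (\<delta> N * norm z)"
proof -
  obtain C where C: "0 \<le> C" "\<And>y. 1 \<le> norm y \<Longrightarrow> \<bar>U y + ln (norm y)\<bar> \<le> C * norm y powr (-1/2)"
    using U_add_ln_bound by blast
  have "\<bar>U (\<phi> N z) + ln (\<eta> N)\<bar> \<le> C * (\<eta> N / 2) powr (-1/2) + 2 * (\<delta> N * norm z)"
    if \<eta>: "2 \<le> \<eta> N" and dz: "\<delta> N * norm z \<le> 1/2" for N z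
  proof -
    let ?\<rho> = "norm (\<upsilon> + \<delta> N *\<^sub>R T z)"
    have r: "\<bar>?\<rho> - 1\<bar> \<le> \<delta> N * norm z" by (rule rho_near_one[OF delta_nonneg])
    then have r2: "\<bar>?\<rho> - 1\<bar> \<le> 1/2" using dz by linarith
    have ln: "\<bar>ln ?\<rho>\<bar> \<le> 2 * (\<delta> N * norm z)"
    by (rule order_trans[OF abs_ln_le_of_near_one[OF r2] mult_left_mono[OF r]]) simp
    have r3: "1/2 \<le> ?\<rho>" using r2 by linarith
    have n: "norm (\<phi> N z) = \<eta> N * ?\<rho>" using \<eta> by (simp add: norm_phi)
    have ge: "\<eta> N / 2 \<le> norm (\<phi> N z)" unfolding n using mult_left_mono[OF r3, of "\<eta> N"] \<eta> by simp
    then have n1: "1 \<le> norm (\<phi> N z)" using \<eta> by linarith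
    have "norm (\<phi> N z) powr (-1/2) \<le> (\<eta> N / 2) powr (-1/2)" using ge \<eta> by (intro powr_mono2') auto
    then have "C * norm (\<phi> N z) powr (-1/2) \<le> C * (\<eta> N / 2) powr (-1/2)" using C(1) by (rule mult_left_mono)
    moreover have "ln (norm (\<phi> N z)) = ln (\<eta> N) + ln ?\<rho>" unfolding n using \<eta> r3 by (intro ln_mult_pos) auto
    ultimately show ?thesis using C(2)[OF n1] ln by linarith
  qed
  then show ?thesis using C(1) by blast
qed

definition density_N :: "nat \<Rightarrow> 'a \<Rightarrow> real" where
  "density_N N z = exp (c0 N - (V (\<phi> N z) - \<eta> N powr \<alpha>) - t N * (U (\<phi> N z) + ln (\<eta> N)))"

lemma density_N_lim: "(\<lambda>N. density_N N z) \<longlonglongrightarrow> L * exp (- (e \<bullet> z))"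
proof -
  obtain C where C: "0 \<le> C" "\<And>N z. 2 \<le> \<eta> N \<Longrightarrow> \<delta> N * norm z \<le> 1/2 \<Longrightarrow>
     \<bar>U (\<phi> N z) + ln (\<eta> N)\<bar> \<le> C * (\<eta> N / 2) powr (-1/2) + 2 * (\<delta> N * norm z)"
    using log_potential_estimate by blast
  have "(\<lambda>N. (\<eta> N / 2) powr (-1/2)) \<longlonglongrightarrow> 0"
  proof (rule tendsto_neg_powr)
    show "filterlim (\<lambda>N. \<eta> N / 2) at_top sequentially"
      using filterlim_tendsto_pos_mult_at_top[OF tendsto_const[of "1/2"] _ eta_lim] by simp
  qed simp
  then have "(\<lambda>N. C * (\<eta> N / 2) powr (-1/2) + 2 * (\<delta> N * norm z)) \<longlonglongrightarrow> C * 0 + 2 * (0 * norm z)"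
    by (intro tendsto_intros delta_lim)
  then have "(\<lambda>N. C * (\<eta> N / 2) powr (-1/2) + 2 * (\<delta> N * norm z)) \<longlonglongrightarrow> 0" by simp
  moreover have "\<forall>\<^sub>F N in sequentially. norm (U (\<phi> N z) + ln (\<eta> N)) \<le> C * (\<eta> N / 2) powr (-1/2) + 2 * (\<delta> N * norm z)"
    using eta_ge delta_small[of "norm z"] by eventually_elim (use C(2) in simp)
  ultimately have U0: "(\<lambda>N. U (\<phi> N z) + ln (\<eta> N)) \<longlonglongrightarrow> 0" by (rule Lim_null_comparison[rotated])
  have "(\<lambda>N. density_N N z) \<longlonglongrightarrow> exp (ln L - (e \<bullet> z) - \<gamma> * 0)"
    unfolding density_N_def by (intro tendsto_intros c0_lim potential_lim t_lim U0)
  then show ?thesis using L_pos by (simp add: exp_diff exp_minus divide_inverse)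
qed

lemma density_N_bound: "\<exists>K. \<forall>\<^sub>F N in sequentially. \<forall>z. norm z \<le> R \<longrightarrow> density_N N z \<le> K"
proof -
  obtain C where C: "0 \<le> C" "\<And>N z. 2 \<le> \<eta> N \<Longrightarrow> \<delta> N * norm z \<le> 1/2 \<Longrightarrow>
     \<bar>U (\<phi> N z) + ln (\<eta> N)\<bar> \<le> C * (\<eta> N / 2) powr (-1/2) + 2 * (\<delta> N * norm z)"
    using log_potential_estimate by blast
  have 1: "\<forall>\<^sub>F N in sequentially. c0 N < ln L + 1" by (rule order_tendstoD(2)[OF c0_lim]) simp
  have 2: "\<forall>\<^sub>F N in sequentially. \<bar>t N\<bar> < \<gamma> + 1"
    using gamma_nonneg by (intro order_tendstoD(2)[OF tendsto_rabs[OF t_lim]]) simp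
  let ?K = "exp (ln L + 1 + 2 * R * (1 + \<alpha> * exp \<alpha>) + (\<gamma> + 1) * (C + 1))"
  have "\<forall>\<^sub>F N in sequentially. \<forall>z. norm z \<le> R \<longrightarrow> density_N N z \<le> ?K"
    using 1 2 eta_ge delta_small[of R]
  proof eventually_elim
    case (elim N)
    show ?case
    proof (intro allI impI)
      fix z :: 'a assume z: "norm z \<le> R"
      have dz: "\<delta> N * norm z \<le> 1/2" using elim mult_left_mono[OF z delta_nonneg, of N] by linarith
      have "\<bar>V (\<phi> N z) - \<eta> N powr \<alpha>\<bar> \<le> 2 * norm z * (1 + \<alpha> * exp \<alpha>)"
        by (rule potential_estimate(2)) (use elim dz in auto)
      also have "\<dots> \<le> 2 * R * (1 + \<alpha> * exp \<alpha>)" using z alpha_pos by (intro mult_right_mono) auto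
      finally have V: "- (V (\<phi> N z) - \<eta> N powr \<alpha>) \<le> 2 * R * (1 + \<alpha> * exp \<alpha>)" by linarith
      have "(\<eta> N / 2) powr (-1/2) \<le> 1 powr (-1/2)" using elim by (intro powr_mono2') auto
      then have "C * (\<eta> N / 2) powr (-1/2) \<le> C" using C(1) by (simp add: mult_left_le)
      then have U1: "\<bar>U (\<phi> N z) + ln (\<eta> N)\<bar> \<le> C + 1" using C(2)[of N z] elim dz by linarith
      have "- (t N * (U (\<phi> N z) + ln (\<eta> N))) \<le> \<bar>t N\<bar> * \<bar>U (\<phi> N z) + ln (\<eta> N)\<bar>"
        by (metis abs_ge_minus_self abs_mult)
      also have "\<dots> \<le> (\<gamma> + 1) * (C + 1)" using elim U1 gamma_nonneg by (intro mult_mono) auto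
      finally show "density_N N z \<le> ?K" unfolding density_N_def using V elim by (subst exp_le_cancel_iff) linarith
    qed
  qed
  then show ?thesis by blast
qed

lemma phi_measurable [measurable]: "\<phi> N \<in> borel_measurable borel"
proof -
  have [measurable]: "T \<in> borel_measurable borel"
    using orthogonal_transformation_linear[OF T]
    by (intro borel_measurable_continuous_onI linear_continuous_on linear_conv_bounded_linear[THEN iffD1])
  show ?thesis unfolding \<phi>_def by measurable
qed

lemma inv_phi:
  assumes "2 \<le> \<eta> N"
  shows "inv (\<phi> N) (\<phi> N z) = z" "inv (\<phi> N) \<in> borel_measurable borel"
proof -
  have d: "0 < \<delta> N" unfolding \<delta>_def using alpha_pos assms by simp
  have injT: "inj T" and surjT: "surj T" using T by (simp_all add: orthogonal_transformation_inj orthogonal_transformation_surj)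
  have inj: "inj (\<phi> N)"
    using assms d injT by (auto simp: inj_on_def \<phi>_def)
  then show "inv (\<phi> N) (\<phi> N z) = z" by (rule inv_f_f)
  have Ti: "orthogonal_transformation (inv T)" by (rule orthogonal_transformation_inv[OF T])
  have [measurable]: "inv T \<in> borel_measurable borel"
    using orthogonal_transformation_linear[OF Ti]
    by (intro borel_measurable_continuous_onI linear_continuous_on linear_conv_bounded_linear[THEN iffD1])
  have "inv (\<phi> N) y = inv T ((1 / \<delta> N) *\<^sub>R ((1 / \<eta> N) *\<^sub>R y - \<upsilon>))" for y
  proof (rule inv_f_eq[OF inj])
    show "\<phi> N (inv T ((1 / \<delta> N) *\<^sub>R ((1 / \<eta> N) *\<^sub>R y - \<upsilon>))) = y"
      using assms d by (simp add: \<phi>_def surj_f_inv_f[OF surjT])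
  qed
  then have eq: "inv (\<phi> N) = (\<lambda>y. inv T ((1 / \<delta> N) *\<^sub>R ((1 / \<eta> N) *\<^sub>R y - \<upsilon>)))" by auto
  show "inv (\<phi> N) \<in> borel_measurable borel" unfolding eq by measurable
qed

lemma intensity_change_of_variables:
  assumes [measurable]: "g \<in> borel_measurable borel" and g0: "\<And>z. 0 \<le> g z" and \<eta>: "2 \<le> \<eta> N" and N: "1 \<le> N"
  shows "real N * (\<integral>y. g (inv (\<phi> N) y) * tilt (t N) y \<partial>lborel) = (\<integral>z. g z * density_N N z \<partial>lborel)"
proof -
  note [measurable] = inv_phi(2)[OF \<eta>]
  define a where "a = \<eta> N * \<delta> N"
  have d: "0 < \<delta> N" unfolding \<delta>_def using alpha_pos \<eta> by simp
  have a: "0 < a" using d \<eta> by (simp add: a_def)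
  have phi: "\<eta> N *\<^sub>R \<upsilon> + a *\<^sub>R T z = \<phi> N z" for z by (simp add: a_def \<phi>_def scaleR_add_right)
  let ?f = "\<lambda>y. g (inv (\<phi> N) y) * tilt (t N) y"
  have f0: "0 \<le> ?f y" for y using g0 tilt_pos by (simp add: less_imp_le)
  have fm: "(\<lambda>y. ennreal (?f y)) \<in> borel_measurable borel" by measurable
  have "(\<integral>\<^sup>+y. ennreal (?f y) \<partial>lborel) = ennreal (a ^ DIM('a)) * (\<integral>\<^sup>+z. ennreal (?f (\<phi> N z)) \<partial>lborel)"
    using nn_integral_scaled_orthogonal[OF T fm a, of "\<eta> N *\<^sub>R \<upsilon>"] by (simp only: phi)
  also have "\<dots> = (\<integral>\<^sup>+z. ennreal (a ^ DIM('a) * (g z * tilt (t N) (\<phi> N z))) \<partial>lborel)"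
    unfolding inv_phi(1)[OF \<eta>] using a g0 tilt_pos
    by (subst nn_integral_cmult[symmetric]) (auto intro!: nn_integral_cong simp: ennreal_mult less_imp_le)
  finally have eq: "(\<integral>y. ?f y \<partial>lborel) = (\<integral>z. a ^ DIM('a) * (g z * tilt (t N) (\<phi> N z)) \<partial>lborel)"
    using f0 a g0 tilt_pos by (subst (1 2) integral_eq_nn_integral) (auto simp: less_imp_le)
  have pt: "real N * (a ^ DIM('a) * (g z * tilt (t N) (\<phi> N z))) = g z * density_N N z" for z
  proof -
    have lna: "ln a = ln (\<eta> N) - ln \<alpha> - \<alpha> * ln (\<eta> N)"
      unfolding a_def \<delta>_def using alpha_pos \<eta> by (simp add: ln_mult_pos ln_powr ln_inverse)
    have "real N * a ^ DIM('a) = exp (ln (real N) + real DIM('a) * ln a)"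
      using N a by (simp add: exp_add exp_of_nat_mult)
    then have "real N * a ^ DIM('a) * tilt (t N) (\<phi> N z) = density_N N z"
      unfolding tilt_def density_N_def c0_def lna by (simp add: exp_add[symmetric] algebra_simps)
    then show ?thesis by (simp add: mult_ac)
  qed
  show ?thesis unfolding eq pt[symmetric] by simp
qed

lemma intensity_lim:
  assumes [measurable]: "g \<in> borel_measurable borel" and g: "\<And>z. 0 \<le> g z" "\<And>z. g z \<le> 1" and R: "\<And>z. R < norm z \<Longrightarrow> g z = 0"
  shows "(\<lambda>N. \<integral>z. g z * density_N N z \<partial>lborel) \<longlonglongrightarrow> L * (\<integral>z. g z * exp (- (e \<bullet> z)) \<partial>lborel)"
proof -
  obtain K where "\<forall>\<^sub>F N in sequentially. \<forall>z. norm z \<le> R \<longrightarrow> density_N N z \<le> K" using density_N_bound by blast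
  then obtain N0 where K: "\<And>N z. N0 \<le> N \<Longrightarrow> norm z \<le> R \<Longrightarrow> density_N N z \<le> K" by (auto simp: eventually_sequentially)
  have [measurable]: "density_N N \<in> borel_measurable borel" for N
    unfolding density_N_def[abs_def] by measurable
  have "(\<lambda>N. \<integral>z. g z * density_N (N + N0) z \<partial>lborel) \<longlonglongrightarrow> (\<integral>z. g z * (L * exp (- (e \<bullet> z))) \<partial>lborel)"
  proof (rule integral_dominated_convergence[where w = "\<lambda>z. K * indicator (cball 0 R) z"])
    have "integrable lborel (indicator (cball (0::'a) R) :: 'a \<Rightarrow> real)"
      using emeasure_lborel_cball_finite[of "0::'a" R] by (intro integrable_real_indicator) auto
    then show "integrable lborel (\<lambda>z::'a. K * indicator (cball 0 R) z)" by (rule integrable_mult_right)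
    show "AE z in lborel. (\<lambda>N. g z * density_N (N + N0) z) \<longlonglongrightarrow> g z * (L * exp (- (e \<bullet> z)))"
      by (intro AE_I2 tendsto_intros LIMSEQ_ignore_initial_segment density_N_lim)
    show "AE z in lborel. norm (g z * density_N (N + N0) z) \<le> K * indicator (cball 0 R) z" for N
    proof (rule AE_I2)
      fix z :: 'a
      have d0: "0 \<le> density_N (N + N0) z" by (simp add: density_N_def)
      show "norm (g z * density_N (N + N0) z) \<le> K * indicator (cball 0 R) z"
      proof (cases "norm z \<le> R")
        case True
        have "g z * density_N (N + N0) z \<le> 1 * K" using g[of z] d0 K[of "N + N0" z] True by (intro mult_mono) auto
        then show ?thesis using True g[of z] d0 by (simp add: abs_mult)
      qed (use R[of z] in auto)
    qed
  qed measurable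
  then have "(\<lambda>N. \<integral>z. g z * density_N N z \<partial>lborel) \<longlonglongrightarrow> (\<integral>z. g z * (L * exp (- (e \<bullet> z))) \<partial>lborel)"
    by (rule LIMSEQ_offset)
  also have "(\<integral>z. g z * (L * exp (- (e \<bullet> z))) \<partial>lborel) = L * (\<integral>z. g z * exp (- (e \<bullet> z)) \<partial>lborel)"
    by (subst integral_mult_right_zero[symmetric]) (simp add: mult.left_commute)
  finally show ?thesis .
qed

lemma laplace_functional_lim:
  assumes f: "f \<in> test_functions"
  shows "(\<lambda>N. laplace_functional (gibbs_measure (b N) V N) (\<lambda>x. dirac_sum N (\<lambda>j. inv (\<phi> N) (x j))) f)
    \<longlonglongrightarrow> exp (\<integral>x. (exp (- f x) - 1) * exp (- (e \<bullet> x)) \<partial>lborel)"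
proof -
  have cont: "continuous_on UNIV f" and f0: "\<And>x. 0 \<le> f x" and cpt: "compact (closure {x. f x \<noteq> 0})"
    using f by (auto simp: test_functions_def)
  have [measurable]: "f \<in> borel_measurable borel" using cont by (rule borel_measurable_continuous_onI)
  obtain R where R: "\<And>x. x \<in> closure {x. f x \<noteq> 0} \<Longrightarrow> norm x \<le> R"
    using compact_imp_bounded[OF cpt] unfolding bounded_iff by auto
  have R: "norm x \<le> R" if "f x \<noteq> 0" for x
    using that closure_subset[of "{x. f x \<noteq> 0}"] by (intro R) auto
  define g where "g z = 1 - exp (- f z)" for z
  have [measurable]: "g \<in> borel_measurable borel" unfolding g_def by measurable
  have g: "0 \<le> g z" "g z \<le> 1" for z using f0[of z] by (auto simp: g_def)
  have gR: "g z = 0" if "R < norm z" for z using R[of z] that by (auto simp: g_def)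
  define u where "u N y = (if 2 \<le> \<eta> N then g (inv (\<phi> N) y) else 0)" for N y
  have um: "u N \<in> borel_measurable borel" for N
  proof (cases "2 \<le> \<eta> N")
    case True
    note [measurable] = inv_phi(2)[OF True]
    show ?thesis unfolding u_def using True by simp
  next
    case False
    then have "u N = (\<lambda>_. 0)" by (auto simp: u_def)
    then show ?thesis by simp
  qed
  have u01: "0 \<le> u N y" "u N y \<le> 1" for N y using g by (auto simp: u_def)
  define \<theta> where "\<theta> = (\<integral>z. g z * exp (- (e \<bullet> z)) \<partial>lborel)"
  have "(\<lambda>N. real N * (\<integral>y. u N y * tilt (b N * (real N - 1)) y \<partial>lborel)) \<longlonglongrightarrow> L * \<theta>"
    unfolding \<theta>_def
  proof (rule Lim_transform_eventually[OF intensity_lim[of g R]])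
    show "\<forall>\<^sub>F N in sequentially. (\<integral>z. g z * density_N N z \<partial>lborel) = real N * (\<integral>y. u N y * tilt (b N * (real N - 1)) y \<partial>lborel)"
      using eta_ge eventually_ge_at_top[of 1]
    proof eventually_elim
      case (elim N)
      then show ?case using intensity_change_of_variables[of g N] g unfolding u_def t_def by simp
    qed
  qed (use g gR in auto)
  then have "(\<lambda>N. \<integral>x. (\<Prod>j\<in>{1..N}. (1 - u N (x j))) \<partial>gibbs (b N) {1..N}) \<longlonglongrightarrow> exp (- \<theta>)"
    using b_pos b_lim um u01 by (intro poisson_limit) auto
  moreover have "- \<theta> = (\<integral>x. (exp (- f x) - 1) * exp (- (e \<bullet> x)) \<partial>lborel)"
    unfolding \<theta>_def g_def by (subst Bochner_Integration.integral_minus[symmetric]) (simp add: algebra_simps)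
  moreover have "\<forall>\<^sub>F N in sequentially. (\<integral>x. (\<Prod>j\<in>{1..N}. (1 - u N (x j))) \<partial>gibbs (b N) {1..N})
    = laplace_functional (gibbs_measure (b N) V N) (\<lambda>x. dirac_sum N (\<lambda>j. inv (\<phi> N) (x j))) f"
    using eta_ge
  proof eventually_elim
    case (elim N)
    have "(\<Prod>j\<in>{1..N}. (1 - u N (x j))) = exp (- (\<integral>y. f y \<partial>dirac_sum N (\<lambda>j. inv (\<phi> N) (x j))))" for x
    proof -
      have "(\<integral>y. f y \<partial>dirac_sum N (\<lambda>j. inv (\<phi> N) (x j))) = (\<Sum>j=1..N. f (inv (\<phi> N) (x j)))"
        unfolding dirac_sum_def by (subst integral_distr) (simp_all add: lebesgue_integral_count_space_finite)
      then show ?thesis using elim by (simp add: u_def g_def exp_sum[symmetric] sum_negf)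
    qed
    then show ?case unfolding laplace_functional_def gibbs_measure_eq by simp
  qed
  ultimately show ?thesis by (auto intro: Lim_transform_eventually)
qed

end

theorem theorem1p8:
  fixes \<alpha> \<gamma> :: real and \<beta> :: "nat \<Rightarrow> real"
    and \<upsilon> :: "real ^ ('n::{finite,linorder})" and \<psi> :: "real ^ ('n::{finite,linorder}) ^ ('n::{finite,linorder})"
    and V :: "real ^ ('n::{finite,linorder}) \<Rightarrow> real" and \<eta> :: "nat \<Rightarrow> real"
    and \<phi> :: "nat \<Rightarrow> real ^ ('n::{finite,linorder}) \<Rightarrow> real ^ ('n::{finite,linorder})"
    and \<Omega> :: "'w measure" and \<Xi> :: "'w \<Rightarrow> (real ^ ('n::{finite,linorder})) measure"
  assumes "CARD('n::{finite,linorder}) \<in> {1, 2}"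
    and "\<gamma> \<ge> 0" and "\<alpha> > 0"
    and "\<And>N. N \<ge> 1 \<Longrightarrow> \<beta> N > 0"
    and "(\<lambda>N. real N * \<beta> N) \<longlonglongrightarrow> \<gamma>"
    and "norm \<upsilon> = 1"
    and "rotation_matrix \<psi> \<or> (CARD('n) = 1 \<and> orthogonal_matrix \<psi>)"
    and "\<psi> *v first_basis_vector = \<upsilon>"
    and "poisson_process \<Omega> \<Xi> (\<lambda>x. exp (- (first_basis_vector \<bullet> x)))"
  defines "V \<equiv> power_potential \<alpha>"
    and "\<eta> \<equiv> (\<lambda>N. edge_scale CARD('n) \<alpha> (L_const \<gamma> V) (\<beta> N) N)"
    and "\<phi> \<equiv> (\<lambda>N. edge_map \<alpha> (\<eta> N) \<upsilon> \<psi>)"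
  shows "converges_in_distribution
           (\<lambda>N. gibbs_measure (\<beta> N) V N)
           (\<lambda>N x. dirac_sum N (\<lambda>j. inv (\<phi> N) (x j)))
           \<Omega> \<Xi>"
proof -
  have "orthogonal_matrix \<psi>" using assms(7) by (auto simp: rotation_matrix_def)
  then have T: "orthogonal_transformation (\<lambda>z. \<psi> *v z)"
    by (simp add: orthogonal_transformation_matrix)
  interpret M: mean_field V \<gamma> unfolding V_def by (rule power_potential_mean_field[OF assms(3,2)])
  have eta: "\<eta> = (\<lambda>N. edge_scale DIM(real ^ ('n::{finite,linorder})) \<alpha> M.L (\<beta> N) N)"
    by (simp add: \<eta>_def M.L_def)
  interpret E: edge V \<gamma> \<alpha> "\<lambda>z. \<psi> *v z" \<upsilon> first_basis_vector \<beta> \<eta>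
    using assms(3-6,8) T by (unfold_locales) (simp_all add: V_def eta mult.commute)
  have phi: "\<phi> = E.\<phi>"
    unfolding \<phi>_def edge_map_def by (simp add: fun_eq_iff E.\<phi>_def E.\<delta>_def)
  show ?thesis
    unfolding converges_in_distribution_def phi
  proof
    fix f :: "real ^ ('n::{finite,linorder}) \<Rightarrow> real" assume f: "f \<in> test_functions"
    then have "laplace_functional \<Omega> \<Xi> f = exp (\<integral>x. (exp (- f x) - 1) * exp (- (first_basis_vector \<bullet> x)) \<partial>lborel)"
      using assms(9) by (simp add: poisson_process_def)
    then show "(\<lambda>N. laplace_functional (gibbs_measure (\<beta> N) V N) (\<lambda>x. dirac_sum N (\<lambda>j. inv (E.\<phi> N) (x j))) f)
      \<longlonglongrightarrow> laplace_functional \<Omega> \<Xi> f"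
      using E.laplace_functional_lim[OF f] by simp
  qed
qed

end
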